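(* Let $(C,\chi_a,(\psi_{s+1}(x))_{x\in C-\{x_0\}})$ be a profitable triple, with attached expansion map $\psi(C):=\psi(C,\chi_a,(\psi_{s+1}(x))_{x\in C-\{x_0\}})$. Suppose that $\mathrm{Up}_{\mathbb{Q}(\sqrt x)/\mathbb{Q}}(a)\in2^s\cdot\mathrm{Cl}(\mathbb{Q}(\sqrt x))[2^{s+1}]$ for each $x\in C$. Then $\mathrm{Up}_{\mathbb{Q}(\sqrt a)/\mathbb{Q}}(p)$ splits completely in $M(\psi(C))$ for each prime $p\mid a$. Furthermore, $\chi_a\in2^s\cdot\mathrm{Cl}(\mathbb{Q}(\sqrt{x_0}))^\vee[2^{s+1}]$ and $$\sum_{x\in C}\langle\mathrm{Up}_{\mathbb{Q}(\sqrt x)/\mathbb{Q}}(a),\chi_a\rangle_{\mathrm{Art}_{s+1}(x)}=\sum_{p\mid a}\psi_{[s]}(\mathrm{Frob}(\mathrm{Up}_{\mathbb{Q}(\sqrt a)/\mathbb{Q}}(p))),$$ where $\psi_{[s]}=\sum_{x\in C}\psi_{s+1}(x)$ is the top component of $\psi(C)$.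
   Context: Fixed choices. $[n]=\{1,\dots,n\}$. $G_K$ is the absolute Galois group of $K$. Fix $\mathbb{Q}^{\mathrm{sep}}$ and, for each place $v$ of $\mathbb{Q}$, $\mathbb{Q}_v^{\mathrm{sep}}$ and an embedding $i_v:\mathbb{Q}^{\mathrm{sep}}\to\mathbb{Q}_v^{\mathrm{sep}}$, inducing $i_v^*:G_{\mathbb{Q}_v}\to G_{\mathbb{Q}}$. Let $\mathcal{G}$ be the Galois group over $\mathbb{Q}$ of the union of all finite Galois extensions of $2$-power degree. For each odd prime $v$ fix a topological generator $\sigma_v$ of the image ($\cong\mathbb{Z}_2$) in $\mathcal{G}$ of the inertia group $I_v$ under $i_v^*$; fix $\sigma_2(1),\sigma_2(2)$ in the image of $I_2$ with $\chi_{-1}(\sigma_2(1))=1$, $\chi_2(\sigma_2(1))=0$, $\chi_{-1}(\sigma_2(2))=0$, $\chi_2(\sigma_2(2))=1$. $\mathfrak{G}=\{\sigma_v\}_{v\text{ odd}}\cup\{\sigma_2(1),\sigma_2(2)\}$. For a squarefree integer $a$ (any sign), $\chi_a:G_{\mathbb{Q}}\to\mathbb{F}_2$ is the quadratic character of $\mathbb{Q}(\sqrt a)$. For a continuous map $\phi$ from $G_{\mathbb{Q}}$ to a discrete space, $L(\phi)$ is the field corresponding to the largest open normal subgroup through whose quotient $\phi$ factors. Expansion maps. For $X$ a finite linearly independent set of quadratic characters of $G_{\mathbb{Q}}$ and $\chi_0\in X$, an expansion map with support $X$ and pointer $\chi_0$ is (equivalently to a suitable homomorphism $\psi:G_{\mathbb{Q}}\to\mathbb{F}_2[\mathbb{F}_2^{X-\{\chi_0\}}]\rtimes\mathbb{F}_2^{X-\{\chi_0\}}$)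 a system of continuous maps $\phi_Y:G_{\mathbb{Q}}\to\mathbb{F}_2$, $Y\subseteq X-\{\chi_0\}$, with $\phi_\varnothing=\chi_0$ and $\phi_Y(\sigma\tau)+\phi_Y(\sigma)+\phi_Y(\tau)=\sum_{\varnothing\ne S\subseteq Y}(\prod_{\chi\in S}\chi(\sigma))\phi_{Y-S}(\tau)$. $L(\psi)$ is the fixed field of $\ker\psi$, and $M(\psi)$ is the compositum of the fields cut out by the characters in $X$ and the $L(\phi_Y)$ for $Y\subsetneq X-\{\chi_0\}$. If $|X|\ge2$, $\mathrm{Gal}(L(\psi)/M(\psi))$ has order $2$ (the center of $\mathrm{Gal}(L(\psi)/\mathbb{Q})$), identified with $\mathbb{F}_2$ via $\phi_{X-\{\chi_0\}}$. There is at most one such system with $\phi_Y(\sigma)=0$ for all $\varnothing\ne Y$ and $\sigma\in\mathfrak{G}$. If it exists, and $S$ is the set of squarefree integers corresponding to $X-\{\chi_0\}$ and $d$ the one corresponding to $\chi_0$, then $\phi_{S;d}(\mathfrak{G}):=\phi_{X-\{\chi_0\}}$ and one says $\phi_{S;d}(\mathfrak{G})$ exists (so $\phi_{\varnothing;d}(\mathfrak{G})=\chi_d$); $M(\phi_{S;d}(\mathfrak{G}))$ is the field $M$ of that system. Raw cocycles. $N=\mathbb{Q}_2/\mathbb{Z}_2$; for squarefree $x$, $N(x)$ is $N$ with $\sigma\cdot n=(-1)^{\chi_x(\sigma)}n$. $\mathrm{Cl}$ denotes the narrow class group, $\mathrm{Cl}^\vee=\mathrm{Hom}(\mathrm{Cl},\mathbb{Q}_2/\mathbb{Z}_2)$.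 A raw cocycle $\psi_k$ for $N(x)$ is a continuous $1$-cocycle $\psi_k:G_{\mathbb{Q}}\to N(x)$ with $2^k\psi_k=0$ whose restriction to $G_{\mathbb{Q}(\sqrt x)}$ (a homomorphism) factors through $\mathrm{Cl}(\mathbb{Q}(\sqrt x))$; put $\psi_j:=2^{k-j}\psi_k$ for $0\le j\le k$ and $\psi_j:=0$ for $j<0$. $\mathbb{F}_2$ is identified with $N[2]$; sums of cocycles for different $x$ are taken in the group of continuous maps $G_{\mathbb{Q}}\to N$. Profitable triples. Let $s\ge1$ and $C=\{p_1(1),p_1(2)\}\times\dots\times\{p_s(1),p_s(2)\}\times\{d_0\}$ with $p_i(h)$ being $2s$ distinct odd primes, $p_i(1)p_i(2)\equiv1\bmod 8$, $d_0$ a positive squarefree integer coprime to all $p_i(h)$. Elements of $C$ are identified with the squarefree integers obtained by multiplying coordinates; $\pi_i$ is the $i$-th coordinate; $x_0=d_0\prod_ip_i(1)$; $C_T=\{x\in C:\pi_i(x)=p_i(2)\ \forall i\in T\}$; $C_{p_i(h)}=\{x\in C:\pi_i(x)=p_i(h)\}$. Let $a\mid d_0$ and for each $x\in C-\{x_0\}$ let $\psi_{s+1}(x)$ be a raw cocycle for $N(x)$ with $2^s\psi_{s+1}(x)=\chi_a$. The triple $(C,\chi_a,(\psi_{s+1}(x))_{x\in C-\{x_0\}})$ is profitable if for each $i\in[s]$: (i) $\big(\sum_{x\in C_T}\psi_{s+1-|T|}(x)\big)(\sigma_{p_i(2)})=0$ for each $T\subseteq[s]$ containing $i$; (ii) $\sum_{x\in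 C_{p_i(2)}}\psi_{s-1}(x)=0$; (iii) $\Phi_i:=\phi_{\{p_j(1)p_j(2):j\in[s]-\{i\}\};p_i(1)p_i(2)}(\mathfrak{G})$ exists; (iv) every prime $l\mid d_0$ splits completely in $L(\Phi_i)/\mathbb{Q}$; (v) $(2)$ and $\infty$ split completely in $M(\Phi_i)/\mathbb{Q}$. Attached objects. For a profitable triple there exists a raw cocycle $\psi_{s+1}(x_0)$ for $N(x_0)$ such that $\sum_{x\in C}\psi_i(x)=0$ for each $i\in[s]$, and such that the maps $\psi_T:=\sum_{x\in C_{[s]-T}}\psi_{|T|+1}(x)$, $T\subseteq[s]$, form an expansion map with support $\{\chi_{p_i(1)p_i(2)}:i\in[s]\}\cup\{\chi_a\}$ and pointer $\chi_a$ (with $T$ corresponding to $\{\chi_{p_i(1)p_i(2)}:i\in T\}$), in whose field of definition every place of $\mathbb{Q}$ has ramification index at most $2$. Such a $\psi_{s+1}(x_0)$ is fixed; the resulting expansion map is the one attached to the triple. Artin pairing. For $x$ squarefree, $A=\mathrm{Cl}(\mathbb{Q}(\sqrt x))[2^\infty]$ and $k\ge1$, $\langle b,\chi\rangle_{\mathrm{Art}_k(x)}:=\psi(b)\in\mathbb{F}_2$ for $b\in2^{k-1}A[2^k]$, $\chi\in2^{k-1}A^\vee[2^k]$, where $\psi\in A^\vee$ is any element with $2^{k-1}\psi=\chi$. $\chi_a$ is viewed in $\mathrm{Cl}(\mathbb{Q}(\sqrt x))^\vee$ by restriction. For $K/\mathbb{Q}$ quadratic and $b$ a positive squarefree integer composed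 of primes ramifying in $K$, $\mathrm{Up}_{K/\mathbb{Q}}(b)$ is the unique integral ideal of $K$ of norm $b$ (for $b=p$ prime, the unique prime above $p$). For $p\mid a$, $\psi_{[s]}(\mathrm{Frob}(\mathrm{Up}_{\mathbb{Q}(\sqrt a)/\mathbb{Q}}(p)))$ is the Frobenius of that prime in $L(\psi(C))/\mathbb{Q}(\sqrt a)$, viewed in $\mathrm{Gal}(L(\psi(C))/M(\psi(C)))\cong\mathbb{F}_2$. *)

theory Defs
  imports
    "HOL-Algebra.Algebraic_Closure_Type"
    "HOL-Algebra.Ideal_Product"
    "HOL-Algebra.Generated_Fields"
    "HOL-Algebra.Embedded_Algebras"
    "HOL-Analysis.Function_Topology"
    "HOL-Library.Z2"
    "HOL-Computational_Algebra.Computational_Algebra"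
begin

type_synonym qbar = "rat alg_closure"

abbreviation field_rec :: "'a::field set \<Rightarrow> 'a ring" where
  "field_rec E \<equiv> ring_of_type_algebra \<lparr>carrier := E\<rparr>"

abbreviation gen_field :: "'a::field set \<Rightarrow> 'a set" where
  "gen_field \<equiv> generate_field ring_of_type_algebra"

definition gal :: "'a::field set \<Rightarrow> 'a set \<Rightarrow> ('a \<Rightarrow> 'a) set" where
  "gal E F = {\<sigma> \<in> extensional E. \<sigma> \<in> ring_iso (field_rec E) (field_rec E) \<and> (\<forall>x\<in>F. \<sigma> x = x)}"

definition gal_group :: "'a::field set \<Rightarrow> 'a set \<Rightarrow> ('a \<Rightarrow> 'a) monoid" where
  "gal_group E F = \<lparr>carrier = gal E F, monoid.mult = compose E, one = restrict id E\<rparr>"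

definition krull :: "'a::field set \<Rightarrow> 'a set \<Rightarrow> ('a \<Rightarrow> 'a) topology" where
  "krull E F = subtopology (product_topology (\<lambda>_. discrete_topology UNIV) E) (gal E F)"

abbreviation GQ :: "(qbar \<Rightarrow> qbar) set" where
  "GQ \<equiv> gal UNIV \<rat>"

definition continuous_GQ :: "((qbar \<Rightarrow> qbar) \<Rightarrow> 'b) \<Rightarrow> bool" where
  "continuous_GQ \<phi> \<longleftrightarrow> continuous_map (krull UNIV \<rat>) (discrete_topology UNIV) \<phi>"

text \<open>
  The value at \<open>\<tau> \<in> Gal(E/\<rat>)\<close> of a map on \<open>G\<^sub>\<rat>\<close> that factors through \<open>Gal(E/\<rat>)\<close>, for
  \<open>E\<close> normal over \<open>\<rat>\<close>. For such maps the choice of the lift of \<open>\<tau>\<close> is irrelevant.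
\<close>
definition value_at :: "qbar set \<Rightarrow> ((qbar \<Rightarrow> qbar) \<Rightarrow> 'b) \<Rightarrow> (qbar \<Rightarrow> qbar) \<Rightarrow> 'b" where
  "value_at E \<phi> \<tau> = \<phi> (inv_into GQ (\<lambda>\<sigma>. restrict \<sigma> E) \<tau>)"

definition fixed_field :: "(qbar \<Rightarrow> qbar) set \<Rightarrow> qbar set" where
  "fixed_field H = {z. \<forall>\<sigma>\<in>H. \<sigma> z = z}"

definition field_of_def :: "((qbar \<Rightarrow> qbar) \<Rightarrow> 'b) \<Rightarrow> qbar set" where
  "field_of_def \<phi> = fixed_field (GREATEST N.
     openin (krull UNIV \<rat>) N \<and> N \<lhd> gal_group UNIV \<rat> \<and>
     (\<forall>\<sigma>\<in>GQ. \<forall>\<tau>\<in>N. \<phi> (\<sigma> \<otimes>\<^bsub>gal_group UNIV \<rat>\<^esub> \<tau>) = \<phi> \<sigma>))"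

definition quad_field :: "int \<Rightarrow> qbar set" where
  "quad_field x = gen_field {z. z\<^sup>2 = of_int x}"

definition quad_char :: "int \<Rightarrow> (qbar \<Rightarrow> qbar) \<Rightarrow> bit" where
  "quad_char a \<sigma> = (if \<forall>z. z\<^sup>2 = of_int a \<longrightarrow> \<sigma> z = z then 0 else 1)"

definition finite_galois :: "nat \<Rightarrow> qbar set \<Rightarrow> bool" where
  "finite_galois n K \<longleftrightarrow> subfield K ring_of_type_algebra \<and>
     ring.dimension ring_of_type_algebra n \<rat> K \<and>
     {z \<in> K. \<forall>\<sigma>\<in>gal K \<rat>. \<sigma> z = z} = \<rat>"

definition Qpro2 :: "qbar set" where
  "Qpro2 = \<Union>{K. \<exists>n. finite_galois (2 ^ n) K}"


text \<open>
  \<open>\<rat>\<^sub>p\<close> is the completion \<open>K\<close> of \<open>\<rat>\<close> for the \<open>p\<close>-adic absolute value, and the whole type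
  \<open>'l\<close> is its separable closure, carrying the unique extension of that absolute value. As fields,
  the algebraic closures of all the \<open>\<rat>\<^sub>p\<close> are isomorphic (to \<open>\<complex>\<close>), so that one type
  can carry all of them, with a different absolute value and a different subfield for each \<open>p\<close>.
\<close>
definition local_closure ::
    "nat \<Rightarrow> ('l::{alg_closed_field,field_char_0} \<Rightarrow> real) \<Rightarrow> 'l set \<Rightarrow> bool" where
  "local_closure p av K \<longleftrightarrow>
     (\<forall>x. av x \<ge> 0) \<and> (\<forall>x. av x = 0 \<longleftrightarrow> x = 0) \<and>
     (\<forall>x y. av (x * y) = av x * av y) \<and>
     (\<forall>x y. av (x + y) \<le> max (av x) (av y)) \<and>
     av (of_nat p) = 1 / real p \<and>
     subfield K ring_of_type_algebra \<and>
     (\<forall>x\<in>K. \<forall>\<epsilon>>0. \<exists>q\<in>\<rat>. av (x - q) < \<epsilon>) \<and>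
     (\<forall>u::nat \<Rightarrow> 'l. (\<forall>n. u n \<in> K) \<and> (\<forall>\<epsilon>>0. \<exists>N. \<forall>m\<ge>N. \<forall>n\<ge>N. av (u m - u n) < \<epsilon>) \<longrightarrow>
        (\<exists>x\<in>K. (\<lambda>n. av (u n - x)) \<longlonglongrightarrow> 0)) \<and>
     (\<forall>x. \<exists>f. f \<noteq> 0 \<and> (\<forall>i. coeff f i \<in> K) \<and> poly f x = 0)"

definition local_inertia :: "('l::field \<Rightarrow> real) \<Rightarrow> 'l set \<Rightarrow> ('l \<Rightarrow> 'l) set" where
  "local_inertia av K = {\<sigma> \<in> gal UNIV K. \<forall>x. av x \<le> 1 \<longrightarrow> av (\<sigma> x - x) < 1}"

definition local_to_global :: "(qbar \<Rightarrow> 'l::field) \<Rightarrow> ('l \<Rightarrow> 'l) \<Rightarrow> qbar \<Rightarrow> qbar" where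
  "local_to_global i \<sigma> = (\<lambda>z. inv_into UNIV i (\<sigma> (i z)))"

definition inertia_image :: "('l::field \<Rightarrow> real) \<Rightarrow> 'l set \<Rightarrow> (qbar \<Rightarrow> 'l) \<Rightarrow> (qbar \<Rightarrow> qbar) set" where
  "inertia_image av K i = (\<lambda>\<sigma>. restrict (local_to_global i \<sigma>) Qpro2) ` local_inertia av K"

definition fixed_choices ::
    "(nat \<Rightarrow> 'l::{alg_closed_field,field_char_0} \<Rightarrow> real) \<Rightarrow> (nat \<Rightarrow> 'l set) \<Rightarrow> (nat \<Rightarrow> qbar \<Rightarrow> 'l) \<Rightarrow>
     (nat \<Rightarrow> qbar \<Rightarrow> qbar) \<Rightarrow> (qbar \<Rightarrow> qbar) \<Rightarrow> (qbar \<Rightarrow> qbar) \<Rightarrow> bool" where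
  "fixed_choices av Qv i sg sg21 sg22 \<longleftrightarrow>
     (\<forall>v. prime v \<longrightarrow> local_closure v (av v) (Qv v) \<and>
        i v \<in> ring_hom ring_of_type_algebra ring_of_type_algebra) \<and>
     (\<forall>v. prime v \<and> odd v \<longrightarrow>
        sg v \<in> inertia_image (av v) (Qv v) (i v) \<and>
        krull Qpro2 \<rat> closure_of (generate (gal_group Qpro2 \<rat>) {sg v})
          = inertia_image (av v) (Qv v) (i v)) \<and>
     sg21 \<in> inertia_image (av 2) (Qv 2) (i 2) \<and>
     value_at Qpro2 (quad_char (-1)) sg21 = 1 \<and> value_at Qpro2 (quad_char 2) sg21 = 0 \<and>
     sg22 \<in> inertia_image (av 2) (Qv 2) (i 2) \<and>
     value_at Qpro2 (quad_char (-1)) sg22 = 0 \<and> value_at Qpro2 (quad_char 2) sg22 = 1"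

definition gen_set ::
    "(nat \<Rightarrow> qbar \<Rightarrow> qbar) \<Rightarrow> (qbar \<Rightarrow> qbar) \<Rightarrow> (qbar \<Rightarrow> qbar) \<Rightarrow> (qbar \<Rightarrow> qbar) set" where
  "gen_set sg sg21 sg22 = {sg v |v. prime v \<and> odd v} \<union> {sg21, sg22}"


definition ring_ints :: "qbar set \<Rightarrow> qbar ring" where
  "ring_ints K = field_rec {z \<in> K. algebraic_int z}"

definition abs_norm :: "qbar set \<Rightarrow> qbar set \<Rightarrow> nat" where
  "abs_norm K I = card (carrier (ring_ints K Quot I))"

definition nonzero_prime :: "qbar set \<Rightarrow> qbar set \<Rightarrow> bool" where
  "nonzero_prime K P \<longleftrightarrow> primeideal P (ring_ints K) \<and> P \<noteq> {0}"

definition ram_index :: "qbar set \<Rightarrow> qbar set \<Rightarrow> qbar set \<Rightarrow> nat" where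
  "ram_index K M Q = (GREATEST e. Q \<inter> K \<subseteq> Q [^]\<^bsub>ideals_set (ring_ints M)\<^esub> (e::nat))"

text \<open>For \<open>Q\<close> above \<open>P\<close>, the residue degree is 1 iff \<open>Q\<close> and \<open>P\<close> have the same norm.\<close>
definition splits_completely :: "qbar set \<Rightarrow> qbar set \<Rightarrow> qbar set \<Rightarrow> bool" where
  "splits_completely K M P \<longleftrightarrow> (\<forall>Q. nonzero_prime M Q \<and> Q \<inter> K = P \<longrightarrow>
     ram_index K M Q = 1 \<and> abs_norm M Q = abs_norm K P)"

definition prime_splits_completely :: "nat \<Rightarrow> qbar set \<Rightarrow> bool" where
  "prime_splits_completely l M \<longleftrightarrow> splits_completely \<rat> M (PIdl\<^bsub>ring_ints \<rat>\<^esub> (of_nat l))"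

definition infinity_splits_completely :: "qbar set \<Rightarrow> bool" where
  "infinity_splits_completely M \<longleftrightarrow>
     (\<forall>f \<in> ring_hom (field_rec M) (ring_of_type_algebra :: complex ring). f ` M \<subseteq> \<real>)"

text \<open>The Frobenius elements at \<open>Q\<close> in \<open>Gal(L/K)\<close>; for ramified \<open>Q\<close>, a coset of inertia.\<close>
definition frob_elts :: "qbar set \<Rightarrow> qbar set \<Rightarrow> qbar set \<Rightarrow> (qbar \<Rightarrow> qbar) set" where
  "frob_elts K L Q =
     {\<tau> \<in> gal L K. \<forall>z \<in> carrier (ring_ints L). \<tau> z - z ^ abs_norm K (Q \<inter> K) \<in> Q}"

text \<open>
  Frobenius of the prime \<open>P\<close> of \<open>K\<close> in \<open>Gal(L/K)\<close>; independent of the choice when \<open>P\<close> is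
  unramified in \<open>L\<close> and its Frobenius class is central.
\<close>
definition Frob :: "qbar set \<Rightarrow> qbar set \<Rightarrow> qbar set \<Rightarrow> qbar \<Rightarrow> qbar" where
  "Frob K L P = (SOME \<tau>. \<exists>Q. nonzero_prime L Q \<and> Q \<inter> K = P \<and> \<tau> \<in> frob_elts K L Q)"

definition Up :: "qbar set \<Rightarrow> nat \<Rightarrow> qbar set" where
  "Up K b = (THE I. ideal I (ring_ints K) \<and> abs_norm K I = b)"


text \<open>
  Products of fractional ideals are again the sets of finite sums of products, so the product of
  ideals of the library applies to them verbatim.
\<close>
definition frac_ideals :: "qbar set \<Rightarrow> qbar set monoid" where
  "frac_ideals K =
     \<lparr>carrier = {(\<lambda>z. z / d) ` J |J d. ideal J (ring_ints K) \<and> J \<noteq> {0} \<and>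
                    d \<in> carrier (ring_ints K) \<and> d \<noteq> 0},
      monoid.mult = ideal_prod (ring_ints K), one = carrier (ring_ints K)\<rparr>"

definition totally_positive :: "qbar set \<Rightarrow> qbar \<Rightarrow> bool" where
  "totally_positive K \<alpha> \<longleftrightarrow>
     (\<forall>f \<in> ring_hom (field_rec K) (ring_of_type_algebra :: real ring). f \<alpha> > 0)"

definition narrow_principal :: "qbar set \<Rightarrow> qbar set set" where
  "narrow_principal K = {(\<lambda>z. \<alpha> * z) ` carrier (ring_ints K) |\<alpha>.
     \<alpha> \<in> K \<and> \<alpha> \<noteq> 0 \<and> totally_positive K \<alpha>}"

definition Cl :: "qbar set \<Rightarrow> qbar set set monoid" where
  "Cl K = frac_ideals K Mod narrow_principal K"

definition ideal_class :: "qbar set \<Rightarrow> qbar set \<Rightarrow> qbar set set" where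
  "ideal_class K I = narrow_principal K #>\<^bsub>frac_ideals K\<^esub> I"


text \<open>
  \<open>\<rat>\<^sub>2/\<int>\<^sub>2\<close> is realised as \<open>\<int>[1/2]/\<int>\<close>, to which it is isomorphic through the inclusion
  of \<open>\<int>[1/2]\<close> in \<open>\<rat>\<^sub>2\<close>.
\<close>
definition dyadic :: "rat \<Rightarrow> bool" where
  "dyadic q \<longleftrightarrow> (\<exists>k::nat. 2 ^ k * q \<in> \<int>)"

lemma dyadic_0 [simp]: "dyadic 0"
  by (simp add: dyadic_def)

lemma dyadic_minus: "dyadic a \<Longrightarrow> dyadic (- a)"
  unfolding dyadic_def by (metis Ints_minus mult_minus_right)

lemma dyadic_add:
  assumes "dyadic a" "dyadic b"
  shows "dyadic (a + b)"
proof -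
  from assms obtain k l :: nat where kl: "2 ^ k * a \<in> \<int>" "2 ^ l * b \<in> \<int>"
    by (auto simp: dyadic_def)
  have "2 ^ l * (2 ^ k * a) + 2 ^ k * (2 ^ l * b) \<in> \<int>"
    by (intro Ints_add Ints_mult kl Ints_power) auto
  moreover have "2 ^ l * (2 ^ k * a) + 2 ^ k * (2 ^ l * b) = 2 ^ (k + l) * (a + b)"
    by (simp add: power_add algebra_simps)
  ultimately show ?thesis
    unfolding dyadic_def by metis
qed

quotient_type q2z2 = rat / partial: "\<lambda>x y. dyadic x \<and> dyadic y \<and> x - y \<in> \<int>"
proof (rule part_equivpI)
  show "\<exists>x. dyadic x \<and> dyadic x \<and> x - x \<in> (\<int> :: rat set)"
    by (rule exI[of _ 0]) simp
  show "symp (\<lambda>x y. dyadic x \<and> dyadic y \<and> x - y \<in> (\<int> :: rat set))"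
    by (rule sympI) (metis Ints_minus minus_diff_eq)
  show "transp (\<lambda>x y. dyadic x \<and> dyadic y \<and> x - y \<in> (\<int> :: rat set))"
  proof (rule transpI)
    fix x y z :: rat
    assume "dyadic x \<and> dyadic y \<and> x - y \<in> \<int>" "dyadic y \<and> dyadic z \<and> y - z \<in> \<int>"
    moreover from this have "(x - y) + (y - z) \<in> \<int>"
      by (intro Ints_add) auto
    ultimately show "dyadic x \<and> dyadic z \<and> x - z \<in> \<int>"
      by simp
  qed
qed

instantiation q2z2 :: ab_group_add
begin

lift_definition zero_q2z2 :: q2z2 is "0 :: rat"
  by simp

lift_definition plus_q2z2 :: "q2z2 \<Rightarrow> q2z2 \<Rightarrow> q2z2" is "(+) :: rat \<Rightarrow> rat \<Rightarrow> rat"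
proof -
  fix a b c d :: rat
  assume *: "dyadic a \<and> dyadic b \<and> a - b \<in> \<int>" "dyadic c \<and> dyadic d \<and> c - d \<in> \<int>"
  have "(a - b) + (c - d) \<in> \<int>"
    using * by (intro Ints_add) auto
  with * show "dyadic (a + c) \<and> dyadic (b + d) \<and> a + c - (b + d) \<in> \<int>"
    by (simp add: dyadic_add algebra_simps)
qed

lift_definition uminus_q2z2 :: "q2z2 \<Rightarrow> q2z2" is "uminus :: rat \<Rightarrow> rat"
  by (metis Ints_minus dyadic_minus minus_diff_eq diff_minus_eq_add add.commute diff_conv_add_uminus)

definition minus_q2z2 :: "q2z2 \<Rightarrow> q2z2 \<Rightarrow> q2z2" where
  "minus_q2z2 x y = x + - y"

instance
proof
  fix x y z :: q2z2
  show "x + y + z = x + (y + z)"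
    by transfer (auto intro: dyadic_add simp: algebra_simps)
  show "x + y = y + x"
    by transfer (auto intro: dyadic_add simp: algebra_simps)
  show "0 + x = x"
    by transfer auto
  show "- x + x = 0"
    by transfer auto
  show "x - y = x + - y"
    by (rule minus_q2z2_def)
qed

end

lift_definition half :: q2z2 is "1 / 2 :: rat"
  by (auto simp: dyadic_def intro!: exI[of _ 1])

text \<open>The identification of \<open>\<bbbF>\<^sub>2\<close> with the 2-torsion of \<open>\<rat>\<^sub>2/\<int>\<^sub>2\<close>.\<close>
definition of_F2 :: "bit \<Rightarrow> q2z2" where
  "of_F2 e = (if e = 0 then 0 else half)"

definition to_F2 :: "q2z2 \<Rightarrow> bit" where
  "to_F2 = inv_into UNIV of_F2"

definition nmult :: "nat \<Rightarrow> q2z2 \<Rightarrow> q2z2" where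
  "nmult n y = (\<Sum>i<n. y)"

definition dual :: "'a monoid \<Rightarrow> ('a \<Rightarrow> q2z2) monoid" where
  "dual G =
     \<lparr>carrier = hom G \<lparr>carrier = UNIV, monoid.mult = (+), one = 0\<rparr> \<inter> extensional (carrier G),
      monoid.mult = (\<lambda>f g. \<lambda>x\<in>carrier G. f x + g x), one = (\<lambda>x\<in>carrier G. 0)\<rparr>"

text \<open>\<open>2\<^sup>n G[2\<^sup>k]\<close>, for an abelian group \<open>G\<close> written multiplicatively.\<close>
definition pow_tors :: "'a monoid \<Rightarrow> nat \<Rightarrow> nat \<Rightarrow> 'a set" where
  "pow_tors G n k =
     {c [^]\<^bsub>G\<^esub> ((2::nat) ^ n) |c. c \<in> carrier G \<and> c [^]\<^bsub>G\<^esub> ((2::nat) ^ k) = \<one>\<^bsub>G\<^esub>}"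

definition two_part :: "'a monoid \<Rightarrow> 'a monoid" where
  "two_part G = G \<lparr>carrier := {c \<in> carrier G. \<exists>n. c [^]\<^bsub>G\<^esub> ((2::nat) ^ n) = \<one>\<^bsub>G\<^esub>}\<rparr>"

text \<open>
  \<open>f \<in> Cl(K)\<^sup>\<or>\<close> corresponds to the map \<open>\<phi>\<close> on \<open>G\<^sub>K\<close> if \<open>\<phi>\<close> is \<open>f\<close> composed with the Artin
  map \<open>G\<^sub>K \<rightarrow> Cl(K)\<close>, that is, if \<open>\<phi>\<close> takes the value \<open>f([P])\<close> at all Frobenius elements
  in \<open>G\<^sub>K\<close> of every nonzero prime \<open>P\<close> of \<open>K\<close>. As these form a full coset of the inertia group
  at a prime of the algebraic closure, a homomorphism \<open>\<phi>\<close> with this property is unramified at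
  all finite primes.
\<close>
definition corresponds_Cl :: "qbar set \<Rightarrow> (qbar set set \<Rightarrow> q2z2) \<Rightarrow> ((qbar \<Rightarrow> qbar) \<Rightarrow> q2z2) \<Rightarrow> bool" where
  "corresponds_Cl K f \<phi> \<longleftrightarrow> f \<in> carrier (dual (Cl K)) \<and>
     (\<forall>Q. nonzero_prime UNIV Q \<longrightarrow>
        (\<forall>\<sigma> \<in> frob_elts K UNIV Q. \<phi> \<sigma> = f (ideal_class K (Q \<inter> K))))"

definition factors_through_Cl :: "qbar set \<Rightarrow> ((qbar \<Rightarrow> qbar) \<Rightarrow> q2z2) \<Rightarrow> bool" where
  "factors_through_Cl K \<phi> \<longleftrightarrow> (\<exists>f. corresponds_Cl K f \<phi>)"

definition as_Cl_char :: "qbar set \<Rightarrow> ((qbar \<Rightarrow> qbar) \<Rightarrow> q2z2) \<Rightarrow> qbar set set \<Rightarrow> q2z2" where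
  "as_Cl_char K \<phi> = (THE f. corresponds_Cl K f \<phi>)"

text \<open>
  The pairing \<open>\<langle>b, \<chi>\<rangle>\<close> for \<open>b \<in> 2\<^sup>k\<^sup>-\<^sup>1 A[2\<^sup>k]\<close>, where \<open>A = Cl(K)[2\<^sup>\<infinity>]\<close> and \<open>k \<ge> 1\<close>;
  \<open>\<chi> \<in> Cl(K)\<^sup>\<or>\<close> is restricted to \<open>A\<close>.
\<close>
definition artin_pairing ::
    "qbar set \<Rightarrow> nat \<Rightarrow> qbar set set \<Rightarrow> (qbar set set \<Rightarrow> q2z2) \<Rightarrow> bit" where
  "artin_pairing K k b \<chi> =
     (let A = two_part (Cl K);
          \<psi> = (SOME \<psi>. \<psi> \<in> carrier (dual A) \<and>
                  \<psi> [^]\<^bsub>dual A\<^esub> ((2::nat) ^ (k - 1)) = restrict \<chi> (carrier A))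
      in to_F2 (\<psi> b))"


type_synonym F2_map = "(qbar \<Rightarrow> qbar) \<Rightarrow> bit"

definition expansion_map :: "F2_map set \<Rightarrow> F2_map \<Rightarrow> (F2_map set \<Rightarrow> F2_map) \<Rightarrow> bool" where
  "expansion_map W \<chi>\<^sub>0 \<phi> \<longleftrightarrow>
     finite W \<and> \<chi>\<^sub>0 \<in> W \<and> W \<subseteq> quad_char ` {a. squarefree a} \<and>
     (\<forall>T. T \<subseteq> W \<and> T \<noteq> {} \<longrightarrow> (\<exists>\<sigma>\<in>GQ. (\<Sum>\<chi>\<in>T. \<chi> \<sigma>) \<noteq> 0)) \<and>
     (\<forall>\<sigma>\<in>GQ. \<phi> {} \<sigma> = \<chi>\<^sub>0 \<sigma>) \<and>
     (\<forall>Y. Y \<subseteq> W - {\<chi>\<^sub>0} \<longrightarrow> continuous_GQ (\<phi> Y) \<and>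
        (\<forall>\<sigma>\<in>GQ. \<forall>\<tau>\<in>GQ.
           \<phi> Y (\<sigma> \<otimes>\<^bsub>gal_group UNIV \<rat>\<^esub> \<tau>) + \<phi> Y \<sigma> + \<phi> Y \<tau> =
             (\<Sum>S \<in> Pow Y - {{}}. (\<Prod>\<chi>\<in>S. \<chi> \<sigma>) * \<phi> (Y - S) \<tau>)))"

text \<open>
  The kernel of the homomorphism \<open>\<psi>\<close> attached to the system is the set of common zeros of its
  coordinates, namely the characters in \<open>W - {\<chi>\<^sub>0}\<close> and the \<open>\<phi>\<^sub>Y\<close>.
\<close>
definition L_exp :: "F2_map set \<Rightarrow> F2_map \<Rightarrow> (F2_map set \<Rightarrow> F2_map) \<Rightarrow> qbar set" where
  "L_exp W \<chi>\<^sub>0 \<phi> = fixed_field {\<sigma> \<in> GQ. (\<forall>\<chi> \<in> W - {\<chi>\<^sub>0}. \<chi> \<sigma> = 0) \<and>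
     (\<forall>Y. Y \<subseteq> W - {\<chi>\<^sub>0} \<longrightarrow> \<phi> Y \<sigma> = 0)}"

definition M_exp :: "F2_map set \<Rightarrow> F2_map \<Rightarrow> (F2_map set \<Rightarrow> F2_map) \<Rightarrow> qbar set" where
  "M_exp W \<chi>\<^sub>0 \<phi> = gen_field
     ((\<Union>\<chi>\<in>W. field_of_def \<chi>) \<union> (\<Union>Y \<in> {Y. Y \<subset> W - {\<chi>\<^sub>0}}. field_of_def (\<phi> Y)))"

definition exp_support :: "int set \<Rightarrow> int \<Rightarrow> F2_map set" where
  "exp_support S d = quad_char ` S \<union> {quad_char d}"

definition is_phi_system ::
    "(qbar \<Rightarrow> qbar) set \<Rightarrow> int set \<Rightarrow> int \<Rightarrow> (F2_map set \<Rightarrow> F2_map) \<Rightarrow> bool" where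
  "is_phi_system G S d \<phi> \<longleftrightarrow>
     d \<notin> S \<and> squarefree d \<and> (\<forall>a\<in>S. squarefree a) \<and>
     expansion_map (exp_support S d) (quad_char d) \<phi> \<and>
     (\<forall>Y. Y \<subseteq> quad_char ` S \<and> Y \<noteq> {} \<longrightarrow> (\<forall>g\<in>G. value_at Qpro2 (\<phi> Y) g = 0))"

definition phi_exists :: "(qbar \<Rightarrow> qbar) set \<Rightarrow> int set \<Rightarrow> int \<Rightarrow> bool" where
  "phi_exists G S d \<longleftrightarrow> (\<exists>\<phi>. is_phi_system G S d \<phi>)"

text \<open>The system is unique up to irrelevant values outside its domain.\<close>
definition phi_system :: "(qbar \<Rightarrow> qbar) set \<Rightarrow> int set \<Rightarrow> int \<Rightarrow> F2_map set \<Rightarrow> F2_map" where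
  "phi_system G S d = (SOME \<phi>. is_phi_system G S d \<phi>)"

definition phi_map :: "(qbar \<Rightarrow> qbar) set \<Rightarrow> int set \<Rightarrow> int \<Rightarrow> F2_map" where
  "phi_map G S d = phi_system G S d (quad_char ` S)"

definition M_phi :: "(qbar \<Rightarrow> qbar) set \<Rightarrow> int set \<Rightarrow> int \<Rightarrow> qbar set" where
  "M_phi G S d = M_exp (exp_support S d) (quad_char d) (phi_system G S d)"


definition raw_cocycle :: "nat \<Rightarrow> int \<Rightarrow> ((qbar \<Rightarrow> qbar) \<Rightarrow> q2z2) \<Rightarrow> bool" where
  "raw_cocycle k x \<psi> \<longleftrightarrow>
     continuous_GQ \<psi> \<and>
     (\<forall>\<sigma>\<in>GQ. \<forall>\<tau>\<in>GQ. \<psi> (\<sigma> \<otimes>\<^bsub>gal_group UNIV \<rat>\<^esub> \<tau>) =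
        \<psi> \<sigma> + (if quad_char x \<sigma> = 0 then \<psi> \<tau> else - \<psi> \<tau>)) \<and>
     (\<forall>\<sigma>\<in>GQ. nmult (2 ^ k) (\<psi> \<sigma>) = 0) \<and>
     factors_through_Cl (quad_field x) \<psi>"

text \<open>\<open>\<psi>\<^sub>j = 2\<^sup>k\<^sup>-\<^sup>j \<psi>\<^sub>k\<close>, for \<open>0 \<le> j \<le> k\<close> only; negative indices \<open>j\<close> do not occur below.\<close>
definition lower :: "nat \<Rightarrow> nat \<Rightarrow> ((qbar \<Rightarrow> qbar) \<Rightarrow> q2z2) \<Rightarrow> (qbar \<Rightarrow> qbar) \<Rightarrow> q2z2" where
  "lower k j \<psi> \<sigma> = nmult (2 ^ (k - j)) (\<psi> \<sigma>)"


text \<open>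
  The primes are \<open>p i h\<close> with \<open>i \<in> {1..s}\<close> and \<open>h \<in> {1, 2}\<close>. A point of \<open>C\<close> is the function
  of its coordinates, the last one (number \<open>s + 1\<close>) being \<open>d0\<close>; \<^term>\<open>val\<close> is the
  corresponding integer.
\<close>
type_synonym point = "nat \<Rightarrow> nat"

definition cube :: "nat \<Rightarrow> (nat \<Rightarrow> nat \<Rightarrow> nat) \<Rightarrow> nat \<Rightarrow> point set" where
  "cube s p d0 = (\<Pi>\<^sub>E i\<in>{1..s+1}. if i = s + 1 then {d0} else {p i 1, p i 2})"

definition val :: "nat \<Rightarrow> point \<Rightarrow> int" where
  "val s x = int (\<Prod>i\<in>{1..s+1}. x i)"

definition point_field :: "nat \<Rightarrow> point \<Rightarrow> qbar set" where
  "point_field s x = quad_field (val s x)"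

definition base_point :: "nat \<Rightarrow> (nat \<Rightarrow> nat \<Rightarrow> nat) \<Rightarrow> nat \<Rightarrow> point" where
  "base_point s p d0 = (\<lambda>i\<in>{1..s+1}. if i = s + 1 then d0 else p i 1)"

definition subcube :: "nat \<Rightarrow> (nat \<Rightarrow> nat \<Rightarrow> nat) \<Rightarrow> nat \<Rightarrow> nat set \<Rightarrow> point set" where
  "subcube s p d0 T = {x \<in> cube s p d0. \<forall>i\<in>T. x i = p i 2}"

definition face :: "nat \<Rightarrow> (nat \<Rightarrow> nat \<Rightarrow> nat) \<Rightarrow> nat \<Rightarrow> nat \<Rightarrow> nat \<Rightarrow> point set" where
  "face s p d0 i h = {x \<in> cube s p d0. x i = p i h}"

definition pp :: "(nat \<Rightarrow> nat \<Rightarrow> nat) \<Rightarrow> nat \<Rightarrow> int" where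
  "pp p i = int (p i 1 * p i 2)"

definition valid_cube :: "nat \<Rightarrow> (nat \<Rightarrow> nat \<Rightarrow> nat) \<Rightarrow> nat \<Rightarrow> bool" where
  "valid_cube s p d0 \<longleftrightarrow> s \<ge> 1 \<and>
     (\<forall>i\<in>{1..s}. \<forall>h\<in>{1,2}. prime (p i h) \<and> odd (p i h) \<and> coprime d0 (p i h)) \<and>
     inj_on (\<lambda>(i, h). p i h) ({1..s} \<times> {1,2}) \<and>
     (\<forall>i\<in>{1..s}. (p i 1 * p i 2) mod 8 = 1) \<and>
     d0 > 0 \<and> squarefree d0"

definition profitable ::
    "(nat \<Rightarrow> qbar \<Rightarrow> qbar) \<Rightarrow> (qbar \<Rightarrow> qbar) \<Rightarrow> (qbar \<Rightarrow> qbar) \<Rightarrow>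
     nat \<Rightarrow> (nat \<Rightarrow> nat \<Rightarrow> nat) \<Rightarrow> nat \<Rightarrow> nat \<Rightarrow> (point \<Rightarrow> (qbar \<Rightarrow> qbar) \<Rightarrow> q2z2) \<Rightarrow> bool" where
  "profitable sg sg21 sg22 s p d0 a \<psi> \<longleftrightarrow>
     valid_cube s p d0 \<and> a dvd d0 \<and>
     (\<forall>x \<in> cube s p d0 - {base_point s p d0}.
        raw_cocycle (s + 1) (val s x) (\<psi> x) \<and>
        (\<forall>\<sigma>\<in>GQ. nmult (2 ^ s) (\<psi> x \<sigma>) = of_F2 (quad_char (int a) \<sigma>))) \<and>
     (\<forall>i\<in>{1..s}.
        (\<forall>T. T \<subseteq> {1..s} \<and> i \<in> T \<longrightarrow>
           value_at Qpro2 (\<lambda>\<sigma>. \<Sum>x \<in> subcube s p d0 T. lower (s + 1) (s + 1 - card T) (\<psi> x) \<sigma>)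
             (sg (p i 2)) = 0) \<and>
        (\<forall>\<sigma>\<in>GQ. (\<Sum>x \<in> face s p d0 i 2. lower (s + 1) (s - 1) (\<psi> x) \<sigma>) = 0) \<and>
        (let G = gen_set sg sg21 sg22; S = pp p ` ({1..s} - {i}); d = pp p i in
           phi_exists G S d \<and>
           (\<forall>l. prime l \<and> l dvd d0 \<longrightarrow>
              prime_splits_completely l (field_of_def (phi_map G S d))) \<and>
           prime_splits_completely 2 (M_phi G S d) \<and>
           infinity_splits_completely (M_phi G S d)))"

definition psi_comp ::
    "nat \<Rightarrow> (nat \<Rightarrow> nat \<Rightarrow> nat) \<Rightarrow> nat \<Rightarrow> (point \<Rightarrow> (qbar \<Rightarrow> qbar) \<Rightarrow> q2z2) \<Rightarrow>
     nat set \<Rightarrow> (qbar \<Rightarrow> qbar) \<Rightarrow> q2z2" where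
  "psi_comp s p d0 \<psi> T \<sigma> =
     (\<Sum>x \<in> subcube s p d0 ({1..s} - T). lower (s + 1) (card T + 1) (\<psi> x) \<sigma>)"

definition psi_support :: "nat \<Rightarrow> (nat \<Rightarrow> nat \<Rightarrow> nat) \<Rightarrow> nat \<Rightarrow> F2_map set" where
  "psi_support s p a = quad_char ` pp p ` {1..s} \<union> {quad_char (int a)}"

text \<open>The family of the \<open>\<psi>\<^sub>T\<close>, reindexed by sets of characters.\<close>
definition psi_exp ::
    "nat \<Rightarrow> (nat \<Rightarrow> nat \<Rightarrow> nat) \<Rightarrow> nat \<Rightarrow> (point \<Rightarrow> (qbar \<Rightarrow> qbar) \<Rightarrow> q2z2) \<Rightarrow> F2_map set \<Rightarrow> F2_map" where
  "psi_exp s p d0 \<psi> Y \<sigma> =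
     to_F2 (psi_comp s p d0 \<psi> {i \<in> {1..s}. quad_char (pp p i) \<in> Y} \<sigma>)"

definition L_psi ::
    "nat \<Rightarrow> (nat \<Rightarrow> nat \<Rightarrow> nat) \<Rightarrow> nat \<Rightarrow> nat \<Rightarrow> (point \<Rightarrow> (qbar \<Rightarrow> qbar) \<Rightarrow> q2z2) \<Rightarrow> qbar set" where
  "L_psi s p d0 a \<psi> = L_exp (psi_support s p a) (quad_char (int a)) (psi_exp s p d0 \<psi>)"

definition M_psi ::
    "nat \<Rightarrow> (nat \<Rightarrow> nat \<Rightarrow> nat) \<Rightarrow> nat \<Rightarrow> nat \<Rightarrow> (point \<Rightarrow> (qbar \<Rightarrow> qbar) \<Rightarrow> q2z2) \<Rightarrow> qbar set" where
  "M_psi s p d0 a \<psi> = M_exp (psi_support s p a) (quad_char (int a)) (psi_exp s p d0 \<psi>)"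

text \<open>
  The value of \<open>\<psi>\<close> at the base point is the fixed raw cocycle attached to the triple. The
  ramification index at the infinite place is at most 2 in any extension.
\<close>
definition attached ::
    "nat \<Rightarrow> (nat \<Rightarrow> nat \<Rightarrow> nat) \<Rightarrow> nat \<Rightarrow> nat \<Rightarrow> (point \<Rightarrow> (qbar \<Rightarrow> qbar) \<Rightarrow> q2z2) \<Rightarrow> bool" where
  "attached s p d0 a \<psi> \<longleftrightarrow>
     raw_cocycle (s + 1) (val s (base_point s p d0)) (\<psi> (base_point s p d0)) \<and>
     (\<forall>i\<in>{1..s}. \<forall>\<sigma>\<in>GQ. (\<Sum>x \<in> cube s p d0. lower (s + 1) i (\<psi> x) \<sigma>) = 0) \<and>
     (\<forall>T. T \<subseteq> {1..s} \<longrightarrow> (\<forall>\<sigma>\<in>GQ. psi_comp s p d0 \<psi> T \<sigma> \<in> range of_F2)) \<and>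
     expansion_map (psi_support s p a) (quad_char (int a)) (psi_exp s p d0 \<psi>) \<and>
     (\<forall>Q. nonzero_prime (L_psi s p d0 a \<psi>) Q \<longrightarrow> ram_index \<rat> (L_psi s p d0 a \<psi>) Q \<le> 2)"

text \<open>The Frobenius of \<open>P\<close> in \<open>Gal(L/\<rat>(\<surd>a))\<close>, read in \<open>\<bbbF>\<^sub>2\<close> through \<open>\<psi>\<^sub>[\<^sub>s\<^sub>]\<close>.\<close>
definition psi_Frob ::
    "nat \<Rightarrow> (nat \<Rightarrow> nat \<Rightarrow> nat) \<Rightarrow> nat \<Rightarrow> nat \<Rightarrow> (point \<Rightarrow> (qbar \<Rightarrow> qbar) \<Rightarrow> q2z2) \<Rightarrow> qbar set \<Rightarrow> bit" where
  "psi_Frob s p d0 a \<psi> P =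
     (let L = L_psi s p d0 a \<psi> in
        to_F2 (value_at L (psi_comp s p d0 \<psi> {1..s}) (Frob (quad_field (int a)) L P)))"

end

theory Submission
  imports Defs
begin

text \<open>
  Let \<open>l\<close> divide \<open>a\<close>, let \<open>R\<close> be a prime of the ring of all algebraic integers above \<open>l\<close>, and let
  \<open>\<tau>\<close> be a Frobenius element at \<open>R\<close> over \<open>\<rat>(\<surd>a)\<close>. The character \<open>\<chi>\<^sub>a = 2\<^sup>s \<psi>(x)\<close> of the class
  group of \<open>\<rat>(\<surd>x)\<close> vanishes on the class of \<open>Up(l)\<close>, which has order at most 2, hence on the
  Frobenius elements and on the inertia group at \<open>R\<close> over \<open>\<rat>(\<surd>x)\<close>. As inertia over \<open>\<rat>\<close> acts
  nontrivially on \<open>\<surd>a\<close>, its elements fixing \<open>\<surd>a\<close> also fix \<open>\<surd>x\<close>; so \<open>\<tau>\<close> is a Frobenius element at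
  \<open>R\<close> over \<open>\<rat>(\<surd>x)\<close> as well, simultaneously for all \<open>x\<close> in \<open>C\<close>, and \<open>\<psi>(x)(\<tau>)\<close> is the value of \<open>\<psi>(x)\<close>
  at the class of \<open>Up(l)\<close>, an element of order at most 2. Therefore \<open>\<tau>\<close> fixes \<open>M\<close>, which makes all
  residue degrees over \<open>Up(l)\<close> equal to 1, and the ramification index 2 allowed in \<open>L\<close> is used up by
  \<open>\<rat>(\<surd>a)\<close>. Both sides of the reciprocity law are the sum over \<open>x\<close> and \<open>l\<close> of the values of \<open>\<psi>(x)\<close>
  at the classes of \<open>Up(l)\<close>.
\<close>

section \<open>Integral elements\<close>

text \<open>A prime \<open>R\<close> of the ring of all algebraic integers lets one automorphism
  serve every field at once, so that no primes of different fields have to be matched. Automorphisms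
  at \<open>R\<close> all come from one principle: a map that respects sums and products of
  algebraic integers only modulo \<open>R\<close>, and is the identity modulo \<open>R\<close> on
  the integers of a subfield, is congruent to an automorphism over that subfield. Power maps give
  Frobenius elements, a conjugation gives the inertia element that moves the square root, and a
  twisted power map lifts the Frobenius chosen in \<open>L\<close>. Class group characters are tied
  to maps on the Galois group through prime ideals only, so their uniqueness rests on factoring
  ideals of quadratic fields, where a prime is inverted explicitly by its conjugate. For
  \<open>L\<close> the arguments use only that its integers are finite modulo each positive integer;
  Nakayama's lemma then bounds the exponents in \<open>ram_index\<close>.\<close>

interpretation Zmod: Modules.module "\<lambda>(c::int) (v::'a::comm_ring_1). of_int c * v"
  by unfold_locales (simp_all add: algebra_simps)

lemma map_poly_add:
  assumes "f 0 = 0" "\<And>x y. f (x + y) = f x + f y"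
  shows "map_poly f (p + q) = map_poly f p + map_poly f q"
  by (intro poly_eqI) (simp add: assms coeff_map_poly)

lemma map_poly_mult:
  fixes f :: "'a::comm_ring_1 \<Rightarrow> 'b::comm_ring_1"
  assumes "f 0 = 0" "\<And>x y. f (x + y) = f x + f y" "\<And>x y. f (x * y) = f x * f y"
  shows "map_poly f (p * q) = map_poly f p * map_poly f q"
proof -
  have f_sum: "f (\<Sum>i\<in>I. g i) = (\<Sum>i\<in>I. f (g i))" for g and I :: "nat set"
    by (induction I rule: infinite_finite_induct) (auto simp: assms)
  show ?thesis
    by (intro poly_eqI) (simp add: assms coeff_map_poly coeff_mult f_sum)
qed

text \<open>The bare equations on \<open>f\<close> let it be \<open>map_poly g\<close> as well: this
  is how an automorphism acts on the resolvent polynomial, whose coefficients are themselves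
  polynomials.\<close>

lemma map_poly_prod:
  fixes f :: "'a::comm_ring_1 \<Rightarrow> 'b::comm_ring_1"
  assumes "f 0 = 0" "f 1 = 1" "\<And>x y. f (x + y) = f x + f y" "\<And>x y. f (x * y) = f x * f y"
  shows "map_poly f (\<Prod>i\<in>I. g i) = (\<Prod>i\<in>I. map_poly f (g i))"
  by (induction I rule: infinite_finite_induct) (simp_all add: assms map_poly_mult)

lemma poly_map_poly_hom:
  fixes f :: "'a::comm_ring_1 \<Rightarrow> 'b::comm_ring_1"
  assumes "f 0 = 0" "\<And>x y. f (x + y) = f x + f y" "\<And>x y. f (x * y) = f x * f y"
  shows "poly (map_poly f p) (f x) = f (poly p x)"
  by (induction p) (simp_all add: assms map_poly_pCons)

text \<open>The ring \<open>int\<close> is Noetherian: the coefficients with which the new generator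
  \<open>s\<close> occurs in \<open>H\<close> are the multiples of the least positive one, so an
  element \<open>h0\<close> with that coefficient, together with generators of
  \<open>H \<inter> Zmod.span S\<close>, generates \<open>H\<close>.\<close>

lemma Zspan_subgroup_finitely_generated:
  assumes "finite S" "Zmod.subspace H" "H \<subseteq> Zmod.span S"
  shows "\<exists>F. finite F \<and> F \<subseteq> H \<and> Zmod.span F = H"
  using assms
proof (induction S arbitrary: H rule: finite_induct)
  case empty
  hence "H = {0}"
    using Zmod.subspace_0 by auto
  thus ?case by (intro exI[of _ "{}"]) simp
next
  case (insert s S)
  define H' where "H' = H \<inter> Zmod.span S"
  have "Zmod.subspace H'"
    unfolding H'_def using insert.prems by (intro Zmod.subspace_inter) auto
  then obtain F' where F': "finite F'" "F' \<subseteq> H'" "Zmod.span F' = H'"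
    using insert.IH[of H'] by (auto simp: H'_def)
  define D where "D = {d::nat. d > 0 \<and> (\<exists>v\<in>Zmod.span S. of_nat d * s + v \<in> H)}"
  have decomp: "\<exists>c v. h = of_int c * s + v \<and> v \<in> Zmod.span S" if "h \<in> H" for h
  proof -
    have "h \<in> Zmod.span (insert s S)" using that insert.prems by auto
    then obtain c where "h - of_int c * s \<in> Zmod.span S"
      by (auto simp: Zmod.span_insert)
    thus ?thesis by (intro exI[of _ c] exI[of _ "h - of_int c * s"]) auto
  qed
  have in_D: "nat c \<in> D" if "c > 0" "v \<in> Zmod.span S" "of_int c * s + v \<in> H" for c v
    using that unfolding D_def by (auto intro!: bexI[of _ v])
  show ?case
  proof (cases "D = {}")
    case True
    have "H \<subseteq> Zmod.span S"
    proof
      fix h assume h: "h \<in> H"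
      obtain c v where cv: "h = of_int c * s + v" "v \<in> Zmod.span S"
        using decomp[OF h] by blast
      have "c \<le> 0" using in_D[of c v] cv h True by (cases "c > 0") auto
      moreover have "- h \<in> H" using h insert.prems Zmod.subspace_neg by blast
      hence "of_int (- c) * s + - v \<in> H" using cv by simp
      hence "\<not> - c > 0" using in_D[of "- c" "- v"] cv Zmod.span_neg[of v] True by blast
      ultimately have "c = 0" by simp
      thus "h \<in> Zmod.span S" using cv by simp
    qed
    thus ?thesis using insert.IH[of H] insert.prems by auto
  next
    case False
    define d where "d = (LEAST d. d \<in> D)"
    have "d \<in> D" unfolding d_def using False by (meson LeastI ex_in_conv)
    then obtain v0 where d: "d > 0" "v0 \<in> Zmod.span S" "of_nat d * s + v0 \<in> H"
      by (auto simp: D_def)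
    define h0 where "h0 = of_nat d * s + v0"
    have "h \<in> Zmod.span (insert h0 F')" if h: "h \<in> H" for h
    proof -
      obtain c v where cv: "h = of_int c * s + v" "v \<in> Zmod.span S"
        using decomp[OF h] by blast
      define q r where "q = c div int d" and "r = c mod int d"
      have c: "c = q * int d + r" by (simp add: q_def r_def)
      have r: "0 \<le> r" "r < int d" using d by (auto simp: r_def)
      have *: "h - of_int q * h0 = of_int r * s + (v - of_int q * v0)"
        by (simp add: cv h0_def c algebra_simps)
      have in_span: "v - of_int q * v0 \<in> Zmod.span S"
        using cv d by (intro Zmod.span_diff Zmod.span_scale)
      have in_H: "h - of_int q * h0 \<in> H"
        using h d insert.prems unfolding h0_def
        by (intro Zmod.subspace_diff Zmod.subspace_scale)
      have "r = 0"
      proof (rule ccontr)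
        assume "r \<noteq> 0"
        hence "nat r \<in> D" using in_D[of r "v - of_int q * v0"] r in_span in_H * by simp
        hence "d \<le> nat r" unfolding d_def by (rule Least_le)
        thus False using r \<open>d > 0\<close> by linarith
      qed
      hence "h - of_int q * h0 \<in> H'" using * in_span in_H by (simp add: H'_def)
      thus ?thesis using F' by (auto simp: Zmod.span_insert)
    qed
    moreover have "Zmod.span (insert h0 F') \<subseteq> H"
      using F' d insert.prems by (intro Zmod.span_minimal) (auto simp: h0_def H'_def)
    ultimately show ?thesis
      using F' d by (intro exI[of _ "insert h0 F'"]) (auto simp: h0_def H'_def)
  qed
qed

text \<open>The values of integral polynomials at \<open>x\<close> form a subgroup of a finitely
  generated group, hence finitely many of them generate it. If \<open>N\<close> exceeds the degrees
  of the polynomials involved, then \<open>x ^ N\<close> is the value of a polynomial of lower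
  degree, which is a monic equation.\<close>

lemma algebraic_int_if_powers_in_Zspan:
  fixes x :: "'a::field_char_0"
  assumes "finite S" "\<And>k. x ^ k \<in> Zmod.span S"
  shows "algebraic_int x"
proof -
  define P where "P = (\<lambda>p::int poly. poly (map_poly of_int p) x)"
  have P_add: "P (p + q) = P p + P q" for p q
    by (simp add: P_def map_poly_add)
  have P_smult: "P (Polynomial.smult c p) = of_int c * P p" for c p
    by (simp add: P_def map_poly_smult)
  have "Zmod.subspace (range P)"
  proof (rule Zmod.subspaceI)
    show "0 \<in> range P" by (rule image_eqI[of _ _ 0]) (auto simp: P_def)
    show "u + v \<in> range P" if "u \<in> range P" "v \<in> range P" for u v
      using that by (auto simp flip: P_add)
    show "of_int c * u \<in> range P" if "u \<in> range P" for c u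
      using that by (auto simp flip: P_smult)
  qed
  moreover have "range P \<subseteq> Zmod.span S"
  proof safe
    fix p
    have "P p = (\<Sum>i\<le>degree p. of_int (coeff p i) * x ^ i)"
      by (simp add: P_def poly_altdef degree_map_poly coeff_map_poly)
    thus "P p \<in> Zmod.span S"
      using assms by (auto intro!: Zmod.span_sum Zmod.span_scale)
  qed
  ultimately have "\<exists>F. finite F \<and> F \<subseteq> range P \<and> Zmod.span F = range P"
    by (rule Zspan_subgroup_finitely_generated[OF assms(1)])
  then obtain F where F: "finite F" "F \<subseteq> range P" "Zmod.span F = range P"
    by blast
  obtain G where G: "finite G" "F = P ` G"
    using finite_subset_image[OF F(1,2)] by blast
  define N where "N = Suc (Max (insert 0 (degree ` G)))"
  have "Zmod.span F \<subseteq> {P p |p. degree p < N}"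
  proof (rule Zmod.span_minimal)
    show "F \<subseteq> {P p |p. degree p < N}"
      using G unfolding N_def by (force simp: less_Suc_eq_le)
    show "Zmod.subspace {P p |p. degree p < N}"
    proof (rule Zmod.subspaceI)
      show "0 \<in> {P p |p. degree p < N}" by (intro CollectI exI[of _ 0]) (auto simp: P_def N_def)
      show "u + v \<in> {P p |p. degree p < N}" if uv: "u \<in> {P p |p. degree p < N}" "v \<in> {P p |p. degree p < N}" for u v
      proof -
        obtain p q where "u = P p" "degree p < N" "v = P q" "degree q < N" using uv by blast
        hence "u + v = P (p + q)" "degree (p + q) < N" by (simp_all add: P_add degree_add_less)
        thus ?thesis by blast
      qed
      show "of_int c * u \<in> {P p |p. degree p < N}" if u: "u \<in> {P p |p. degree p < N}" for c u
      proof -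
        obtain p where "u = P p" "degree p < N" using u by blast
        hence "of_int c * u = P (Polynomial.smult c p)" "degree (Polynomial.smult c p) < N"
          using degree_smult_le[of c p] by (simp_all add: P_smult)
        thus ?thesis by blast
      qed
    qed
  qed
  moreover have "x ^ N \<in> range P"
    by (rule range_eqI[of _ _ "monom 1 N"]) (simp add: P_def map_poly_monom poly_monom)
  ultimately obtain p where p: "degree p < N" "x ^ N = P p"
    using F by auto
  define q where "q = monom 1 N - p"
  have "degree q = N" "lead_coeff q = 1"
  proof -
    have "degree (- p) < degree (monom (1::int) N)" using p by (simp add: degree_monom_eq)
    from degree_add_eq_left[OF this] show "degree q = N"
      by (simp add: q_def degree_monom_eq)
    thus "lead_coeff q = 1" using p by (simp add: q_def coeff_eq_0)
  qed
  moreover have "poly (map_poly of_int q) x = 0"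
    using p using P_add[of q p] by (simp add: q_def P_def map_poly_monom poly_monom)
  ultimately show ?thesis
    unfolding algebraic_int_altdef_ipoly by blast
qed

lemma power_in_Zspan_if_algebraic_int:
  fixes x :: "'a::field_char_0"
  assumes "algebraic_int x"
  shows "\<exists>n. \<forall>k. x ^ k \<in> Zmod.span ((\<lambda>i. x ^ i) ` {..<n})"
proof -
  obtain p where p: "poly (map_poly of_int p) x = 0" "lead_coeff p = (1::int)"
    using assms unfolding algebraic_int_altdef_ipoly by blast
  define n where "n = degree p"
  have "0 = (\<Sum>i\<le>n. of_int (coeff p i) * x ^ i)"
    using p by (simp add: n_def poly_altdef degree_map_poly coeff_map_poly)
  also have "\<dots> = x ^ n + (\<Sum>i<n. of_int (coeff p i) * x ^ i)"
    using p by (simp add: n_def flip: lessThan_Suc_atMost)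
  finally have xn: "x ^ n = (\<Sum>i<n. of_int (- coeff p i) * x ^ i)"
    by (simp add: eq_neg_iff_add_eq_0 sum_negf)
  have "x ^ k \<in> Zmod.span ((\<lambda>i. x ^ i) ` {..<n})" for k
  proof (induction k rule: less_induct)
    case (less k)
    show ?case
    proof (cases "k < n")
      case True
      thus ?thesis by (intro Zmod.span_base) auto
    next
      case False
      have "x ^ k = x ^ (k - n) * x ^ n" using False by (simp flip: power_add)
      also have "\<dots> = (\<Sum>i<n. of_int (- coeff p i) * x ^ (k - n + i))"
        unfolding xn sum_distrib_left by (intro sum.cong) (auto simp: power_add)
      also have "\<dots> \<in> Zmod.span ((\<lambda>i. x ^ i) ` {..<n})"
        using False by (intro Zmod.span_sum Zmod.span_scale less) auto
      finally show ?thesis .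
    qed
  qed
  thus ?thesis by blast
qed

lemma mult_in_Zspan:
  assumes "u \<in> Zmod.span A" "v \<in> Zmod.span B"
  shows "u * v \<in> Zmod.span ((\<lambda>(a, b). a * b) ` (A \<times> B))" (is "_ \<in> ?S")
proof -
  have sub: "Zmod.subspace {v. a * v \<in> ?S}" for a
    by (rule Zmod.subspaceI) (auto simp: distrib_left mult.left_commute[of _ "of_int _"] intro: Zmod.span_zero Zmod.span_add Zmod.span_scale)
  have sub': "Zmod.subspace {u. u * v \<in> ?S}"
    by (rule Zmod.subspaceI) (auto simp: distrib_right mult.assoc intro: Zmod.span_zero Zmod.span_add Zmod.span_scale)
  have "a * v \<in> ?S" if "a \<in> A" for a
    using Zmod.span_induct[OF assms(2), of "\<lambda>v. a * v \<in> ?S"] sub[of a] that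
    by (force intro: Zmod.span_base)
  thus ?thesis
    using Zmod.span_induct[OF assms(1), of "\<lambda>u. u * v \<in> ?S"] sub' by blast
qed

text \<open>The reduced powers of \<open>x\<close> and of \<open>y\<close> have products that
  generate a group containing all \<open>x ^ i * y ^ j\<close>, hence every power of
  \<open>x + y\<close> and of \<open>x * y\<close>.\<close>

lemma algebraic_int_add_mult:
  fixes x y :: "'a::field_char_0"
  assumes "algebraic_int x" "algebraic_int y"
  shows algebraic_int_add: "algebraic_int (x + y)" and algebraic_int_mult: "algebraic_int (x * y)"
proof -
  obtain m n where mn: "\<forall>k. x ^ k \<in> Zmod.span ((\<lambda>i. x ^ i) ` {..<m})"
     "\<forall>k. y ^ k \<in> Zmod.span ((\<lambda>i. y ^ i) ` {..<n})"
    using assms power_in_Zspan_if_algebraic_int by metis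
  let ?S = "(\<lambda>(a, b). a * b) ` ((\<lambda>i. x ^ i) ` {..<m::nat} \<times> (\<lambda>i. y ^ i) ` {..<n::nat})"
  have *: "x ^ i * y ^ j \<in> Zmod.span ?S" for i j
    using mn by (intro mult_in_Zspan) auto
  have "(x + y) ^ k \<in> Zmod.span ?S" for k
    unfolding binomial_ring using Zmod.span_scale[OF *, of "int (k choose _)"]
    by (intro Zmod.span_sum) (simp add: mult.assoc)
  thus "algebraic_int (x + y)"
    by (intro algebraic_int_if_powers_in_Zspan[of ?S]) auto
  show "algebraic_int (x * y)"
    using * by (intro algebraic_int_if_powers_in_Zspan[of ?S]) (auto simp: power_mult_distrib)
qed

lemma algebraic_int_diff:
  "algebraic_int x \<Longrightarrow> algebraic_int y \<Longrightarrow> algebraic_int (x - y)" for x y :: "'a::field_char_0"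
  using algebraic_int_add[of x "- y"] by simp

lemma algebraic_int_sum:
  "(\<And>i. i \<in> I \<Longrightarrow> algebraic_int (f i)) \<Longrightarrow> algebraic_int (\<Sum>i\<in>I. f i)" for f :: "_ \<Rightarrow> 'a::field_char_0"
  by (induction I rule: infinite_finite_induct) (auto intro: algebraic_int_add)

lemma algebraic_int_power: "algebraic_int x \<Longrightarrow> algebraic_int (x ^ n)" for x :: "'a::field_char_0"
  by (induction n) (auto intro: algebraic_int_mult)

section \<open>Automorphisms of the algebraic closure\<close>

lemma ring_of_type_algebra_simps [simp]:
  "carrier ring_of_type_algebra = UNIV" "x \<otimes>\<^bsub>ring_of_type_algebra\<^esub> y = x * y"
  "x \<oplus>\<^bsub>ring_of_type_algebra\<^esub> y = x + y" "\<one>\<^bsub>ring_of_type_algebra\<^esub> = 1"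
  "\<zero>\<^bsub>ring_of_type_algebra\<^esub> = 0"
  by (simp_all add: ring_of_type_algebra_def)

lemma a_inv_ring_of_type_algebra [simp]: "\<ominus>\<^bsub>ring_of_type_algebra\<^esub> x = - (x :: 'a::field)"
proof -
  interpret R: field "ring_of_type_algebra :: 'a ring" by (rule field_from_type_algebra)
  show ?thesis by (rule R.minus_equality) auto
qed

lemma m_inv_ring_of_type_algebra [simp]:
  "x \<noteq> 0 \<Longrightarrow> inv\<^bsub>ring_of_type_algebra\<^esub> x = inverse (x :: 'a::field)"
proof -
  interpret R: field "ring_of_type_algebra :: 'a ring" by (rule field_from_type_algebra)
  assume "x \<noteq> 0"
  thus ?thesis by (intro R.comm_inv_char) auto
qed

lemma subfield_iff:
  "subfield (K :: 'a::field set) ring_of_type_algebra \<longleftrightarrow> 0 \<in> K \<and> 1 \<in> K \<and>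
     (\<forall>x\<in>K. \<forall>y\<in>K. x + y \<in> K \<and> x * y \<in> K) \<and> (\<forall>x\<in>K. - x \<in> K \<and> inverse x \<in> K)" (is "?l \<longleftrightarrow> ?r")
proof -
  interpret R: field "ring_of_type_algebra :: 'a ring" by (rule field_from_type_algebra)
  show ?thesis
  proof
    assume l: ?l
    have inv: "inverse x \<in> K" if "x \<in> K" for x
      using R.subfield_m_inv(1)[OF l, of x] that subringE(2)[OF subfieldE(1)[OF l]] by (cases "x = 0") auto
    show ?r
      using inv subringE[OF subfieldE(1)[OF l]] by (auto simp: subset_iff)
  next
    assume r: ?r
    have "subring K ring_of_type_algebra"
      using r by (intro R.subringI) auto
    thus ?l using r by (intro R.subfieldI') auto
  qed
qed

lemma Rats_subset_subfield:
  fixes K :: "'a::field_char_0 set"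
  assumes "subfield K ring_of_type_algebra" shows "\<rat> \<subseteq> K"
proof -
  have nat: "of_nat n \<in> K" for n
    using assms by (induction n) (auto simp: subfield_iff)
  have int: "of_int n \<in> K" for n
    using nat assms by (cases n rule: int_cases2) (auto simp: subfield_iff)
  show ?thesis
  proof
    fix x :: 'a assume "x \<in> \<rat>"
    then obtain a b where "x = of_int a / of_int b" by (rule Rats_cases') auto
    thus "x \<in> K" using int assms by (auto simp: subfield_iff divide_inverse)
  qed
qed

lemma subfield_Rats: "subfield (\<rat> :: 'a::field_char_0 set) ring_of_type_algebra"
  by (auto simp: subfield_iff)

lemma subfield_UNIV: "subfield (UNIV :: 'a::field set) ring_of_type_algebra"
  by (auto simp: subfield_iff)

lemma gal_iff:
  "\<sigma> \<in> gal E F \<longleftrightarrow> \<sigma> \<in> extensional E \<and> bij_betw \<sigma> E E \<and>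
     (\<forall>x\<in>E. \<forall>y\<in>E. \<sigma> (x + y) = \<sigma> x + \<sigma> y \<and> \<sigma> (x * y) = \<sigma> x * \<sigma> y) \<and> \<sigma> 1 = 1 \<and> (\<forall>x\<in>F. \<sigma> x = x)"
  by (auto simp: gal_def ring_iso_def ring_hom_def ring_of_type_algebra_def bij_betw_def)

lemma gal_UNIV_iff:
  "\<sigma> \<in> gal UNIV F \<longleftrightarrow> bij \<sigma> \<and> (\<forall>x y. \<sigma> (x + y) = \<sigma> x + \<sigma> y) \<and> (\<forall>x y. \<sigma> (x * y) = \<sigma> x * \<sigma> y) \<and>
     \<sigma> 1 = 1 \<and> (\<forall>x\<in>F. \<sigma> x = x)"
  by (auto simp: gal_iff)

text \<open>Two fields and a map that is only required to be a homomorphism on a subfield: this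
  covers \<open>to_ac\<close> as well as homomorphisms known on a subfield of \<open>qbar\<close>
  only.\<close>

lemma hom_of_rat:
  fixes \<sigma> :: "'a::field_char_0 \<Rightarrow> 'b::field_char_0"
  assumes K: "subfield K ring_of_type_algebra"
    and hom: "\<And>x y. x \<in> K \<Longrightarrow> y \<in> K \<Longrightarrow> \<sigma> (x + y) = \<sigma> x + \<sigma> y"
      "\<And>x y. x \<in> K \<Longrightarrow> y \<in> K \<Longrightarrow> \<sigma> (x * y) = \<sigma> x * \<sigma> y" "\<sigma> 1 = 1"
  shows "\<sigma> (of_rat r) = of_rat r"
proof -
  have QK: "\<rat> \<subseteq> K" using K by (rule Rats_subset_subfield)
  have zero: "\<sigma> 0 = 0" using hom(1)[of 0 0] K by (simp add: subfield_iff)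
  have nat: "\<sigma> (of_nat n) = of_nat n" for n
    using QK by (induction n) (auto simp: hom zero subset_iff)
  have neg: "\<sigma> (- x) = - \<sigma> x" if "x \<in> K" for x
    using hom(1)[of x "- x"] that K zero by (simp add: subfield_iff add_eq_0_iff)
  have int: "\<sigma> (of_int n) = of_int n" for n
    using QK by (cases n rule: int_cases2) (auto simp: nat neg subset_iff)
  obtain a b where r: "r = of_int a / of_int b" "b > 0"
    by (metis Fract_of_int_quotient Rat_cases)
  have "of_int b * (of_rat r :: 'a) = of_int a" and r': "of_int b * (of_rat r :: 'b) = of_int a"
    using r by (simp_all add: of_rat_divide)
  hence "of_int b * \<sigma> (of_rat r) = of_int a"
    using hom(2)[of "of_int b" "of_rat r"] QK int by (auto simp: subset_iff)
  with r' have "of_int b * \<sigma> (of_rat r) = of_int b * (of_rat r :: 'b)" by simp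
  thus ?thesis using r by simp
qed

section \<open>Algebraicity over the rational numbers and extension of homomorphisms\<close>

lemma qbar_algebraic:
  obtains p :: "qbar poly" where "lead_coeff p = 1" "\<And>i. coeff p i \<in> \<rat>" "poly p x = 0"
proof -
  obtain q where q: "q \<noteq> 0" "poly (map_poly to_ac q) x = 0"
    by (rule alg_closure_algebraic)
  define p where "p = Polynomial.smult (inverse (to_ac (lead_coeff q))) (map_poly to_ac q)"
  have "to_ac r = of_rat r" for r :: rat
    using hom_of_rat[of UNIV "to_ac :: rat \<Rightarrow> qbar" r] by (simp add: subfield_UNIV)
  hence "coeff p i \<in> \<rat>" for i
    by (auto simp: p_def coeff_map_poly intro!: Rats_mult)
  moreover have "lead_coeff p = 1" "poly p x = 0"
    using q by (simp_all add: p_def coeff_map_poly degree_map_poly)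
  ultimately show ?thesis using that by blast
qed

text \<open>In a monic polynomial of least degree vanishing at \<open>x\<close> the constant term
  \<open>a\<close> is nonzero, since otherwise \<open>x\<close> could be cancelled; then
  \<open>a + x * poly q x = 0\<close> exhibits the inverse.\<close>

lemma qbar_inverse_eq_poly:
  fixes x :: qbar
  assumes "x \<noteq> 0"
  obtains p :: "qbar poly" where "\<And>i. coeff p i \<in> \<rat>" "inverse x = poly p x"
proof -
  define D where "D = {degree p |p. lead_coeff p = 1 \<and> (\<forall>i. coeff p i \<in> \<rat>) \<and> poly p x = 0}"
  obtain p0 where "lead_coeff p0 = 1" "\<And>i. coeff p0 i \<in> \<rat>" "poly p0 x = 0"
    by (rule qbar_algebraic[of x]) blast
  hence "D \<noteq> {}" by (auto simp: D_def)
  hence "(LEAST d. d \<in> D) \<in> D" by (meson LeastI ex_in_conv)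
  then obtain p where p: "degree p = (LEAST d. d \<in> D)" "lead_coeff p = 1" "\<forall>i. coeff p i \<in> \<rat>" "poly p x = 0"
    unfolding D_def by auto
  obtain a q where pq: "p = pCons a q" by (cases p)
  have q0: "q \<noteq> 0" using p assms by (auto simp: pq split: if_splits)
  have q: "\<forall>i. coeff q i \<in> \<rat>" "lead_coeff q = 1"
    using p(3)[rule_format, of "Suc _"] p(2) q0 by (auto simp: pq)
  have "a \<noteq> 0"
  proof
    assume "a = 0"
    hence "poly q x = 0" using p assms by (simp add: pq)
    hence "degree q \<in> D" using q by (auto simp: D_def)
    hence "degree p \<le> degree q" unfolding p by (rule Least_le)
    thus False using q0 by (simp add: pq)
  qed
  moreover have "a \<in> \<rat>" using p(3)[rule_format, of 0] by (simp add: pq)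
  moreover have "a + x * poly q x = 0" using p by (simp add: pq)
  hence "x * poly q x = - a" by (simp add: add_eq_0_iff)
  hence "x * poly (Polynomial.smult (- inverse a) q) x = 1"
    using \<open>a \<noteq> 0\<close> by (simp add: mult.left_commute[of x])
  hence "inverse x = poly (Polynomial.smult (- inverse a) q) x" by (rule inverse_unique)
  ultimately show ?thesis using q by (intro that[of "Polynomial.smult (- inverse a) q"]) (auto intro!: Rats_mult)
qed

text \<open>A partial homomorphism is encoded by its graph, so that Zorn's lemma applies to
  inclusion directly. The condition on \<open>(0, b)\<close> makes the graph single-valued. The
  domain is only asked to be a ring containing \<open>\<rat>\<close>; algebraicity turns it into a
  field.\<close>

definition graph_hom :: "(qbar \<times> qbar) set \<Rightarrow> bool" where
  "graph_hom G \<longleftrightarrow> (\<forall>r\<in>\<rat>. (r, r) \<in> G) \<and> (\<forall>b. (0, b) \<in> G \<longrightarrow> b = 0) \<and>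
     (\<forall>a b c d. (a, b) \<in> G \<longrightarrow> (c, d) \<in> G \<longrightarrow> (a + c, b + d) \<in> G \<and> (a * c, b * d) \<in> G)"

text \<open>The polynomial \<open>q\<close> is the image of \<open>p\<close> under the partial
  homomorphism. Both are carried along because a graph cannot be applied to coefficients like a
  function.\<close>

definition graph_poly :: "(qbar \<times> qbar) set \<Rightarrow> qbar poly \<Rightarrow> qbar poly \<Rightarrow> bool" where
  "graph_poly G p q \<longleftrightarrow> (\<forall>i. (coeff p i, coeff q i) \<in> G)"

context
  fixes G assumes G: "graph_hom G"
begin

lemma graph_rat: "r \<in> \<rat> \<Longrightarrow> (r, r) \<in> G"
  and graph_zero: "(0, b) \<in> G \<Longrightarrow> b = 0"
  and graph_add: "(a, b) \<in> G \<Longrightarrow> (c, d) \<in> G \<Longrightarrow> (a + c, b + d) \<in> G"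
  and graph_mult: "(a, b) \<in> G \<Longrightarrow> (c, d) \<in> G \<Longrightarrow> (a * c, b * d) \<in> G"
  using G by (auto simp: graph_hom_def)

lemma graph_uminus: "(a, b) \<in> G \<Longrightarrow> (- a, - b) \<in> G"
  using graph_mult[of "-1" "-1" a b] graph_rat[of "-1"] by simp

lemma graph_unique: "(a, b) \<in> G \<Longrightarrow> (a, c) \<in> G \<Longrightarrow> b = c"
  using graph_add[of a b "- a" "- c"] graph_uminus[of a c] graph_zero[of "b - c"] by simp

lemma graph_sum: "(\<And>i. i \<in> I \<Longrightarrow> (f i, g i) \<in> G) \<Longrightarrow> (sum f I, sum g I) \<in> G"
  by (induction I rule: infinite_finite_induct) (auto intro: graph_add graph_rat)

lemma graph_power: "(a, b) \<in> G \<Longrightarrow> (a ^ n, b ^ n) \<in> G"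
  by (induction n) (auto intro: graph_mult graph_rat)

lemma graph_poly_eval: "graph_poly G p q \<Longrightarrow> (a, b) \<in> G \<Longrightarrow> (poly p a, poly q b) \<in> G"
proof -
  assume *: "graph_poly G p q" "(a, b) \<in> G"
  define n where "n = max (degree p) (degree q)"
  have "poly r x = (\<Sum>i\<le>n. coeff r i * x ^ i)" if "degree r \<le> n" for r and x :: qbar
    unfolding poly_altdef using that by (intro sum.mono_neutral_left) (auto simp: coeff_eq_0)
  hence "poly p a = (\<Sum>i\<le>n. coeff p i * a ^ i)" "poly q b = (\<Sum>i\<le>n. coeff q i * b ^ i)"
    by (auto simp: n_def)
  thus ?thesis using * by (auto simp: graph_poly_def intro!: graph_sum graph_mult graph_power)
qed

text \<open>The inverse of \<open>a\<close> is a rational polynomial in \<open>a\<close>; the value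
  of the same polynomial at \<open>b\<close> corresponds to it and is therefore an inverse of
  \<open>b\<close>.\<close>

lemma graph_inverse:
  assumes "(a, b) \<in> G" "a \<noteq> 0"
  shows "(inverse a, inverse b) \<in> G"
proof -
  obtain p where p: "\<And>i. coeff p i \<in> \<rat>" "inverse a = poly p a"
    using qbar_inverse_eq_poly[OF assms(2)] by metis
  have "(inverse a, poly p b) \<in> G"
    unfolding p(2) using graph_poly_eval[of p p a b] p assms graph_rat by (auto simp: graph_poly_def)
  moreover from graph_mult[OF this assms(1)] assms(2) have "(1, poly p b * b) \<in> G" by simp
  with graph_rat[of 1] graph_unique have "poly p b * b = 1" by force
  hence "poly p b = inverse b" by (metis inverse_unique inverse_inverse_eq)
  ultimately show ?thesis by simp
qed

lemma graph_poly_add: "graph_poly G p q \<Longrightarrow> graph_poly G p' q' \<Longrightarrow> graph_poly G (p + p') (q + q')"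
  by (auto simp: graph_poly_def intro: graph_add)

lemma graph_poly_mult: "graph_poly G p q \<Longrightarrow> graph_poly G p' q' \<Longrightarrow> graph_poly G (p * p') (q * q')"
  by (auto simp: graph_poly_def coeff_mult intro!: graph_sum graph_mult)

lemma graph_poly_monom: "(a, b) \<in> G \<Longrightarrow> graph_poly G (monom a n) (monom b n)"
  by (auto simp: graph_poly_def intro: graph_rat)

lemma graph_poly_minus: "graph_poly G p q \<Longrightarrow> graph_poly G p' q' \<Longrightarrow> graph_poly G (p - p') (q - q')"
  using graph_add graph_uminus by (simp add: graph_poly_def flip: add_uminus_conv_diff)

lemma graph_poly_zero: "graph_poly G 0 q \<Longrightarrow> q = 0"
  by (auto simp: graph_poly_def poly_eq_iff intro: graph_zero)

lemma graph_poly_degree: "graph_poly G p q \<Longrightarrow> degree q \<le> degree p"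
  by (auto simp: graph_poly_def intro!: degree_le intro: graph_zero) (metis coeff_eq_0 graph_zero)

text \<open>The divisor is monic, so each step of the division takes place within the domain of
  \<open>G\<close> and can be repeated on the image polynomials.\<close>

lemma graph_poly_division:
  assumes "graph_poly G m n" "lead_coeff m = 1" "graph_poly G p q"
  shows "\<exists>s t r u. graph_poly G s t \<and> graph_poly G r u \<and> p = m * s + r \<and> q = n * t + u \<and>
           (r = 0 \<or> degree r < degree m)"
  using assms(3)
proof (induction "degree p" arbitrary: p q rule: less_induct)
  case less
  have z: "graph_poly G 0 0" by (auto simp: graph_poly_def graph_rat)
  show ?case
  proof (cases "p = 0 \<or> degree p < degree m")
    case True
    thus ?thesis using less.prems z by (intro exI[of _ 0] exI[of _ p] exI[of _ q]) auto
  next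
    case False
    define k where "k = degree p - degree m"
    define s t where "s = monom (lead_coeff p) k" and "t = monom (coeff q (degree p)) k"
    have st: "graph_poly G s t"
      unfolding s_def t_def using less.prems by (intro graph_poly_monom) (auto simp: graph_poly_def)
    define p' q' where "p' = p - m * s" and "q' = q - n * t"
    have g: "graph_poly G p' q'"
      unfolding p'_def q'_def by (intro graph_poly_minus graph_poly_mult less.prems assms st)
    have "m \<noteq> 0" "s \<noteq> 0" using assms False by (auto simp: s_def)
    have deg: "degree (m * s) = degree p"
      using False \<open>m \<noteq> 0\<close> \<open>s \<noteq> 0\<close> by (simp add: degree_mult_eq s_def degree_monom_eq k_def)
    have "lead_coeff (m * s) = lead_coeff p"
      using assms False by (simp only: lead_coeff_mult) (auto simp: s_def degree_monom_eq)
    hence lc: "coeff (m * s) (degree p) = lead_coeff p" by (simp only: deg)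
    have "\<exists>s t r u. graph_poly G s t \<and> graph_poly G r u \<and> p' = m * s + r \<and> q' = n * t + u \<and>
           (r = 0 \<or> degree r < degree m)"
    proof (cases "degree p = 0")
      case True
      hence "p' = 0" using lc deg unfolding p'_def
        by (metis (no_types, lifting) coeff_diff degree_diff_le degree_eq_zeroE diff_self le_0_eq le_numeral_extra(3) coeff_pCons_0 pCons_0_0)
      thus ?thesis using g graph_poly_zero z by (intro exI[of _ 0]) auto
    next
      case False
      have "degree p' \<le> degree p" unfolding p'_def using deg by (simp add: degree_diff_le)
      moreover have "coeff p' (degree p) = 0" by (simp add: p'_def lc)
      ultimately have "degree p' < degree p" using False
        by (metis le_neq_implies_less leading_coeff_0_iff degree_0)
      from less.hyps[OF this g] show ?thesis .
    qed
    then obtain s' t' r u where *: "graph_poly G s' t'" "graph_poly G r u" "p' = m * s' + r" "q' = n * t' + u"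
           "r = 0 \<or> degree r < degree m" by blast
    have "p = m * (s + s') + r" "q = n * (t + t') + u"
      using *(3,4) by (simp_all add: p'_def q'_def algebra_simps)
    thus ?thesis using * st graph_poly_add by blast
  qed
qed

text \<open>Here \<open>m\<close> is the minimal polynomial of \<open>w\<close> over the domain, and
  \<open>w'\<close> a root of its image. The larger graph is single-valued because a polynomial
  vanishing at \<open>w\<close> has remainder zero modulo \<open>m\<close>, so that its image is a
  multiple of \<open>n\<close> and vanishes at \<open>w'\<close>.\<close>

lemma graph_adjoin:
  assumes mn: "graph_poly G m n" "lead_coeff m = 1" "poly m w = 0" "poly n w' = 0"
    and minimal: "\<And>p q. graph_poly G p q \<Longrightarrow> lead_coeff p = 1 \<Longrightarrow> poly p w = 0 \<Longrightarrow> degree m \<le> degree p"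
  obtains G' where "graph_hom G'" "G \<subseteq> G'" "(w, w') \<in> G'"
proof
  define G' where "G' = {(poly p w, poly q w') |p q. graph_poly G p q}"
  have const: "graph_poly G [:a:] [:b:]" if "(a, b) \<in> G" for a b
    using graph_poly_monom[OF that, of 0] by (simp add: monom_0)
  show "G \<subseteq> G'"
  proof safe
    fix a b assume "(a, b) \<in> G"
    thus "(a, b) \<in> G'" unfolding G'_def using const by (intro CollectI exI[of _ "[:a:]"] exI[of _ "[:b:]"]) auto
  qed
  show "(w, w') \<in> G'"
    unfolding G'_def using graph_poly_monom[of 1 1 1] graph_rat[of 1]
    by (intro CollectI exI[of _ "monom 1 1"]) (auto simp: poly_monom)
  have "b = 0" if zb: "(0, b) \<in> G'" for b
  proof -
    obtain p q where pq: "graph_poly G p q" "poly p w = 0" "b = poly q w'"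
      using zb by (auto simp: G'_def)
    obtain s t r u where *: "graph_poly G s t" "graph_poly G r u" "p = m * s + r" "q = n * t + u"
           "r = 0 \<or> degree r < degree m"
      using graph_poly_division[OF mn(1,2) pq(1)] by blast
    have "r = 0"
    proof (rule ccontr)
      assume "r \<noteq> 0"
      \<comment> \<open>Minimality of \<open>m\<close> is stated among monic polynomials, so the
        remainder is divided by its leading coefficient.\<close>
      define c d where "c = lead_coeff r" and "d = coeff u (degree r)"
      have "c \<noteq> 0" "(c, d) \<in> G" using * \<open>r \<noteq> 0\<close> by (auto simp: c_def d_def graph_poly_def)
      hence "graph_poly G ([:inverse c:] * r) ([:inverse d:] * u)"
        by (intro graph_poly_mult const graph_inverse *)
      moreover have "lead_coeff ([:inverse c:] * r) = 1" using \<open>c \<noteq> 0\<close> by (simp add: c_def)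
      moreover have "poly r w = 0" using * pq mn by simp
      hence "poly ([:inverse c:] * r) w = 0" by simp
      ultimately have "degree m \<le> degree ([:inverse c:] * r)" by (rule minimal)
      thus False using * \<open>r \<noteq> 0\<close> \<open>c \<noteq> 0\<close> by simp
    qed
    with * have "u = 0" using graph_poly_zero by blast
    thus ?thesis using * pq mn by simp
  qed
  moreover have "(r, r) \<in> G'" if "r \<in> \<rat>" for r
    using \<open>G \<subseteq> G'\<close> graph_rat[OF that] by blast
  moreover have "(a + c, b + d) \<in> G' \<and> (a * c, b * d) \<in> G'" if abcd: "(a, b) \<in> G'" "(c, d) \<in> G'" for a b c d
  proof -
    obtain p q p' q' where pq: "graph_poly G p q" "a = poly p w" "b = poly q w'"
       "graph_poly G p' q'" "c = poly p' w" "d = poly q' w'"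
      using abcd by (auto simp: G'_def)
    have "a + c = poly (p + p') w \<and> b + d = poly (q + q') w' \<and> graph_poly G (p + p') (q + q')"
      "a * c = poly (p * p') w \<and> b * d = poly (q * q') w' \<and> graph_poly G (p * p') (q * q')"
      using pq by (simp_all add: graph_poly_add graph_poly_mult)
    thus ?thesis unfolding G'_def by blast
  qed
  ultimately show "graph_hom G'" by (auto simp: graph_hom_def)
qed

lemma graph_minimal_poly:
  obtains m n where "graph_poly G m n" "lead_coeff m = 1" "poly m w = 0"
    "\<And>p q. graph_poly G p q \<Longrightarrow> lead_coeff p = 1 \<Longrightarrow> poly p w = 0 \<Longrightarrow> degree m \<le> degree p"
proof -
  define D where "D = {degree p |p. \<exists>q. graph_poly G p q \<and> lead_coeff p = 1 \<and> poly p w = 0}"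
  obtain p where "lead_coeff p = 1" "\<And>i. coeff p i \<in> \<rat>" "poly p w = 0"
    by (rule qbar_algebraic[of w]) blast
  hence "degree p \<in> D" using graph_rat by (auto simp: D_def graph_poly_def)
  hence "(LEAST d. d \<in> D) \<in> D" by (rule LeastI)
  then obtain m n where "graph_poly G m n" "lead_coeff m = 1" "poly m w = 0" "degree m = (LEAST d. d \<in> D)"
    by (auto simp: D_def)
  moreover from this have "degree m \<le> degree p"
    if "graph_poly G p q" "lead_coeff p = 1" "poly p w = 0" for p q
    using that by (auto simp: D_def intro!: Least_le)
  ultimately show ?thesis using that by blast
qed

lemma graph_poly_monic:
  assumes "graph_poly G m n" "lead_coeff m = 1"
  shows "lead_coeff n = 1" "degree n = degree m"
proof -
  have "(1, coeff n (degree m)) \<in> G" using assms by (metis graph_poly_def)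
  hence 1: "coeff n (degree m) = 1" using graph_rat[of 1] graph_unique[of 1 1] by auto
  thus "degree n = degree m" using graph_poly_degree[OF assms(1)] le_degree[of n "degree m"] by simp
  thus "lead_coeff n = 1" using 1 by simp
qed

end

text \<open>A maximal graph is defined everywhere, since the image of any minimal polynomial has a
  root. The resulting map is injective and sends the finite root set of each rational polynomial to
  itself, so it is surjective too.\<close>

lemma graph_hom_extends:
  assumes "graph_hom G"
  obtains g where "g \<in> GQ" "\<And>a b. (a, b) \<in> G \<Longrightarrow> g a = b"
proof -
  have "\<exists>M\<in>{H. graph_hom H \<and> G \<subseteq> H}. \<forall>Y\<in>{H. graph_hom H \<and> G \<subseteq> H}. M \<subseteq> Y \<longrightarrow> Y = M"
  proof (rule subset_Zorn_nonempty)
    show "{H. graph_hom H \<and> G \<subseteq> H} \<noteq> {}" using assms by blast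
    fix C assume C: "C \<noteq> {}" "subset.chain {H. graph_hom H \<and> G \<subseteq> H} C"
    have "graph_hom (\<Union>C)"
      unfolding graph_hom_def
    proof (intro conjI allI impI ballI)
      show "(r, r) \<in> \<Union>C" if "r \<in> \<rat>" for r
        using C that by (fastforce simp: subset_chain_def graph_hom_def)
      show "b = 0" if "(0, b) \<in> \<Union>C" for b
        using C that by (fastforce simp: subset_chain_def graph_hom_def)
      fix a b c d assume *: "(a, b) \<in> \<Union>C" "(c, d) \<in> \<Union>C"
      then obtain H1 H2 where H12: "H1 \<in> C" "(a, b) \<in> H1" "H2 \<in> C" "(c, d) \<in> H2" by blast
      hence "H1 \<subseteq> H2 \<or> H2 \<subseteq> H1" using C by (simp add: subset_chain_def)
      then obtain H where "H \<in> C" "(a, b) \<in> H" "(c, d) \<in> H" using H12 by blast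
      thus "(a + c, b + d) \<in> \<Union>C" "(a * c, b * d) \<in> \<Union>C"
        using C by (auto simp: subset_chain_def graph_hom_def intro!: bexI[of _ H])
    qed
    moreover obtain H where "H \<in> C" using C(1) by blast
    hence "G \<subseteq> \<Union>C" using C(2) unfolding subset_chain_def by blast
    ultimately show "\<Union>C \<in> {H. graph_hom H \<and> G \<subseteq> H}" by simp
  qed
  then obtain M where M': "M \<in> {H. graph_hom H \<and> G \<subseteq> H}"
      "\<forall>Y\<in>{H. graph_hom H \<and> G \<subseteq> H}. M \<subseteq> Y \<longrightarrow> Y = M"
    by (rule bexE)
  hence M: "graph_hom M" "G \<subseteq> M" by simp_all
  have maximal: "H = M" if "graph_hom H" "M \<subseteq> H" for H
    using M'(2) that M(2) by auto
  have "\<exists>b. (w, b) \<in> M" for w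
  proof -
    obtain m n where mn: "graph_poly M m n" "lead_coeff m = 1" "poly m w = 0"
       "\<And>p q. graph_poly M p q \<Longrightarrow> lead_coeff p = 1 \<Longrightarrow> poly p w = 0 \<Longrightarrow> degree m \<le> degree p"
      by (rule graph_minimal_poly[OF M(1), of w]) (rule that)
    have "degree m \<noteq> 0" using mn(2,3) by (intro notI) (auto elim!: degree_eq_zeroE)
    hence "degree n > 0" using graph_poly_monic[OF M(1) mn(1,2)] by simp
    then obtain w' where nw: "poly n w' = 0" using alg_closed_imp_poly_has_root by blast
    obtain G' where "graph_hom G'" "M \<subseteq> G'" "(w, w') \<in> G'"
      by (rule graph_adjoin[OF M(1) mn(1-3) nw mn(4)])
    thus ?thesis using maximal by blast
  qed
  then obtain g where g: "(w, g w) \<in> M" for w by metis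
  have g_eq: "g a = b" if "(a, b) \<in> M" for a b using graph_unique[OF M(1) that g] by simp
  have add: "g (x + y) = g x + g y" for x y using graph_add[OF M(1) g g] by (rule g_eq)
  have mult: "g (x * y) = g x * g y" for x y using graph_mult[OF M(1) g g] by (rule g_eq)
  have one: "g 1 = 1" using graph_rat[OF M(1), of 1] by (intro g_eq) auto
  have rat: "g r = r" if "r \<in> \<rat>" for r using graph_rat[OF M(1) that] by (rule g_eq)
  have inj: "inj g"
  proof (rule injI)
    fix x y assume "g x = g y"
    moreover have "g (x - y) + g y = g x" by (simp flip: add)
    ultimately have "g (x - y) = 0" by simp
    moreover have "g (x - y) * g (inverse (x - y)) = 1" if "x \<noteq> y"
      using that by (simp add: one flip: mult)
    ultimately show "x = y" by auto
  qed
  have "y \<in> range g" for y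
  proof -
    obtain p where p: "lead_coeff p = 1" "\<And>i. coeff p i \<in> \<rat>" "poly p y = 0"
      by (rule qbar_algebraic[of y]) blast
    have "map_poly g p = p" using p by (intro poly_eqI) (simp add: coeff_map_poly rat)
    hence "poly p (g x) = g (poly p x)" for x
      using poly_map_poly_hom[of g p x] add mult rat[of 0] by simp
    hence sub: "g ` {x. poly p x = 0} \<subseteq> {x. poly p x = 0}" using rat[of 0] by auto
    have "finite {x. poly p x = 0}" using p by (intro poly_roots_finite) auto
    hence "g ` {x. poly p x = 0} = {x. poly p x = 0}"
      by (intro endo_inj_surj sub inj_on_subset[OF inj]) auto
    hence "y \<in> g ` {x. poly p x = 0}" using p by simp
    thus "y \<in> range g" by blast
  qed
  hence "surj g" by blast
  thus ?thesis using that[of g] g_eq M(2) inj add mult one rat by (auto simp: gal_UNIV_iff bij_def)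
qed

lemma graph_hom_image:
  assumes K: "subfield K ring_of_type_algebra"
    and hom: "\<And>x y. x \<in> K \<Longrightarrow> y \<in> K \<Longrightarrow> h (x + y) = h x + h y"
      "\<And>x y. x \<in> K \<Longrightarrow> y \<in> K \<Longrightarrow> h (x * y) = h x * h y" "h 1 = 1"
  shows "graph_hom ((\<lambda>x. (x, h x)) ` K)"
  unfolding graph_hom_def
proof (intro conjI allI impI ballI)
  show "(r, r) \<in> (\<lambda>x. (x, h x)) ` K" if r: "r \<in> \<rat>" for r
  proof -
    obtain q where q: "r = of_rat q" using r by (rule Rats_cases)
    have "h (of_rat q) = of_rat q" by (rule hom_of_rat[OF K hom])
    thus ?thesis using r q Rats_subset_subfield[OF K] by (auto intro!: image_eqI[of _ _ r])
  qed
  show "b = 0" if "(0, b) \<in> (\<lambda>x. (x, h x)) ` K" for b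
    using that hom(1)[of 0 0] K by (auto simp: subfield_iff)
qed (use K hom in \<open>auto simp: subfield_iff\<close>)

lemma subfield_hom_extends:
  assumes K: "subfield K ring_of_type_algebra"
    and hom: "\<And>x y. x \<in> K \<Longrightarrow> y \<in> K \<Longrightarrow> h (x + y) = h x + h y"
      "\<And>x y. x \<in> K \<Longrightarrow> y \<in> K \<Longrightarrow> h (x * y) = h x * h y" "h 1 = 1"
  obtains g where "g \<in> GQ" "\<And>x. x \<in> K \<Longrightarrow> g x = h x"
proof -
  obtain g where "g \<in> GQ" "\<And>a b. (a, b) \<in> (\<lambda>x. (x, h x)) ` K \<Longrightarrow> g a = b"
    by (rule graph_hom_extends[OF graph_hom_image[OF K hom]]) blast+
  thus ?thesis using that by blast
qed

text \<open>The minimal polynomial of \<open>w\<close> over \<open>K\<close> is not linear, and in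
  characteristic zero it has a root other than \<open>w\<close>. Sending \<open>w\<close> to that
  root extends to an automorphism over \<open>K\<close>.\<close>

lemma gal_UNIV_moves:
  fixes K :: "qbar set"
  assumes K: "subfield K ring_of_type_algebra" and w: "w \<notin> K"
  shows "\<exists>g\<in>gal UNIV K. g w \<noteq> w"
proof -
  define G :: "(qbar \<times> qbar) set" where "G = (\<lambda>x. (x, x)) ` K"
  have G: "graph_hom G"
    unfolding G_def by (rule graph_hom_image[OF K]) simp_all
  obtain m n where mn: "graph_poly G m n" "lead_coeff m = 1" "poly m w = 0"
      "\<And>p q. graph_poly G p q \<Longrightarrow> lead_coeff p = 1 \<Longrightarrow> poly p w = 0 \<Longrightarrow> degree m \<le> degree p"
    by (rule graph_minimal_poly[OF G, of w]) (rule that)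
  have "n = m" and mK: "coeff m i \<in> K" for i
    using mn(1) by (auto simp: graph_poly_def G_def poly_eq_iff)
  obtain q where q: "m = [:- w, 1:] * q"
    using mn(3) by (metis dvdE poly_eq_0_iff_dvd)
  have "degree q \<noteq> 0"
  proof
    assume "degree q = 0"
    then obtain c where "q = [:c:]" by (rule degree_eq_zeroE)
    moreover from this mn(2) q have "c = 1" by (auto split: if_splits)
    ultimately have "coeff m 0 = - w" using q by simp
    thus False using mK[of 0] w K by (metis minus_minus subfield_iff)
  qed
  then obtain w' where w': "poly q w' = 0" using alg_closed_imp_poly_has_root[of q] by auto
  have "w' \<noteq> w"
  proof
    assume "w' = w"
    define d where "d = degree m"
    have "q \<noteq> 0" using \<open>degree q \<noteq> 0\<close> by auto
    hence d: "d > 0" unfolding d_def q by (subst degree_mult_eq) auto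
    \<comment> \<open>The derivative made monic: at a double root it would be a polynomial over
      \<open>K\<close> that vanishes at \<open>w\<close> and has smaller degree than
      \<open>m\<close>.\<close>
    define r where "r = Polynomial.smult (inverse (of_nat d)) (pderiv m)"
    have "poly (pderiv m) w = 0"
      unfolding q pderiv_mult using w' \<open>w' = w\<close> by (simp add: pderiv_pCons)
    hence "poly r w = 0" by (simp add: r_def)
    moreover have dr: "degree r = d - 1" using d by (simp add: r_def degree_pderiv d_def)
    moreover have "coeff r (d - 1) = 1"
      using d mn(2) by (simp add: r_def coeff_pderiv) (simp add: d_def)
    moreover have "coeff r i \<in> K" for i
      using mK[of "Suc i"] K Rats_subset_subfield[OF K]
      by (auto simp: r_def coeff_pderiv subfield_iff subset_iff simp del: of_nat_Suc)
    hence "graph_poly G r r" by (auto simp: graph_poly_def G_def)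
    ultimately have "degree m \<le> degree r" using mn(4) by metis
    thus False using d dr by (simp add: d_def)
  qed
  have nw: "poly n w' = 0" using w' q \<open>n = m\<close> by simp
  obtain G' where "graph_hom G'" "G \<subseteq> G'" "(w, w') \<in> G'"
    by (rule graph_adjoin[OF G mn(1-3) nw mn(4)])
  moreover from this(1) obtain g where "g \<in> GQ" "\<And>a b. (a, b) \<in> G' \<Longrightarrow> g a = b"
    by (rule graph_hom_extends) blast
  ultimately show ?thesis using \<open>w' \<noteq> w\<close>
    by (intro bexI[of _ g]) (auto simp: gal_UNIV_iff G_def)
qed

lemma mult_gal_group_UNIV [simp]: "\<sigma> \<otimes>\<^bsub>gal_group UNIV F\<^esub> \<tau> = (\<lambda>x. \<sigma> (\<tau> x))"
  by (simp add: gal_group_def compose_def restrict_UNIV)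

lemma gal_UNIV_comp: "\<sigma> \<in> gal UNIV F \<Longrightarrow> \<tau> \<in> gal UNIV F \<Longrightarrow> (\<lambda>x. \<sigma> (\<tau> x)) \<in> gal UNIV F"
  using bij_comp[of \<tau> \<sigma>] by (auto simp: gal_UNIV_iff comp_def)

lemma gal_UNIV_id: "(\<lambda>x. x) \<in> gal UNIV F"
  by (auto simp: gal_UNIV_iff bij_def)

context
  fixes \<sigma> :: "'a::field \<Rightarrow> 'a" and F
  assumes \<sigma>: "\<sigma> \<in> gal UNIV F"
begin

lemma gal_add: "\<sigma> (x + y) = \<sigma> x + \<sigma> y"
  and gal_mult: "\<sigma> (x * y) = \<sigma> x * \<sigma> y"
  and gal_one: "\<sigma> 1 = 1"
  and gal_fixes: "x \<in> F \<Longrightarrow> \<sigma> x = x"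
  and gal_bij: "bij \<sigma>"
  using \<sigma> by (auto simp: gal_UNIV_iff)

lemma gal_zero: "\<sigma> 0 = 0"
  using gal_add[of 0 0] by (simp only: add_0_left add_cancel_right_right)

lemma gal_minus: "\<sigma> (- x) = - \<sigma> x"
  using gal_add[of x "- x"] gal_zero by (simp add: add_eq_0_iff)

lemma gal_diff: "\<sigma> (x - y) = \<sigma> x - \<sigma> y"
  using gal_add[of x "- y"] gal_minus[of y] by simp

lemma gal_power: "\<sigma> (x ^ n) = \<sigma> x ^ n"
  by (induction n) (auto simp: gal_mult gal_one)

lemma gal_inverse: "\<sigma> (inverse x) = inverse (\<sigma> x)"
  using gal_mult[of x "inverse x"] gal_one gal_zero
  by (cases "x = 0") (auto intro: inverse_unique[symmetric])

lemma gal_eq_iff: "\<sigma> x = \<sigma> y \<longleftrightarrow> x = y"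
  using gal_bij by (auto simp: bij_def inj_def)

lemma inv_gal_apply: "inv_into UNIV \<sigma> (\<sigma> x) = x"
  and apply_inv_gal: "\<sigma> (inv_into UNIV \<sigma> x) = x"
  using gal_bij by (simp_all add: bij_def surj_f_inv_f)

lemma gal_UNIV_inv: "inv_into UNIV \<sigma> \<in> gal UNIV F"
  unfolding gal_UNIV_iff
proof (intro conjI allI ballI)
  show "bij (inv_into UNIV \<sigma>)" using gal_bij by (rule bij_imp_bij_inv)
qed (subst gal_eq_iff[symmetric], simp add: apply_inv_gal gal_add gal_mult gal_one gal_fixes)+

end

lemma gal_UNIV_mono: "E \<subseteq> F \<Longrightarrow> gal UNIV F \<subseteq> gal UNIV E"
  by (auto simp: gal_UNIV_iff subset_iff)

lemma gal_UNIV_subset_GQ: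
  fixes K :: "qbar set"
  assumes "subfield K ring_of_type_algebra" shows "gal UNIV K \<subseteq> GQ"
  using gal_UNIV_mono Rats_subset_subfield[OF assms] by blast

lemma GQ_poly:
  assumes "\<sigma> \<in> GQ" "\<And>i. coeff p i \<in> \<rat>"
  shows "\<sigma> (poly p x) = poly p (\<sigma> x)"
proof -
  have "map_poly \<sigma> p = p"
    using assms by (intro poly_eqI) (simp add: coeff_map_poly gal_zero gal_fixes)
  thus ?thesis using poly_map_poly_hom[of \<sigma> p x] assms(1) by (simp add: gal_add gal_mult gal_zero)
qed

lemma GQ_algebraic_int:
  assumes "\<sigma> \<in> GQ" "algebraic_int x"
  shows "algebraic_int (\<sigma> x)"
proof -
  obtain p where p: "lead_coeff p = 1" "\<forall>i. coeff p i \<in> \<int>" "poly p x = 0"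
    using assms(2) by (auto simp: algebraic_int.simps)
  have "poly p (\<sigma> x) = 0"
    using GQ_poly[OF assms(1), of p x] p Ints_subset_Rats assms(1) by (auto simp: gal_zero)
  thus ?thesis using p by (intro algebraic_int.intros)
qed

text \<open>Finite orbits have two uses: they make the orbit defining the resolvent polynomial
  finite, and they make the space of candidates in \<open>conjugate_modulo_prime_all\<close>
  compact.\<close>

lemma finite_conjugates: "finite ((\<lambda>\<sigma>. \<sigma> x) ` GQ)"
proof -
  obtain p where p: "lead_coeff p = 1" "\<And>i. coeff p i \<in> \<rat>" "poly p x = 0"
    by (rule qbar_algebraic[of x]) blast
  have "poly p (\<sigma> x) = 0" if "\<sigma> \<in> GQ" for \<sigma>
    using GQ_poly[OF that p(2), of x] p that by (simp add: gal_zero)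
  hence "(\<lambda>\<sigma>. \<sigma> x) ` GQ \<subseteq> {x. poly p x = 0}" by auto
  moreover have "finite {x. poly p x = 0}" using p by (intro poly_roots_finite) auto
  ultimately show ?thesis by (rule finite_subset)
qed

lemma subfield_fixed_field: "H \<subseteq> GQ \<Longrightarrow> subfield (fixed_field H) ring_of_type_algebra"
  unfolding subfield_iff fixed_field_def
  by (auto simp: subset_iff gal_add[of _ \<rat>] gal_mult[of _ \<rat>] gal_zero[of _ \<rat>] gal_one[of _ \<rat>]
      gal_minus[of _ \<rat>] gal_inverse[of _ \<rat>])

lemma fixed_field_gal:
  assumes "subfield K ring_of_type_algebra"
  shows "fixed_field (gal UNIV K) = K"
  using gal_UNIV_moves[OF assms] by (auto simp: fixed_field_def gal_fixes)

text \<open>If \<open>D\<close> clears the denominators of a monic equation \<open>p\<close> of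
  degree \<open>N\<close>, then \<open>D ^ N * p(Y / D)\<close> is monic with integral coefficients
  and vanishes at \<open>D * x\<close>.\<close>

lemma qbar_integral_multiple:
  fixes x :: qbar
  obtains n :: nat where "n > 0" "algebraic_int (of_nat n * x)"
proof -
  obtain p where p: "lead_coeff p = 1" "\<And>i. coeff p i \<in> \<rat>" "poly p x = 0"
    by (rule qbar_algebraic[of x]) blast
  define N where "N = degree p"
  have "\<exists>d::nat. d > 0 \<and> of_nat d * coeff p i \<in> \<int>" for i
  proof -
    obtain a b where "coeff p i = of_int a / of_int b" "b > 0"
      using p(2)[of i] by (auto elim: Rats_cases')
    thus ?thesis by (intro exI[of _ "nat b"]) (auto simp: field_simps)
  qed
  then obtain d :: "nat \<Rightarrow> nat" where d: "\<And>i. d i > 0" "\<And>i. of_nat (d i) * coeff p i \<in> \<int>" by metis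
  define D where "D = (\<Prod>i\<le>N. d i)"
  have Dc: "of_nat D * coeff p i \<in> \<int>" if "i \<le> N" for i
  proof -
    have "d i dvd D" unfolding D_def using that by (intro dvd_prodI) auto
    then obtain k where "D = d i * k" by (rule dvdE)
    hence "of_nat D * coeff p i = of_nat k * (of_nat (d i) * coeff p i)" by simp
    also have "\<dots> \<in> \<int>" by (intro Ints_mult d(2)) simp
    finally show ?thesis .
  qed
  have "D > 0" using d by (simp add: D_def)
  define q where "q = (\<Sum>i\<le>N. monom (coeff p i * of_nat D ^ (N - i)) i)"
  have cq: "coeff q i = (if i \<le> N then coeff p i * of_nat D ^ (N - i) else 0)" for i
    by (simp add: q_def coeff_sum)
  have "degree q \<le> N" by (intro degree_le) (simp add: cq)
  moreover have "coeff q N = 1" using p by (simp add: cq N_def)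
  ultimately have "lead_coeff q = 1" by (metis le_degree le_antisym zero_neq_one)
  moreover have "coeff q i \<in> \<int>" for i
  proof (cases "i < N")
    case True
    then obtain k where "N - i = Suc k" by (metis Suc_diff_Suc)
    hence "coeff q i = of_nat D * coeff p i * of_nat D ^ k" using True by (simp add: cq)
    thus ?thesis using Dc[of i] True by simp
  next
    case False
    thus ?thesis using p(1) by (auto simp: cq N_def not_less)
  qed
  moreover have "poly q (of_nat D * x) = of_nat D ^ N * poly p x"
  proof -
    have "poly p x = (\<Sum>i\<le>N. coeff p i * x ^ i)" by (simp add: poly_altdef N_def)
    thus ?thesis
      unfolding q_def poly_sum poly_monom
      by (auto simp: sum_distrib_left power_mult_distrib mult_ac simp flip: power_add intro!: sum.cong)
  qed
  hence "poly q (of_nat D * x) = 0" using p by simp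
  ultimately show ?thesis using that[OF \<open>D > 0\<close>] by (blast intro: algebraic_int.intros)
qed

section \<open>Rings of integers and their ideals\<close>

lemma ring_ints_simps [simp]:
  "z \<in> carrier (ring_ints K) \<longleftrightarrow> z \<in> K \<and> algebraic_int z" "x \<otimes>\<^bsub>ring_ints K\<^esub> y = x * y"
  "x \<oplus>\<^bsub>ring_ints K\<^esub> y = x + y" "\<one>\<^bsub>ring_ints K\<^esub> = 1" "\<zero>\<^bsub>ring_ints K\<^esub> = 0"
  by (simp_all add: ring_ints_def ring_of_type_algebra_def)

lemma cring_ring_ints:
  assumes K: "subfield K ring_of_type_algebra"
  shows "cring (ring_ints K)"
proof (rule cringI)
  show "abelian_group (ring_ints K)"
  proof (rule abelian_groupI)
    fix x assume "x \<in> carrier (ring_ints K)"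
    thus "\<exists>y\<in>carrier (ring_ints K). y \<oplus>\<^bsub>ring_ints K\<^esub> x = \<zero>\<^bsub>ring_ints K\<^esub>"
      using K by (intro bexI[of _ "- x"]) (auto simp: subfield_iff)
  qed (use K in \<open>auto simp: subfield_iff intro: algebraic_int_add\<close>)
  show "comm_monoid (ring_ints K)"
    by (rule comm_monoidI) (use K in \<open>auto simp: subfield_iff intro: algebraic_int_mult\<close>)
qed (auto simp: algebra_simps)

lemma a_inv_ring_ints [simp]:
  assumes "subfield K ring_of_type_algebra" "x \<in> K" "algebraic_int x"
  shows "\<ominus>\<^bsub>ring_ints K\<^esub> x = - x"
proof -
  interpret R: cring "ring_ints K" using assms by (intro cring_ring_ints)
  show ?thesis using assms by (intro R.minus_equality) (auto simp: subfield_iff)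
qed

lemma ideal_ring_ints_iff:
  assumes K: "subfield K ring_of_type_algebra"
  shows "ideal I (ring_ints K) \<longleftrightarrow> (\<forall>x\<in>I. x \<in> K \<and> algebraic_int x) \<and> 0 \<in> I \<and> (\<forall>x\<in>I. \<forall>y\<in>I. x + y \<in> I) \<and>
     (\<forall>x\<in>I. \<forall>z. z \<in> K \<longrightarrow> algebraic_int z \<longrightarrow> z * x \<in> I)" (is "?l \<longleftrightarrow> ?r")
proof
  interpret R: cring "ring_ints K" using assms by (intro cring_ring_ints)
  show ?r if ?l
  proof -
    interpret I: ideal I "ring_ints K" by fact
    show ?thesis using I.Icarr I.zero_closed I.a_closed I.I_l_closed by auto
  qed
  show ?l if r: ?r
  proof (rule idealI[OF R.ring_axioms])
    have "- x \<in> I" if "x \<in> I" for x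
      using r[THEN conjunct2, THEN conjunct2, THEN conjunct2, rule_format, OF that, of "- 1"] K
      by (auto simp: subfield_iff)
    thus "subgroup I (add_monoid (ring_ints K))"
      using r K by (intro R.add.subgroupI) (auto simp: simp flip: a_inv_def)
  qed (use r in \<open>auto simp: mult.commute\<close>)
qed

lemma primeideal_ring_ints_iff:
  assumes K: "subfield K ring_of_type_algebra"
  shows "primeideal I (ring_ints K) \<longleftrightarrow> ideal I (ring_ints K) \<and> 1 \<notin> I \<and>
    (\<forall>x y. x \<in> K \<longrightarrow> algebraic_int x \<longrightarrow> y \<in> K \<longrightarrow> algebraic_int y \<longrightarrow> x * y \<in> I \<longrightarrow> x \<in> I \<or> y \<in> I)"
    (is "?l \<longleftrightarrow> ?r")
proof
  interpret R: cring "ring_ints K" using assms by (intro cring_ring_ints)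
  show ?r if ?l
  proof -
    interpret I: primeideal I "ring_ints K" by fact
    show ?thesis using I.ideal_axioms I.I_prime I.I_notcarr I.one_imp_carrier by auto
  qed
  show ?l if r: ?r
  proof (rule primeidealI)
    show "carrier (ring_ints K) \<noteq> I" using r R.one_closed by auto
  qed (use r R.cring_axioms in auto)
qed


lemma ideal_closed:
  assumes "subfield K ring_of_type_algebra" "ideal I (ring_ints K)"
  shows ideal_in: "x \<in> I \<Longrightarrow> x \<in> K" and ideal_algebraic_int: "x \<in> I \<Longrightarrow> algebraic_int x"
    and ideal_zero: "0 \<in> I" and ideal_add: "x \<in> I \<Longrightarrow> y \<in> I \<Longrightarrow> x + y \<in> I"
    and ideal_mult: "x \<in> I \<Longrightarrow> z \<in> K \<Longrightarrow> algebraic_int z \<Longrightarrow> z * x \<in> I"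
    and ideal_mult_right: "x \<in> I \<Longrightarrow> z \<in> K \<Longrightarrow> algebraic_int z \<Longrightarrow> x * z \<in> I"
  using assms(2) unfolding ideal_ring_ints_iff[OF assms(1)] by (auto simp: mult.commute)

lemma ideal_uminus:
  assumes "subfield K ring_of_type_algebra" "ideal I (ring_ints K)" "x \<in> I"
  shows "- x \<in> I"
  using ideal_mult[OF assms, of "- 1"] assms(1) by (auto simp: subfield_iff)

lemma ideal_diff:
  assumes "subfield K ring_of_type_algebra" "ideal I (ring_ints K)" "x \<in> I" "y \<in> I"
  shows "x - y \<in> I"
  using ideal_add[OF assms(1-3) ideal_uminus[OF assms(1,2,4)]] by simp

lemma ideal_sum:
  assumes "subfield K ring_of_type_algebra" "ideal I (ring_ints K)" "\<And>i. i \<in> A \<Longrightarrow> f i \<in> I"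
  shows "sum f A \<in> I"
  using assms(3) by (induction A rule: infinite_finite_induct)
    (auto intro: ideal_add[OF assms(1,2)] ideal_zero[OF assms(1,2)])

section \<open>Conjugation modulo a prime of the ring of all algebraic integers\<close>

context
  fixes R assumes R: "primeideal R (ring_ints (UNIV :: qbar set))"
begin

lemma R_ideal: "ideal R (ring_ints UNIV)"
  using R by (simp add: primeideal_ring_ints_iff[OF subfield_UNIV])

lemmas R_closed = ideal_closed[OF subfield_UNIV R_ideal] ideal_uminus[OF subfield_UNIV R_ideal]
  ideal_diff[OF subfield_UNIV R_ideal] ideal_sum[OF subfield_UNIV R_ideal]

lemma R_prime: "algebraic_int x \<Longrightarrow> algebraic_int y \<Longrightarrow> x * y \<in> R \<Longrightarrow> x \<in> R \<or> y \<in> R"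
  and R_one: "1 \<notin> R"
  using R by (auto simp: primeideal_ring_ints_iff[OF subfield_UNIV])

text \<open>In the coefficient of degree \<open>i + j\<close>, where \<open>i\<close> and
  \<open>j\<close> are the lowest degrees of coefficients outside \<open>R\<close>, all terms but
  one lie in \<open>R\<close>.\<close>

lemma Gauss_prime_ideal:
  assumes p: "\<And>i. algebraic_int (coeff p i)" and q: "\<And>i. algebraic_int (coeff q i)"
    and pq: "\<And>i. coeff (p * q) i \<in> R"
  shows "(\<forall>i. coeff p i \<in> R) \<or> (\<forall>i. coeff q i \<in> R)"
proof (rule ccontr)
  assume "\<not> ?thesis"
  hence ex: "\<exists>i. coeff p i \<notin> R" "\<exists>j. coeff q j \<notin> R" by auto
  define i j where "i = (LEAST i. coeff p i \<notin> R)" and "j = (LEAST j. coeff q j \<notin> R)"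
  have i: "coeff p i \<notin> R" "\<And>k. k < i \<Longrightarrow> coeff p k \<in> R"
    unfolding i_def using LeastI_ex[OF ex(1)] not_less_Least by auto
  have j: "coeff q j \<notin> R" "\<And>k. k < j \<Longrightarrow> coeff q k \<in> R"
    unfolding j_def using LeastI_ex[OF ex(2)] not_less_Least by auto
  have "coeff p k * coeff q (i + j - k) \<in> R" if "k \<in> {..i + j} - {i}" for k
  proof (cases "k < i")
    case True
    thus ?thesis using i q R_closed(6) by simp
  next
    case False
    hence "i + j - k < j" using that by auto
    thus ?thesis using j p R_closed(5) by simp
  qed
  hence rest: "(\<Sum>k\<in>{..i + j} - {i}. coeff p k * coeff q (i + j - k)) \<in> R" by (rule R_closed(9))
  have eq: "coeff (p * q) (i + j) =
      coeff p i * coeff q j + (\<Sum>k\<in>{..i + j} - {i}. coeff p k * coeff q (i + j - k))"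
    unfolding coeff_mult by (subst sum.remove[of _ i]) auto
  have "coeff p i * coeff q j \<in> R"
    using R_closed(8)[OF pq[of "i + j"] rest] by (simp only: eq add_diff_cancel_right')
  thus False using R_prime p q i j by blast
qed

lemma algebraic_int_coeff_prod:
  fixes f :: "'b \<Rightarrow> 'a::field_char_0 poly"
  assumes "\<And>t i. t \<in> A \<Longrightarrow> algebraic_int (coeff (f t) i)"
  shows "algebraic_int (coeff (\<Prod>t\<in>A. f t) i)"
  using assms
proof (induction A arbitrary: i rule: infinite_finite_induct)
  case (insert t A)
  thus ?case by (auto simp: coeff_mult intro!: algebraic_int_sum algebraic_int_mult)
qed (auto simp: coeff_1)

lemma Gauss_prime_ideal_prod:
  assumes "finite A" "\<And>t i. t \<in> A \<Longrightarrow> algebraic_int (coeff (f t) i)" "\<And>i. coeff (\<Prod>t\<in>A. f t) i \<in> R"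
  shows "\<exists>t\<in>A. \<forall>i. coeff (f t) i \<in> R"
  using assms
proof (induction A rule: finite_induct)
  case empty
  from empty.prems(2)[of 0] R_one show ?case by simp
next
  case (insert t A)
  have "algebraic_int (coeff (\<Prod>t\<in>A. f t) i)" for i
    using insert.prems by (intro algebraic_int_coeff_prod) auto
  from Gauss_prime_ideal[OF insert.prems(1) this, of t] insert
  show ?case by auto
qed

text \<open>The conjugating element is read off from the factorisation of the resolvent
  \<open>\<Prod>\<^sub>t (Y - \<Sum> t\<^sub>i X\<^sup>i)\<close> over the orbit of the given elements.\<close>
lemma conjugate_modulo_prime:
  assumes H: "H \<subseteq> GQ" "\<And>g h. g \<in> H \<Longrightarrow> h \<in> H \<Longrightarrow> (\<lambda>x. g (h x)) \<in> H" "(\<lambda>x. x) \<in> H"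
    and F: "\<And>x. algebraic_int x \<Longrightarrow> algebraic_int (F x)"
      "\<And>x y. algebraic_int x \<Longrightarrow> algebraic_int y \<Longrightarrow> F (x + y) - (F x + F y) \<in> R"
      "\<And>x y. algebraic_int x \<Longrightarrow> algebraic_int y \<Longrightarrow> F (x * y) - F x * F y \<in> R"
      "\<And>x. algebraic_int x \<Longrightarrow> (\<And>h. h \<in> H \<Longrightarrow> h x = x) \<Longrightarrow> F x - x \<in> R"
    and Z: "finite Z" "\<And>z. z \<in> Z \<Longrightarrow> algebraic_int z"
  shows "\<exists>h\<in>H. \<forall>z\<in>Z. F z - h z \<in> R"
proof -
  \<comment> \<open>The exponents \<open>e z\<close> label the elements of \<open>Z\<close>, so that
    \<open>P t\<close> records all values of \<open>t\<close> on \<open>Z\<close> in a single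
    polynomial.\<close>
  obtain e :: "qbar \<Rightarrow> nat" where e: "inj_on e Z"
    using finite_imp_inj_to_nat_seg[OF Z(1)] by blast
  define P :: "(qbar \<Rightarrow> qbar) \<Rightarrow> qbar poly" where "P = (\<lambda>t. \<Sum>z\<in>Z. monom (t z) (e z))"
  have cP: "coeff (P t) (e z) = t z" if "z \<in> Z" for t z
  proof -
    have "coeff (P t) (e z) = (\<Sum>y\<in>Z. if y = z then t y else 0)"
      unfolding P_def coeff_sum coeff_monom
      using e that by (intro sum.cong) (auto simp: inj_on_def)
    thus ?thesis using that Z by simp
  qed
  have map_P: "map_poly g (P t) = P (\<lambda>z. g (t z))" if "g \<in> H" for g t
  proof -
    have g: "g \<in> GQ" using H that by auto
    have "map_poly g (sum f A) = (\<Sum>i\<in>A. map_poly g (f i))" for f :: "qbar \<Rightarrow> qbar poly" and A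
      by (induction A rule: infinite_finite_induct) (simp_all add: gal_zero[OF g] gal_add[OF g] map_poly_add)
    thus ?thesis by (simp add: P_def map_poly_monom gal_zero[OF g])
  qed
  define Orb where "Orb = P ` H"
  \<comment> \<open>The polynomial \<open>P h\<close> depends only on the restriction of
    \<open>h\<close> to \<open>Z\<close>, and every element has finitely many conjugates.\<close>
  have "Orb \<subseteq> P ` (\<Pi>\<^sub>E z\<in>Z. (\<lambda>\<sigma>. \<sigma> z) ` GQ)"
  proof
    fix q assume "q \<in> Orb"
    then obtain h where h: "h \<in> H" "q = P h" by (auto simp: Orb_def)
    have "P h = P (restrict h Z)" by (simp add: P_def)
    thus "q \<in> P ` (\<Pi>\<^sub>E z\<in>Z. (\<lambda>\<sigma>. \<sigma> z) ` GQ)" using h H by auto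
  qed
  hence fin: "finite Orb"
    by (rule finite_subset) (intro finite_imageI finite_PiE Z finite_conjugates)
  \<comment> \<open>An element of \<open>H\<close> permutes the orbit, so the coefficients of the
    resolvent are fixed by \<open>H\<close>, and therefore by \<open>F\<close> modulo
    \<open>R\<close>.\<close>
  define \<Phi> where "\<Phi> = (\<Prod>t\<in>Orb. [:- t, 1:])"
  have Orb_int: "algebraic_int (coeff t i)" if t: "t \<in> Orb" for t i
  proof -
    obtain h where h: "h \<in> GQ" "t = P h" using t H by (auto simp: Orb_def)
    thus ?thesis using Z by (auto simp: P_def coeff_sum GQ_algebraic_int[OF h(1)] intro!: algebraic_int_sum)
  qed
  have inv: "map_poly (map_poly g) \<Phi> = \<Phi>" if g: "g \<in> H" for g
  proof -
    have g': "g \<in> GQ" using H g by auto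
    have add: "map_poly g (x + y) = map_poly g x + map_poly g y"
      and mult: "map_poly g (x * y) = map_poly g x * map_poly g y" for x y
      by (simp_all add: gal_zero[OF g'] gal_add[OF g'] gal_mult[OF g'] map_poly_add map_poly_mult)
    have one: "map_poly g 1 = 1" by (simp add: gal_one[OF g'])
    have minus: "map_poly g (- x) = - map_poly g x" for x
      by (intro poly_eqI) (simp add: coeff_map_poly gal_zero[OF g'] gal_minus[OF g'])
    have "map_poly (map_poly g) \<Phi> = (\<Prod>t\<in>Orb. [:- map_poly g t, 1:])"
      unfolding \<Phi>_def by (subst map_poly_prod) (simp_all add: add mult one minus map_poly_pCons)
    also have "\<dots> = (\<Prod>t\<in>map_poly g ` Orb. [:- t, 1:])"
    proof (subst prod.reindex)
      show "inj_on (map_poly g) Orb"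
        by (intro inj_onI poly_eqI) (metis coeff_map_poly gal_zero[OF g'] gal_eq_iff[OF g'])
    qed simp
    also have "map_poly g ` Orb = Orb"
    proof (rule endo_inj_surj[OF fin])
      show "map_poly g ` Orb \<subseteq> Orb" using map_P[OF g] H(2)[OF g] by (auto simp: Orb_def)
      show "inj_on (map_poly g) Orb"
        by (intro inj_onI poly_eqI) (metis coeff_map_poly gal_zero[OF g'] gal_eq_iff[OF g'])
    qed
    finally show ?thesis by (simp add: \<Phi>_def)
  qed
  have fix_coeff: "g (coeff (coeff \<Phi> k) i) = coeff (coeff \<Phi> k) i" if g: "g \<in> H" for g k i
  proof -
    have g': "g \<in> GQ" using H g by auto
    have "coeff (coeff (map_poly (map_poly g) \<Phi>) k) i = g (coeff (coeff \<Phi> k) i)"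
      by (simp add: coeff_map_poly gal_zero[OF g'])
    thus ?thesis by (simp add: inv[OF g])
  qed
  have int_coeff: "algebraic_int (coeff (coeff \<Phi> k) i)" for k i
  proof -
    have "\<forall>k i. algebraic_int (coeff (coeff (\<Prod>t\<in>B. [:- t, 1:]) k) i)" if "B \<subseteq> Orb" for B
      using finite_subset[OF that fin] that
    proof (induction B rule: finite_induct)
      case (insert t B)
      have t: "algebraic_int (coeff (coeff [:- t, 1:] k) i)" for k i
        using insert.prems Orb_int by (auto simp: coeff_pCons coeff_1 split: nat.splits)
      have IH: "algebraic_int (coeff (coeff (\<Prod>t\<in>B. [:- t, 1:]) k) i)" for k i
        using insert by blast
      have "algebraic_int (coeff (coeff ([:- t, 1:] * (\<Prod>t\<in>B. [:- t, 1:])) k) i)" for k i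
        unfolding coeff_mult coeff_sum by (intro algebraic_int_sum algebraic_int_mult t IH)
      thus ?case unfolding prod.insert[OF insert.hyps(1,2)] by blast
    qed (auto simp: coeff_1)
    thus ?thesis by (simp add: \<Phi>_def)
  qed
  \<comment> \<open>\<open>F\<close> respects sums and products modulo \<open>R\<close> only. So
    instead of applying it to polynomials, \<open>rel p q\<close> says that \<open>q\<close> is
    coefficientwise congruent to the image of \<open>p\<close>; this relation is compatible with
    sums and products.\<close>
  define rel where "rel = (\<lambda>p q. \<forall>i. algebraic_int (coeff p i) \<and> algebraic_int (coeff q i) \<and> F (coeff p i) - coeff q i \<in> R)"
  have F0: "F 0 \<in> R" using F(4)[of 0] H by (force simp: gal_zero[of _ \<rat>])
  have rel_sum_elt: "F (sum f A) - sum g A \<in> R"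
    if "\<And>i. i \<in> A \<Longrightarrow> algebraic_int (f i) \<and> algebraic_int (g i) \<and> F (f i) - g i \<in> R" for f g :: "nat \<Rightarrow> qbar" and A
    using that
  proof (induction A rule: infinite_finite_induct)
    case (insert x A)
    have "F (f x + sum f A) - (F (f x) + F (sum f A)) \<in> R"
      using insert by (intro F algebraic_int_sum) auto
    moreover have "(F (f x) - g x) + (F (sum f A) - sum g A) \<in> R"
      using insert by (intro R_closed(4)) auto
    ultimately have "(F (f x + sum f A) - (F (f x) + F (sum f A))) + ((F (f x) - g x) + (F (sum f A) - sum g A)) \<in> R"
      by (rule R_closed(4))
    thus ?case using insert by (simp add: algebra_simps)
  qed (use F0 in simp_all)
  have rel_mult_elt: "F (a * b) - c * d \<in> R"
    if "algebraic_int a" "algebraic_int b" "algebraic_int c" "algebraic_int d" "F a - c \<in> R" "F b - d \<in> R" for a b c d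
  proof -
    have "F (a * b) - F a * F b \<in> R" using that by (intro F(3))
    moreover have "F b * (F a - c) + c * (F b - d) \<in> R" using that F(1) by (intro R_closed(4,5)) auto
    ultimately have "(F (a * b) - F a * F b) + (F b * (F a - c) + c * (F b - d)) \<in> R" by (rule R_closed(4))
    thus ?thesis by (simp add: algebra_simps)
  qed
  have rel_mult: "rel (p * p') (q * q')" if "rel p q" "rel p' q'" for p q p' q'
    using that unfolding rel_def coeff_mult
    by (auto intro!: algebraic_int_sum algebraic_int_mult rel_sum_elt rel_mult_elt)
  have rel_sum: "rel (sum f A) (sum g A)" if "\<And>i. i \<in> A \<Longrightarrow> rel (f i) (g i)" for f g and A :: "nat set"
    using that unfolding rel_def coeff_sum by (auto intro!: algebraic_int_sum rel_sum_elt)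
  have "F 1 - 1 \<in> R" using H by (intro F) (auto simp: gal_one[of _ \<rat>])
  hence rel_one: "rel 1 1" using F0 by (simp add: rel_def coeff_1)
  have rel_power: "rel (p ^ n) (q ^ n)" if "rel p q" for p q n
    by (induction n) (auto intro: rel_one rel_mult that)
  have rel_\<Phi>: "rel (coeff \<Phi> k) (coeff \<Phi> k)" for k
    unfolding rel_def using F(4) fix_coeff int_coeff by simp
  define Q where "Q = P F"
  have cP0: "coeff (P t) i = 0" if "i \<notin> e ` Z" for t i
    using that unfolding P_def coeff_sum coeff_monom by (intro sum.neutral) auto
  have "rel (P (\<lambda>x. x)) Q"
    unfolding rel_def
  proof
    fix i show "algebraic_int (coeff (P (\<lambda>x. x)) i) \<and> algebraic_int (coeff Q i) \<and> F (coeff (P (\<lambda>x. x)) i) - coeff Q i \<in> R"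
      using Z F(1) F0 R_closed(3) unfolding Q_def by (cases "i \<in> e ` Z") (auto simp: cP cP0)
  qed
  \<comment> \<open>Transporting the root \<open>P (\<lambda>x. x)\<close> of the resolvent by
    \<open>F\<close> makes \<open>Q\<close> a root modulo \<open>R\<close>. By Gauss's lemma one of
    the factors \<open>Q - t\<close> then has all its coefficients in \<open>R\<close>.\<close>
  hence "rel (poly \<Phi> (P (\<lambda>x. x))) (poly \<Phi> Q)"
    unfolding poly_altdef by (intro rel_sum rel_mult rel_power rel_\<Phi>)
  moreover have "P (\<lambda>x. x) \<in> Orb" using H by (auto simp: Orb_def)
  hence "poly \<Phi> (P (\<lambda>x. x)) = 0" using fin by (auto simp: \<Phi>_def poly_prod)
  ultimately have F0': "F 0 - coeff (poly \<Phi> Q) i \<in> R" for i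
    by (auto simp: rel_def)
  have "F 0 - (F 0 - coeff (poly \<Phi> Q) i) \<in> R" for i
    by (rule R_closed(8)[OF F0 F0'])
  hence "coeff (\<Prod>t\<in>Orb. Q - t) i \<in> R" for i by (simp add: \<Phi>_def poly_prod)
  moreover have "algebraic_int (coeff (Q - t) i)" if "t \<in> Orb" for t i
    using Orb_int[OF that] \<open>rel (P (\<lambda>x. x)) Q\<close> by (auto simp: rel_def intro: algebraic_int_diff)
  ultimately have "\<exists>t\<in>Orb. \<forall>i. coeff (Q - t) i \<in> R"
    by (intro Gauss_prime_ideal_prod[OF fin, of "\<lambda>t. Q - t"])
  then obtain t where t: "t \<in> Orb" "\<And>i. coeff (Q - t) i \<in> R" by blast
  then obtain h where h: "h \<in> H" "t = P h" by (auto simp: Orb_def)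
  have "F z - h z \<in> R" if "z \<in> Z" for z
    using t(2)[of "e z"] that by (simp add: h Q_def cP)
  thus ?thesis using h by blast
qed

end

lemma hom_in_gal:
  assumes "\<And>x y. h (x + y) = h x + h y" "\<And>x y. h (x * y) = h x * h y" "h 1 = 1" "\<And>x. x \<in> F \<Longrightarrow> h x = x"
  shows "h \<in> gal UNIV (F :: qbar set)"
proof -
  obtain g where "g \<in> GQ" "\<And>x. x \<in> UNIV \<Longrightarrow> g x = h x"
    using subfield_hom_extends[OF subfield_UNIV, of h] assms(1-3) by metis
  hence "h \<in> GQ" by (metis UNIV_I ext)
  thus ?thesis using assms by (auto simp: gal_UNIV_iff)
qed

text \<open>Compactness of the Galois group removes the finiteness restriction.\<close>
lemma conjugate_modulo_prime_all:
  assumes R: "primeideal R (ring_ints (UNIV :: qbar set))" and L: "subfield L ring_of_type_algebra"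
    and F: "\<And>x. algebraic_int x \<Longrightarrow> algebraic_int (F x)"
      "\<And>x y. algebraic_int x \<Longrightarrow> algebraic_int y \<Longrightarrow> F (x + y) - (F x + F y) \<in> R"
      "\<And>x y. algebraic_int x \<Longrightarrow> algebraic_int y \<Longrightarrow> F (x * y) - F x * F y \<in> R"
      "\<And>x. algebraic_int x \<Longrightarrow> x \<in> L \<Longrightarrow> F x - x \<in> R"
  shows "\<exists>h\<in>gal UNIV L. \<forall>z. algebraic_int z \<longrightarrow> F z - h z \<in> R"
proof -
  define C where "C = (\<lambda>z. (\<lambda>\<sigma>. \<sigma> z) ` GQ)"
  define T where "T = product_topology (\<lambda>z. discrete_topology (C z)) (UNIV :: qbar set)"
  \<comment> \<open>The candidates that agree on \<open>S\<close> with an automorphism having the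
    required congruences there. Membership depends on the values on the finite set \<open>S\<close>
    only, so \<open>A S\<close> is closed; a point common to all \<open>A S\<close> is the
    automorphism sought.\<close>
  define A where "A = (\<lambda>S. {h \<in> topspace T. \<exists>g\<in>gal UNIV L. \<forall>z\<in>S. g z = h z \<and> (algebraic_int z \<longrightarrow> F z - g z \<in> R)})"
  have top: "topspace T = {h. \<forall>z. h z \<in> C z}"
    by (auto simp: T_def PiE_def)
  have sub: "gal UNIV L \<subseteq> GQ" using L by (rule gal_UNIV_subset_GQ)
  have "compact_space T"
    unfolding T_def by (simp add: compact_space_product_topology compact_space_discrete_topology C_def finite_conjugates)
  have closed: "closedin T (A S)" if "finite S" for S
  proof -
    have "openin T (topspace T - A S)"
    proof (subst openin_subopen, intro ballI)
      fix h assume h: "h \<in> topspace T - A S"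
      define U where "U = (\<Pi>\<^sub>E z\<in>UNIV. if z \<in> S then {h z} else C z)"
      have "{z. (if z \<in> S then {h z} else C z) \<noteq> C z} \<subseteq> S" by auto
      hence "openin T U"
        unfolding T_def U_def openin_PiE_gen using h finite_subset[OF _ that] by (auto simp: top)
      moreover have "h \<in> U" using h by (auto simp: U_def top)
      moreover have "U \<subseteq> topspace T - A S"
      proof
        fix h' assume h': "h' \<in> U"
        hence eq: "h' z = h z" if "z \<in> S" for z
          using that PiE_mem[OF h'[unfolded U_def], of z] by simp
        have "h' \<in> topspace T" using h' openin_subset[OF \<open>openin T U\<close>] by blast
        moreover have "h' \<notin> A S" using h eq unfolding A_def by auto
        ultimately show "h' \<in> topspace T - A S" by blast
      qed
      ultimately show "\<exists>U. openin T U \<and> h \<in> U \<and> U \<subseteq> topspace T - A S" by blast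
    qed
    moreover have "A S \<subseteq> topspace T" by (auto simp: A_def)
    ultimately show ?thesis by (simp add: closedin_def)
  qed
  have nonempty: "A S \<noteq> {}" if "finite S" for S
  proof -
    have fixL: "x \<in> L" if "\<And>h. h \<in> gal UNIV L \<Longrightarrow> h x = x" for x
      using that fixed_field_gal[OF L] by (auto simp: fixed_field_def)
    have "\<exists>h\<in>gal UNIV L. \<forall>z\<in>{z \<in> S. algebraic_int z}. F z - h z \<in> R"
      by (rule conjugate_modulo_prime[OF R sub]) (use that gal_UNIV_comp gal_UNIV_id F fixL in auto)
    then obtain h where h: "h \<in> gal UNIV L" "\<forall>z\<in>S. algebraic_int z \<longrightarrow> F z - h z \<in> R" by auto
    hence "h \<in> A S" using sub unfolding A_def top C_def by auto
    thus ?thesis by blast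
  qed
  have "\<Inter> (A ` {S. finite S}) \<noteq> {}"
  proof (rule \<open>compact_space T\<close>[unfolded compact_space_fip, rule_format], intro conjI ballI allI impI)
    show "closedin T B" if "B \<in> A ` {S. finite S}" for B using that closed by auto
    fix \<F> assume "finite \<F> \<and> \<F> \<subseteq> A ` {S. finite S}"
    then obtain \<S> where \<S>: "finite \<S>" "\<S> \<subseteq> {S. finite S}" "\<F> = A ` \<S>"
      using finite_subset_image by metis
    have "A (\<Union>\<S>) \<subseteq> \<Inter> \<F>" unfolding \<S>(3) A_def by blast
    moreover have "finite (\<Union>\<S>)" using \<S> by auto
    ultimately show "\<Inter> \<F> \<noteq> {}" using nonempty by blast
  qed
  then obtain h where h: "\<And>S. finite S \<Longrightarrow> h \<in> A S" by blast
  have *: "\<exists>g\<in>gal UNIV L. (\<forall>z\<in>S. g z = h z) \<and> (\<forall>z\<in>S. algebraic_int z \<longrightarrow> F z - g z \<in> R)" if "finite S" for S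
    using h[OF that] by (auto simp: A_def)
  have "h \<in> gal UNIV L"
  proof (rule hom_in_gal)
    fix x y
    obtain g where "g \<in> gal UNIV L" "\<forall>z\<in>{x, y, x + y, x * y}. g z = h z" using *[of "{x, y, x + y, x * y}"] by auto
    thus "h (x + y) = h x + h y" "h (x * y) = h x * h y" using gal_add[of g L x y] gal_mult[of g L x y] by auto
  next
    show "h 1 = 1" using *[of "{1}"] gal_one[of _ L] by force
    show "h x = x" if "x \<in> L" for x using *[of "{x}"] gal_fixes[OF _ that] by force
  qed
  moreover have "F z - h z \<in> R" if "algebraic_int z" for z using *[of "{z}"] that by auto
  ultimately show ?thesis by blast
qed

text \<open>Modulo the zero ideal the congruences of \<open>conjugate_modulo_prime\<close> are
  equalities. This special case yields the Galois correspondence for open subgroups.\<close>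

lemma primeideal_zero: "primeideal {0} (ring_ints (UNIV :: qbar set))"
  by (simp add: primeideal_ring_ints_iff[OF subfield_UNIV] ideal_ring_ints_iff[OF subfield_UNIV])

text \<open>Conjugation modulo the zero ideal makes \<open>\<sigma>\<close> agree on
  \<open>S\<close> with some \<open>h\<close> in \<open>H\<close>, so that the inverse of
  \<open>h\<close> after \<open>\<sigma>\<close> stabilises \<open>S\<close>. The multipliers
  \<open>n z\<close> turn the elements of \<open>S\<close> into algebraic integers.\<close>

lemma gal_fixed_field_open:
  assumes H: "H \<subseteq> GQ" "\<And>g h. g \<in> H \<Longrightarrow> h \<in> H \<Longrightarrow> (\<lambda>x. g (h x)) \<in> H" "(\<lambda>x. x) \<in> H"
    and S: "finite S" "{\<sigma>\<in>GQ. \<forall>z\<in>S. \<sigma> z = z} \<subseteq> H" and \<sigma>: "\<sigma> \<in> gal UNIV (fixed_field H)"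
  shows "\<sigma> \<in> H"
proof -
  have \<sigma>': "\<sigma> \<in> GQ" using \<sigma> gal_UNIV_subset_GQ[OF subfield_fixed_field[OF H(1)]] by blast
  have "\<exists>n::nat. n > 0 \<and> algebraic_int (of_nat n * z)" for z :: qbar
    by (rule qbar_integral_multiple[of z]) blast
  then obtain n :: "qbar \<Rightarrow> nat" where n: "\<And>z. n z > 0" "\<And>z. algebraic_int (of_nat (n z) * z)"
    by metis
  have "\<exists>h\<in>H. \<forall>z\<in>(\<lambda>z. of_nat (n z) * z) ` S. \<sigma> z - h z \<in> {0}"
  proof (rule conjugate_modulo_prime[OF primeideal_zero H(1), of \<sigma>])
    show "(\<lambda>x. g (h x)) \<in> H" if "g \<in> H" "h \<in> H" for g h using that by (rule H(2))
    show "\<sigma> x - x \<in> {0}" if "\<And>h. h \<in> H \<Longrightarrow> h x = x" for x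
      using that gal_fixes[OF \<sigma>, of x] by (auto simp: fixed_field_def)
  qed (use H(3) GQ_algebraic_int[OF \<sigma>'] S n gal_add[OF \<sigma>'] gal_mult[OF \<sigma>'] in auto)
  then obtain h where h: "h \<in> H" "\<And>z. z \<in> S \<Longrightarrow> \<sigma> (of_nat (n z) * z) = h (of_nat (n z) * z)" by auto
  have h': "h \<in> GQ" using h H by auto
  have "\<sigma> z = h z" if "z \<in> S" for z
    using h(2)[OF that] n(1)[of z]
    by (simp add: gal_mult[OF \<sigma>'] gal_mult[OF h'] gal_fixes[OF \<sigma>'] gal_fixes[OF h'])
  hence "(\<lambda>x. inv_into UNIV h (\<sigma> x)) \<in> {\<sigma>\<in>GQ. \<forall>z\<in>S. \<sigma> z = z}"
    using gal_UNIV_comp[OF gal_UNIV_inv[OF h'] \<sigma>'] by (auto simp: inv_gal_apply[OF h'])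
  hence "(\<lambda>x. inv_into UNIV h (\<sigma> x)) \<in> H" using S by auto
  from H(2)[OF h(1) this] show ?thesis by (simp add: apply_inv_gal[OF h'])
qed

section \<open>Neighbourhoods of the identity and primes lying over a given prime\<close>

lemma topspace_krull: "topspace (krull E F) = gal E F"
  by (auto simp: krull_def gal_def PiE_def)

lemma krull_open_contains_stabiliser:
  assumes "openin (krull UNIV F) N" "(\<lambda>x. x) \<in> N"
  obtains S where "finite S" "{\<sigma>\<in>gal UNIV F. \<forall>z\<in>S. \<sigma> z = z} \<subseteq> N"
proof -
  obtain U where U: "openin (product_topology (\<lambda>_. discrete_topology UNIV) UNIV) U" "N = U \<inter> gal UNIV F"
    using assms(1) by (auto simp: krull_def openin_subtopology)
  then obtain V where V: "finite {i \<in> UNIV. V i \<noteq> topspace (discrete_topology UNIV)}" "(\<lambda>x. x) \<in> PiE UNIV V" "PiE UNIV V \<subseteq> U"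
    using assms(2) unfolding openin_product_topology_alt by blast
  show ?thesis
  proof (rule that)
    show "finite {i. V i \<noteq> UNIV}" using V(1) by simp
    show "{\<sigma>\<in>gal UNIV F. \<forall>z\<in>{i. V i \<noteq> UNIV}. \<sigma> z = z} \<subseteq> N"
    proof
      fix \<sigma> assume \<sigma>: "\<sigma> \<in> {\<sigma>\<in>gal UNIV F. \<forall>z\<in>{i. V i \<noteq> UNIV}. \<sigma> z = z}"
      have "\<sigma> z \<in> V z" for z using \<sigma> V(2) by (cases "V z = UNIV") (auto simp: PiE_def)
      hence "\<sigma> \<in> U" using V(3) by (auto simp: PiE_def)
      thus "\<sigma> \<in> N" using \<sigma> U by auto
    qed
  qed
qed

text \<open>\<open>Q\<close> is taken maximal among the ideals of all algebraic integers whose trace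
  on \<open>L\<close> lies in \<open>P\<close>. It is prime because the integers of \<open>L\<close>
  outside \<open>P\<close> are closed under products, and its trace is all of \<open>P\<close> by
  integrality.\<close>

lemma lying_over:
  assumes L: "subfield L ring_of_type_algebra" and P: "primeideal P (ring_ints L)"
  obtains Q where "primeideal Q (ring_ints (UNIV :: qbar set))" "Q \<inter> L = P"
proof -
  have Pi: "ideal P (ring_ints L)" and P1: "1 \<notin> P"
    and Pp: "\<And>x y. x \<in> L \<Longrightarrow> algebraic_int x \<Longrightarrow> y \<in> L \<Longrightarrow> algebraic_int y \<Longrightarrow> x * y \<in> P \<Longrightarrow> x \<in> P \<or> y \<in> P"
    using P by (auto simp: primeideal_ring_ints_iff[OF L])
  note Pc = ideal_closed[OF L Pi]
  define M where "M = {I. ideal I (ring_ints (UNIV :: qbar set)) \<and> I \<inter> L \<subseteq> P}"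
  have "\<exists>Q\<in>M. \<forall>Y\<in>M. Q \<subseteq> Y \<longrightarrow> Y = Q"
  proof (rule subset_Zorn_nonempty)
    have "{0} \<in> M" using Pc(3) by (auto simp: M_def ideal_ring_ints_iff[OF subfield_UNIV])
    thus "M \<noteq> {}" by blast
    fix C assume C: "C \<noteq> {}" "subset.chain M C"
    have CM: "C \<subseteq> M" and tot: "\<And>Y Z. Y \<in> C \<Longrightarrow> Z \<in> C \<Longrightarrow> Y \<subseteq> Z \<or> Z \<subseteq> Y"
      using C(2) by (auto simp: subset_chain_def)
    have id: "ideal I (ring_ints UNIV)" if "I \<in> C" for I using that CM by (auto simp: M_def)
    have "ideal (\<Union>C) (ring_ints UNIV)"
      unfolding ideal_ring_ints_iff[OF subfield_UNIV]
    proof (intro conjI ballI allI impI)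
      show "0 \<in> \<Union>C" using C(1) ideal_zero[OF subfield_UNIV id] by blast
      show "x + y \<in> \<Union>C" if xy: "x \<in> \<Union>C" "y \<in> \<Union>C" for x y
      proof -
        obtain Y Z where YZ: "Y \<in> C" "x \<in> Y" "Z \<in> C" "y \<in> Z" using xy by blast
        hence "\<exists>I\<in>C. x \<in> I \<and> y \<in> I" using tot[of Y Z] by blast
        thus ?thesis using ideal_add[OF subfield_UNIV id] by blast
      qed
      show "algebraic_int x" if "x \<in> \<Union>C" for x using that ideal_algebraic_int[OF subfield_UNIV id] by blast
      show "z * x \<in> \<Union>C" if "x \<in> \<Union>C" "algebraic_int z" for x z
        using that ideal_mult[OF subfield_UNIV id] by blast
    qed auto
    moreover have "\<Union>C \<inter> L \<subseteq> P" using CM by (auto simp: M_def)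
    ultimately show "\<Union>C \<in> M" by (simp add: M_def)
  qed
  then obtain Q where QM: "Q \<in> M" and max: "\<And>Y. Y \<in> M \<Longrightarrow> Q \<subseteq> Y \<Longrightarrow> Y = Q" by blast
  have Qi: "ideal Q (ring_ints UNIV)" and QL: "Q \<inter> L \<subseteq> P" using QM by (auto simp: M_def)
  note Qc = ideal_closed[OF subfield_UNIV Qi]
  have adjoin: "\<exists>q z. q \<in> Q \<and> algebraic_int z \<and> q + r * z \<in> L \<and> q + r * z \<notin> P" if r: "algebraic_int r" "r \<notin> Q" for r
  proof (rule ccontr)
    assume neg: "\<not> ?thesis"
    define Y where "Y = {q + r * z |q z. q \<in> Q \<and> algebraic_int z}"
    have "ideal Y (ring_ints UNIV)"
      unfolding ideal_ring_ints_iff[OF subfield_UNIV]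
    proof (intro conjI ballI allI impI)
      show "0 \<in> Y" unfolding Y_def using Qc(3) by (auto intro!: exI[of _ 0])
      show "x + y \<in> Y" if xy: "x \<in> Y" "y \<in> Y" for x y
      proof -
        obtain q z q' z' where *: "x = q + r * z" "q \<in> Q" "algebraic_int z" "y = q' + r * z'" "q' \<in> Q" "algebraic_int z'"
          using xy by (auto simp: Y_def)
        have "x + y = (q + q') + r * (z + z')" using * by (simp add: algebra_simps)
        thus ?thesis unfolding Y_def using Qc(4)[OF *(2,5)] algebraic_int_add[OF *(3,6)] by blast
      qed
      show "algebraic_int x" if "x \<in> Y" for x
        using that r Qc(2) by (auto simp: Y_def intro!: algebraic_int_add algebraic_int_mult)
      show "w * x \<in> Y" if x: "x \<in> Y" "algebraic_int w" for w x
      proof -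
        obtain q z where *: "x = q + r * z" "q \<in> Q" "algebraic_int z" using x by (auto simp: Y_def)
        have "w * x = w * q + r * (w * z)" using * by (simp add: algebra_simps)
        thus ?thesis unfolding Y_def using Qc(5)[OF *(2), of w] algebraic_int_mult[OF x(2) *(3)] x(2) by blast
      qed
    qed auto
    moreover have "Y \<inter> L \<subseteq> P" using neg by (auto simp: Y_def)
    ultimately have "Y \<in> M" by (simp add: M_def)
    moreover have "Q \<subseteq> Y"
    proof
      fix q assume "q \<in> Q"
      thus "q \<in> Y" unfolding Y_def by (intro CollectI exI[of _ q] exI[of _ 0]) auto
    qed
    ultimately have "Y = Q" by (rule max)
    moreover have "r \<in> Y" unfolding Y_def using Qc(3) by (intro CollectI exI[of _ 0] exI[of _ 1]) auto
    ultimately show False using r by simp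
  qed
  have prime: "x \<in> Q \<or> y \<in> Q" if xy: "algebraic_int x" "algebraic_int y" "x * y \<in> Q" for x y
  proof (rule ccontr)
    assume "\<not> ?thesis"
    then obtain q z q' z' where 1: "q \<in> Q" "algebraic_int z" "q + x * z \<in> L" "q + x * z \<notin> P"
      and 2: "q' \<in> Q" "algebraic_int z'" "q' + y * z' \<in> L" "q' + y * z' \<notin> P"
      using adjoin[of x] adjoin[of y] xy by blast
    have int: "algebraic_int (q + x * z)" "algebraic_int (q' + y * z')"
      using 1 2 xy Qc(2) by (auto intro!: algebraic_int_add algebraic_int_mult)
    have "(q + x * z) * (q' + y * z') = (q' + y * z') * q + ((x * z) * q' + (z * z') * (x * y))"
      by (simp add: algebra_simps)
    also have "\<dots> \<in> Q"
      using int by (intro Qc(4) Qc(5)[OF 1(1)] Qc(5)[OF 2(1)] Qc(5)[OF xy(3)])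
        (auto intro!: algebraic_int_mult 1 2 xy)
    finally have "(q + x * z) * (q' + y * z') \<in> P"
      using QL 1 2 L by (auto simp: subfield_iff)
    thus False using Pp[OF 1(3) int(1) 2(3) int(2)] 1 2 by blast
  qed
  have "P \<subseteq> Q"
  proof
    fix r assume r: "r \<in> P"
    note rr = Pc(1)[OF r] Pc(2)[OF r]
    show "r \<in> Q"
    proof (rule ccontr)
      assume "r \<notin> Q"
      then obtain q z where qz: "q \<in> Q" "algebraic_int z" "q + r * z \<in> L" "q + r * z \<notin> P"
        using adjoin[of r] rr by blast
      define s where "s = q + r * z"
      have s: "algebraic_int s" "s \<in> L" "s \<notin> P"
        using qz Qc(2) rr by (auto simp: s_def intro!: algebraic_int_add algebraic_int_mult)
      obtain p where p: "lead_coeff p = 1" "\<forall>i. coeff p i \<in> \<int>" "poly p z = 0"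
        using qz(2) by (auto simp: algebraic_int.simps)
      define n where "n = degree p"
      have pint: "algebraic_int (coeff p i)" "coeff p i \<in> L" for i
        using p(2) Rats_subset_subfield[OF L] Ints_subset_Rats by (auto intro: int_imp_algebraic_int)
      have "n > 0" using p by (intro Nat.gr0I) (auto simp: n_def elim!: degree_eq_zeroE)
      \<comment> \<open>homogenised at \<open>r\<close>, the equation of \<open>z\<close> becomes an equation of \<open>r z\<close>, which is \<open>s\<close> modulo \<open>Q\<close>\<close>
      define f where "f = (\<lambda>u. \<Sum>i\<le>n. coeff p i * r ^ (n - i) * u ^ i)"
      have "f (r * z) = r ^ n * poly p z"
        unfolding f_def poly_altdef n_def[symmetric]
        by (auto simp: sum_distrib_left power_mult_distrib mult_ac simp flip: power_add intro!: sum.cong)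
      hence fz: "f (r * z) = 0" using p by simp
      have powdiff: "s ^ i - (r * z) ^ i \<in> Q" for i
      proof (induction i)
        case (Suc i)
        have "s ^ Suc i - (r * z) ^ Suc i = s * (s ^ i - (r * z) ^ i) + (r * z) ^ i * q"
          by (simp add: s_def algebra_simps)
        also have "\<dots> \<in> Q" using Suc qz rr s
          by (intro Qc(4,5)) (auto intro!: algebraic_int_power algebraic_int_mult)
        finally show ?case .
      qed (use Qc(3) in simp)
      have "f s - f (r * z) = (\<Sum>i\<le>n. (coeff p i * r ^ (n - i)) * (s ^ i - (r * z) ^ i))"
        by (simp add: f_def sum_subtractf algebra_simps)
      also have "\<dots> \<in> Q"
        using powdiff pint rr by (intro ideal_sum[OF subfield_UNIV Qi] Qc(5)) (auto intro!: algebraic_int_mult algebraic_int_power)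
      finally have "f s \<in> Q" by (simp add: fz)
      have powL: "x ^ i \<in> L" if "x \<in> L" for x i
        using that L by (induction i) (auto simp: subfield_iff)
      have multL: "x * y \<in> L" if "x \<in> L" "y \<in> L" for x y using that L by (auto simp: subfield_iff)
      \<comment> \<open>Every term of \<open>g\<close> contains a factor \<open>r\<close>, so
        \<open>g\<close> lies in \<open>P\<close>. What remains of the equation is a power of
        \<open>s\<close>, which would then lie in \<open>P\<close>, although \<open>s\<close> does
        not.\<close>
      define g where "g = (\<Sum>i<n. coeff p i * r ^ (n - i) * s ^ i)"
      have fg: "f s = s ^ n + g"
        using p by (simp add: f_def g_def n_def lessThan_Suc_atMost[symmetric] add.commute)
      have "g \<in> P"
        unfolding g_def
      proof (rule ideal_sum[OF L Pi])
        fix i assume "i \<in> {..<n}"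
        then obtain k where k: "n - i = Suc k" by (metis Suc_diff_Suc lessThan_iff)
        have "(coeff p i * r ^ k * s ^ i) * r \<in> P"
          using r rr s pint by (intro Pc(5) multL powL) (auto intro!: algebraic_int_mult algebraic_int_power)
        thus "coeff p i * r ^ (n - i) * s ^ i \<in> P" by (simp add: k mult_ac)
      qed
      have "s ^ n + g \<in> L" using Pc(1)[OF \<open>g \<in> P\<close>] powL[OF s(2)] L by (auto simp: subfield_iff)
      hence "s ^ n + g \<in> P" using \<open>f s \<in> Q\<close> QL fg by auto
      hence "s ^ n \<in> P" using ideal_diff[OF L Pi _ \<open>g \<in> P\<close>] by fastforce
      moreover have "s ^ i \<notin> P" for i
        by (induction i) (use P1 Pp[OF s(2,1)] powL[OF s(2)] algebraic_int_power[OF s(1)] s(3) in auto)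
      ultimately show False by blast
    qed
  qed
  hence "Q \<inter> L = P" using QL Pc(1) by blast
  moreover have "1 \<notin> Q" using QL P1 L by (auto simp: subfield_iff)
  ultimately show ?thesis
    using that[of Q] Qi prime by (auto simp: primeideal_ring_ints_iff[OF subfield_UNIV])
qed

section \<open>Ideals in rings of integers\<close>

lemma subfield_closed:
  fixes K :: "'a::field_char_0 set"
  assumes K: "subfield K ring_of_type_algebra"
  shows subfield_zero: "0 \<in> K" and subfield_one: "1 \<in> K"
    and subfield_add: "x \<in> K \<Longrightarrow> y \<in> K \<Longrightarrow> x + y \<in> K"
    and subfield_mult: "x \<in> K \<Longrightarrow> y \<in> K \<Longrightarrow> x * y \<in> K"
    and subfield_uminus: "x \<in> K \<Longrightarrow> - x \<in> K"
    and subfield_inverse: "x \<in> K \<Longrightarrow> inverse x \<in> K"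
    and subfield_of_nat: "of_nat n \<in> K" and subfield_of_int: "of_int i \<in> K"
  using K Rats_subset_subfield[OF K] by (auto simp: subfield_iff)

lemma subfield_diff: "subfield K ring_of_type_algebra \<Longrightarrow> x \<in> K \<Longrightarrow> y \<in> K \<Longrightarrow> x - y \<in> K"
  for K :: "'a::field_char_0 set"
  using subfield_add[of K x "- y"] subfield_uminus[of K y] by simp

lemma subfield_divide: "subfield K ring_of_type_algebra \<Longrightarrow> x \<in> K \<Longrightarrow> y \<in> K \<Longrightarrow> x / y \<in> K"
  for K :: "'a::field_char_0 set"
  unfolding divide_inverse by (intro subfield_mult subfield_inverse)

lemma subfield_power: "subfield K ring_of_type_algebra \<Longrightarrow> x \<in> K \<Longrightarrow> x ^ n \<in> K"
  for K :: "'a::field_char_0 set"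
  by (induction n) (auto intro: subfield_one subfield_mult)

lemma subfield_sum:
  fixes K :: "'a::field_char_0 set"
  shows "subfield K ring_of_type_algebra \<Longrightarrow> (\<And>i. i \<in> I \<Longrightarrow> f i \<in> K) \<Longrightarrow> sum f I \<in> K"
  by (induction I rule: infinite_finite_induct) (auto intro: subfield_zero subfield_add)

text \<open>Finiteness of an extension of \<open>\<rat>\<close> is expressed below as containment in
  the span of a finite set over \<open>rat\<close>.\<close>

interpretation Qvs: Vector_Spaces.vector_space "\<lambda>(c::rat) (v::'a::field_char_0). of_rat c * v"
  by unfold_locales (simp_all add: algebra_simps of_rat_add of_rat_mult)

lemma mult_in_Qspan:
  assumes "u \<in> Qvs.span A" "v \<in> Qvs.span B"
  shows "u * v \<in> Qvs.span ((\<lambda>(a, b). a * b) ` (A \<times> B))" (is "_ \<in> ?S")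
proof -
  have sub: "Qvs.subspace {v. a * v \<in> ?S}" for a
    by (rule Qvs.subspaceI) (auto simp: distrib_left mult.left_commute[of _ "of_rat _"] intro: Qvs.span_zero Qvs.span_add Qvs.span_scale)
  have sub': "Qvs.subspace {u. u * v \<in> ?S}"
    by (rule Qvs.subspaceI) (auto simp: distrib_right mult.assoc intro: Qvs.span_zero Qvs.span_add Qvs.span_scale)
  have "a * v \<in> ?S" if "a \<in> A" for a
    using Qvs.span_induct[OF assms(2), of "\<lambda>v. a * v \<in> ?S"] sub[of a] that
    by (force intro: Qvs.span_base)
  thus ?thesis
    using Qvs.span_induct[OF assms(1), of "\<lambda>u. u * v \<in> ?S"] sub' by blast
qed

lemma power_in_Qspan:
  fixes x :: qbar
  obtains n where "\<And>k. x ^ k \<in> Qvs.span ((\<lambda>i. x ^ i) ` {..<n::nat})"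
proof -
  obtain p where p: "lead_coeff p = 1" "\<And>i. coeff p i \<in> \<rat>" "poly p x = 0"
    by (rule qbar_algebraic[of x]) blast
  define n where "n = degree p"
  have "\<forall>i. \<exists>r. coeff p i = of_rat r" using p(2) by (auto simp: Rats_def)
  then obtain r where r: "\<And>i. coeff p i = of_rat (r i)" by metis
  have "0 = (\<Sum>i\<le>n. coeff p i * x ^ i)"
    using p by (simp add: n_def poly_altdef)
  also have "\<dots> = x ^ n + (\<Sum>i<n. coeff p i * x ^ i)"
    using p by (simp add: n_def flip: lessThan_Suc_atMost)
  finally have xn: "x ^ n = (\<Sum>i<n. of_rat (- r i) * x ^ i)"
    by (simp add: eq_neg_iff_add_eq_0 sum_negf r of_rat_minus)
  have "x ^ k \<in> Qvs.span ((\<lambda>i. x ^ i) ` {..<n})" for k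
  proof (induction k rule: less_induct)
    case (less k)
    show ?case
    proof (cases "k < n")
      case True
      thus ?thesis by (intro Qvs.span_base) auto
    next
      case False
      have "x ^ k = x ^ (k - n) * x ^ n" using False by (simp flip: power_add)
      also have "\<dots> = (\<Sum>i<n. of_rat (- r i) * x ^ (k - n + i))"
        unfolding xn sum_distrib_left by (intro sum.cong) (auto simp: power_add)
      also have "\<dots> \<in> Qvs.span ((\<lambda>i. x ^ i) ` {..<n})"
        using False by (intro Qvs.span_sum Qvs.span_scale less) auto
      finally show ?thesis .
    qed
  qed
  thus ?thesis using that by blast
qed

text \<open>Inverses are rational polynomials in the element itself, so closure under products is
  enough.\<close>

lemma subfield_Qspan:
  assumes one: "(1::qbar) \<in> Qvs.span B"
    and mult: "\<And>u v. u \<in> Qvs.span B \<Longrightarrow> v \<in> Qvs.span B \<Longrightarrow> u * v \<in> Qvs.span B"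
  shows "subfield (Qvs.span B) ring_of_type_algebra"
  unfolding subfield_iff
proof (intro conjI ballI)
  have power: "u ^ n \<in> Qvs.span B" if "u \<in> Qvs.span B" for u n
    using that one mult by (induction n) auto
  show "inverse x \<in> Qvs.span B" if x: "x \<in> Qvs.span B" for x
  proof (cases "x = 0")
    case False
    then obtain p where p: "\<And>i. coeff p i \<in> \<rat>" "inverse x = poly p x"
      by (rule qbar_inverse_eq_poly) blast
    have "coeff p i * x ^ i \<in> Qvs.span B" for i
      using p(1)[of i] Qvs.span_scale[OF power[OF x, of i]] by (auto elim!: Rats_cases)
    thus ?thesis unfolding p(2) poly_altdef by (intro Qvs.span_sum)
  qed (auto intro: Qvs.span_zero)
qed (use one mult in \<open>auto intro: Qvs.span_zero Qvs.span_add Qvs.span_neg\<close>)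

text \<open>The powers of \<open>z\<close> stay in the span of finitely many of them, so the
  products of these with \<open>B\<close> span a field that also contains \<open>z\<close>.\<close>

lemma finite_dimensional_subfield:
  assumes "finite (S :: qbar set)"
  shows "\<exists>B. finite B \<and> S \<subseteq> Qvs.span B \<and> subfield (Qvs.span B) ring_of_type_algebra"
  using assms
proof (induction S rule: finite_induct)
  case empty
  have "subfield (Qvs.span {1::qbar}) ring_of_type_algebra"
  proof (rule subfield_Qspan)
    fix u v :: qbar assume "u \<in> Qvs.span {1}" "v \<in> Qvs.span {1}"
    from mult_in_Qspan[OF this] show "u * v \<in> Qvs.span {1}" by simp
  qed (auto intro: Qvs.span_base)
  thus ?case by (intro exI[of _ "{1}"]) auto
next
  case (insert z S)
  then obtain B where B: "finite B" "S \<subseteq> Qvs.span B" "subfield (Qvs.span B) ring_of_type_algebra" by blast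
  obtain n where n: "\<And>k. z ^ k \<in> Qvs.span ((\<lambda>i. z ^ i) ` {..<n::nat})" by (rule power_in_Qspan[of z]) blast
  define B' where "B' = (\<lambda>(a, b). a * b) ` (B \<times> (\<lambda>i. z ^ i) ` {..<n})"
  have *: "b * z ^ k \<in> Qvs.span B'" if "b \<in> Qvs.span B" for b k
    unfolding B'_def by (rule mult_in_Qspan[OF that n])
  have sub: "subfield (Qvs.span B') ring_of_type_algebra"
  proof (rule subfield_Qspan)
    show "1 \<in> Qvs.span B'" using *[of 1 0] B(3) by (simp add: subfield_iff)
    fix u v assume uv: "u \<in> Qvs.span B'" "v \<in> Qvs.span B'"
    have "Qvs.span ((\<lambda>(a, b). a * b) ` (B' \<times> B')) \<subseteq> Qvs.span B'"
    proof (rule Qvs.span_minimal)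
      show "(\<lambda>(a, b). a * b) ` (B' \<times> B') \<subseteq> Qvs.span B'"
      proof clarify
        fix u v assume "u \<in> B'" "v \<in> B'"
        then obtain a b i j where "a \<in> B" "b \<in> B" "u = a * z ^ i" "v = b * z ^ j" by (auto simp: B'_def)
        moreover from this have "a * b \<in> Qvs.span B"
          using B(3) Qvs.span_base[of a B] Qvs.span_base[of b B] by (simp add: subfield_iff)
        ultimately show "u * v \<in> Qvs.span B'" using *[of "a * b" "i + j"] by (simp add: power_add mult_ac)
      qed
    qed (rule Qvs.subspace_span)
    thus "u * v \<in> Qvs.span B'" using mult_in_Qspan[OF uv] by blast
  qed
  have "x \<in> Qvs.span B'" if "x \<in> S" for x using *[of x 0] that B(2) by auto
  moreover have "z \<in> Qvs.span B'" using *[of 1 1] B(3) by (simp add: subfield_iff)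
  moreover have "finite B'" using B by (simp add: B'_def)
  ultimately show ?case using sub by (intro exI[of _ B']) auto
qed

text \<open>A field of finite dimension containing \<open>S\<close> has its Galois group inside
  \<open>H\<close>, so it contains the fixed field of \<open>H\<close>.\<close>

lemma finite_dimensional_fixed_field:
  assumes H: "H \<subseteq> GQ" and S: "finite S" "{\<sigma>\<in>GQ. \<forall>z\<in>S. \<sigma> z = z} \<subseteq> H"
  shows "\<exists>B. finite B \<and> fixed_field H \<subseteq> Qvs.span B"
proof -
  obtain B where B: "finite B" "S \<subseteq> Qvs.span B" "subfield (Qvs.span B) ring_of_type_algebra"
    using finite_dimensional_subfield[OF S(1)] by blast
  have "gal UNIV (Qvs.span B) \<subseteq> H"
    using S(2) B(2) gal_UNIV_subset_GQ[OF B(3)] gal_fixes[of _ "Qvs.span B"] by blast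
  hence "fixed_field H \<subseteq> fixed_field (gal UNIV (Qvs.span B))" by (auto simp: fixed_field_def)
  thus ?thesis using B fixed_field_gal[OF B(3)] by blast
qed

text \<open>For algebraic integers and a prime \<open>l\<close>, this is linear independence of the
  classes modulo \<open>l\<close> over the field with \<open>l\<close> elements; division by
  \<open>l\<close> avoids forming the quotient ring.\<close>

definition independent_mod :: "nat \<Rightarrow> qbar set \<Rightarrow> bool" where
  "independent_mod l A \<longleftrightarrow> finite A \<and>
     (\<forall>c::qbar \<Rightarrow> int. algebraic_int ((\<Sum>b\<in>A. of_int (c b) * b) / of_nat l) \<longrightarrow> (\<forall>b\<in>A. int l dvd c b))"

text \<open>Descent: in a relation with integral coefficients all coefficients are divisible by
  \<open>l\<close>, and dividing them by \<open>l\<close> gives a smaller relation. Rational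
  relations are reduced to integral ones by clearing denominators.\<close>

lemma independent_mod_imp_independent:
  assumes l: "l > 1" and A: "independent_mod l A"
  shows "Qvs.independent A"
proof
  have fin: "finite A" using A by (simp add: independent_mod_def)
  have zero: "\<forall>b\<in>A. c b = 0" if "(\<Sum>b\<in>A. of_int (c b) * b) = 0" for c :: "qbar \<Rightarrow> int"
    using that
  proof (induction "\<Sum>b\<in>A. nat \<bar>c b\<bar>" arbitrary: c rule: less_induct)
    case less
    have "\<forall>b\<in>A. int l dvd c b" using A less.prems by (simp add: independent_mod_def)
    define d where "d = (\<lambda>b. c b div int l)"
    have d: "c b = int l * d b" if "b \<in> A" for b
      using that \<open>\<forall>b\<in>A. int l dvd c b\<close> by (simp add: d_def)
    have "of_nat l * (\<Sum>b\<in>A. of_int (d b) * b) = (\<Sum>b\<in>A. of_int (c b) * b)"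
      unfolding sum_distrib_left by (intro sum.cong) (auto simp: d)
    hence d0: "(\<Sum>b\<in>A. of_int (d b) * b) = 0" using less.prems l by simp
    show ?case
    proof (rule ccontr)
      assume "\<not> ?thesis"
      then obtain b where b: "b \<in> A" "c b \<noteq> 0" by blast
      have "(\<Sum>b\<in>A. nat \<bar>d b\<bar>) < (\<Sum>b\<in>A. nat \<bar>c b\<bar>)"
      proof (rule sum_strict_mono_ex1[OF fin])
        show "\<forall>b\<in>A. nat \<bar>d b\<bar> \<le> nat \<bar>c b\<bar>"
          using l by (auto simp: d abs_mult nat_mult_distrib)
        show "\<exists>b\<in>A. nat \<bar>d b\<bar> < nat \<bar>c b\<bar>"
          using b l by (intro bexI[of _ b]) (auto simp: d abs_mult nat_mult_distrib)
      qed
      from less.hyps[OF this d0] b d show False by auto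
    qed
  qed
  assume "Qvs.dependent A"
  then obtain u v where u: "v \<in> A" "u v \<noteq> 0" "(\<Sum>b\<in>A. of_rat (u b) * b) = 0"
    using Qvs.dependent_finite[OF fin] by blast
  have "\<exists>n::nat. n > 0 \<and> of_nat n * u b \<in> \<int>" for b
  proof -
    obtain i j where "u b = Rat.Fract i j" "j > 0" by (cases "u b") auto
    hence "of_nat (nat j) * u b = of_int i" by (simp only: Fract_of_int_quotient) simp
    thus ?thesis using \<open>j > 0\<close> by (intro exI[of _ "nat j"]) simp
  qed
  then obtain n where n: "\<And>b. n b > 0" "\<And>b. of_nat (n b) * u b \<in> \<int>" by metis
  define N where "N = (\<Prod>b\<in>A. n b)"
  have "\<exists>c. of_nat N * u b = of_int c" if "b \<in> A" for b
  proof -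
    have "n b dvd N" unfolding N_def using that fin by (intro dvd_prodI) auto
    then obtain k where "N = n b * k" by (rule dvdE)
    hence "of_nat N * u b = of_nat k * (of_nat (n b) * u b)" by simp
    also have "\<dots> \<in> \<int>" by (intro Ints_mult n(2)) simp
    finally show ?thesis by (auto elim: Ints_cases)
  qed
  then obtain c where c: "\<And>b. b \<in> A \<Longrightarrow> of_nat N * u b = of_int (c b)" by metis
  have "N > 0" using n by (simp add: N_def prod_pos)
  have "(\<Sum>b\<in>A. of_int (c b) * b) = of_nat N * (\<Sum>b\<in>A. of_rat (u b) * b)"
    unfolding sum_distrib_left
  proof (intro sum.cong refl)
    fix b assume "b \<in> A"
    have "(of_int (c b) :: qbar) = of_rat (of_nat N * u b)" by (simp add: c[OF \<open>b \<in> A\<close>])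
    thus "of_int (c b) * b = of_nat N * (of_rat (u b) * b)" by (simp add: of_rat_mult)
  qed
  hence "c v = 0" using zero[of c] u by simp
  thus False using c[OF u(1)] u(2) \<open>N > 0\<close> by simp
qed

text \<open>Representatives of the integers of \<open>L\<close> modulo \<open>m\<close>, repetitions
  allowed. Such a finite set takes the place of an integral basis in the finiteness arguments on
  ideals that contain \<open>m\<close>.\<close>

definition residue_system :: "qbar set \<Rightarrow> nat \<Rightarrow> qbar set \<Rightarrow> bool" where
  "residue_system L m T \<longleftrightarrow> finite T \<and> T \<subseteq> carrier (ring_ints L) \<and>
     (\<forall>z\<in>carrier (ring_ints L). \<exists>t\<in>T. algebraic_int ((z - t) / of_nat m))"

text \<open>Independence over \<open>\<rat>\<close> bounds the size of sets independent modulo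
  \<open>l\<close> by the dimension, so there is one of greatest size. Its combinations with
  coefficients from \<open>0\<close> to \<open>l - 1\<close> represent every class.\<close>

lemma residue_system_prime:
  assumes L: "subfield L ring_of_type_algebra" and B: "finite B" "L \<subseteq> Qvs.span B" and l: "prime l"
  shows "\<exists>T. residue_system L l T"
proof -
  have l1: "l > 1" using l by (rule prime_gt_1_nat)
  have "independent_mod l {}" by (simp add: independent_mod_def)
  moreover have bound: "card A \<le> card B" if "independent_mod l A" "A \<subseteq> carrier (ring_ints L)" for A
    using Qvs.independent_span_bound[OF B(1) independent_mod_imp_independent[OF l1 that(1)]] that B(2)
    by (auto simp: subset_iff)
  ultimately obtain A where A: "independent_mod l A" "A \<subseteq> carrier (ring_ints L)"
    and max: "\<And>A'. independent_mod l A' \<Longrightarrow> A' \<subseteq> carrier (ring_ints L) \<Longrightarrow> card A' \<le> card A"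
    using ex_has_greatest_nat[of "\<lambda>A. independent_mod l A \<and> A \<subseteq> carrier (ring_ints L)" "{}" card "Suc (card B)"]
    by (metis empty_subsetI le_imp_less_Suc)
  have fin: "finite A" using A by (simp add: independent_mod_def)
  have comb: "(\<Sum>b\<in>A. of_int (c b) * b) \<in> carrier (ring_ints L)" for c
    using A(2) L by (auto intro!: subfield_sum subfield_mult subfield_of_int algebraic_int_sum algebraic_int_mult)
  have ex: "\<exists>c. algebraic_int ((z - (\<Sum>b\<in>A. of_int (c b) * b)) / of_nat l)" if z: "z \<in> carrier (ring_ints L)" for z
  proof (cases "z \<in> A")
    case True
    have "(\<Sum>b\<in>A. of_int (if b = z then 1 else 0) * b) = (\<Sum>b\<in>A. if b = z then z else 0)"
      by (intro sum.cong) auto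
    thus ?thesis using True fin by (intro exI[of _ "\<lambda>b. if b = z then 1 else 0"]) simp
  next
    case False
    have "\<not> independent_mod l (insert z A)"
      using max[of "insert z A"] A(2) z False fin by auto
    then obtain c b0 where c: "algebraic_int ((\<Sum>b\<in>insert z A. of_int (c b) * b) / of_nat l)"
        and b0: "b0 \<in> insert z A" "\<not> int l dvd c b0"
      using fin by (auto simp: independent_mod_def)
    have sum: "(\<Sum>b\<in>insert z A. of_int (c b) * b) = of_int (c z) * z + (\<Sum>b\<in>A. of_int (c b) * b)"
      using fin False by simp
    have "\<not> int l dvd c z"
    proof
      assume dvd: "int l dvd c z"
      then obtain k where k: "c z = int l * k" by (rule dvdE)
      have "(\<Sum>b\<in>A. of_int (c b) * b) / of_nat l = (\<Sum>b\<in>insert z A. of_int (c b) * b) / of_nat l - of_int k * z"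
        unfolding sum k using l1 by (simp add: field_simps)
      also have "algebraic_int \<dots>" using c z by (intro algebraic_int_diff algebraic_int_mult) auto
      finally have "\<forall>b\<in>A. int l dvd c b" using A(1) by (simp add: independent_mod_def)
      thus False using b0 dvd by auto
    qed
    \<comment> \<open>The coefficient of \<open>z\<close> in the dependence relation is invertible
      modulo \<open>l\<close>; multiplying by an inverse \<open>k\<close> solves the relation for
      \<open>z\<close>.\<close>
    hence "coprime (c z) (int l)"
      using l by (metis coprime_commute prime_imp_coprime prime_nat_int_transfer)
    moreover obtain k m' where "k * c z + m' * int l = gcd (c z) (int l)"
      using bezout_int[of "c z" "int l"] by blast
    ultimately have "c z * k = 1 + int l * (- m')" by (simp add: algebra_simps)
    then obtain m where m: "c z * k = 1 + int l * m" by blast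
    have m': "of_int (c z) * of_int k = (1 + of_nat l * of_int m :: qbar)"
      using arg_cong[OF m, of "of_int :: int \<Rightarrow> qbar"] by simp
    have "(z - (\<Sum>b\<in>A. of_int (- k * c b) * b)) / of_nat l =
        of_int k * ((\<Sum>b\<in>insert z A. of_int (c b) * b) / of_nat l) - of_int m * z"
    proof -
      have "(\<Sum>b\<in>A. of_int (- k * c b) * b) = - of_int k * (\<Sum>b\<in>A. of_int (c b) * b)"
        unfolding sum_distrib_left by (intro sum.cong refl) (simp only: of_int_mult of_int_minus mult.assoc)
      moreover have "of_int k * (of_int (c z) * z) = (of_int (c z) * of_int k) * z" by (simp only: mult_ac)
      hence "of_int k * (of_int (c z) * z) = (1 + of_nat l * of_int m) * z" by (simp only: m')
      moreover have "of_int k * ((of_int (c z) * z + (\<Sum>b\<in>A. of_int (c b) * b)) / of_nat l) =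
          (of_int k * (of_int (c z) * z) + of_int k * (\<Sum>b\<in>A. of_int (c b) * b)) / of_nat l"
        by (simp add: distrib_left)
      ultimately show ?thesis unfolding sum using l1
        by (simp only: distrib_right add_divide_distrib diff_divide_distrib mult_minus_left) simp
    qed
    also have "algebraic_int \<dots>" using c z by (intro algebraic_int_diff algebraic_int_mult) auto
    finally show ?thesis by (rule exI[of _ "\<lambda>b. - k * c b"])
  qed
  define T where "T = (\<lambda>c. \<Sum>b\<in>A. of_int (c b) * b) ` (A \<rightarrow>\<^sub>E {0..<int l})"
  have "\<exists>t\<in>T. algebraic_int ((z - t) / of_nat l)" if z: "z \<in> carrier (ring_ints L)" for z
  proof -
    obtain c where c: "algebraic_int ((z - (\<Sum>b\<in>A. of_int (c b) * b)) / of_nat l)" using ex[OF z] by blast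
    define d where "d = (\<lambda>b\<in>A. c b mod int l)"
    have "d \<in> A \<rightarrow>\<^sub>E {0..<int l}" using l1 by (auto simp: d_def)
    moreover have "(z - (\<Sum>b\<in>A. of_int (d b) * b)) / of_nat l =
        (z - (\<Sum>b\<in>A. of_int (c b) * b)) / of_nat l + (\<Sum>b\<in>A. of_int (c b div int l) * b)"
    proof -
      have "(\<Sum>b\<in>A. of_int (c b) * b) = (\<Sum>b\<in>A. of_int (d b) * b + of_nat l * (of_int (c b div int l) * b))"
      proof (intro sum.cong refl)
        fix b assume "b \<in> A"
        have "of_int (c b) = (of_int (c b mod int l + int l * (c b div int l)) :: qbar)" by simp
        thus "of_int (c b) * b = of_int (d b) * b + of_nat l * (of_int (c b div int l) * b)"
          using \<open>b \<in> A\<close> unfolding of_int_add of_int_mult by (simp add: d_def algebra_simps)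
      qed
      hence "(\<Sum>b\<in>A. of_int (c b) * b) = (\<Sum>b\<in>A. of_int (d b) * b) + of_nat l * (\<Sum>b\<in>A. of_int (c b div int l) * b)"
        unfolding sum.distrib sum_distrib_left .
      thus ?thesis using l1 by (simp add: diff_divide_distrib add_divide_distrib)
    qed
    hence "algebraic_int ((z - (\<Sum>b\<in>A. of_int (d b) * b)) / of_nat l)"
      using c comb[of "\<lambda>b. c b div int l"] by (auto intro: algebraic_int_add)
    ultimately show ?thesis unfolding T_def by blast
  qed
  moreover have "finite T" "T \<subseteq> carrier (ring_ints L)"
    using fin comb by (auto simp: T_def intro!: finite_PiE)
  ultimately show ?thesis unfolding residue_system_def by blast
qed

text \<open>Induction over the prime factors: representatives modulo \<open>l * m\<close> are
  \<open>t + l * t'\<close>, with \<open>t\<close> taken modulo \<open>l\<close> and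
  \<open>t'\<close> modulo \<open>m\<close>.\<close>

lemma residue_system_exists:
  assumes L: "subfield L ring_of_type_algebra" and B: "finite B" "L \<subseteq> Qvs.span B" and "m > 0"
  shows "\<exists>T. residue_system L m T"
  using \<open>m > 0\<close>
proof (induction m rule: prime_divisors_induct)
  case (unit m)
  thus ?case using L by (intro exI[of _ "{0}"]) (auto simp: residue_system_def subfield_iff)
next
  case (factor l m)
  obtain T T' where T: "residue_system L l T" "residue_system L m T'"
    using factor residue_system_prime[OF L B factor.hyps(1)] by (auto simp: prime_gt_0_nat)
  define U where "U = (\<lambda>(t, t'). t + of_nat l * t') ` (T \<times> T')"
  have "of_nat l \<in> L" using Rats_subset_subfield[OF L] by auto
  hence U: "finite U" "U \<subseteq> carrier (ring_ints L)"
    using T L by (auto simp: U_def residue_system_def subfield_iff subset_iff intro!: algebraic_int_add algebraic_int_mult)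
  have "\<exists>u\<in>U. algebraic_int ((z - u) / of_nat (l * m))" if z: "z \<in> carrier (ring_ints L)" for z
  proof -
    obtain t where t: "t \<in> T" "algebraic_int ((z - t) / of_nat l)" using T z unfolding residue_system_def by blast
    have "t \<in> L" "z \<in> L" using t T z by (auto simp: residue_system_def subset_iff)
    hence "(z - t) / of_nat l \<in> L" using L by (intro subfield_divide subfield_diff subfield_of_nat)
    hence "(z - t) / of_nat l \<in> carrier (ring_ints L)" using t by simp
    then obtain t' where t': "t' \<in> T'" "algebraic_int (((z - t) / of_nat l - t') / of_nat m)"
      using T(2) unfolding residue_system_def by blast
    have "(z - (t + of_nat l * t')) / of_nat (l * m) = ((z - t) / of_nat l - t') / of_nat m"
      using prime_gt_0_nat[OF factor.hyps(1)] by (simp add: diff_divide_distrib add_divide_distrib)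
    thus ?thesis using t t' by (intro bexI[of _ "t + of_nat l * t'"]) (auto simp: U_def)
  qed
  thus ?case using U unfolding residue_system_def by blast
qed auto


section \<open>Powers of ideals and ramification indices\<close>

lemma ideal_prod_ring_ints:
  assumes "subfield K ring_of_type_algebra" "ideal I (ring_ints K)" "ideal J (ring_ints K)"
  shows "ideal (ideal_prod (ring_ints K) I J) (ring_ints K)"
proof -
  interpret cring "ring_ints K" by (rule cring_ring_ints) fact
  show ?thesis using assms by (intro ideal_prod_is_ideal)
qed

abbreviation ideal_pow :: "qbar set \<Rightarrow> qbar set \<Rightarrow> nat \<Rightarrow> qbar set" where
  "ideal_pow K Q e \<equiv> Q [^]\<^bsub>ideals_set (ring_ints K)\<^esub> e"

lemma ideal_pow_0 [simp]: "ideal_pow K Q 0 = carrier (ring_ints K)"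
  and ideal_pow_Suc [simp]: "ideal_pow K Q (Suc e) = ideal_prod (ring_ints K) (ideal_pow K Q e) Q"
  by (simp_all add: nat_pow_def ideals_set_def)

lemma ideals_set_simps [simp]:
  "\<one>\<^bsub>ideals_set R\<^esub> = carrier R" "I \<otimes>\<^bsub>ideals_set R\<^esub> J = ideal_prod R I J"
  by (simp_all add: ideals_set_def)

context
  fixes L Q
  assumes L: "subfield L ring_of_type_algebra" and Q: "ideal Q (ring_ints L)"
begin

interpretation OL: cring "ring_ints L" by (rule cring_ring_ints) (rule L)

lemma ideal_pow_ideal: "ideal (ideal_pow L Q e) (ring_ints L)"
  by (induction e) (auto intro: OL.oneideal ideal_prod_ring_ints[OF L] Q)

lemma ideal_pow_1: "ideal_pow L Q (Suc 0) = Q"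
  using OL.ideal_prod_one[OF Q] OL.ideal_prod_commute[OF Q OL.oneideal] by simp

lemma ideal_pow_antimono: "d \<le> e \<Longrightarrow> ideal_pow L Q e \<subseteq> ideal_pow L Q d"
proof (induction e rule: dec_induct)
  case (step n)
  thus ?case using OL.ideal_prod_inter[OF ideal_pow_ideal Q, of n] by auto
qed simp

text \<open>Nakayama's lemma; the generators in \<open>Y\<close> are eliminated one at a time.\<close>
lemma finitely_generated_ideal_eq_prod:
  assumes I: "ideal I (ring_ints L)" "ideal_prod (ring_ints L) I Q = I"
    and Y: "finite Y" "Y \<subseteq> I"
    and q: "q \<in> Q" "\<And>x. x \<in> I \<Longrightarrow> \<exists>a. (\<forall>y\<in>Y. a y \<in> carrier (ring_ints L)) \<and> (1 - q) * x = (\<Sum>y\<in>Y. a y * y)"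
  shows "\<exists>q\<in>Q. \<forall>x\<in>I. (1 - q) * x = 0"
  using Y q
proof (induction Y arbitrary: q rule: finite_induct)
  case empty
  thus ?case by auto
next
  case (insert y Y)
  note Qc = ideal_closed[OF L Q] and Ic = ideal_closed[OF L I(1)]
  have gen: "\<exists>a. (\<forall>y\<in>insert y Y. a y \<in> Q) \<and> (1 - q) * x = (\<Sum>y\<in>insert y Y. a y * y)"
    if "x \<in> ideal_prod (ring_ints L) I Q" for x
    using that
  proof (induction rule: ideal_prod.induct)
    case (prod i j)
    obtain a where a: "\<forall>y\<in>insert y Y. a y \<in> carrier (ring_ints L)" "(1 - q) * i = (\<Sum>y\<in>insert y Y. a y * y)"
      using insert.prems(3)[OF prod(1)] by blast
    have "(1 - q) * (i * j) = j * ((1 - q) * i)" by (simp add: mult_ac)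
    also have "\<dots> = (\<Sum>y\<in>insert y Y. (a y * j) * y)"
      unfolding a(2) sum_distrib_left by (intro sum.cong) (auto simp: mult_ac)
    finally show ?case using a(1) Qc(5)[OF prod(2)] by (intro exI[of _ "\<lambda>y. a y * j"]) auto
  next
    case (sum s1 s2)
    then obtain a b where "\<forall>y\<in>insert y Y. a y \<in> Q" "(1 - q) * s1 = (\<Sum>y\<in>insert y Y. a y * y)"
       "\<forall>y\<in>insert y Y. b y \<in> Q" "(1 - q) * s2 = (\<Sum>y\<in>insert y Y. b y * y)" by blast
    thus ?case using Qc(4)
      by (intro exI[of _ "\<lambda>y. a y + b y"]) (simp add: distrib_left distrib_right sum.distrib)
  qed
  have yI: "y \<in> I" using insert.prems by simp
  then obtain a where a: "\<forall>y\<in>insert y Y. a y \<in> Q" "(1 - q) * y = (\<Sum>y\<in>insert y Y. a y * y)"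
    using gen[of y] I(2) by blast
  \<comment> \<open>Moving the term \<open>a y * y\<close> to the other side: multiplication by
    \<open>1 - r\<close> brings \<open>y\<close> into the combinations of the remaining
    generators.\<close>
  define r where "r = q + a y"
  have r: "r \<in> Q" using a insert.prems Qc(4) by (simp add: r_def)
  have ry: "(1 - r) * y = (\<Sum>w\<in>Y. a w * w)"
    using a(2) insert.hyps by (simp add: r_def algebra_simps)
  \<comment> \<open>Chosen so that \<open>1 - q' = (1 - q) * (1 - r)\<close>.\<close>
  define q' where "q' = q + r - q * r"
  have "q \<in> L" "algebraic_int q" "r \<in> L" "algebraic_int r" using Qc(1,2) insert.prems(2) r by auto
  hence q': "q' \<in> Q" unfolding q'_def using Qc(4)[OF insert.prems(2) r] Qc(5)[OF r, of q]
    by (intro ideal_diff[OF L Q]) auto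
  have "\<exists>q\<in>Q. \<forall>x\<in>I. (1 - q) * x = 0"
  proof (rule insert.IH[OF _ q'])
    show "Y \<subseteq> I" using insert.prems by simp
    fix x assume "x \<in> I"
    then obtain b where b: "\<forall>y\<in>insert y Y. b y \<in> carrier (ring_ints L)" "(1 - q) * x = (\<Sum>y\<in>insert y Y. b y * y)"
      using insert.prems(3) by blast
    have "(1 - q') * x = (1 - r) * ((1 - q) * x)" by (simp add: q'_def algebra_simps)
    also have "\<dots> = b y * ((1 - r) * y) + (1 - r) * (\<Sum>w\<in>Y. b w * w)"
      unfolding b(2) using insert.hyps by (simp add: algebra_simps)
    also have "\<dots> = (\<Sum>w\<in>Y. (b y * a w + (1 - r) * b w) * w)"
      unfolding ry by (simp add: sum_distrib_left sum.distrib distrib_right mult.assoc)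
    finally have "(1 - q') * x = (\<Sum>w\<in>Y. (b y * a w + (1 - r) * b w) * w)" .
    moreover have "b y * a w + (1 - r) * b w \<in> carrier (ring_ints L)" if "w \<in> Y" for w
    proof -
      have "a w \<in> L" "algebraic_int (a w)" using a(1) that Qc(1,2) by auto
      moreover have "b y \<in> L" "algebraic_int (b y)" "b w \<in> L" "algebraic_int (b w)" using b(1) that by auto
      ultimately show ?thesis using \<open>r \<in> L\<close> \<open>algebraic_int r\<close> unfolding ring_ints_simps
        by (intro conjI subfield_add[OF L] subfield_mult[OF L] subfield_diff[OF L] subfield_one[OF L]
            algebraic_int_add algebraic_int_mult algebraic_int_diff algebraic_int_1)
    qed
    ultimately show "\<exists>a. (\<forall>y\<in>Y. a y \<in> carrier (ring_ints L)) \<and> (1 - q') * x = (\<Sum>y\<in>Y. a y * y)"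
      by (intro exI[of _ "\<lambda>w. b y * a w + (1 - r) * b w"] conjI ballI)
  qed
  thus ?case .
qed

text \<open>A power of \<open>Q\<close> containing \<open>l\<close> is determined by its trace on
  the finite set \<open>T\<close>. If all powers contained \<open>l\<close>, two would coincide, so
  some power would equal its product with \<open>Q\<close>. Nakayama's lemma, with \<open>l\<close>
  and the elements of \<open>T\<close> in that power as generators, would give
  \<open>(1 - q) * l = 0\<close> for some \<open>q\<close> in \<open>Q\<close>.\<close>

lemma integer_notin_ideal_pow:
  assumes T: "residue_system L l T" and l: "l > 0" and Q1: "1 \<notin> Q"
  obtains e where "of_nat l \<notin> ideal_pow L Q e"
proof (rule ccontr)
  assume "\<not> thesis"
  hence lQ: "of_nat l \<in> ideal_pow L Q e" for e using that by blast
  have fin: "finite T" and TL: "T \<subseteq> carrier (ring_ints L)" using T by (auto simp: residue_system_def)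
  have split: "\<exists>t w. t \<in> T \<inter> ideal_pow L Q e \<and> w \<in> carrier (ring_ints L) \<and> x = t + w * of_nat l"
    if x: "x \<in> ideal_pow L Q e" for x e
  proof -
    have xL: "x \<in> L" "algebraic_int x" using ideal_closed[OF L ideal_pow_ideal] x by auto
    hence "x \<in> carrier (ring_ints L)" by simp
    then obtain t where t: "t \<in> T" "algebraic_int ((x - t) / of_nat l)"
      using T unfolding residue_system_def by blast
    define w where "w = (x - t) / of_nat l"
    have "w \<in> carrier (ring_ints L)"
      using t xL TL L by (auto simp: w_def intro!: subfield_divide subfield_diff subfield_of_nat)
    moreover have xt: "x = t + w * of_nat l" using l by (simp add: w_def)
    moreover have "x - w * of_nat l \<in> ideal_pow L Q e"
      using calculation ideal_mult[OF L ideal_pow_ideal lQ[of e], of w]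
      by (intro ideal_diff[OF L ideal_pow_ideal x]) auto
    hence "t \<in> ideal_pow L Q e" unfolding xt by simp
    ultimately show ?thesis using t by blast
  qed
  have "\<not> inj (\<lambda>e. T \<inter> ideal_pow L Q e)"
  proof
    assume "inj (\<lambda>e. T \<inter> ideal_pow L Q e)"
    moreover have "finite (range (\<lambda>e. T \<inter> ideal_pow L Q e))"
      by (rule finite_subset[of _ "Pow T"]) (use fin in auto)
    ultimately show False using finite_imageD infinite_UNIV_nat by blast
  qed
  then obtain d e where de: "d < e" "T \<inter> ideal_pow L Q d = T \<inter> ideal_pow L Q e"
    unfolding inj_def by (metis linorder_neqE_nat)
  have "ideal_pow L Q d \<subseteq> ideal_pow L Q e"
  proof
    fix x assume "x \<in> ideal_pow L Q d"
    then obtain t w where "t \<in> T \<inter> ideal_pow L Q d" "w \<in> carrier (ring_ints L)" "x = t + w * of_nat l"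
      using split by blast
    thus "x \<in> ideal_pow L Q e"
      using de ideal_mult[OF L ideal_pow_ideal lQ[of e], of w] ideal_add[OF L ideal_pow_ideal] by auto
  qed
  moreover have "ideal_pow L Q e \<subseteq> ideal_pow L Q (Suc d)" using de by (intro ideal_pow_antimono) simp
  moreover have "ideal_pow L Q (Suc d) \<subseteq> ideal_pow L Q d" by (rule ideal_pow_antimono) simp
  ultimately have eq: "ideal_prod (ring_ints L) (ideal_pow L Q d) Q = ideal_pow L Q d" by auto
  define Y where "Y = insert (of_nat l) (T \<inter> ideal_pow L Q d)"
  have "\<exists>q\<in>Q. \<forall>x\<in>ideal_pow L Q d. (1 - q) * x = 0"
  proof (rule finitely_generated_ideal_eq_prod[OF ideal_pow_ideal eq, of Y 0])
    show finY: "finite Y" using fin by (simp add: Y_def)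
    show "Y \<subseteq> ideal_pow L Q d" using lQ by (auto simp: Y_def)
    show "0 \<in> Q" by (rule ideal_zero[OF L Q])
    fix x assume "x \<in> ideal_pow L Q d"
    then obtain t w where tw: "t \<in> T \<inter> ideal_pow L Q d" "w \<in> carrier (ring_ints L)" "x = t + w * of_nat l"
      using split by blast
    define a where "a = (\<lambda>y. (if y = t then 1 else 0) + (if y = of_nat l then w else 0))"
    have "(\<Sum>y\<in>Y. a y * y) = (\<Sum>y\<in>Y. if y = t then t else 0) + (\<Sum>y\<in>Y. if y = of_nat l then w * of_nat l else 0)"
      unfolding a_def distrib_right sum.distrib by (intro arg_cong2[of _ _ _ _ "(+)"] sum.cong) auto
    also have "\<dots> = t + w * of_nat l" using tw finY by (simp add: Y_def)
    finally have "(1 - 0) * x = (\<Sum>y\<in>Y. a y * y)" by (simp add: tw)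
    moreover have "a y \<in> carrier (ring_ints L)" for y
      using tw L by (auto simp: a_def intro!: subfield_add subfield_one subfield_zero algebraic_int_add)
    ultimately show "\<exists>a. (\<forall>y\<in>Y. a y \<in> carrier (ring_ints L)) \<and> (1 - 0) * x = (\<Sum>y\<in>Y. a y * y)"
      by (intro exI[of _ a] conjI ballI)
  qed
  then obtain q where "q \<in> Q" "(1 - q) * of_nat l = 0" using lQ by blast
  thus False using l Q1 by simp
qed

text \<open>The \<open>GREATEST\<close> in \<open>ram_index\<close> is meaningful only if the
  exponents are bounded; the bound is an exponent \<open>d\<close> for which the power of
  \<open>Q\<close> misses \<open>l\<close>.\<close>

lemma ram_index_ge:
  assumes T: "residue_system L l T" and l: "l > 0" and Q1: "1 \<notin> Q"
    and P: "of_nat l \<in> Q \<inter> K" "Q \<inter> K \<subseteq> ideal_pow L Q e"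
  shows "e \<le> ram_index K L Q"
proof -
  obtain d where d: "of_nat l \<notin> ideal_pow L Q d" by (rule integer_notin_ideal_pow[OF T l Q1]) blast
  have "y \<le> d" if "Q \<inter> K \<subseteq> ideal_pow L Q y" for y
  proof (rule ccontr)
    assume "\<not> y \<le> d"
    hence "ideal_pow L Q y \<subseteq> ideal_pow L Q d" by (intro ideal_pow_antimono) simp
    thus False using that P(1) d by blast
  qed
  thus ?thesis unfolding ram_index_def using P(2) by (intro Greatest_le_nat[of _ e d]) auto
qed

end

text \<open>With \<open>b = g * h\<close> and \<open>g = gcd b n\<close>, the cofactor
  \<open>h\<close> is coprime to \<open>n div g\<close> and so divides \<open>g\<close>. Then
  \<open>h ^ 2\<close> divides the squarefree \<open>b\<close>.\<close>

lemma dvd_square_squarefree: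
  fixes b n :: "'a::{factorial_semiring, semiring_gcd}"
  assumes "squarefree b" "b dvd n ^ 2"
  shows "b dvd n"
proof (cases "n = 0")
  case False
  define g where "g = gcd b n"
  define h m where "h = b div g" and "m = n div g"
  have h: "b = g * h" "n = g * m" by (simp_all add: h_def m_def g_def)
  have cop: "coprime h m" unfolding h_def m_def g_def using False by (intro div_gcd_coprime) simp
  have g0: "g \<noteq> 0" using False by (simp add: g_def)
  have "g * h dvd g * (g * m ^ 2)" using assms(2) h by (simp add: power2_eq_square mult_ac)
  hence "h dvd g * m ^ 2" using g0 by simp
  hence "h dvd g" using cop by (simp add: coprime_dvd_mult_left_iff)
  hence "h ^ 2 dvd b" unfolding h(1) power2_eq_square by (rule mult_dvd_mono) simp
  hence "h dvd 1" using assms(1) squarefreeD by blast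
  thus ?thesis unfolding h by (intro mult_dvd_mono) (auto intro: dvd_trans)
qed simp

lemma qbar_sqrt:
  obtains w :: qbar where "w ^ 2 = y"
proof -
  obtain w where "w ^ 2 = y" using nth_root_exists[of 2 y] by auto
  thus ?thesis by (rule that)
qed

lemma algebraic_int_sqrt_iff:
  fixes w :: "'a::field_char_0"
  shows "algebraic_int (w ^ 2) \<longleftrightarrow> algebraic_int w"
proof
  assume "algebraic_int (w ^ 2)"
  thus "algebraic_int w"
    by (rule algebraic_int_root[where p = "monom 1 2"]) (auto simp: poly_monom degree_monom_eq)
qed (rule algebraic_int_power)

lemma principal_ideal:
  assumes K: "subfield K ring_of_type_algebra" and \<beta>: "\<beta> \<in> carrier (ring_ints K)"
  shows "ideal ((\<lambda>z. \<beta> * z) ` carrier (ring_ints K)) (ring_ints K)"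
  unfolding ideal_ring_ints_iff[OF K]
proof (intro conjI ballI allI impI)
  show "0 \<in> (\<lambda>z. \<beta> * z) ` carrier (ring_ints K)"
    by (rule image_eqI[of _ _ 0]) (use K in \<open>auto simp: subfield_zero\<close>)
  fix y assume "y \<in> (\<lambda>z. \<beta> * z) ` carrier (ring_ints K)"
  then obtain u where "y = \<beta> * u" "u \<in> carrier (ring_ints K)" by (rule imageE)
  hence u: "y = \<beta> * u" "u \<in> K" "algebraic_int u" by simp_all
  have \<beta>': "\<beta> \<in> K" "algebraic_int \<beta>" using \<beta> by simp_all
  show "y \<in> K" "algebraic_int y" unfolding u(1) by (intro subfield_mult[OF K] algebraic_int_mult \<beta>' u)+
  show "y + y' \<in> (\<lambda>z. \<beta> * z) ` carrier (ring_ints K)" if y': "y' \<in> (\<lambda>z. \<beta> * z) ` carrier (ring_ints K)" for y'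
  proof -
    obtain u' where "y' = \<beta> * u'" "u' \<in> carrier (ring_ints K)" using y' by (rule imageE)
    hence u': "y' = \<beta> * u'" "u' \<in> K" "algebraic_int u'" by simp_all
    show ?thesis by (rule image_eqI[of _ _ "u + u'"])
      (simp_all add: u u' distrib_left subfield_add[OF K] algebraic_int_add)
  qed
  show "v * y \<in> (\<lambda>z. \<beta> * z) ` carrier (ring_ints K)" if "v \<in> K" "algebraic_int v" for v
    using that by (intro image_eqI[of _ _ "v * u"]) (simp_all add: u subfield_mult[OF K] algebraic_int_mult)
qed

subsection \<open>Norms of ideals\<close>

context
  fixes K I
  assumes K: "subfield K ring_of_type_algebra" and I: "ideal I (ring_ints K)"
begin

lemma quotient_carrier: "carrier (ring_ints K Quot I) = (\<lambda>z. (\<lambda>i. i + z) ` I) ` carrier (ring_ints K)"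
  by (auto simp: FactRing_def A_RCOSETS_def RCOSETS_def r_coset_def)

lemma coset_eq_iff:
  "(\<lambda>i. i + z) ` I = (\<lambda>i. i + w) ` I \<longleftrightarrow> z - w \<in> I"
proof
  assume "(\<lambda>i. i + z) ` I = (\<lambda>i. i + w) ` I"
  hence "0 + z \<in> (\<lambda>i. i + w) ` I" using ideal_zero[OF K I] by blast
  thus "z - w \<in> I" by auto
next
  assume zw: "z - w \<in> I"
  show "(\<lambda>i. i + z) ` I = (\<lambda>i. i + w) ` I"
  proof safe
    fix i assume "i \<in> I"
    thus "i + z \<in> (\<lambda>i. i + w) ` I" using ideal_add[OF K I _ zw]
      by (intro image_eqI[of _ _ "i + (z - w)"]) auto
    show "i + w \<in> (\<lambda>i. i + z) ` I" using ideal_diff[OF K I \<open>i \<in> I\<close> zw]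
      by (intro image_eqI[of _ _ "i - (z - w)"]) auto
  qed
qed

lemma abs_norm_eq_card:
  assumes T: "T \<subseteq> carrier (ring_ints K)"
    and ex: "\<And>z. z \<in> carrier (ring_ints K) \<Longrightarrow> \<exists>t\<in>T. z - t \<in> I"
    and uniq: "\<And>t u. t \<in> T \<Longrightarrow> u \<in> T \<Longrightarrow> t - u \<in> I \<Longrightarrow> t = u"
  shows "abs_norm K I = card T"
proof -
  have "(\<lambda>z. (\<lambda>i. i + z) ` I) ` T = carrier (ring_ints K Quot I)"
    unfolding quotient_carrier
  proof safe
    fix z assume "z \<in> carrier (ring_ints K)"
    then obtain t where "t \<in> T" "z - t \<in> I" using ex by blast
    thus "(\<lambda>i. i + z) ` I \<in> (\<lambda>z. (\<lambda>i. i + z) ` I) ` T" using coset_eq_iff[of z t] by blast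
  qed (use T in auto)
  moreover have "inj_on (\<lambda>z. (\<lambda>i. i + z) ` I) T"
    using uniq by (auto simp: inj_on_def coset_eq_iff)
  ultimately show ?thesis unfolding abs_norm_def using card_image by metis
qed

lemma abs_norm_integers:
  assumes b: "b > 0" "\<And>n::int. of_int n \<in> I \<longleftrightarrow> int b dvd n"
    and ex: "\<And>z. z \<in> carrier (ring_ints K) \<Longrightarrow> \<exists>n::int. z - of_int n \<in> I"
  shows "abs_norm K I = b"
proof -
  have "abs_norm K I = card ((of_int :: int \<Rightarrow> qbar) ` {0..<int b})"
  proof (rule abs_norm_eq_card)
    show "of_int ` {0..<int b} \<subseteq> carrier (ring_ints K)" using K by (auto intro: subfield_of_int)
    fix z assume "z \<in> carrier (ring_ints K)"
    then obtain n where n: "z - of_int n \<in> I" using ex by blast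
    have "of_int (n - n mod int b) \<in> I" unfolding b(2) by (rule dvd_minus_mod)
    from ideal_add[OF K I n this] have "z - of_int (n mod int b) \<in> I" by simp
    thus "\<exists>t\<in>of_int ` {0..<int b}. z - t \<in> I" using b(1) by (intro bexI[of _ "of_int (n mod int b)"]) auto
  next
    fix t u :: qbar assume "t \<in> of_int ` {0..<int b}" "u \<in> of_int ` {0..<int b}" "t - u \<in> I"
    then obtain m n where mn: "t = of_int m" "u = of_int n" "m \<in> {0..<int b}" "n \<in> {0..<int b}" "of_int (m - n) \<in> I"
      by auto
    hence "int b dvd m - n" using b by blast
    hence "m mod int b = n mod int b" by (simp add: mod_eq_dvd_iff)
    thus "t = u" using mn by simp
  qed
  thus ?thesis by (simp add: card_image inj_on_def)
qed

lemma integers_in_ideal: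
  assumes "of_nat m \<in> I" "m > 0"
  obtains c :: nat where "c > 0" "\<And>n::int. of_int n \<in> I \<longleftrightarrow> int c dvd n"
proof -
  define c where "c = (LEAST c::nat. c > 0 \<and> of_nat c \<in> I)"
  have c: "c > 0" "of_nat c \<in> I" unfolding c_def using LeastI[of "\<lambda>c. c > 0 \<and> of_nat c \<in> I" m] assms by auto
  have least: "c \<le> n" if "n > 0" "of_nat n \<in> I" for n unfolding c_def using that by (intro Least_le) auto
  have mult: "of_int (int c * k) \<in> I" for k
    using ideal_mult[OF K I c(2), of "of_int k"] K by (simp add: subfield_of_int mult.commute)
  have "of_int n \<in> I \<longleftrightarrow> int c dvd n" for n :: int
  proof
    assume n: "of_int n \<in> I"
    have "n mod int c = n - int c * (n div int c)" by (simp add: minus_mult_div_eq_mod)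
    hence "of_int (n mod int c) = (of_int n - of_int (int c * (n div int c)) :: qbar)"
      by (simp only: of_int_diff)
    also have "\<dots> \<in> I" by (rule ideal_diff[OF K I n mult])
    finally have "of_nat (nat (n mod int c)) \<in> I" using c by simp
    hence "\<not> nat (n mod int c) > 0" using least[of "nat (n mod int c)"] c
      by (metis nat_less_iff not_less pos_mod_bound pos_mod_sign of_nat_0_less_iff)
    thus "int c dvd n" using c by (simp add: dvd_eq_mod_eq_0 not_less) (metis antisym pos_mod_sign of_nat_0_less_iff)
  qed (use mult in auto)
  thus ?thesis using that c by blast
qed

text \<open>\<open>card\<close> of an infinite set is zero, so a positive norm means a finite
  quotient, in which two natural numbers have the same class.\<close>

lemma finite_quotient_integer:
  assumes "abs_norm K I > 0"
  obtains m :: nat where "of_nat m \<in> I" "m > 0"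
proof -
  have "\<not> inj (\<lambda>n::nat. (\<lambda>i. i + of_nat n) ` I)"
  proof
    assume "inj (\<lambda>n::nat. (\<lambda>i. i + of_nat n) ` I)"
    moreover have "range (\<lambda>n::nat. (\<lambda>i. i + of_nat n) ` I) \<subseteq> carrier (ring_ints K Quot I)"
      unfolding quotient_carrier using K
      by (intro image_subsetI rev_image_eqI[of "of_nat _"]) (auto intro: subfield_of_nat)
    hence "finite (range (\<lambda>n::nat. (\<lambda>i. i + of_nat n) ` I))"
      using assms by (intro finite_subset[OF _ card_ge_0_finite]) (auto simp: abs_norm_def)
    ultimately show False using finite_imageD infinite_UNIV_nat by blast
  qed
  then obtain m n :: nat where mn: "m < n" "of_nat n - of_nat m \<in> I"
    unfolding inj_def coset_eq_iff by (metis linorder_neqE_nat coset_eq_iff)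
  thus ?thesis using that[of "n - m"] by (simp add: of_nat_diff)
qed

end

text \<open>In an integral equation of a nonzero \<open>z\<close> in \<open>P\<close>, after
  cancelling factors \<open>z\<close>, the constant term is a nonzero multiple of
  \<open>z\<close>.\<close>

lemma nonzero_ideal_contains_nat:
  assumes K: "subfield K ring_of_type_algebra" and Pi: "ideal P (ring_ints K)" and P0: "P \<noteq> {0}"
  shows "\<exists>m::nat. m > 0 \<and> of_nat m \<in> P"
proof -
  note Pc = ideal_closed[OF K Pi]
  obtain z where z: "z \<in> P" "z \<noteq> 0" using P0 Pc(3) by blast
  have "\<exists>n. n \<noteq> 0 \<and> of_int n \<in> P" if "p \<noteq> 0" "poly (map_poly of_int p) z = 0" for p :: "int poly"
    using that
  proof (induction p)
    case (pCons a p)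
    have eq: "of_int a = - (poly (map_poly of_int p) z * z)"
      using pCons.prems by (simp add: map_poly_pCons add_eq_0_iff mult.commute)
    have int: "algebraic_int (poly (map_poly of_int p) z) \<and> poly (map_poly of_int p) z \<in> K"
      unfolding poly_altdef using Pc(1,2)[OF z(1)] K
      by (auto simp: coeff_map_poly intro!: algebraic_int_sum algebraic_int_mult algebraic_int_power
          subfield_sum subfield_mult subfield_power subfield_of_int)
    show ?case
    proof (cases "a = 0")
      case True
      hence "poly (map_poly of_int p) z = 0" using eq z by simp
      moreover have "p \<noteq> 0" using True pCons.hyps by auto
      ultimately show ?thesis using pCons.IH by blast
    next
      case False
      have "of_int a \<in> P" unfolding eq using int Pc(5)[OF z(1)] by (intro ideal_uminus[OF K Pi]) auto
      thus ?thesis using False by blast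
    qed
  qed simp
  moreover obtain p :: "int poly" where "poly (map_poly of_int p) z = 0" "lead_coeff p = 1"
    using Pc(2)[OF z(1)] unfolding algebraic_int_altdef_ipoly by blast
  moreover from this have "p \<noteq> 0" by auto
  ultimately obtain n where n: "n \<noteq> 0" "of_int n \<in> P" by blast
  have "of_int \<bar>n\<bar> \<in> P" using n(2) ideal_uminus[OF K Pi n(2)] by (cases "n \<ge> 0") auto
  thus ?thesis using n by (intro exI[of _ "nat \<bar>n\<bar>"]) simp
qed

lemma nonzero_prime_contains_prime:
  assumes K: "subfield K ring_of_type_algebra" and P: "nonzero_prime K P"
  obtains l :: nat where "prime l" "of_nat l \<in> P" "\<And>n::int. of_int n \<in> P \<longleftrightarrow> int l dvd n"
proof -
  have Pp: "primeideal P (ring_ints K)" and P0: "P \<noteq> {0}" using P by (auto simp: nonzero_prime_def)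
  note PP = Pp[unfolded primeideal_ring_ints_iff[OF K]]
  have Pi: "ideal P (ring_ints K)" and P1: "1 \<notin> P" using PP by auto
  obtain m :: nat where m: "m > 0" "of_nat m \<in> P"
    using nonzero_ideal_contains_nat[OF K Pi P0] by blast
  obtain c :: nat where c: "c > 0" "\<And>n::int. of_int n \<in> P \<longleftrightarrow> int c dvd n"
    by (rule integers_in_ideal[OF K Pi m(2,1)]) blast
  have "prime c"
    unfolding prime_nat_iff
  proof (intro conjI allI impI)
    show "1 < c" using c P1 c(2)[of 1] by (cases "c = 1") auto
    fix d assume "d dvd c"
    then obtain e where e: "c = d * e" by (rule dvdE)
    have "of_nat c \<in> P" using c(2)[of "int c"] by simp
    hence "of_nat d \<in> P \<or> of_nat e \<in> P"
      using PP[THEN conjunct2, THEN conjunct2, rule_format, of "of_nat d" "of_nat e"] K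
      by (auto simp: e subfield_of_nat)
    hence "c dvd d \<or> c dvd e" using c(2)[of "int d"] c(2)[of "int e"] by auto
    thus "d = 1 \<or> d = c" using e c(1) by (metis dvd_antisym dvd_triv_left dvd_triv_right mult_cancel1 mult_cancel2 nat_mult_1 nat_mult_1_right neq0_conv)
  qed
  moreover have "of_nat c \<in> P" using c(2)[of "int c"] by simp
  ultimately show ?thesis using that c(2) by blast
qed

subsection \<open>Powers modulo a prime\<close>

context
  fixes R l
  assumes R: "ideal R (ring_ints (UNIV :: qbar set))" and l: "prime l" "of_nat l \<in> R"
begin

lemmas Rc = ideal_closed[OF subfield_UNIV R]

lemma frobenius_add:
  assumes "algebraic_int x" "algebraic_int y"
  shows "(x + y) ^ l - (x ^ l + y ^ l) \<in> R"
proof -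
  have l1: "l > 1" using l(1) by (rule prime_gt_1_nat)
  have "(x + y) ^ l = (\<Sum>k\<in>{..l}. of_nat (l choose k) * x ^ k * y ^ (l - k))" by (rule binomial_ring)
  also have "{..l} = insert 0 (insert l {1..<l})" using l1 by auto
  also have "(\<Sum>k\<in>\<dots>. of_nat (l choose k) * x ^ k * y ^ (l - k)) =
      y ^ l + (x ^ l + (\<Sum>k\<in>{1..<l}. of_nat (l choose k) * x ^ k * y ^ (l - k)))"
    using l1 by simp
  finally have "(x + y) ^ l - (x ^ l + y ^ l) = (\<Sum>k\<in>{1..<l}. of_nat (l choose k) * x ^ k * y ^ (l - k))"
    by simp
  also have "\<dots> \<in> R"
  proof (rule ideal_sum[OF subfield_UNIV R])
    fix k assume "k \<in> {1..<l}"
    hence "l dvd l choose k" using l by (intro dvd_choose_prime) auto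
    then obtain m where "l choose k = l * m" by (rule dvdE)
    hence "of_nat (l choose k) * x ^ k * y ^ (l - k) = (of_nat m * x ^ k * y ^ (l - k)) * of_nat l" by simp
    also have "\<dots> \<in> R" using assms by (intro Rc(5)[OF l(2)]) (auto intro!: algebraic_int_mult algebraic_int_power)
    finally show "of_nat (l choose k) * x ^ k * y ^ (l - k) \<in> R" .
  qed
  finally show ?thesis .
qed

lemma power_cong:
  assumes "algebraic_int x" "algebraic_int y" "x - y \<in> R"
  shows "x ^ n - y ^ n \<in> R"
proof (induction n)
  case (Suc n)
  have "x ^ Suc n - y ^ Suc n = x * (x ^ n - y ^ n) + y ^ n * (x - y)" by (simp add: algebra_simps)
  also have "\<dots> \<in> R" using Suc assms by (intro Rc(4) Rc(5)) (auto intro: algebraic_int_power)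
  finally show ?case .
qed (use Rc(3) in simp)

lemma frobenius_power_add:
  assumes "algebraic_int x" "algebraic_int y"
  shows "(x + y) ^ (l ^ k) - (x ^ (l ^ k) + y ^ (l ^ k)) \<in> R"
proof (induction k)
  case (Suc k)
  have "((x + y) ^ (l ^ k)) ^ l - (x ^ (l ^ k) + y ^ (l ^ k)) ^ l \<in> R"
    using Suc assms by (intro power_cong algebraic_int_power algebraic_int_add)
  moreover have "(x ^ (l ^ k) + y ^ (l ^ k)) ^ l - ((x ^ (l ^ k)) ^ l + (y ^ (l ^ k)) ^ l) \<in> R"
    using assms by (intro frobenius_add algebraic_int_power)
  ultimately have "(((x + y) ^ (l ^ k)) ^ l - (x ^ (l ^ k) + y ^ (l ^ k)) ^ l) +
     ((x ^ (l ^ k) + y ^ (l ^ k)) ^ l - ((x ^ (l ^ k)) ^ l + (y ^ (l ^ k)) ^ l)) \<in> R" by (rule Rc(4))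
  hence "((x + y) ^ (l ^ k)) ^ l - ((x ^ (l ^ k)) ^ l + (y ^ (l ^ k)) ^ l) \<in> R"
    by (simp only: diff_add_cancel add_diff_eq)
  thus ?case by (simp only: power_Suc mult.commute[of l] power_mult)
qed (use Rc(3) in simp)

lemma fermat_int: "of_int n ^ l - of_int n \<in> R"
proof -
  have nat: "of_nat n ^ l - of_nat n \<in> R" for n
  proof (induction n)
    case 0
    thus ?case using Rc(3) prime_gt_0_nat[OF l(1)] by (simp add: zero_power)
  next
    case (Suc n)
    have "((of_nat n + 1) ^ l - (of_nat n ^ l + 1 ^ l)) + (of_nat n ^ l - of_nat n) \<in> R"
      by (intro Rc(4) Suc frobenius_add) auto
    thus ?case by (simp add: algebra_simps)
  qed
  define m where "m = nat (n mod int l)"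
  have "of_int (n - int m) \<in> R"
  proof -
    have "n - int m = int l * (n div int l)"
      using prime_gt_0_nat[OF l(1)] by (simp add: m_def minus_mod_eq_mult_div)
    hence "of_int (n - int m) = of_int (n div int l) * (of_nat l :: qbar)" by simp
    also have "\<dots> \<in> R" by (intro Rc(5)[OF l(2)]) auto
    finally show ?thesis .
  qed
  hence m: "of_int n - of_nat m \<in> R" by simp
  from power_cong[OF _ _ m, of l] have "of_int n ^ l - of_nat m ^ l \<in> R" by simp
  from Rc(4)[OF this nat[of m]] have "of_int n ^ l - of_nat m \<in> R" by simp
  from ideal_diff[OF subfield_UNIV R this m] show ?thesis by simp
qed

end

section \<open>Real quadratic fields\<close>

lemma subfield_gen_field: "subfield (gen_field A) (ring_of_type_algebra :: 'a::field ring)"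
  and gen_field_incl: "A \<subseteq> gen_field A"
  and gen_field_minimal: "subfield E ring_of_type_algebra \<Longrightarrow> A \<subseteq> E \<Longrightarrow> gen_field A \<subseteq> (E :: 'a set)"
proof -
  interpret R: field "ring_of_type_algebra :: 'a ring" by (rule field_from_type_algebra)
  show "subfield (gen_field A) (ring_of_type_algebra :: 'a::field ring)"
    by (rule R.generate_field_is_subfield) simp
  show "A \<subseteq> gen_field A" by (auto intro: generate_field.incl)
  show "subfield E ring_of_type_algebra \<Longrightarrow> A \<subseteq> E \<Longrightarrow> gen_field A \<subseteq> E"
    by (rule R.generate_field_min_subfield1) auto
qed

lemma quad_char_zero_iff:
  fixes w :: qbar
  assumes "w ^ 2 = of_int x" "\<sigma> \<in> GQ"
  shows "quad_char x \<sigma> = 0 \<longleftrightarrow> \<sigma> w = w"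
proof -
  have "z = w \<or> z = - w" if "z ^ 2 = of_int x" for z :: qbar
  proof -
    have "z ^ 2 = w ^ 2" using that assms(1) by simp
    thus ?thesis by (simp only: power2_eq_iff)
  qed
  hence "(\<forall>z. z\<^sup>2 = of_int x \<longrightarrow> \<sigma> z = z) \<longleftrightarrow> \<sigma> w = w"
    using assms(1) gal_minus[OF assms(2), of w] by metis
  thus ?thesis by (simp add: quad_char_def)
qed

lemma quad_char_mult:
  assumes "\<sigma> \<in> GQ" "\<tau> \<in> GQ"
  shows "quad_char x (\<lambda>z. \<sigma> (\<tau> z)) = quad_char x \<sigma> + quad_char x \<tau>"
proof -
  obtain w :: qbar where w: "w ^ 2 = of_int x" by (rule qbar_sqrt)
  have "\<rho> w = w \<or> \<rho> w = - w" if "\<rho> \<in> GQ" for \<rho>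
  proof -
    have "\<rho> w ^ 2 = w ^ 2" using gal_power[OF that, of w 2] gal_fixes[OF that, of "of_int x"] w by simp
    thus ?thesis by (simp only: power2_eq_iff)
  qed
  hence "\<sigma> w = w \<or> \<sigma> w = - w" "\<tau> w = w \<or> \<tau> w = - w" using assms by auto
  moreover have "quad_char x (\<lambda>z. \<sigma> (\<tau> z)) = 0 \<longleftrightarrow> \<sigma> (\<tau> w) = w"
    using quad_char_zero_iff[OF w gal_UNIV_comp[OF assms]] .
  ultimately show ?thesis
    using quad_char_zero_iff[OF w assms(1)] quad_char_zero_iff[OF w assms(2)] gal_minus[OF assms(1), of w]
    by (cases "quad_char x \<sigma>"; cases "quad_char x \<tau>"; cases "quad_char x (\<lambda>z. \<sigma> (\<tau> z))") auto
qed

text \<open>The root \<open>w\<close> is fixed so that elements of the field can be written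
  \<open>r + t * w\<close>. All quadratic fields that occur, those of the points of the cube and
  that of \<open>a\<close>, have radicands greater than 1.\<close>

locale real_quadratic =
  fixes x :: nat and w :: qbar
  assumes squarefree: "squarefree x" and gt_1: "x > 1" and sq: "w ^ 2 = of_nat x"
begin

definition "K = quad_field (int x)"

lemma w_int: "algebraic_int w"
  using algebraic_int_sqrt_iff[of w] by (simp add: sq)

lemma w_irrational: "w \<notin> \<rat>"
proof
  assume "w \<in> \<rat>"
  then obtain n where "w = of_int n" using w_int rational_algebraic_int_is_int by (auto elim: Ints_cases)
  hence "of_int (n ^ 2) = (of_int (int x) :: qbar)" using sq by simp
  hence "int x = n ^ 2" by (simp only: of_int_eq_iff)
  hence "x = nat \<bar>n\<bar> ^ 2" by (metis abs_of_nat nat_int nat_power_eq power2_abs abs_ge_zero)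
  hence "nat \<bar>n\<bar> dvd 1" using squarefreeD[OF squarefree, of "nat \<bar>n\<bar>"] by simp
  thus False using gt_1 \<open>x = nat \<bar>n\<bar> ^ 2\<close> by simp
qed

lemma K_subfield: "subfield K ring_of_type_algebra"
  unfolding K_def quad_field_def by (rule subfield_gen_field)

lemma w_in_K: "w \<in> K"
  unfolding K_def quad_field_def using sq by (intro subsetD[OF gen_field_incl]) simp

lemma K_eq: "K = {of_rat r + of_rat t * w |r t. True}" (is "_ = ?S")
proof
  have rt: "r = 0 \<and> t = 0" if "of_rat r + of_rat t * w = 0" for r t
  proof -
    have "t = 0"
    proof (rule ccontr)
      assume "t \<noteq> 0"
      hence "w = - of_rat r / of_rat t" using that by (simp add: field_simps add_eq_0_iff)
      thus False using w_irrational by simp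
    qed
    thus ?thesis using that by simp
  qed
  have "subfield ?S ring_of_type_algebra"
    unfolding subfield_iff
  proof (intro conjI ballI)
    show "0 \<in> ?S" by (auto intro!: exI[of _ 0])
    show "1 \<in> ?S" by (intro CollectI exI[of _ 1] exI[of _ 0]) simp
    fix z assume "z \<in> ?S"
    then obtain r t where z: "z = of_rat r + of_rat t * w" by auto
    show "- z \<in> ?S" unfolding z by (intro CollectI exI[of _ "- r"] exI[of _ "- t"]) (simp add: of_rat_minus)
    define N where "N = r ^ 2 - t ^ 2 * of_nat x"
    have zz: "z * (of_rat r - of_rat t * w) = of_rat N"
      using sq by (simp add: z N_def of_rat_diff of_rat_mult of_rat_power algebra_simps power2_eq_square)
    show "inverse z \<in> ?S"
    proof (cases "z = 0")
      case False
      hence "of_rat r + of_rat (- t) * w \<noteq> 0" using rt[of r "- t"] z by (auto simp: of_rat_minus)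
      hence "of_rat N \<noteq> (0::qbar)" using zz False by (auto simp: of_rat_minus)
      hence "z * ((of_rat r - of_rat t * w) / of_rat N) = 1" using zz by simp
      hence "inverse z = (of_rat r - of_rat t * w) / of_rat N" by (rule inverse_unique)
      also have "\<dots> = of_rat (r / N) + of_rat (- t / N) * w"
        by (simp add: of_rat_divide of_rat_minus diff_divide_distrib)
      finally show ?thesis by blast
    qed (auto intro!: exI[of _ 0])
    fix z' assume "z' \<in> ?S"
    then obtain r' t' where z': "z' = of_rat r' + of_rat t' * w" by auto
    show "z + z' \<in> ?S" unfolding z z'
      by (intro CollectI exI[of _ "r + r'"] exI[of _ "t + t'"]) (simp add: of_rat_add algebra_simps)
    have "z * z' = of_rat (r * r' + t * t' * of_nat x) + of_rat (r * t' + t * r') * w"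
      using sq by (simp add: z z' of_rat_add of_rat_mult algebra_simps power2_eq_square)
    thus "z * z' \<in> ?S" by blast
  qed
  moreover have "{z. z\<^sup>2 = of_int (int x)} \<subseteq> ?S"
  proof
    fix z :: qbar assume "z \<in> {z. z\<^sup>2 = of_int (int x)}"
    hence "z ^ 2 = w ^ 2" by (simp add: sq)
    hence "z = w \<or> z = - w" by (simp only: power2_eq_iff)
    hence "z = of_rat 0 + of_rat 1 * w \<or> z = of_rat 0 + of_rat (- 1) * w" by (auto simp: of_rat_minus)
    thus "z \<in> ?S" by blast
  qed
  ultimately show "K \<subseteq> ?S" unfolding K_def quad_field_def by (rule gen_field_minimal)
  show "?S \<subseteq> K" using w_in_K K_subfield Rats_subset_subfield[OF K_subfield]
    by (auto intro!: subfield_add subfield_mult)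
qed

lemma gal_K_iff: "\<sigma> \<in> gal UNIV K \<longleftrightarrow> \<sigma> \<in> GQ \<and> \<sigma> w = w"
proof
  assume "\<sigma> \<in> gal UNIV K"
  thus "\<sigma> \<in> GQ \<and> \<sigma> w = w" using gal_UNIV_subset_GQ[OF K_subfield] w_in_K gal_fixes by blast
next
  assume *: "\<sigma> \<in> GQ \<and> \<sigma> w = w"
  hence "\<sigma> z = z" if "z \<in> K" for z
    using that unfolding K_eq by (auto simp: gal_add[of \<sigma> \<rat>] gal_mult[of \<sigma> \<rat>] gal_fixes[of \<sigma> \<rat>])
  thus "\<sigma> \<in> gal UNIV K" using * by (auto simp: gal_UNIV_iff)
qed

lemma quad_char_iff: "\<sigma> \<in> GQ \<Longrightarrow> quad_char (int x) \<sigma> = 0 \<longleftrightarrow> \<sigma> \<in> gal UNIV K"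
  using quad_char_zero_iff[of w "int x" \<sigma>] by (simp add: sq gal_K_iff)

lemma gal_w: "\<sigma> \<in> GQ \<Longrightarrow> \<sigma> w = w \<or> \<sigma> w = - w"
proof -
  assume "\<sigma> \<in> GQ"
  hence "\<sigma> w ^ 2 = w ^ 2" using gal_power[of \<sigma> \<rat> w 2] gal_fixes[of \<sigma> \<rat> "of_nat x"] by (simp add: sq)
  thus ?thesis by (simp only: power2_eq_iff)
qed

lemma conjugation: obtains c where "c \<in> GQ" "c w = - w"
  using gal_UNIV_moves[OF subfield_Rats w_irrational] gal_w by blast

lemma squarefree_mod_4: "x mod 4 \<noteq> 0"
proof
  assume "x mod 4 = 0"
  hence "2 ^ 2 dvd x" by (simp add: dvd_eq_mod_eq_0)
  from squarefreeD[OF squarefree this] show False by simp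
qed

definition "\<omega> = (if x mod 4 = 1 then (1 + w) / 2 else w)"

lemma two_\<omega>: "x mod 4 = 1 \<Longrightarrow> 2 * \<omega> = 1 + w" and \<omega>_eq: "x mod 4 \<noteq> 1 \<Longrightarrow> \<omega> = w"
  by (simp_all add: \<omega>_def)

lemma \<omega>_int: "algebraic_int \<omega>"
proof (cases "x mod 4 = 1")
  case True
  then obtain k where k: "x = 4 * k + 1" by (metis mult_div_mod_eq)
  have "(2 * \<omega>) ^ 2 = (1 + w) ^ 2" by (simp only: two_\<omega>[OF True])
  also have "\<dots> = 2 * (1 + w) + 4 * of_nat k" using sq by (simp add: k power2_eq_square algebra_simps)
  also have "\<dots> = 2 * (2 * \<omega>) + 4 * of_nat k" by (simp only: two_\<omega>[OF True])
  finally have "4 * (\<omega> ^ 2 - \<omega> - of_nat k) = 0" by (simp add: power2_eq_square algebra_simps)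
  from this[unfolded mult_eq_0_iff] have "\<omega> ^ 2 - \<omega> - of_nat k = 0" by simp
  hence "poly [:- of_nat k, -1, 1:] \<omega> = 0" by (simp add: power2_eq_square algebra_simps)
  thus ?thesis by (intro algebraic_int.intros[of "[:- of_nat k, -1, 1:]"]) (auto simp: coeff_pCons split: nat.splits)
qed (simp add: \<omega>_eq w_int)

lemma \<omega>_in_K: "\<omega> \<in> K"
  unfolding \<omega>_def using w_in_K K_subfield subfield_of_nat[OF K_subfield, of 2]
  by (auto intro!: subfield_divide subfield_add subfield_one)

text \<open>Trace and norm of \<open>r + t * w\<close> are rational and integral. So
  \<open>2 * r\<close> and, since the radicand is squarefree, also \<open>2 * t\<close> are
  integers; which parities occur is decided by squares modulo 4.\<close>

lemma ring_ints_K: "z \<in> carrier (ring_ints K) \<longleftrightarrow> (\<exists>m n. z = of_int m + of_int n * \<omega>)"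
proof
  assume "\<exists>m n. z = of_int m + of_int n * \<omega>"
  thus "z \<in> carrier (ring_ints K)" using \<omega>_int \<omega>_in_K K_subfield
    by (auto intro!: algebraic_int_add algebraic_int_mult subfield_add subfield_mult subfield_of_int)
next
  assume z: "z \<in> carrier (ring_ints K)"
  then obtain r t where rt: "z = of_rat r + of_rat t * w" unfolding ring_ints_simps K_eq by blast
  obtain c where c: "c \<in> GQ" "c w = - w" by (rule conjugation)
  have cz: "c z = of_rat r - of_rat t * w"
    by (simp add: rt gal_add[OF c(1)] gal_mult[OF c(1)] gal_fixes[OF c(1)] c(2))
  have int_rat: "q \<in> \<int>" if "algebraic_int (of_rat q :: qbar)" for q
  proof -
    have "(of_rat q :: qbar) \<in> \<int>" by (rule rational_algebraic_int_is_int[OF that]) simp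
    then obtain n where "(of_rat q :: qbar) = of_rat (of_int n)" by (auto elim: Ints_cases)
    thus ?thesis by (simp only: of_rat_eq_iff) simp
  qed
  have "z + c z = of_rat (2 * r)" "z * c z = of_rat (r ^ 2 - t ^ 2 * of_nat x)"
    using sq unfolding cz by (simp_all add: rt of_rat_diff of_rat_mult of_rat_power algebra_simps power2_eq_square)
  moreover have "algebraic_int (z + c z)" "algebraic_int (z * c z)"
    using z GQ_algebraic_int[OF c(1)] by (auto intro: algebraic_int_add algebraic_int_mult)
  ultimately have "2 * r \<in> \<int>" "r ^ 2 - t ^ 2 * of_nat x \<in> \<int>" using int_rat by auto
  then obtain A N where A: "2 * r = of_int A" and N: "r ^ 2 - t ^ 2 * of_nat x = of_int N" by (auto elim!: Ints_cases)
  have "(2 * t) ^ 2 * of_nat x = (2 * r) ^ 2 - 4 * (r ^ 2 - t ^ 2 * of_nat x)" by (simp add: power2_eq_square algebra_simps)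
  also have "\<dots> = of_int (A ^ 2 - 4 * N)" unfolding A N by simp
  finally have tx: "(2 * t) ^ 2 * of_nat x = of_int (A ^ 2 - 4 * N)" .
  \<comment> \<open>The square of a denominator \<open>v\<close> would divide the squarefree
    radicand.\<close>
  have "2 * t \<in> \<int>"
  proof -
    obtain u v where uv: "2 * t = of_int u / of_int v" "v > 0" "coprime u v"
      by (cases "2 * t") (auto simp: Fract_of_int_quotient)
    have "of_int (u ^ 2 * int x) = (2 * t) ^ 2 * of_nat x * of_int (v ^ 2)" using uv by (simp add: power2_eq_square)
    also have "\<dots> = of_int ((A ^ 2 - 4 * N) * v ^ 2)" unfolding tx by simp
    finally have "u ^ 2 * int x = (A ^ 2 - 4 * N) * v ^ 2" by (simp only: of_int_eq_iff)
    hence "v ^ 2 dvd u ^ 2 * int x" by simp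
    hence "v ^ 2 dvd int x" using uv(3) by (subst (asm) coprime_dvd_mult_right_iff) (auto simp: coprime_commute)
    hence "nat v ^ 2 dvd x" using uv(2) by (metis int_nat_eq less_imp_le of_nat_dvd_iff of_nat_power)
    hence "nat v dvd 1" using squarefree squarefreeD by blast
    hence "v = 1" using uv(2) by simp
    thus ?thesis using uv(1) by simp
  qed
  then obtain B where B: "2 * t = of_int B" by (auto elim: Ints_cases)
  have "of_int (B ^ 2 * int x) = (of_int (A ^ 2 - 4 * N) :: rat)" using tx unfolding B by simp
  hence eq: "A ^ 2 = B ^ 2 * int x + 4 * N" by (simp only: of_int_eq_iff)
  have rtz: "2 * z = of_int A + of_int B * w"
  proof -
    have "2 * z = of_rat (2 * r) + of_rat (2 * t) * w" unfolding rt by (simp add: of_rat_mult algebra_simps)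
    thus ?thesis unfolding A B by simp
  qed
  have mod4: "(A * A) mod 4 = (if even A then 0 else 1)" for A :: int
  proof -
    show ?thesis
    proof (cases "even A")
      case True
      then obtain k where "A = 2 * k" by (rule evenE)
      hence "A * A = 4 * (k * k)" by simp
      thus ?thesis using True by simp
    next
      case False
      then obtain k where "A = 2 * k + 1" by (rule oddE)
      hence "A * A = 1 + 4 * (k * k + k)" by (simp add: algebra_simps)
      thus ?thesis using False by (simp only: mod_mult_self2) simp
    qed
  qed
  show "\<exists>m n. z = of_int m + of_int n * \<omega>"
  proof (cases "x mod 4 = 1")
    case True
    hence "int x mod 4 = 1" by (metis of_nat_1 of_nat_numeral zmod_int)
    hence "odd (int x)" by presburger
    moreover have "even (A ^ 2) \<longleftrightarrow> even (B ^ 2 * int x + 4 * N)" by (simp only: eq)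
    ultimately have "even (A - B)" by simp
    then obtain m where "A - B = 2 * m" by (rule evenE)
    hence m: "A = B + 2 * m" by simp
    have "2 * z = 2 * (of_int m + of_int B * \<omega>)"
      unfolding rtz m distrib_left mult.left_commute[of 2 "of_int B"] two_\<omega>[OF True] by (simp add: algebra_simps)
    from this[unfolded mult_cancel_left] show ?thesis by auto
  next
    case False
    hence x23: "int x mod 4 = 2 \<or> int x mod 4 = 3" using squarefree_mod_4 by presburger
    have "A * A mod 4 = (B * B mod 4) * (int x mod 4) mod 4"
      using eq by (simp add: power2_eq_square mod_mult_eq)
    hence "even A \<and> even B" using x23 unfolding mod4 by (auto split: if_splits)
    then obtain m n where "A = 2 * m" "B = 2 * n" by (auto elim!: evenE)
    hence "2 * z = 2 * (of_int m + of_int n * \<omega>)" using rtz \<omega>_eq[OF False] by (simp add: algebra_simps)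
    from this[unfolded mult_cancel_left] show ?thesis by auto
  qed
qed

end

lemma primeideal_restrict:
  assumes K: "subfield K ring_of_type_algebra" and R: "primeideal R (ring_ints (UNIV :: qbar set))"
  shows "primeideal (R \<inter> K) (ring_ints K)"
proof -
  note Rc = R_closed[OF R]
  show ?thesis
    unfolding primeideal_ring_ints_iff[OF K] ideal_ring_ints_iff[OF K]
    using Rc(2-5) R_one[OF R] R_prime[OF R] subfield_closed[OF K] by auto
qed

lemma squarefree_int: "squarefree b \<Longrightarrow> squarefree (int b)"
proof (rule squarefreeI)
  fix y assume b: "squarefree b" and "y ^ 2 dvd int b"
  moreover have "int ((nat \<bar>y\<bar>) ^ 2) = y ^ 2" by simp
  ultimately have "int ((nat \<bar>y\<bar>) ^ 2) dvd int b" by simp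
  hence "nat \<bar>y\<bar> dvd 1" using squarefreeD[OF b] by (simp only: of_nat_dvd_iff)
  thus "y dvd 1" by (simp add: nat_eq_iff)
qed

lemma squarefree_mult_imp_coprime: "squarefree (a * b) \<Longrightarrow> coprime a b" for a b :: nat
  by (rule coprimeI) (metis mult_dvd_mono power2_eq_square squarefreeD)

lemma int_multiple_in_ideal:
  assumes "subfield K ring_of_type_algebra" "ideal I (ring_ints K)" "of_nat b \<in> I" "int b dvd n"
  shows "of_int n \<in> I"
proof -
  obtain k where "n = int b * k" using assms(4) by (rule dvdE)
  hence "of_int n = of_int k * (of_nat b :: qbar)" by simp
  thus ?thesis using ideal_mult[OF assms(1-3), of "of_int k"] assms(1) by (simp add: subfield_of_int)
qed

lemma prime_int_mult_1:
  assumes "prime l" "\<not> int l dvd n"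
  obtains k j where "k * n + j * int l = 1"
proof -
  have "coprime (int l) n" using assms by (intro prime_imp_coprime) auto
  hence "coprime n (int l)" by (simp add: coprime_commute)
  thus ?thesis using bezout_int[of n "int l"] that by auto
qed

section \<open>Products of ramified primes of a quadratic field\<close>

context real_quadratic
begin

text \<open>Equivalently, \<open>z\<close> divided by a square root of \<open>b\<close> is integral;
  squaring avoids the choice of that root. For \<open>b\<close> dividing \<open>x\<close> this is
  the product of the ramified primes above the prime factors of \<open>b\<close>.\<close>

definition "ram b = {z \<in> K. algebraic_int z \<and> algebraic_int (z ^ 2 / of_nat b)}"

lemma ram_sqrt:
  assumes "\<beta> ^ 2 = (of_nat b :: qbar)"
  shows "z \<in> ram b \<longleftrightarrow> z \<in> K \<and> algebraic_int z \<and> algebraic_int (z / \<beta>)"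
  using algebraic_int_sqrt_iff[of "z / \<beta>"] assms by (simp add: ram_def power_divide)

lemma ram_ideal: "ideal (ram b) (ring_ints K)"
proof -
  obtain \<beta> :: qbar where \<beta>: "\<beta> ^ 2 = of_nat b" by (rule qbar_sqrt)
  have "algebraic_int (z * u / \<beta>)" if "algebraic_int z" "algebraic_int (u / \<beta>)" for z u
    using algebraic_int_mult[OF that] by simp
  thus ?thesis
    unfolding ideal_ring_ints_iff[OF K_subfield]
    using subfield_closed[OF K_subfield]
    by (auto simp: ram_sqrt[OF \<beta>] add_divide_distrib intro: algebraic_int_add algebraic_int_mult)
qed

lemmas ram_closed = ideal_closed[OF K_subfield ram_ideal] ideal_diff[OF K_subfield ram_ideal]

lemma of_nat_in_ram: "b > 0 \<Longrightarrow> of_nat b \<in> ram b"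
  using K_subfield by (auto simp: ram_def power2_eq_square subfield_of_nat)

lemma of_int_in_ram_iff:
  assumes "squarefree b" "b > 0"
  shows "of_int n \<in> ram b \<longleftrightarrow> int b dvd n"
proof
  assume "of_int n \<in> ram b"
  hence "algebraic_int (of_int n ^ 2 / of_nat b :: qbar)" by (simp add: ram_def)
  hence "of_int n ^ 2 / of_nat b \<in> (\<int> :: qbar set)" by (rule rational_algebraic_int_is_int) simp
  then obtain k where "of_int n ^ 2 / of_nat b = (of_int k :: qbar)" by (rule Ints_cases)
  hence "of_int (n ^ 2) = (of_int (int b * k) :: qbar)" using assms by (simp add: field_simps)
  hence "n ^ 2 = int b * k" by (simp only: of_int_eq_iff)
  hence "int b dvd n ^ 2" by simp
  thus "int b dvd n" by (rule dvd_square_squarefree[OF squarefree_int[OF assms(1)]])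
qed (rule int_multiple_in_ideal[OF K_subfield ram_ideal of_nat_in_ram[OF assms(2)]])

context
  fixes b assumes b: "b dvd x"
begin

lemma b_pos: "b > 0" using b gt_1 by (auto intro: Nat.gr0I)

lemma b_squarefree: "squarefree b" using b squarefree squarefree_mono by blast

lemma w_in_ram: "w \<in> ram b"
proof -
  obtain y where "x = b * y" using b by (rule dvdE)
  hence "w ^ 2 / of_nat b = of_nat y" using b_pos by (simp add: sq)
  thus ?thesis by (simp add: ram_def w_in_K w_int)
qed

text \<open>It suffices to treat \<open>\<omega>\<close>. The consequence is that the quotient by
  \<open>ram b\<close> consists of classes of integers; for a prime \<open>b\<close> the residue
  field has \<open>b\<close> elements.\<close>

lemma ram_residue:
  assumes "z \<in> carrier (ring_ints K)"
  shows "\<exists>n. z - of_int n \<in> ram b"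
proof -
  obtain m n where z: "z = of_int m + of_int n * \<omega>" using assms ring_ints_K by blast
  have "\<exists>h. \<omega> - of_int h \<in> ram b"
  proof (cases "x mod 4 = 1")
    case False
    thus ?thesis using w_in_ram by (intro exI[of _ 0]) (simp add: \<omega>_eq)
  next
    case True
    have "odd x" using True by presburger
    hence "odd b" using b by (meson dvd_trans)
    then obtain k where k: "b = 2 * k + 1" by (rule oddE)
    \<comment> \<open>\<open>b\<close> divides the odd number \<open>x\<close>, so
      \<open>k + 1\<close> is an inverse of 2 modulo \<open>b\<close>. Multiplying
      \<open>2 * (\<omega> - h) = w - b\<close> by it shows that \<open>\<omega>\<close> is
      congruent to \<open>h\<close>.\<close>
    define h :: qbar where "h = of_nat (k + 1)"
    have 2: "2 * (\<omega> - h) = w - of_nat b"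
      unfolding right_diff_distrib two_\<omega>[OF True] by (simp add: h_def k)
    have "\<omega> - h = h * (2 * (\<omega> - h)) - (\<omega> - h) * of_nat b"
      by (simp add: h_def k algebra_simps)
    also have "\<dots> = h * (w - of_nat b) - (\<omega> - h) * of_nat b" unfolding 2 ..
    also have "\<dots> \<in> ram b"
      using w_in_ram of_nat_in_ram[OF b_pos] \<omega>_int \<omega>_in_K K_subfield unfolding h_def
      by (intro ram_closed(7) ram_closed(5)) (auto intro!: subfield_of_nat subfield_diff algebraic_int_diff simp del: of_nat_add of_nat_Suc)
    finally show ?thesis unfolding h_def by (intro exI[of _ "int (k + 1)"]) simp
  qed
  then obtain h where h: "\<omega> - of_int h \<in> ram b" by blast
  have "z - of_int (m + n * h) = of_int n * (\<omega> - of_int h)" by (simp add: z algebra_simps)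
  also have "\<dots> \<in> ram b" by (intro ram_closed(5)[OF h] subfield_of_int K_subfield) simp
  finally show ?thesis by blast
qed

lemma abs_norm_ram: "abs_norm K (ram b) = b"
  using b_pos of_int_in_ram_iff[OF b_squarefree b_pos] ram_residue
  by (intro abs_norm_integers[OF K_subfield ram_ideal])

text \<open>\<open>I\<close> has a basis \<open>c\<close>, \<open>d * \<omega> + m0\<close> over the
  integers with \<open>d\<close> dividing \<open>c\<close>, so its norm is \<open>c * d\<close>. As
  \<open>b\<close> is squarefree, \<open>d = 1\<close> and \<open>c = b\<close>. If then
  \<open>z\<close> in \<open>ram b\<close> is congruent to \<open>n\<close> modulo \<open>I\<close>,
  the square of \<open>z\<close> is a multiple of \<open>b\<close>, so \<open>b\<close> divides
  \<open>n ^ 2\<close> and hence \<open>n\<close>.\<close>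

lemma ideal_of_norm_eq_ram:
  assumes I: "ideal I (ring_ints K)" and norm: "abs_norm K I = b"
  shows "I = ram b"
proof -
  note Ic = ideal_closed[OF K_subfield I] ideal_diff[OF K_subfield I]
  obtain m :: nat where m: "of_nat m \<in> I" "m > 0"
    by (rule finite_quotient_integer[OF K_subfield I]) (use norm b_pos in auto)
  obtain c :: nat where c: "c > 0" "\<And>n::int. of_int n \<in> I \<longleftrightarrow> int c dvd n"
    by (rule integers_in_ideal[OF K_subfield I m]) blast
  have cI: "of_nat c \<in> I" using c(2)[of "int c"] by simp
  define D where "D = {d::nat. d > 0 \<and> (\<exists>m. of_nat d * \<omega> + of_int m \<in> I)}"
  have "c \<in> D"
    using c(1) Ic(5)[OF cI \<omega>_in_K \<omega>_int] unfolding D_def by (auto simp: mult.commute intro!: exI[of _ 0])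
  define d where "d = (LEAST d. d \<in> D)"
  have dD: "d \<in> D" unfolding d_def using \<open>c \<in> D\<close> by (rule LeastI)
  then obtain m0 where d: "d > 0" "of_nat d * \<omega> + of_int m0 \<in> I" by (auto simp: D_def)
  have least: "n = 0" if "of_int n * \<omega> + of_int m \<in> I" "\<bar>n\<bar> < int d" for n m
  proof (rule ccontr)
    assume "n \<noteq> 0"
    have "of_int \<bar>n\<bar> * \<omega> + of_int (sgn n * m) \<in> I"
    proof (cases "n > 0")
      case True
      thus ?thesis using that(1) by simp
    next
      case False
      hence "of_int \<bar>n\<bar> * \<omega> + of_int (sgn n * m) = - (of_int n * \<omega> + of_int m)" using \<open>n \<noteq> 0\<close> by simp
      thus ?thesis using ideal_uminus[OF K_subfield I that(1)] by simp
    qed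
    moreover have "of_int \<bar>n\<bar> = (of_nat (nat \<bar>n\<bar>) :: qbar)" by simp
    ultimately have "of_nat (nat \<bar>n\<bar>) * \<omega> + of_int (sgn n * m) \<in> I" by (simp only:)
    hence "nat \<bar>n\<bar> \<in> D" using \<open>n \<noteq> 0\<close> unfolding D_def by (intro CollectI conjI exI) simp
    hence "d \<le> nat \<bar>n\<bar>" unfolding d_def by (rule Least_le)
    thus False using that(2) by linarith
  qed
  have intK: "of_int i \<in> K" for i by (rule subfield_of_int[OF K_subfield])
  have red: "of_int (n mod int d) * \<omega> + of_int (m - n div int d * m0) \<in> I \<longleftrightarrow> of_int n * \<omega> + of_int m \<in> I" for n m
  proof -
    have q: "of_int (n div int d) * (of_nat d * \<omega> + of_int m0) \<in> I" using Ic(5)[OF d(2)] intK by auto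
    have n: "of_int n = of_int (n div int d) * of_nat d + (of_int (n mod int d) :: qbar)"
    proof -
      have "of_int n = (of_int (n div int d * int d + n mod int d) :: qbar)" by simp
      thus ?thesis by (simp only: of_int_add of_int_mult of_int_of_nat_eq)
    qed
    have eq: "of_int n * \<omega> + of_int m = (of_int (n mod int d) * \<omega> + of_int (m - n div int d * m0)) +
        of_int (n div int d) * (of_nat d * \<omega> + of_int m0)"
      unfolding n by (simp add: algebra_simps)
    show ?thesis unfolding eq using Ic(4)[OF _ q] Ic(7)[OF _ q] by fastforce
  qed
  have "d dvd c"
  proof -
    have "of_int (int c) * \<omega> + of_int 0 \<in> I" using Ic(5)[OF cI \<omega>_in_K \<omega>_int] by (simp add: mult.commute)
    hence "of_int (int c mod int d) * \<omega> + of_int (0 - int c div int d * m0) \<in> I" by (simp only: red)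
    hence "int c mod int d = 0" by (rule least) (use d in auto)
    thus ?thesis by (metis dvd_eq_mod_eq_0 int_dvd_int_iff)
  qed
  define T where "T = (\<lambda>(m, n). of_int m + of_int n * \<omega>) ` ({0..<int c} \<times> {0..<int d})"
  have uniq: "m = m' \<and> n = n'"
    if "m \<in> {0..<int c}" "m' \<in> {0..<int c}" "n \<in> {0..<int d}" "n' \<in> {0..<int d}"
      "(of_int m + of_int n * \<omega>) - (of_int m' + of_int n' * \<omega>) \<in> I" for m m' n n'
  proof -
    have *: "of_int (n - n') * \<omega> + of_int (m - m') \<in> I" using that(5) by (simp add: algebra_simps)
    hence n: "n - n' = 0" by (rule least) (use that in auto)
    hence "of_int (m - m') \<in> I" using * by simp
    hence "int c dvd m - m'" using c(2) by blast
    hence "m mod int c = m' mod int c" by (simp add: mod_eq_dvd_iff)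
    thus ?thesis using that n by simp
  qed
  have "abs_norm K I = card T"
  proof (rule abs_norm_eq_card[OF K_subfield I])
    show "T \<subseteq> carrier (ring_ints K)"
    proof
      fix t assume "t \<in> T"
      then obtain m n where "t = of_int m + of_int n * \<omega>" by (auto simp: T_def)
      thus "t \<in> carrier (ring_ints K)" unfolding ring_ints_K by blast
    qed
    show "t = u" if tu: "t \<in> T" "u \<in> T" "t - u \<in> I" for t u
    proof -
      obtain m n m' n' where "m \<in> {0..<int c}" "m' \<in> {0..<int c}" "n \<in> {0..<int d}" "n' \<in> {0..<int d}"
        and *: "t = of_int m + of_int n * \<omega>" "u = of_int m' + of_int n' * \<omega>"
        using tu(1,2) by (auto simp: T_def)
      hence "m = m' \<and> n = n'" using tu(3) uniq by blast
      thus ?thesis using * by simp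
    qed
    fix z assume "z \<in> carrier (ring_ints K)"
    then obtain m n where z: "z = of_int m + of_int n * \<omega>" using ring_ints_K by blast
    define m' where "m' = m - n div int d * m0"
    define t where "t = of_int (m' mod int c) + of_int (n mod int d) * \<omega>"
    have "of_int (n mod int d mod int d) * \<omega> + of_int (- (m' mod int c) + m' - 0) - of_int (n mod int d) * \<omega> \<in> I"
      using c(2)[of "m' - m' mod int c"] by simp
    hence "of_int (n mod int d) * \<omega> + of_int m' - t \<in> I" unfolding t_def by (simp add: algebra_simps)
    moreover have "z - (of_int (n mod int d) * \<omega> + of_int m') \<in> I"
    proof -
      have n: "of_int n = of_int (n div int d) * of_nat d + (of_int (n mod int d) :: qbar)"
      proof -
        have "of_int n = (of_int (n div int d * int d + n mod int d) :: qbar)" by simp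
        thus ?thesis by (simp only: of_int_add of_int_mult of_int_of_nat_eq)
      qed
      have "z - (of_int (n mod int d) * \<omega> + of_int m') = of_int (n div int d) * (of_nat d * \<omega> + of_int m0)"
        unfolding z n m'_def by (simp add: algebra_simps)
      thus ?thesis using Ic(5)[OF d(2)] intK by auto
    qed
    ultimately have "z - t \<in> I" using Ic(4) by fastforce
    moreover have "t \<in> T" unfolding T_def t_def using c d by auto
    ultimately show "\<exists>t\<in>T. z - t \<in> I" by blast
  qed
  also have "card T = c * d"
    unfolding T_def
  proof (subst card_image)
    show "inj_on (\<lambda>(m, n). of_int m + of_int n * \<omega>) ({0..<int c} \<times> {0..<int d})"
      using uniq Ic(3) by (auto simp: inj_on_def)
  qed simp
  finally have bcd: "b = c * d" using norm by simp
  hence "d ^ 2 dvd b" using \<open>d dvd c\<close> by (simp add: power2_eq_square mult_dvd_mono)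
  hence "d = 1" using squarefreeD[OF b_squarefree] by simp
  hence "c = b" using bcd by simp
  have resI: "\<exists>n. z - of_int n \<in> I" if zO: "z \<in> carrier (ring_ints K)" for z
  proof -
    obtain m n where z: "z = of_int m + of_int n * \<omega>" using zO ring_ints_K by blast
    have "z - of_int (m - n * m0) = of_int n * (of_nat d * \<omega> + of_int m0)"
      by (simp add: z \<open>d = 1\<close> algebra_simps)
    thus ?thesis using Ic(5)[OF d(2)] intK by (intro exI[of _ "m - n * m0"]) simp
  qed
  have bI: "of_int n \<in> I \<longleftrightarrow> of_int n \<in> ram b" for n
    using c(2) \<open>c = b\<close> of_int_in_ram_iff[OF b_squarefree b_pos] by simp
  have sub: "ram b \<subseteq> I"
  proof
    fix z assume z: "z \<in> ram b"
    hence zO: "z \<in> carrier (ring_ints K)" using ram_closed(1,2) by simp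
    then obtain n where n: "z - of_int n \<in> I" using resI by blast
    have "z ^ 2 / of_nat b \<in> carrier (ring_ints K)"
      using z by (auto simp: ram_def intro!: subfield_divide subfield_power subfield_of_nat K_subfield)
    hence "z ^ 2 \<in> I" using Ic(5)[OF cI, of "z ^ 2 / of_nat b"] b_pos by (simp add: \<open>c = b\<close>)
    moreover have "(z + of_int n) * (z - of_int n) \<in> I"
      using zO intK by (intro Ic(5)[OF n]) (auto intro!: subfield_add K_subfield algebraic_int_add)
    ultimately have "z ^ 2 - (z + of_int n) * (z - of_int n) \<in> I" by (rule Ic(7))
    hence "of_int (n ^ 2) \<in> I" by (simp add: power2_eq_square algebra_simps)
    hence "int b dvd n ^ 2" using c(2) \<open>c = b\<close> by blast
    hence "int b dvd n"
      by (rule dvd_square_squarefree[OF squarefree_int[OF b_squarefree]])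
    hence "of_int n \<in> I" using c(2) \<open>c = b\<close> by blast
    thus "z \<in> I" using Ic(4)[OF n] by fastforce
  qed
  show ?thesis
  proof
    show "I \<subseteq> ram b"
    proof
      fix z assume z: "z \<in> I"
      hence "z \<in> carrier (ring_ints K)" using Ic(1,2) by simp
      then obtain n where n: "z - of_int n \<in> ram b" using ram_residue by blast
      hence "z - (z - of_int n) \<in> I" using sub z Ic(7) by blast
      hence "of_int n \<in> ram b" using bI by simp
      thus "z \<in> ram b" using ram_closed(4)[OF n] by fastforce
    qed
  qed (rule sub)
qed

lemma Up_eq_ram: "Up K b = ram b"
  unfolding Up_def using abs_norm_ram ram_ideal ideal_of_norm_eq_ram by (intro the_equality) auto

text \<open>The product contains \<open>b * b\<close> and \<open>w * w = b * y\<close>, where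
  \<open>x = b * y\<close>. As \<open>x\<close> is squarefree, \<open>b\<close> and \<open>y\<close>
  are coprime, so the product contains \<open>b\<close>.\<close>

lemma ram_square: "ideal_prod (ring_ints K) (ram b) (ram b) = (\<lambda>z. of_nat b * z) ` carrier (ring_ints K)"
proof
  obtain \<beta> :: qbar where \<beta>: "\<beta> ^ 2 = of_nat b" by (rule qbar_sqrt)
  have "s / of_nat b \<in> carrier (ring_ints K)" if "s \<in> ideal_prod (ring_ints K) (ram b) (ram b)" for s
    using that
  proof (induction rule: ideal_prod.induct)
    case (prod i j)
    hence ij: "algebraic_int (i / \<beta>)" "algebraic_int (j / \<beta>)" "i \<in> K" "j \<in> K" by (simp_all add: ram_sqrt[OF \<beta>])
    have "algebraic_int (i / \<beta> * (j / \<beta>))" using ij by (intro algebraic_int_mult)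
    also have "i / \<beta> * (j / \<beta>) = i * j / of_nat b" unfolding \<beta>[symmetric] power2_eq_square by simp
    finally show ?case
      using ij by (simp add: subfield_divide[OF K_subfield] subfield_mult[OF K_subfield] subfield_of_nat[OF K_subfield])
  next
    case (sum s1 s2)
    thus ?case using K_subfield by (auto simp: add_divide_distrib intro: algebraic_int_add subfield_add)
  qed
  thus "ideal_prod (ring_ints K) (ram b) (ram b) \<subseteq> (\<lambda>z. of_nat b * z) ` carrier (ring_ints K)"
    using b_pos by (intro subsetI rev_image_eqI[of "_ / of_nat b"]) auto
  obtain y where y: "x = b * y" using b by (rule dvdE)
  have "coprime b y" using squarefree unfolding y by (rule squarefree_mult_imp_coprime)
  hence "coprime (int b) (int y)" by simp
  then obtain u v where "u * int b + v * int y = 1" using bezout_int[of "int b" "int y"] by auto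
  hence "of_int (u * int b + v * int y) = (1 :: qbar)" by simp
  hence uv: "of_int u * of_nat b + of_int v * of_nat y = (1 :: qbar)" by simp
  note Pi = ideal_prod_ring_ints[OF K_subfield ram_ideal ram_ideal, of b b]
  show "(\<lambda>z. of_nat b * z) ` carrier (ring_ints K) \<subseteq> ideal_prod (ring_ints K) (ram b) (ram b)"
  proof safe
    fix z assume z: "z \<in> carrier (ring_ints K)"
    have intK: "of_int i \<in> K" for i by (rule subfield_of_int[OF K_subfield])
    have "of_nat b * z = (of_int u * of_nat b + of_int v * of_nat y) * (of_nat b * z)" by (simp only: uv mult_1)
    also have "\<dots> = (of_int u * z) * (of_nat b * of_nat b) + (of_int v * z) * (w * w)"
      using sq by (simp add: y power2_eq_square algebra_simps)
    also have "\<dots> \<in> ideal_prod (ring_ints K) (ram b) (ram b)"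
    proof (rule ideal_add[OF K_subfield Pi]; rule ideal_mult[OF K_subfield Pi])
      show "of_nat b * of_nat b \<in> ideal_prod (ring_ints K) (ram b) (ram b)"
        "w * w \<in> ideal_prod (ring_ints K) (ram b) (ram b)"
        using ideal_prod.prod[of _ "ram b" _ "ram b" "ring_ints K"] of_nat_in_ram[OF b_pos] w_in_ram by auto
    qed (use z intK K_subfield in \<open>auto intro!: subfield_mult algebraic_int_mult\<close>)
    finally show "of_nat b * z \<in> ideal_prod (ring_ints K) (ram b) (ram b)" .
  qed
qed

end

text \<open>An element of \<open>ram (a * b)\<close> lies in both factors; a Bezout relation
  \<open>u * a + v * b = 1\<close> writes it as a sum of products of \<open>a\<close> with an
  element of \<open>ram b\<close> and of \<open>b\<close> with an element of
  \<open>ram a\<close>.\<close>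

lemma ram_mult:
  assumes ab: "a * b dvd x" "coprime a b"
  shows "ideal_prod (ring_ints K) (ram a) (ram b) = ram (a * b)"
proof
  obtain \<alpha> :: qbar where \<alpha>: "\<alpha> ^ 2 = of_nat a" by (rule qbar_sqrt)
  obtain \<beta> :: qbar where \<beta>: "\<beta> ^ 2 = of_nat b" by (rule qbar_sqrt)
  have \<alpha>\<beta>: "(\<alpha> * \<beta>) ^ 2 = of_nat (a * b)" by (simp add: \<alpha> \<beta> power_mult_distrib)
  have pos: "a > 0" "b > 0" using ab gt_1 by (auto intro: Nat.gr0I)
  show "ideal_prod (ring_ints K) (ram a) (ram b) \<subseteq> ram (a * b)"
  proof
    fix s assume "s \<in> ideal_prod (ring_ints K) (ram a) (ram b)"
    thus "s \<in> ram (a * b)"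
    proof (induction rule: ideal_prod.induct)
      case (prod i j)
      hence ij: "algebraic_int (i / \<alpha>)" "algebraic_int (j / \<beta>)" by (simp_all add: ram_sqrt[OF \<alpha>] ram_sqrt[OF \<beta>])
      from algebraic_int_mult[OF ij] have "algebraic_int (i * j / (\<alpha> * \<beta>))" by (simp only: times_divide_times_eq)
      thus ?case using prod ram_closed(1,2)[of i a] ram_closed(1,2)[of j b] K_subfield unfolding ram_sqrt[OF \<alpha>\<beta>]
        by (auto intro: algebraic_int_mult subfield_mult)
    qed (use ram_closed(4) in auto)
  qed
  have "coprime (int a) (int b)" using ab(2) by simp
  then obtain u v where "u * int a + v * int b = 1" using bezout_int[of "int a" "int b"] by auto
  hence "of_int (u * int a + v * int b) = (1 :: qbar)" by simp
  hence uv: "of_int u * of_nat a + of_int v * of_nat b = (1 :: qbar)" by simp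
  note Pi = ideal_prod_ring_ints[OF K_subfield ram_ideal ram_ideal, of a b]
  show "ram (a * b) \<subseteq> ideal_prod (ring_ints K) (ram a) (ram b)"
  proof
    fix z assume z: "z \<in> ram (a * b)"
    have intK: "of_int i \<in> K" for i by (rule subfield_of_int[OF K_subfield])
    have \<beta>0: "\<alpha> \<noteq> 0" "\<beta> \<noteq> 0" using \<alpha> \<beta> pos by auto
    have "algebraic_int \<alpha>" "algebraic_int \<beta>" using algebraic_int_sqrt_iff \<alpha> \<beta> by (metis algebraic_int_of_nat)+
    moreover have zab: "z \<in> K" "algebraic_int z" "algebraic_int (z / (\<alpha> * \<beta>))"
      using z unfolding ram_sqrt[OF \<alpha>\<beta>] by auto
    ultimately have "algebraic_int (\<alpha> * (z / (\<alpha> * \<beta>)))" "algebraic_int (\<beta> * (z / (\<alpha> * \<beta>)))"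
      by (auto intro!: algebraic_int_mult simp del: times_divide_eq_right)
    moreover have "\<alpha> * (z / (\<alpha> * \<beta>)) = z / \<beta>" "\<beta> * (z / (\<alpha> * \<beta>)) = z / \<alpha>" using \<beta>0 by simp_all
    ultimately have "algebraic_int (z / \<beta>)" "algebraic_int (z / \<alpha>)" by (simp_all only:)
    hence "z \<in> ram a" "z \<in> ram b"
      using zab unfolding ram_sqrt[OF \<alpha>] ram_sqrt[OF \<beta>] by auto
    have "z = (of_int u * of_nat a + of_int v * of_nat b) * z" by (simp only: uv mult_1)
    also have "\<dots> = of_int u * (of_nat a * z) + of_int v * (z * of_nat b)" by (simp add: algebra_simps)
    also have "\<dots> \<in> ideal_prod (ring_ints K) (ram a) (ram b)"
    proof (rule ideal_add[OF K_subfield Pi]; rule ideal_mult[OF K_subfield Pi])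
      show "of_nat a * z \<in> ideal_prod (ring_ints K) (ram a) (ram b)"
        using ideal_prod.prod[of "of_nat a" "ram a" z "ram b" "ring_ints K"] of_nat_in_ram[OF pos(1)] \<open>z \<in> ram b\<close> by simp
      show "z * of_nat b \<in> ideal_prod (ring_ints K) (ram a) (ram b)"
        using ideal_prod.prod[of z "ram a" "of_nat b" "ram b" "ring_ints K"] of_nat_in_ram[OF pos(2)] \<open>z \<in> ram a\<close> by simp
    qed (use intK in auto)
    finally show "z \<in> ideal_prod (ring_ints K) (ram a) (ram b)" .
  qed
qed

end

lemma of_int_in_prime_iff:
  assumes K: "subfield K ring_of_type_algebra" and P: "ideal P (ring_ints K)" "1 \<notin> P"
    and l: "prime l" "of_nat l \<in> P"
  shows "of_int n \<in> P \<longleftrightarrow> int l dvd n"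
proof
  assume n: "of_int n \<in> P"
  show "int l dvd n"
  proof (rule ccontr)
    assume "\<not> int l dvd n"
    then obtain k j where "k * n + j * int l = 1" using prime_int_mult_1[OF l(1)] by blast
    hence "of_int (k * n + j * int l) = (1 :: qbar)" by simp
    hence "of_int k * of_int n + of_int j * of_nat l = (1 :: qbar)" by simp
    moreover have "of_int k * of_int n + of_int j * of_nat l \<in> P"
      using ideal_add[OF K P(1) ideal_mult[OF K P(1) n] ideal_mult[OF K P(1) l(2)]] subfield_of_int[OF K] by simp
    ultimately show False using P(2) by simp
  qed
qed (rule int_multiple_in_ideal[OF K P(1) l(2)])

section \<open>Primes of a quadratic field\<close>

context real_quadratic
begin

text \<open>Squares of elements of \<open>ram l\<close> are multiples of \<open>l\<close>, so
  \<open>ram l\<close> is contained in \<open>P\<close>. Conversely, modulo \<open>ram l\<close>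
  every integer of \<open>K\<close> is a rational integer, and a rational integer in
  \<open>P\<close> is a multiple of \<open>l\<close>.\<close>

lemma prime_over_ramified:
  assumes P: "nonzero_prime K P" and l: "prime l" "of_nat l \<in> P" "l dvd x"
  shows "P = ram l"
proof
  have Pp: "primeideal P (ring_ints K)" using P by (simp add: nonzero_prime_def)
  note PP = Pp[unfolded primeideal_ring_ints_iff[OF K_subfield]]
  have Pi: "ideal P (ring_ints K)" and P1: "1 \<notin> P" using PP by auto
  note Pc = ideal_closed[OF K_subfield Pi]
  have l0: "l > 0" using l(1) by (rule prime_gt_0_nat)
  show sub: "ram l \<subseteq> P"
  proof
    fix z assume z: "z \<in> ram l"
    hence "z ^ 2 / of_nat l \<in> K" "algebraic_int (z ^ 2 / of_nat l)"
      by (auto simp: ram_def intro!: subfield_divide subfield_power subfield_of_nat K_subfield)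
    hence "z ^ 2 / of_nat l * of_nat l \<in> P" by (rule Pc(5)[OF l(2)])
    hence "z * z \<in> P" using l0 by (simp add: power2_eq_square)
    thus "z \<in> P" using PP ram_closed(1,2)[OF z] by blast
  qed
  show "P \<subseteq> ram l"
  proof
    fix z assume z: "z \<in> P"
    hence "z \<in> carrier (ring_ints K)" using Pc(1,2) by simp
    then obtain n where n: "z - of_int n \<in> ram l" using ram_residue[OF l(3)] by blast
    have "z - (z - of_int n) \<in> P" by (rule ideal_diff[OF K_subfield Pi z]) (use n sub in blast)
    hence "of_int n \<in> P" by simp
    hence "int l dvd n" using of_int_in_prime_iff[OF K_subfield Pi P1 l(1,2)] by blast
    hence "of_int n \<in> ram l" using of_int_in_ram_iff[OF b_squarefree[OF l(3)] l0] by blast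
    thus "z \<in> ram l" using ram_closed(4)[OF n] by fastforce
  qed
qed

lemma restrict_ramified_prime:
  assumes R: "primeideal R (ring_ints UNIV)" and l: "prime l" "of_nat l \<in> R" "l dvd x"
  shows "R \<inter> K = ram l" "nonzero_prime K (ram l)"
proof -
  have "of_nat l \<in> R \<inter> K" using l K_subfield by (simp add: subfield_of_nat)
  moreover have "(of_nat l :: qbar) \<noteq> 0" using prime_gt_0_nat[OF l(1)] by simp
  ultimately have "R \<inter> K \<noteq> {0}" by (metis singletonD)
  hence n: "nonzero_prime K (R \<inter> K)"
    using primeideal_restrict[OF K_subfield R] by (simp add: nonzero_prime_def)
  thus "R \<inter> K = ram l" using prime_over_ramified[OF n l(1) _ l(3)] \<open>of_nat l \<in> R \<inter> K\<close> by blast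
  thus "nonzero_prime K (ram l)" using n by simp
qed

text \<open>If \<open>P\<close> is larger than the ideal of \<open>l\<close>, it is generated by
  \<open>l\<close> and some \<open>\<alpha> = \<omega> + m'\<close>, and \<open>P'\<close> is the
  conjugate of \<open>P\<close>. The product contains \<open>l * l\<close>, \<open>l\<close> times
  the trace of \<open>\<alpha>\<close>, and its norm; the greatest common divisor of these is
  \<open>l\<close>, for otherwise \<open>\<alpha> / l\<close> would be integral.\<close>

lemma prime_ideal_invertible:
  assumes P: "nonzero_prime K P" and l: "prime l" "of_nat l \<in> P"
  obtains P' where "ideal P' (ring_ints K)"
    "ideal_prod (ring_ints K) P P' = (\<lambda>z. of_nat l * z) ` carrier (ring_ints K)"
proof -
  define lO where "lO = (\<lambda>z. of_nat l * z) ` carrier (ring_ints K)"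
  interpret OK: cring "ring_ints K" by (rule cring_ring_ints) (rule K_subfield)
  have Pp: "primeideal P (ring_ints K)" using P by (simp add: nonzero_prime_def)
  have Pi: "ideal P (ring_ints K)" and P1: "1 \<notin> P"
    using Pp by (auto simp: primeideal_ring_ints_iff[OF K_subfield])
  note Pc = ideal_closed[OF K_subfield Pi] ideal_diff[OF K_subfield Pi]
  have intP: "of_int n \<in> P \<longleftrightarrow> int l dvd n" for n
    by (rule of_int_in_prime_iff[OF K_subfield Pi P1 l])
  have intK: "of_int i \<in> K" for i by (rule subfield_of_int[OF K_subfield])
  have l0: "l > 0" using l(1) by (rule prime_gt_0_nat)
  have lOI: "ideal lO (ring_ints K)"
    unfolding lO_def by (rule principal_ideal[OF K_subfield]) (simp add: K_subfield subfield_of_nat)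
  have lO_P: "lO \<subseteq> P" unfolding lO_def using Pc(6)[OF l(2)] by auto
  show ?thesis
  proof (cases "P = lO")
    \<comment> \<open>The inert case, in which the unit ideal serves as \<open>P'\<close>.\<close>
    case True
    have "ideal_prod (ring_ints K) P (carrier (ring_ints K)) = P" by (rule OK.ideal_prod_one[OF Pi])
    thus ?thesis using that[OF OK.oneideal] True by (simp add: lO_def)
  next
    case False
    then obtain z where z: "z \<in> P" "z \<notin> lO" using lO_P by blast
    then obtain m n where zmn: "z = of_int m + of_int n * \<omega>" using Pc(1,2) ring_ints_K[of z] by auto
    have l_mult: "of_int (int l * i) * u \<in> lO" if "u \<in> carrier (ring_ints K)" for i u
    proof -
      have "of_int (int l * i) * u = of_nat l * (of_int i * u)" by simp
      thus ?thesis unfolding lO_def using that intK K_subfield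
        by (intro image_eqI[of _ _ "of_int i * u"]) (auto intro: subfield_mult algebraic_int_mult)
    qed
    note lOc = ideal_closed[OF K_subfield lOI] ideal_diff[OF K_subfield lOI]
    have \<omega>O: "\<omega> \<in> carrier (ring_ints K)" using \<omega>_in_K \<omega>_int by simp
    have one: "1 \<in> carrier (ring_ints K)" using K_subfield by (simp add: subfield_one)
    have "\<not> int l dvd n"
    proof
      assume "int l dvd n"
      then obtain i where i: "n = int l * i" by (rule dvdE)
      have 1: "of_int n * \<omega> \<in> lO" unfolding i by (rule l_mult[OF \<omega>O])
      hence "z - of_int n * \<omega> \<in> P" using Pc(7) z(1) lO_P by blast
      hence "int l dvd m" using intP by (simp add: zmn)
      then obtain j where "m = int l * j" by (rule dvdE)
      hence "of_int m * 1 \<in> lO" using l_mult[OF one] by metis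
      hence "z \<in> lO" using lOc(4)[OF _ 1] zmn by simp
      thus False using z by simp
    qed
    \<comment> \<open>Multiplying \<open>z\<close> by \<open>k\<close> makes the coefficient of
      \<open>\<omega>\<close> congruent to 1 modulo \<open>l\<close>; this is the origin of
      \<open>\<alpha>\<close>.\<close>
    then obtain k j where kj: "k * n + j * int l = 1" by (rule prime_int_mult_1[OF l(1)])
    define m' where "m' = k * m"
    define \<alpha> where "\<alpha> = \<omega> + of_int m'"
    have \<alpha>_eq: "\<alpha> = of_int k * z + of_int (int l * j) * \<omega>"
    proof -
      have "of_int (k * n + j * int l) * \<omega> = \<omega>" by (simp only: kj) simp
      hence "(of_int k * of_int n + of_int j * of_nat l) * \<omega> = \<omega>" by simp
      hence "\<alpha> = (of_int k * of_int n + of_int j * of_nat l) * \<omega> + of_int k * of_int m"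
        by (simp only: \<alpha>_def m'_def of_int_mult)
      also have "\<dots> = of_int k * z + of_int (int l * j) * \<omega>"
        unfolding zmn of_int_mult of_int_of_nat_eq distrib_left distrib_right by (simp only: mult_ac add_ac)
      finally show ?thesis .
    qed
    have \<alpha>P: "\<alpha> \<in> P" unfolding \<alpha>_eq using l_mult[OF \<omega>O] lO_P intK by (intro Pc(4) Pc(5)[OF z(1)]) auto
    have \<alpha>K: "\<alpha> \<in> K" "algebraic_int \<alpha>" using Pc(1,2)[OF \<alpha>P] .
    have decomp: "\<exists>d e. y = of_int d * \<alpha> + of_nat l * of_int e" if y: "y \<in> P" for y
    proof -
      obtain c0 d where yd: "y = of_int c0 + of_int d * \<omega>" using Pc(1,2)[OF y] ring_ints_K[of y] by auto
      have "y - of_int d * \<alpha> \<in> P" using \<alpha>P intK by (intro Pc(7) y Pc(5)) auto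
      moreover have eq: "y - of_int d * \<alpha> = of_int (c0 - d * m')" by (simp add: yd \<alpha>_def algebra_simps)
      ultimately have "of_int (c0 - d * m') \<in> P" by (simp only:)
      hence "int l dvd c0 - d * m'" using intP by blast
      then obtain e where "c0 - d * m' = int l * e" by (rule dvdE)
      thus ?thesis using eq by (intro exI[of _ d] exI[of _ e]) (simp add: algebra_simps)
    qed
    have \<alpha>_lO: "\<alpha> \<notin> lO"
    proof
      assume "\<alpha> \<in> lO"
      hence n\<alpha>: "of_int n * \<alpha> \<in> lO" using intK by (intro lOc(5)) auto
      have eq: "z - of_int n * \<alpha> = of_int (m - n * m')" by (simp add: zmn \<alpha>_def algebra_simps)
      have "z - of_int n * \<alpha> \<in> P" using n\<alpha> lO_P z(1) Pc(7) by blast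
      hence "int l dvd m - n * m'" unfolding eq using intP by blast
      then obtain i where "m - n * m' = int l * i" by (rule dvdE)
      hence "of_int (m - n * m') * 1 \<in> lO" using l_mult[OF one] by metis
      moreover have "z = of_int (m - n * m') * 1 + of_int n * \<alpha>"
        using eq by (simp only: mult_1_right diff_eq_eq)
      ultimately have "z \<in> lO" using lOc(4)[OF _ n\<alpha>] by (simp only:)
      thus False using z by simp
    qed
    obtain c where c: "c \<in> GQ" "c w = - w" by (rule conjugation)
    have cK: "c u \<in> K" if u: "u \<in> K" for u
    proof -
      obtain r t where "u = of_rat r + of_rat t * w" using u unfolding K_eq by blast
      hence "c u = of_rat r + of_rat (- t) * w"
        by (simp add: gal_add[OF c(1)] gal_mult[OF c(1)] gal_fixes[OF c(1)] c(2) of_rat_minus)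
      thus ?thesis unfolding K_eq by blast
    qed
    have cc: "c (c u) = u" if u: "u \<in> K" for u
    proof -
      obtain r t where "u = of_rat r + of_rat t * w" using u unfolding K_eq by blast
      thus ?thesis by (simp add: gal_add[OF c(1)] gal_mult[OF c(1)] gal_fixes[OF c(1)] gal_minus[OF c(1)] gal_diff[OF c(1)] c(2))
    qed
    have cO: "algebraic_int (c u)" if "algebraic_int u" for u using GQ_algebraic_int[OF c(1) that] .
    have c_int: "\<exists>i. u = of_int i" if u: "algebraic_int u" "u \<in> K" "c u = u" for u
    proof -
      obtain r t where rt: "u = of_rat r + of_rat t * w" using u(2) unfolding K_eq by blast
      have "c u = of_rat r - of_rat t * w"
        by (simp add: rt gal_add[OF c(1)] gal_mult[OF c(1)] gal_fixes[OF c(1)] c(2))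
      hence "of_rat t * w = 0" using u(3) rt by auto
      hence "u \<in> \<rat>" using rt by auto
      hence "u \<in> \<int>" using u(1) rational_algebraic_int_is_int by blast
      thus ?thesis by (auto elim: Ints_cases)
    qed
    define P' where "P' = c ` P"
    have P'i: "ideal P' (ring_ints K)"
      unfolding ideal_ring_ints_iff[OF K_subfield]
    proof (intro conjI ballI allI impI)
      show "0 \<in> P'" unfolding P'_def using Pc(3) gal_zero[OF c(1)] by (metis image_eqI)
      fix y assume "y \<in> P'"
      then obtain u where u: "u \<in> P" "y = c u" by (auto simp: P'_def)
      show "y \<in> K" "algebraic_int y" using u cK cO Pc(1,2) by auto
      show "y + y' \<in> P'" if y': "y' \<in> P'" for y'
      proof -
        obtain u' where u': "u' \<in> P" "y' = c u'" using y' by (auto simp: P'_def)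
        have "y + y' = c (u + u')" by (simp add: u u' gal_add[OF c(1)])
        thus ?thesis unfolding P'_def using Pc(4)[OF u(1) u'(1)] by blast
      qed
      show "v * y \<in> P'" if v: "v \<in> K" "algebraic_int v" for v
      proof -
        have "v * y = c (c v * u)" using cc[OF v(1)] by (simp add: u gal_mult[OF c(1)])
        thus ?thesis unfolding P'_def using Pc(5)[OF u(1), of "c v"] cK cO v by blast
      qed
    qed
    obtain N where N: "\<alpha> * c \<alpha> = of_int N"
      using c_int[of "\<alpha> * c \<alpha>"] \<alpha>K cK cO cc[OF \<alpha>K(1)] K_subfield
      by (auto simp: gal_mult[OF c(1)] mult.commute intro: subfield_mult algebraic_int_mult)
    obtain t where t: "\<alpha> + c \<alpha> = of_int t"
      using c_int[of "\<alpha> + c \<alpha>"] \<alpha>K cK cO cc[OF \<alpha>K(1)] K_subfield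
      by (auto simp: gal_add[OF c(1)] add.commute intro: subfield_add algebraic_int_add)
    have "c \<alpha> * \<alpha> \<in> P" using \<alpha>P cK[OF \<alpha>K(1)] cO[OF \<alpha>K(2)] by (rule Pc(5))
    hence "int l dvd N" using N intP by (simp add: mult.commute)
    then obtain N' where N': "N = int l * N'" by (rule dvdE)
    note Q = ideal_prod_ring_ints[OF K_subfield Pi P'i]
    note Qc = ideal_closed[OF K_subfield Q]
    have cl: "c (of_nat l) = of_nat l" and ci: "c (of_int i) = of_int i" for i
      by (simp_all add: gal_fixes[OF c(1)])
    have in_Q: "u * c v \<in> ideal_prod (ring_ints K) P P'" if "u \<in> P" "v \<in> P" for u v
      using ideal_prod.prod[of u P "c v" P' "ring_ints K"] that by (simp add: P'_def)
    have l_in_Q: "of_nat l \<in> ideal_prod (ring_ints K) P P'"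
    proof -
      have 1: "of_nat l * of_nat l \<in> ideal_prod (ring_ints K) P P'" using in_Q[OF l(2) l(2)] by (simp add: cl)
      have 2: "of_nat l * of_int t \<in> ideal_prod (ring_ints K) P P'"
      proof -
        have "\<alpha> * c (of_nat l) + of_nat l * c \<alpha> \<in> ideal_prod (ring_ints K) P P'"
          by (intro Qc(4) in_Q \<alpha>P l(2))
        thus ?thesis by (simp add: cl algebra_simps flip: t)
      qed
      have 3: "of_nat l * of_int N' \<in> ideal_prod (ring_ints K) P P'" using in_Q[OF \<alpha>P \<alpha>P] by (simp add: N N')
      have comb: "of_nat l \<in> ideal_prod (ring_ints K) P P'"
        if i: "of_nat l * of_int i \<in> ideal_prod (ring_ints K) P P'" "\<not> int l dvd i" for i
      proof -
        obtain k j where kj: "k * i + j * int l = 1" by (rule prime_int_mult_1[OF l(1) i(2)])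
        have "of_int (k * i + j * int l) * of_nat l = (of_nat l :: qbar)" by (simp only: kj) simp
        hence "of_int k * (of_nat l * of_int i) + of_int j * (of_nat l * of_nat l) = (of_nat l :: qbar)"
          by (simp only: of_int_add of_int_mult of_int_of_nat_eq distrib_right distrib_left mult_ac)
        moreover have "of_int k * (of_nat l * of_int i) + of_int j * (of_nat l * of_nat l) \<in> ideal_prod (ring_ints K) P P'"
          using intK by (intro Qc(4) Qc(5) i(1) 1) auto
        ultimately show ?thesis by simp
      qed
      have "\<not> (int l dvd t \<and> int l dvd N')"
      proof
        assume dvd: "int l dvd t \<and> int l dvd N'"
        then obtain t' N'' where t': "t = int l * t'" and N'': "N' = int l * N''" by (auto elim!: dvdE)
        define y where "y = \<alpha> / of_nat l"
        have \<alpha>y: "\<alpha> = of_nat l * y" using l0 by (simp add: y_def)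
        have "c \<alpha> = of_int t - \<alpha>" unfolding t[symmetric] by simp
        hence "c \<alpha> = of_nat l * (of_int t' - y)"
          unfolding t' of_int_mult of_int_of_nat_eq right_diff_distrib \<alpha>y[symmetric] .
        hence "(of_nat l * y) * (of_nat l * (of_int t' - y)) = of_int (int l * (int l * N''))"
          using N by (simp only: \<alpha>y[symmetric] N' N'')
        hence "of_nat l ^ 2 * (y * (of_int t' - y)) = of_nat l ^ 2 * (of_int N'' :: qbar)"
          by (simp only: of_int_mult of_int_of_nat_eq power2_eq_square mult_ac)
        hence "y * (of_int t' - y) = of_int N''" using l0 by simp
        hence "poly [:of_int N'', - of_int t', 1:] y = 0" by (simp add: algebra_simps)
        hence "algebraic_int y"
          by (intro algebraic_int.intros[of "[:of_int N'', - of_int t', 1:]"]) (auto simp: coeff_pCons split: nat.splits)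
        hence "y \<in> carrier (ring_ints K)"
          using \<alpha>K(1) K_subfield by (simp add: y_def subfield_divide subfield_of_nat)
        hence "\<alpha> \<in> lO" unfolding lO_def \<alpha>y by blast
        thus False using \<alpha>_lO by simp
      qed
      thus ?thesis using comb[OF 2] comb[OF 3] by blast
    qed
    have "ideal_prod (ring_ints K) P P' = lO"
    proof
      show "lO \<subseteq> ideal_prod (ring_ints K) P P'" unfolding lO_def using Qc(6)[OF l_in_Q] by auto
      show "ideal_prod (ring_ints K) P P' \<subseteq> lO"
      proof
        fix s assume "s \<in> ideal_prod (ring_ints K) P P'"
        thus "s \<in> lO"
        proof (induction rule: ideal_prod.induct)
          case (prod i j)
          then obtain v where v: "v \<in> P" "j = c v" by (auto simp: P'_def)
          obtain d e where de: "i = of_int d * \<alpha> + of_nat l * of_int e" using decomp[OF prod(1)] by blast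
          obtain d' e' where de': "v = of_int d' * \<alpha> + of_nat l * of_int e'" using decomp[OF v(1)] by blast
          have j: "j = of_int d' * c \<alpha> + of_nat l * of_int e'"
            by (simp add: v de' gal_add[OF c(1)] gal_mult[OF c(1)] cl ci)
          have "i * j = of_int (d * d') * (\<alpha> * c \<alpha>) + of_nat l * (of_int (d * e') * \<alpha> + of_int e * j)"
          proof -
            have "i * j = of_int d * \<alpha> * j + of_nat l * (of_int e * j)"
              unfolding de by (simp only: distrib_left distrib_right mult_ac)
            also have "of_int d * \<alpha> * j = of_int (d * d') * (\<alpha> * c \<alpha>) + of_nat l * (of_int (d * e') * \<alpha>)"
              unfolding j by (simp only: of_int_mult distrib_left mult_ac)
            finally show ?thesis by (simp only: distrib_left add_ac)
          qed
          also have "\<dots> = of_nat l * (of_int (d * d') * of_int N' + (of_int (d * e') * \<alpha> + of_int e * j))"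
            unfolding N N' by (simp only: of_int_mult of_int_of_nat_eq distrib_left mult_ac)
          finally have ij: "i * j = of_nat l * (of_int (d * d') * of_int N' + (of_int (d * e') * \<alpha> + of_int e * j))" .
          have jK: "j \<in> K" "algebraic_int j" using v Pc(1,2) cK cO by auto
          have "of_int (d * d') * of_int N' + (of_int (d * e') * \<alpha> + of_int e * j) \<in> carrier (ring_ints K)"
            unfolding ring_ints_simps using \<alpha>K jK
            by (intro conjI subfield_add[OF K_subfield] subfield_mult[OF K_subfield] intK algebraic_int_add
                algebraic_int_mult algebraic_int_of_int)
          thus ?case unfolding ring_ints_simps(2) ij lO_def by (rule imageI)
        qed (use lOc(4) in simp)
      qed
    qed
    thus ?thesis using that[OF P'i] by (simp add: lO_def)
  qed
qed

text \<open>Unless all integers of \<open>K\<close> are congruent to rational integers, the classes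
  are those of \<open>m + n * \<omega>\<close>, and there are \<open>l * l\<close> of them. The
  congruence then comes from the quadratic equation of \<open>z\<close> over the integers: modulo a
  prime \<open>R\<close> above \<open>P\<close>, the \<open>l\<close>-th power of a root is again a
  root.\<close>

lemma abs_norm_prime:
  assumes P: "nonzero_prime K P" and l: "prime l" "of_nat l \<in> P"
  obtains k where "abs_norm K P = l ^ k" "\<And>z. z \<in> carrier (ring_ints K) \<Longrightarrow> z ^ (l ^ k) - z \<in> P"
proof -
  have Pp: "primeideal P (ring_ints K)" using P by (simp add: nonzero_prime_def)
  have Pi: "ideal P (ring_ints K)" and P1: "1 \<notin> P"
    using Pp by (auto simp: primeideal_ring_ints_iff[OF K_subfield])
  note Pc = ideal_closed[OF K_subfield Pi] ideal_diff[OF K_subfield Pi]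
  have intP: "of_int n \<in> P \<longleftrightarrow> int l dvd n" for n
    by (rule of_int_in_prime_iff[OF K_subfield Pi P1 l])
  have intK: "of_int i \<in> K" for i by (rule subfield_of_int[OF K_subfield])
  have l0: "l > 0" using l(1) by (rule prime_gt_0_nat)
  obtain R where R: "primeideal R (ring_ints (UNIV :: qbar set))" "R \<inter> K = P"
    by (rule lying_over[OF K_subfield Pp]) blast
  have Ri: "ideal R (ring_ints UNIV)" by (rule R_ideal[OF R(1)])
  have lR: "of_nat l \<in> R" using l(2) R(2) by blast
  note Rc = R_closed[OF R(1)]
  have PR: "u \<in> P" if "u \<in> R" "u \<in> K" for u using that R(2) by blast
  show ?thesis
  proof (cases "\<forall>z\<in>carrier (ring_ints K). \<exists>n::int. z - of_int n \<in> P")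
    case True
    have "abs_norm K P = l ^ 1"
      using abs_norm_integers[OF K_subfield Pi l0 intP] True by simp
    moreover have "z ^ (l ^ 1) - z \<in> P" if z: "z \<in> carrier (ring_ints K)" for z
    proof -
      obtain n where n: "z - of_int n \<in> P" using True z by blast
      hence nR: "z - of_int n \<in> R" using R(2) by blast
      have "z ^ l - of_int n ^ l \<in> R" using z by (intro power_cong[OF Ri l(1) lR _ _ nR]) auto
      from Rc(4)[OF this fermat_int[OF Ri l(1) lR, of n]] have "z ^ l - of_int n \<in> R" by simp
      from Rc(8)[OF this nR] have "z ^ l - z \<in> R" by simp
      thus ?thesis using z K_subfield by (simp add: PR subfield_diff subfield_power)
    qed
    ultimately show ?thesis by (rule that)
  next
    case False
    have \<omega>_not: "of_int n * \<omega> - of_int m \<notin> P" if ndvd: "\<not> int l dvd n" for m n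
    proof
      assume a: "of_int n * \<omega> - of_int m \<in> P"
      obtain k j where kj: "k * n + j * int l = 1" by (rule prime_int_mult_1[OF l(1) ndvd])
      have "of_int k * (of_int n * \<omega> - of_int m) + (of_int j * \<omega>) * of_nat l \<in> P"
        using intK K_subfield \<omega>_in_K \<omega>_int by (intro Pc(4) Pc(5)[OF a] Pc(5)[OF l(2)]) (auto intro: subfield_mult algebraic_int_mult)
      moreover have "of_int k * (of_int n * \<omega> - of_int m) + (of_int j * \<omega>) * of_nat l =
          of_int (k * n + j * int l) * \<omega> - of_int (k * m)"
        by (simp only: of_int_add of_int_mult of_int_of_nat_eq right_diff_distrib distrib_right mult.assoc
            mult.commute[of _ "of_nat l"] mult.left_commute[of _ "of_nat l"]) simp
      ultimately have *: "\<omega> - of_int (k * m) \<in> P" unfolding kj by simp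
      have "\<exists>n::int. z - of_int n \<in> P" if z: "z \<in> carrier (ring_ints K)" for z
      proof -
        obtain a b where ab: "z = of_int a + of_int b * \<omega>" using z ring_ints_K by blast
        have "z - of_int (a + b * (k * m)) = of_int b * (\<omega> - of_int (k * m))"
          unfolding ab of_int_add of_int_mult right_diff_distrib by simp
        also have "\<dots> \<in> P" using intK by (intro Pc(5)[OF *]) auto
        finally show ?thesis by blast
      qed
      thus False using False by blast
    qed
    define T where "T = (\<lambda>(m, n). of_int m + of_int n * \<omega>) ` ({0..<int l} \<times> {0..<int l})"
    have uniq: "m = m' \<and> n = n'"
      if "m \<in> {0..<int l}" "m' \<in> {0..<int l}" "n \<in> {0..<int l}" "n' \<in> {0..<int l}"
        "(of_int m + of_int n * \<omega>) - (of_int m' + of_int n' * \<omega>) \<in> P" for m m' n n'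
    proof -
      have eq_mod: "i = j" if "i \<in> {0..<int l}" "j \<in> {0..<int l}" "int l dvd i - j" for i j
      proof -
        have "i mod int l = j mod int l" using that(3) by (simp add: mod_eq_dvd_iff)
        thus ?thesis using that(1,2) by simp
      qed
      have "of_int (n - n') * \<omega> - of_int (m' - m) \<in> P" using that(5) by (simp add: algebra_simps)
      hence n: "int l dvd n - n'" using \<omega>_not by blast
      hence nn: "n = n'" using eq_mod that by blast
      hence "of_int (m - m') \<in> P" using that(5) by simp
      hence "int l dvd m - m'" using intP by blast
      thus ?thesis using eq_mod that nn by blast
    qed
    have "abs_norm K P = card T"
    proof (rule abs_norm_eq_card[OF K_subfield Pi])
      show "T \<subseteq> carrier (ring_ints K)"
      proof
        fix t assume "t \<in> T"
        then obtain m n where "t = of_int m + of_int n * \<omega>" by (auto simp: T_def)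
        thus "t \<in> carrier (ring_ints K)" unfolding ring_ints_K by blast
      qed
      show "t = u" if tu: "t \<in> T" "u \<in> T" "t - u \<in> P" for t u
      proof -
        obtain m n m' n' where "m \<in> {0..<int l}" "m' \<in> {0..<int l}" "n \<in> {0..<int l}" "n' \<in> {0..<int l}"
          and *: "t = of_int m + of_int n * \<omega>" "u = of_int m' + of_int n' * \<omega>"
          using tu(1,2) by (auto simp: T_def)
        hence "m = m' \<and> n = n'" using tu(3) uniq by blast
        thus ?thesis using * by simp
      qed
      fix z assume "z \<in> carrier (ring_ints K)"
      then obtain m n where z: "z = of_int m + of_int n * \<omega>" using ring_ints_K by blast
      define t where "t = of_int (m mod int l) + of_int (n mod int l) * \<omega>"
      have "of_int (m - m mod int l) \<in> P" "of_int (n - n mod int l) \<in> P" by (simp_all only: intP dvd_minus_mod)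
      hence "of_int (m - m mod int l) + \<omega> * of_int (n - n mod int l) \<in> P"
        using \<omega>_in_K \<omega>_int by (intro Pc(4) Pc(5))
      hence "z - t \<in> P" by (simp add: z t_def algebra_simps)
      moreover have "t \<in> T" unfolding T_def t_def using l0 by auto
      ultimately show "\<exists>t\<in>T. z - t \<in> P" by blast
    qed
    also have "card T = l * l"
      unfolding T_def
    proof (subst card_image)
      show "inj_on (\<lambda>(m, n). of_int m + of_int n * \<omega>) ({0..<int l} \<times> {0..<int l})"
        using uniq Pc(3) by (auto simp: inj_on_def)
    qed simp
    finally have "abs_norm K P = l ^ 2" by (simp add: power2_eq_square)
    moreover have "z ^ (l ^ 2) - z \<in> P" if z: "z \<in> carrier (ring_ints K)" for z
    proof -
      obtain c where c: "c \<in> GQ" "c w = - w" by (rule conjugation)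
      have zi: "algebraic_int z" "z \<in> K" using z by auto
      have czi: "algebraic_int (c z)" using GQ_algebraic_int[OF c(1) zi(1)] .
      obtain r t where rt: "z = of_rat r + of_rat t * w" using zi(2) unfolding K_eq by blast
      have cz: "c z = of_rat r - of_rat t * w"
        by (simp add: rt gal_add[OF c(1)] gal_mult[OF c(1)] gal_fixes[OF c(1)] c(2))
      have "z + c z = of_rat (2 * r)" "z * c z = of_rat (r ^ 2 - t ^ 2 * of_nat x)"
        using sq unfolding cz by (simp_all add: rt of_rat_diff of_rat_mult of_rat_power algebra_simps power2_eq_square)
      hence "z + c z \<in> \<rat>" "z * c z \<in> \<rat>" by simp_all
      moreover have "algebraic_int (z + c z)" "algebraic_int (z * c z)"
        using zi czi by (auto intro: algebraic_int_add algebraic_int_mult)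
      ultimately have "z + c z \<in> \<int>" "z * c z \<in> \<int>" using rational_algebraic_int_is_int by blast+
      then obtain s N where s: "z + c z = of_int s" and N: "z * c z = of_int N" by (auto elim!: Ints_cases)
      define f where "f = (\<lambda>u. u * u - of_int s * u + of_int N :: qbar)"
      have f_eq: "f u = (u - z) * (u - c z)" for u
        unfolding f_def s[symmetric] N[symmetric] by (simp add: algebra_simps)
      have f_pow: "f (u ^ l) \<in> R" if u: "algebraic_int u" "f u \<in> R" for u
      proof -
        have uu: "algebraic_int (u * u)" "algebraic_int (- of_int s * u)" "algebraic_int (of_int N :: qbar)"
          using u by (auto intro!: algebraic_int_mult)
        have A: "f u ^ l - ((u * u - of_int s * u) ^ l + of_int N ^ l) \<in> R"
          using frobenius_add[OF Ri l(1) lR algebraic_int_add[OF uu(1,2)] uu(3)] by (simp add: f_def)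
        have B: "(u * u - of_int s * u) ^ l - ((u * u) ^ l + (of_int (- s) * u) ^ l) \<in> R"
          using frobenius_add[OF Ri l(1) lR uu(1,2)] by simp
        have C: "u ^ l * (of_int (- s) ^ l - of_int (- s)) \<in> R"
          by (intro Rc(5) fermat_int[OF Ri l(1) lR] algebraic_int_power u) simp
        have D: "of_int N ^ l - of_int N \<in> R" by (rule fermat_int[OF Ri l(1) lR])
        have "f u ^ l = f u ^ (l - 1) * f u" using l0 by (metis power_minus_mult)
        moreover have "algebraic_int (f u ^ (l - 1))"
          using u Rc(2) by (intro algebraic_int_power) auto
        ultimately have E: "f u ^ l \<in> R" using u Rc(5)[OF u(2), of "f u ^ (l - 1)"] by simp
        \<comment> \<open>A telescoping from \<open>f u ^ l\<close>, which lies in \<open>R\<close>,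
          to \<open>f (u ^ l)\<close>: each correction is an instance of additivity of the
          \<open>l\<close>-th power modulo \<open>R\<close> or of Fermat's little theorem for
          \<open>s\<close> and \<open>N\<close>.\<close>
        have "f (u ^ l) = f u ^ l - ((f u ^ l - ((u * u - of_int s * u) ^ l + of_int N ^ l)) +
            (((u * u - of_int s * u) ^ l - ((u * u) ^ l + (of_int (- s) * u) ^ l)) +
             (u ^ l * (of_int (- s) ^ l - of_int (- s)) + (of_int N ^ l - of_int N))))"
          unfolding f_def power_mult_distrib by (simp add: algebra_simps)
        also have "\<dots> \<in> R" by (intro Rc(8) Rc(4) A B C D E)
        finally show ?thesis .
      qed
      have root: "u - z \<in> R \<or> u - c z \<in> R" if "algebraic_int u" "f u \<in> R" for u
        using that zi czi R_prime[OF R(1), of "u - z" "u - c z"] by (auto simp: f_eq intro: algebraic_int_diff)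
      have zl: "algebraic_int (z ^ l)" using zi by (intro algebraic_int_power)
      have "f z = 0" by (simp add: f_eq)
      hence "f z \<in> R" using Rc(3) by simp
      from f_pow[OF zi(1) this] have fzl: "f (z ^ l) \<in> R" .
      from f_pow[OF zl this] have fzll: "f ((z ^ l) ^ l) \<in> R" .
      have zll: "algebraic_int ((z ^ l) ^ l)" using zl by (rule algebraic_int_power)
      have step: "(z ^ l) ^ l - z \<in> R" if "z ^ l - z \<in> R"
        using Rc(4)[OF power_cong[OF Ri l(1) lR zl zi(1) that, of l] that] by simp
      have "(z ^ l) ^ l - z \<in> R"
        using root[OF zl fzl]
      proof
        assume "z ^ l - z \<in> R" thus ?thesis by (rule step)
      next
        assume a: "z ^ l - c z \<in> R"
        show ?thesis using root[OF zll fzll]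
        proof
          \<comment> \<open>Then \<open>z ^ l\<close> is congruent to its own \<open>l\<close>-th
            power, so the \<open>l\<close>-th power of \<open>z ^ l - z\<close> lies in
            \<open>R\<close>, and \<open>z ^ l\<close> is congruent to \<open>z\<close> after
            all.\<close>
          assume b: "(z ^ l) ^ l - c z \<in> R"
          have d: "(z ^ l) ^ l - z ^ l \<in> R" using Rc(8)[OF b a] by simp
          have e: "(z + (z ^ l - z)) ^ l - (z ^ l + (z ^ l - z) ^ l) \<in> R"
            using zi zl by (intro frobenius_add[OF Ri l(1) lR]) (auto intro: algebraic_int_diff)
          have "(z ^ l - z) ^ l = ((z ^ l) ^ l - z ^ l) - ((z + (z ^ l - z)) ^ l - (z ^ l + (z ^ l - z) ^ l))" by simp
          also have "\<dots> \<in> R" by (rule Rc(8)[OF d e])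
          finally have "(z ^ l - z) ^ l \<in> R" .
          hence "z ^ l - z \<in> R"
          proof -
            have "u \<in> R" if "algebraic_int u" "u ^ n \<in> R" for u n
              using that(2) R_one[OF R(1)] R_prime[OF R(1) that(1) algebraic_int_power[OF that(1)]]
              by (induction n) auto
            thus ?thesis using \<open>(z ^ l - z) ^ l \<in> R\<close> zi zl algebraic_int_diff by blast
          qed
          thus ?thesis by (rule step)
        qed simp
      qed
      hence "z ^ (l ^ 2) - z \<in> R" by (simp add: power2_eq_square power_mult)
      thus ?thesis using zi K_subfield by (simp add: PR subfield_diff subfield_power)
    qed
    ultimately show ?thesis by (rule that)
  qed
qed

end

section \<open>The narrow class group and its dual\<close>

lemma nmult_0 [simp]: "nmult 0 y = 0" and nmult_Suc [simp]: "nmult (Suc n) y = nmult n y + y"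
  by (simp_all add: nmult_def)

lemma nmult_zero [simp]: "nmult n 0 = 0"
  by (induction n) auto

lemma nmult_add: "nmult (m + n) y = nmult m y + nmult n y"
  by (induction n) (auto simp: add_ac)

lemma nmult_plus: "nmult n (y + z) = nmult n y + nmult n z"
  by (induction n) (auto simp: add_ac)

lemma nmult_mult: "nmult (m * n) y = nmult m (nmult n y)"
  by (induction m) (auto simp: nmult_add add_ac)

lemma dual_mult:
  "f \<in> carrier (dual G) \<Longrightarrow> c \<in> carrier G \<Longrightarrow> d \<in> carrier G \<Longrightarrow> f (c \<otimes>\<^bsub>G\<^esub> d) = f c + f d"
  by (auto simp: dual_def hom_def)

lemma dual_one:
  assumes "Group.monoid G" "f \<in> carrier (dual G)"
  shows "f \<one>\<^bsub>G\<^esub> = 0"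
proof -
  interpret Group.monoid G by fact
  show ?thesis using dual_mult[OF assms(2) one_closed one_closed] by simp
qed

lemma dual_pow:
  assumes "Group.monoid G" "f \<in> carrier (dual G)" "c \<in> carrier G"
  shows "f (c [^]\<^bsub>G\<^esub> (n::nat)) = nmult n (f c)"
proof -
  interpret Group.monoid G by fact
  show ?thesis using assms dual_one[OF assms(1,2)] by (induction n) (auto simp: dual_mult)
qed

lemma pow_dual: "f \<in> carrier (dual G) \<Longrightarrow> f [^]\<^bsub>dual G\<^esub> (n::nat) = (\<lambda>c\<in>carrier G. nmult n (f c))"
proof (induction n)
  case (Suc n)
  thus ?case by (simp add: nat_pow_def) (auto simp: dual_def restrict_def fun_eq_iff)
qed (simp add: nat_pow_def dual_def)

lemma pow_dual_carrier:
  assumes "Group.monoid G" "f \<in> carrier (dual G)"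
  shows "(\<lambda>c\<in>carrier G. nmult n (f c)) \<in> carrier (dual G)"
proof -
  interpret Group.monoid G by fact
  show ?thesis using dual_mult[OF assms(2)] by (auto simp: dual_def hom_def nmult_plus)
qed

subsection \<open>The narrow class group\<close>

context
  fixes K :: "qbar set" assumes K: "subfield K ring_of_type_algebra"
begin

interpretation OK: cring "ring_ints K" by (rule cring_ring_ints) (rule K)

text \<open>Stated for arbitrary sets because the same product is applied to fractional ideals,
  which need not lie in the ring.\<close>

lemma ideal_prod_comm: "ideal_prod (ring_ints K) I J = ideal_prod (ring_ints K) J I"
proof -
  have "ideal_prod (ring_ints K) I J \<subseteq> ideal_prod (ring_ints K) J I" for I J
  proof
    fix s assume "s \<in> ideal_prod (ring_ints K) I J"
    thus "s \<in> ideal_prod (ring_ints K) J I"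
    proof (induction rule: ideal_prod.induct)
      case (prod i j)
      thus ?case using ideal_prod.prod[of j J i I "ring_ints K"] by (simp add: mult.commute)
    qed (rule ideal_prod.sum)
  qed
  thus ?thesis by blast
qed

lemma ideal_prod_assoc_sets:
  "ideal_prod (ring_ints K) (ideal_prod (ring_ints K) I J) H = ideal_prod (ring_ints K) I (ideal_prod (ring_ints K) J H)"
proof -
  have *: "ideal_prod (ring_ints K) (ideal_prod (ring_ints K) I J) H \<subseteq> ideal_prod (ring_ints K) I (ideal_prod (ring_ints K) J H)" for I J H
  proof
    fix s assume "s \<in> ideal_prod (ring_ints K) (ideal_prod (ring_ints K) I J) H"
    thus "s \<in> ideal_prod (ring_ints K) I (ideal_prod (ring_ints K) J H)"
    proof (induction rule: ideal_prod.induct)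
      case (prod i h)
      from prod(1) show ?case
      proof (induction rule: ideal_prod.induct)
        case (prod i j)
        have "j \<otimes>\<^bsub>ring_ints K\<^esub> h \<in> ideal_prod (ring_ints K) J H" by (intro ideal_prod.prod prod \<open>h \<in> H\<close>)
        from ideal_prod.prod[OF prod(1) this, of "ring_ints K"] show ?case by (simp add: mult.assoc)
      next
        case (sum s1 s2)
        from ideal_prod.sum[OF sum.IH] show ?case by (simp add: distrib_right)
      qed
    qed (rule ideal_prod.sum)
  qed
  have "ideal_prod (ring_ints K) I (ideal_prod (ring_ints K) J H) = ideal_prod (ring_ints K) (ideal_prod (ring_ints K) H J) I"
    by (simp add: ideal_prod_comm)
  also have "\<dots> \<subseteq> ideal_prod (ring_ints K) H (ideal_prod (ring_ints K) J I)" by (rule *)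
  also have "\<dots> = ideal_prod (ring_ints K) (ideal_prod (ring_ints K) I J) H" by (simp add: ideal_prod_comm)
  finally show ?thesis using * by blast
qed

lemma ideal_prod_mono:
  assumes "I \<subseteq> I'" "J \<subseteq> J'" shows "ideal_prod (ring_ints K) I J \<subseteq> ideal_prod (ring_ints K) I' J'"
proof
  fix s assume "s \<in> ideal_prod (ring_ints K) I J"
  thus "s \<in> ideal_prod (ring_ints K) I' J'"
  proof (induction rule: ideal_prod.induct)
    case (prod i j)
    thus ?case using assms by (intro ideal_prod.prod) auto
  qed (rule ideal_prod.sum)
qed

lemma ideal_prod_scale:
  "ideal_prod (ring_ints K) ((\<lambda>z. z / d) ` I) ((\<lambda>z. z / e) ` J) = (\<lambda>z. z / (d * e)) ` ideal_prod (ring_ints K) I J"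
proof
  show "ideal_prod (ring_ints K) ((\<lambda>z. z / d) ` I) ((\<lambda>z. z / e) ` J) \<subseteq> (\<lambda>z. z / (d * e)) ` ideal_prod (ring_ints K) I J"
  proof
    fix s assume "s \<in> ideal_prod (ring_ints K) ((\<lambda>z. z / d) ` I) ((\<lambda>z. z / e) ` J)"
    thus "s \<in> (\<lambda>z. z / (d * e)) ` ideal_prod (ring_ints K) I J"
    proof (induction rule: ideal_prod.induct)
      case (prod i j)
      then obtain a b where ab: "a \<in> I" "i = a / d" "b \<in> J" "j = b / e" by auto
      have "a * b \<in> ideal_prod (ring_ints K) I J" using ideal_prod.prod[OF ab(1,3), of "ring_ints K"] by simp
      thus ?case by (intro image_eqI[of _ _ "a * b"]) (simp_all add: ab)
    next
      case (sum s1 s2)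
      then obtain a b where ab: "a \<in> ideal_prod (ring_ints K) I J" "s1 = a / (d * e)"
        "b \<in> ideal_prod (ring_ints K) I J" "s2 = b / (d * e)" by auto
      have "a + b \<in> ideal_prod (ring_ints K) I J" using ideal_prod.sum[OF ab(1,3)] by simp
      thus ?case by (intro image_eqI[of _ _ "a + b"]) (simp_all add: ab add_divide_distrib)
    qed
  qed
  have "s / (d * e) \<in> ideal_prod (ring_ints K) ((\<lambda>z. z / d) ` I) ((\<lambda>z. z / e) ` J)"
    if "s \<in> ideal_prod (ring_ints K) I J" for s
    using that
  proof (induction rule: ideal_prod.induct)
    case (prod i j)
    have "(i / d) \<otimes>\<^bsub>ring_ints K\<^esub> (j / e) \<in> ideal_prod (ring_ints K) ((\<lambda>z. z / d) ` I) ((\<lambda>z. z / e) ` J)"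
      using prod by (intro ideal_prod.prod) auto
    thus ?case by simp
  next
    case (sum s1 s2)
    from ideal_prod.sum[OF sum.IH] show ?case by (simp add: add_divide_distrib)
  qed
  thus "(\<lambda>z. z / (d * e)) ` ideal_prod (ring_ints K) I J \<subseteq> ideal_prod (ring_ints K) ((\<lambda>z. z / d) ` I) ((\<lambda>z. z / e) ` J)"
    by blast
qed

lemma frac_ideals_simps [simp]:
  "I \<otimes>\<^bsub>frac_ideals K\<^esub> J = ideal_prod (ring_ints K) I J" "\<one>\<^bsub>frac_ideals K\<^esub> = carrier (ring_ints K)"
  by (simp_all add: frac_ideals_def)

lemma frac_idealI: "ideal J (ring_ints K) \<Longrightarrow> J \<noteq> {0} \<Longrightarrow> d \<in> carrier (ring_ints K) \<Longrightarrow> d \<noteq> 0 \<Longrightarrow>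
    (\<lambda>z. z / d) ` J \<in> carrier (frac_ideals K)"
  unfolding frac_ideals_def by auto

lemma frac_idealE:
  assumes "I \<in> carrier (frac_ideals K)"
  obtains J d where "ideal J (ring_ints K)" "J \<noteq> {0}" "d \<in> carrier (ring_ints K)" "d \<noteq> 0" "I = (\<lambda>z. z / d) ` J"
  using assms unfolding frac_ideals_def by auto

lemma ideal_in_frac_ideals: "ideal J (ring_ints K) \<Longrightarrow> J \<noteq> {0} \<Longrightarrow> J \<in> carrier (frac_ideals K)"
  using frac_idealI[of J 1] OK.one_closed by simp

lemma ideal_prod_nonzero:
  assumes "ideal I (ring_ints K)" "I \<noteq> {0}" "ideal J (ring_ints K)" "J \<noteq> {0}"
  shows "ideal_prod (ring_ints K) I J \<noteq> {0}"
proof -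
  have "\<exists>a\<in>I. a \<noteq> 0" "\<exists>b\<in>J. b \<noteq> 0"
    using ideal_zero[OF K assms(1)] ideal_zero[OF K assms(3)] assms(2,4) by auto
  then obtain a b where "a \<in> I" "a \<noteq> 0" "b \<in> J" "b \<noteq> 0" by blast
  moreover from this have "a * b \<in> ideal_prod (ring_ints K) I J"
    using ideal_prod.prod[of a I b J "ring_ints K"] by simp
  ultimately show ?thesis by (metis mult_eq_0_iff singletonD)
qed

lemma carrier_ring_ints_nonzero: "carrier (ring_ints K) \<noteq> {0}"
  using OK.one_closed by (metis ring_ints_simps(4) singletonD zero_neq_one)

lemma frac_ideals_comm_monoid: "comm_monoid (frac_ideals K)"
proof (rule comm_monoidI)
  show "\<one>\<^bsub>frac_ideals K\<^esub> \<in> carrier (frac_ideals K)"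
    using ideal_in_frac_ideals[OF OK.oneideal carrier_ring_ints_nonzero] by simp
  fix I assume "I \<in> carrier (frac_ideals K)"
  then obtain J d where J: "ideal J (ring_ints K)" "J \<noteq> {0}" "d \<in> carrier (ring_ints K)" "d \<noteq> 0" "I = (\<lambda>z. z / d) ` J"
    by (rule frac_idealE)
  have "ideal_prod (ring_ints K) (carrier (ring_ints K)) J = J"
    using OK.ideal_prod_one[OF J(1)] by (simp add: ideal_prod_comm)
  thus "\<one>\<^bsub>frac_ideals K\<^esub> \<otimes>\<^bsub>frac_ideals K\<^esub> I = I"
    using ideal_prod_scale[of 1 "carrier (ring_ints K)" d J] by (simp add: J)
  fix I' assume "I' \<in> carrier (frac_ideals K)"
  then obtain J' d' where J': "ideal J' (ring_ints K)" "J' \<noteq> {0}" "d' \<in> carrier (ring_ints K)" "d' \<noteq> 0" "I' = (\<lambda>z. z / d') ` J'"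
    by (rule frac_idealE)
  have "d * d' \<in> carrier (ring_ints K)" using OK.m_closed[OF J(3) J'(3)] by simp
  thus "I \<otimes>\<^bsub>frac_ideals K\<^esub> I' \<in> carrier (frac_ideals K)"
    unfolding frac_ideals_simps J(5) J'(5) ideal_prod_scale using J J'
    by (intro frac_idealI ideal_prod_ring_ints[OF K] ideal_prod_nonzero) auto
qed (simp_all only: frac_ideals_simps ideal_prod_assoc_sets, rule ideal_prod_comm)

lemma principal_in_frac_ideals:
  assumes "\<alpha> \<in> K" "\<alpha> \<noteq> 0"
  shows "(\<lambda>z. \<alpha> * z) ` carrier (ring_ints K) \<in> carrier (frac_ideals K)"
proof -
  obtain n :: nat where n: "n > 0" "algebraic_int (of_nat n * \<alpha>)" by (rule qbar_integral_multiple)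
  define \<beta> where "\<beta> = of_nat n * \<alpha>"
  have \<beta>: "\<beta> \<in> K" "algebraic_int \<beta>" "\<beta> \<noteq> 0"
    using n assms K by (auto simp: \<beta>_def subfield_of_nat subfield_mult)
  have "ideal ((\<lambda>z. \<beta> * z) ` carrier (ring_ints K)) (ring_ints K)"
    using \<beta> by (intro principal_ideal[OF K]) simp
  moreover have "\<beta> * 1 \<in> (\<lambda>z. \<beta> * z) ` carrier (ring_ints K)" using K by (intro imageI) (simp add: subfield_one)
  hence "(\<lambda>z. \<beta> * z) ` carrier (ring_ints K) \<noteq> {0}" using \<beta>(3) by auto
  ultimately have "(\<lambda>z. z / of_nat n) ` ((\<lambda>z. \<beta> * z) ` carrier (ring_ints K)) \<in> carrier (frac_ideals K)"
    using n K by (intro frac_idealI) (auto simp: subfield_of_nat)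
  also have "(\<lambda>z. z / of_nat n) ` ((\<lambda>z. \<beta> * z) ` carrier (ring_ints K)) = (\<lambda>z. \<alpha> * z) ` carrier (ring_ints K)"
    unfolding image_image using n by (intro image_cong) (auto simp: \<beta>_def)
  finally show ?thesis .
qed

lemma principal_mult:
  "ideal_prod (ring_ints K) ((\<lambda>z. \<alpha> * z) ` carrier (ring_ints K)) ((\<lambda>z. \<beta> * z) ` carrier (ring_ints K)) =
     (\<lambda>z. \<alpha> * \<beta> * z) ` carrier (ring_ints K)"
proof -
  have "ideal_prod (ring_ints K) (carrier (ring_ints K)) (carrier (ring_ints K)) = carrier (ring_ints K)"
    by (rule OK.ideal_prod_one[OF OK.oneideal])
  thus ?thesis
    using ideal_prod_scale[of "inverse \<alpha>" "carrier (ring_ints K)" "inverse \<beta>" "carrier (ring_ints K)"]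
    by (simp add: divide_inverse mult_ac)
qed

lemma real_embedding:
  assumes "f \<in> ring_hom (field_rec K) (ring_of_type_algebra :: real ring)"
  shows "a \<in> K \<Longrightarrow> b \<in> K \<Longrightarrow> f (a * b) = f a * f b" "a \<in> K \<Longrightarrow> b \<in> K \<Longrightarrow> f (a + b) = f a + f b" "f 1 = 1"
  using assms by (auto simp: ring_hom_def ring_of_type_algebra_def)

lemma totally_positive_mult:
  "\<alpha> \<in> K \<Longrightarrow> \<beta> \<in> K \<Longrightarrow> totally_positive K \<alpha> \<Longrightarrow> totally_positive K \<beta> \<Longrightarrow> totally_positive K (\<alpha> * \<beta>)"
  unfolding totally_positive_def by (auto simp: real_embedding(1))

lemma totally_positive_of_nat: "n > 0 \<Longrightarrow> totally_positive K (of_nat n)"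
  unfolding totally_positive_def
proof (intro ballI)
  fix f assume f: "f \<in> ring_hom (field_rec K) (ring_of_type_algebra :: real ring)" and "n > 0"
  have "f 0 = 0" using real_embedding(2)[OF f, of 0 0] K by (simp add: subfield_zero)
  hence "f (of_nat m) = of_nat m" for m
    using K by (induction m) (simp_all add: real_embedding[OF f] subfield_of_nat subfield_one)
  thus "f (of_nat n) > 0" using \<open>n > 0\<close> by simp
qed

lemma totally_positive_inverse:
  assumes "\<alpha> \<in> K" "\<alpha> \<noteq> 0" "totally_positive K \<alpha>"
  shows "totally_positive K (inverse \<alpha>)"
  unfolding totally_positive_def
proof (intro ballI)
  fix f assume f: "f \<in> ring_hom (field_rec K) (ring_of_type_algebra :: real ring)"
  have "f (inverse \<alpha>) * f \<alpha> = 1"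
    using real_embedding(1)[OF f, of "inverse \<alpha>" \<alpha>] real_embedding(3)[OF f] assms K by (simp add: subfield_inverse)
  moreover have "f \<alpha> > 0" using assms f by (simp add: totally_positive_def)
  ultimately show "f (inverse \<alpha>) > 0" by (metis zero_less_mult_pos2 zero_less_one)
qed

lemma narrow_principalI: "\<alpha> \<in> K \<Longrightarrow> \<alpha> \<noteq> 0 \<Longrightarrow> totally_positive K \<alpha> \<Longrightarrow> (\<lambda>z. \<alpha> * z) ` carrier (ring_ints K) \<in> narrow_principal K"
  unfolding narrow_principal_def by blast

lemma narrow_principalE:
  assumes "A \<in> narrow_principal K"
  obtains \<alpha> where "\<alpha> \<in> K" "\<alpha> \<noteq> 0" "totally_positive K \<alpha>" "A = (\<lambda>z. \<alpha> * z) ` carrier (ring_ints K)"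
  using assms unfolding narrow_principal_def by blast

lemma narrow_principal_subset: "A \<in> narrow_principal K \<Longrightarrow> A \<in> carrier (frac_ideals K)"
proof -
  assume "A \<in> narrow_principal K"
  then obtain \<alpha> where "\<alpha> \<in> K" "\<alpha> \<noteq> 0" "A = (\<lambda>z. \<alpha> * z) ` carrier (ring_ints K)" by (rule narrow_principalE)
  thus ?thesis using principal_in_frac_ideals by blast
qed

lemma narrow_principal_mult:
  "A \<in> narrow_principal K \<Longrightarrow> B \<in> narrow_principal K \<Longrightarrow> ideal_prod (ring_ints K) A B \<in> narrow_principal K"
proof -
  assume "A \<in> narrow_principal K" "B \<in> narrow_principal K"
  then obtain \<alpha> \<beta> where "\<alpha> \<in> K" "\<alpha> \<noteq> 0" "totally_positive K \<alpha>" "A = (\<lambda>z. \<alpha> * z) ` carrier (ring_ints K)"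
    and "\<beta> \<in> K" "\<beta> \<noteq> 0" "totally_positive K \<beta>" "B = (\<lambda>z. \<beta> * z) ` carrier (ring_ints K)"
    unfolding narrow_principal_def by blast
  thus ?thesis using narrow_principalI[of "\<alpha> * \<beta>"] K
    by (simp add: principal_mult subfield_mult totally_positive_mult)
qed

lemma narrow_principal_one: "carrier (ring_ints K) \<in> narrow_principal K"
  using narrow_principalI[of 1] totally_positive_of_nat[of 1] K by (simp add: subfield_one)

lemma carrier_Cl: "carrier (Cl K) = ideal_class K ` carrier (frac_ideals K)"
  by (auto simp: Cl_def FactGroup_def RCOSETS_def ideal_class_def)

lemma ideal_class_eq: "ideal_class K I = (\<lambda>A. ideal_prod (ring_ints K) A I) ` narrow_principal K"
  by (auto simp: ideal_class_def r_coset_def)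

lemma one_Cl: "\<one>\<^bsub>Cl K\<^esub> = narrow_principal K"
  by (simp add: Cl_def FactGroup_def)

lemma ideal_class_mult:
  assumes I: "I \<in> carrier (frac_ideals K)" and J: "J \<in> carrier (frac_ideals K)"
  shows "ideal_class K I \<otimes>\<^bsub>Cl K\<^esub> ideal_class K J = ideal_class K (ideal_prod (ring_ints K) I J)"
proof -
  interpret FI: comm_monoid "frac_ideals K" by (rule frac_ideals_comm_monoid)
  let ?p = "ideal_prod (ring_ints K)"
  have "ideal_class K I \<otimes>\<^bsub>Cl K\<^esub> ideal_class K J = {?p (?p A I) (?p B J) |A B. A \<in> narrow_principal K \<and> B \<in> narrow_principal K}"
    by (auto simp: Cl_def FactGroup_def set_mult_def ideal_class_eq)
  also have "\<dots> = {?p (?p A B) (?p I J) |A B. A \<in> narrow_principal K \<and> B \<in> narrow_principal K}"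
  proof -
    have "?p (?p A I) (?p B J) = ?p (?p A B) (?p I J)" for A B
      by (metis ideal_prod_assoc_sets ideal_prod_comm)
    thus ?thesis by simp
  qed
  also have "\<dots> = ideal_class K (?p I J)"
  proof -
    have "?p A (carrier (ring_ints K)) = A" if "A \<in> narrow_principal K" for A
      using FI.r_one[OF narrow_principal_subset[OF that]] by simp
    hence "A \<in> {?p A B |A B. A \<in> narrow_principal K \<and> B \<in> narrow_principal K}" if "A \<in> narrow_principal K" for A
      using that narrow_principal_one by (intro CollectI exI[of _ A] exI[of _ "carrier (ring_ints K)"]) simp
    thus ?thesis unfolding ideal_class_eq using narrow_principal_mult by blast
  qed
  finally show ?thesis .
qed

lemma ideal_class_principal:
  assumes "\<alpha> \<in> K" "\<alpha> \<noteq> 0" "totally_positive K \<alpha>"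
  shows "ideal_class K ((\<lambda>z. \<alpha> * z) ` carrier (ring_ints K)) = \<one>\<^bsub>Cl K\<^esub>"
proof
  note N = narrow_principalI[OF assms]
  show "ideal_class K ((\<lambda>z. \<alpha> * z) ` carrier (ring_ints K)) \<subseteq> \<one>\<^bsub>Cl K\<^esub>"
    using narrow_principal_mult[OF _ N] by (auto simp: ideal_class_eq one_Cl)
  show "\<one>\<^bsub>Cl K\<^esub> \<subseteq> ideal_class K ((\<lambda>z. \<alpha> * z) ` carrier (ring_ints K))"
    unfolding one_Cl
  proof
    fix A assume "A \<in> narrow_principal K"
    then obtain \<beta> where \<beta>: "\<beta> \<in> K" "\<beta> \<noteq> 0" "totally_positive K \<beta>" "A = (\<lambda>z. \<beta> * z) ` carrier (ring_ints K)"
      by (rule narrow_principalE)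
    have "(\<lambda>z. \<beta> * inverse \<alpha> * z) ` carrier (ring_ints K) \<in> narrow_principal K"
      using assms \<beta> K by (intro narrow_principalI totally_positive_mult totally_positive_inverse subfield_mult subfield_inverse) auto
    moreover have "A = ideal_prod (ring_ints K) ((\<lambda>z. \<beta> * inverse \<alpha> * z) ` carrier (ring_ints K)) ((\<lambda>z. \<alpha> * z) ` carrier (ring_ints K))"
      unfolding principal_mult \<beta>(4) using assms(2) by (simp add: mult.assoc)
    ultimately show "A \<in> ideal_class K ((\<lambda>z. \<alpha> * z) ` carrier (ring_ints K))" unfolding ideal_class_eq by blast
  qed
qed

lemma Cl_comm_monoid: "comm_monoid (Cl K)"
proof -
  interpret FI: comm_monoid "frac_ideals K" by (rule frac_ideals_comm_monoid)
  have one: "\<one>\<^bsub>Cl K\<^esub> = ideal_class K (carrier (ring_ints K))"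
    using ideal_class_principal[of 1] totally_positive_of_nat[of 1] K by (simp add: subfield_one)
  have oneF: "carrier (ring_ints K) \<in> carrier (frac_ideals K)" using FI.one_closed by simp
  have mF: "ideal_prod (ring_ints K) I J \<in> carrier (frac_ideals K)"
    if "I \<in> carrier (frac_ideals K)" "J \<in> carrier (frac_ideals K)" for I J
    using FI.m_closed[OF that] by simp
  show ?thesis
  proof (rule comm_monoidI)
    show "\<one>\<^bsub>Cl K\<^esub> \<in> carrier (Cl K)" unfolding one carrier_Cl using oneF by (rule imageI)
    fix x assume "x \<in> carrier (Cl K)"
    then obtain I where I: "I \<in> carrier (frac_ideals K)" "x = ideal_class K I" unfolding carrier_Cl by blast
    show "\<one>\<^bsub>Cl K\<^esub> \<otimes>\<^bsub>Cl K\<^esub> x = x"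
      unfolding one I(2) ideal_class_mult[OF oneF I(1)] using FI.l_one[OF I(1)] by simp
    fix y assume "y \<in> carrier (Cl K)"
    then obtain J where J: "J \<in> carrier (frac_ideals K)" "y = ideal_class K J" unfolding carrier_Cl by blast
    show "x \<otimes>\<^bsub>Cl K\<^esub> y \<in> carrier (Cl K)"
      unfolding I(2) J(2) ideal_class_mult[OF I(1) J(1)] carrier_Cl by (intro imageI mF I J)
    show "x \<otimes>\<^bsub>Cl K\<^esub> y = y \<otimes>\<^bsub>Cl K\<^esub> x"
      unfolding I(2) J(2) ideal_class_mult[OF I(1) J(1)] ideal_class_mult[OF J(1) I(1)] by (simp add: ideal_prod_comm)
    fix z assume "z \<in> carrier (Cl K)"
    then obtain H where H: "H \<in> carrier (frac_ideals K)" "z = ideal_class K H" unfolding carrier_Cl by blast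
    show "x \<otimes>\<^bsub>Cl K\<^esub> y \<otimes>\<^bsub>Cl K\<^esub> z = x \<otimes>\<^bsub>Cl K\<^esub> (y \<otimes>\<^bsub>Cl K\<^esub> z)"
      unfolding I(2) J(2) H(2) ideal_class_mult[OF I(1) J(1)] ideal_class_mult[OF J(1) H(1)]
        ideal_class_mult[OF mF[OF I(1) J(1)] H(1)] ideal_class_mult[OF I(1) mF[OF J(1) H(1)]]
        ideal_prod_assoc_sets ..
  qed
qed

end

text \<open>The power map whose exponent is the norm is a homomorphism modulo \<open>R\<close> and
  trivial on the integers of \<open>K\<close>, so it is congruent to an automorphism over
  \<open>K\<close>.\<close>

lemma frob_elts_exists:
  assumes K: "subfield K ring_of_type_algebra" and R: "primeideal R (ring_ints UNIV)"
    and l: "prime l" "of_nat l \<in> R" and norm: "abs_norm K (R \<inter> K) = l ^ k"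
    and fix_K: "\<And>z. z \<in> carrier (ring_ints K) \<Longrightarrow> z ^ (l ^ k) - z \<in> R"
  shows "\<exists>\<sigma>. \<sigma> \<in> frob_elts K UNIV R"
proof -
  have Ri: "ideal R (ring_ints UNIV)" by (rule R_ideal[OF R])
  have "\<exists>h\<in>gal UNIV K. \<forall>z. algebraic_int z \<longrightarrow> z ^ (l ^ k) - h z \<in> R"
  proof (rule conjugate_modulo_prime_all[OF R K])
    show "algebraic_int (x ^ (l ^ k))" if "algebraic_int x" for x :: qbar using that by (rule algebraic_int_power)
    show "(x + y) ^ (l ^ k) - (x ^ (l ^ k) + y ^ (l ^ k)) \<in> R" if "algebraic_int x" "algebraic_int y" for x y
      by (rule frobenius_power_add[OF Ri l that])
    show "(x * y) ^ (l ^ k) - x ^ (l ^ k) * y ^ (l ^ k) \<in> R" for x y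
      using ideal_zero[OF subfield_UNIV Ri] by (simp add: power_mult_distrib)
  qed (use fix_K in auto)
  then obtain h where h: "h \<in> gal UNIV K" "\<And>z. algebraic_int z \<Longrightarrow> z ^ (l ^ k) - h z \<in> R" by blast
  have "h z - z ^ (l ^ k) \<in> R" if "algebraic_int z" for z
    using ideal_uminus[OF subfield_UNIV Ri h(2)[OF that]] by simp
  thus ?thesis using h(1) by (auto simp: frob_elts_def norm)
qed

section \<open>Characters of the class group are determined by the primes\<close>

context real_quadratic
begin

lemma residue_system_K:
  assumes "m > 0"
  shows "\<exists>T. residue_system K m T"
proof (rule residue_system_exists[OF K_subfield _ _ assms])
  show "finite {1, w}" by simp
  show "K \<subseteq> Qvs.span {1, w}"
  proof
    fix z assume "z \<in> K"
    then obtain r t where z: "z = of_rat r * 1 + of_rat t * w" unfolding K_eq by auto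
    show "z \<in> Qvs.span {1, w}" unfolding z by (intro Qvs.span_add Qvs.span_scale Qvs.span_base) simp_all
  qed
qed

lemma nonzero_prime_frobenius:
  assumes P: "nonzero_prime K P"
  obtains R \<sigma> where "nonzero_prime UNIV R" "R \<inter> K = P" "\<sigma> \<in> frob_elts K UNIV R"
proof -
  obtain l where l: "prime l" "of_nat l \<in> P"
    by (rule nonzero_prime_contains_prime[OF K_subfield P]) blast
  have Pp: "primeideal P (ring_ints K)" using P by (simp add: nonzero_prime_def)
  obtain R where R: "primeideal R (ring_ints (UNIV :: qbar set))" "R \<inter> K = P"
    by (rule lying_over[OF K_subfield Pp]) blast
  obtain k where k: "abs_norm K P = l ^ k" "\<And>z. z \<in> carrier (ring_ints K) \<Longrightarrow> z ^ (l ^ k) - z \<in> P"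
    by (rule abs_norm_prime[OF P l]) blast
  have lR: "of_nat l \<in> R" using l R by blast
  have "\<exists>\<sigma>. \<sigma> \<in> frob_elts K UNIV R"
    by (rule frob_elts_exists[OF K_subfield R(1) l(1) lR]) (use k R(2) in auto)
  then obtain \<sigma> where "\<sigma> \<in> frob_elts K UNIV R" by blast
  moreover have "R \<noteq> {0}" using lR prime_gt_0_nat[OF l(1)] by (metis of_nat_0_eq_iff order_less_irrefl singletonD)
  hence "nonzero_prime UNIV R" using R by (simp add: nonzero_prime_def)
  ultimately show ?thesis using that R(2) by blast
qed

text \<open>Every nonzero ideal is a product of primes: peel off a maximal ideal above it.\<close>
lemma dual_Cl_eqI:
  assumes f: "f \<in> carrier (dual (Cl K))" and f': "f' \<in> carrier (dual (Cl K))"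
    and primes: "\<And>P. nonzero_prime K P \<Longrightarrow> f (ideal_class K P) = f' (ideal_class K P)"
  shows "f = f'"
proof -
  interpret OK: cring "ring_ints K" by (rule cring_ring_ints) (rule K_subfield)
  interpret Cl: comm_monoid "Cl K" by (rule Cl_comm_monoid[OF K_subfield])
  note pm = ideal_class_mult[OF K_subfield] and frac = ideal_in_frac_ideals[OF K_subfield]
  have cls: "ideal_class K I \<in> carrier (Cl K)" if "I \<in> carrier (frac_ideals K)" for I
    unfolding carrier_Cl[OF K_subfield] using that by (rule imageI)
  have ideals: "f (ideal_class K J) = f' (ideal_class K J)"
    if J: "ideal J (ring_ints K)" "of_nat m \<in> J" and m: "m > 0" for J and m :: nat
  proof -
    obtain T where T: "residue_system K m T" using residue_system_K[OF m] by blast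
    have finT: "finite T" using T by (simp add: residue_system_def)
    have split: "\<exists>t u. t \<in> T \<inter> I \<and> u \<in> carrier (ring_ints K) \<and> z = t + u * of_nat m"
      if I: "ideal I (ring_ints K)" "of_nat m \<in> I" and z: "z \<in> I" for I z
    proof -
      have zO: "z \<in> carrier (ring_ints K)" using ideal_closed[OF K_subfield I(1)] z by simp
      then obtain t where t: "t \<in> T" "algebraic_int ((z - t) / of_nat m)"
        using T unfolding residue_system_def by blast
      have "t \<in> K" using t(1) T by (auto simp: residue_system_def)
      define u where "u = (z - t) / of_nat m"
      have u: "u \<in> carrier (ring_ints K)"
        using t zO \<open>t \<in> K\<close> K_subfield by (simp add: u_def subfield_divide subfield_diff subfield_of_nat)
      have eq: "z = t + u * of_nat m" using m by (simp add: u_def)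
      have "u * of_nat m \<in> I" using ideal_mult[OF K_subfield I] u by simp
      from ideal_diff[OF K_subfield I(1) z this] have "t \<in> I" unfolding eq by simp
      thus ?thesis using t(1) u eq by blast
    qed
    have det: "I \<subseteq> I'" if hyps: "ideal I (ring_ints K)" "of_nat m \<in> I" "ideal I' (ring_ints K)" "of_nat m \<in> I'" "T \<inter> I \<subseteq> I'" for I I'
    proof
      fix z assume "z \<in> I"
      then obtain t u where "t \<in> T \<inter> I" "u \<in> carrier (ring_ints K)" "z = t + u * of_nat m"
        using split[OF hyps(1,2)] by blast
      thus "z \<in> I'" using hyps(5) ideal_mult[OF K_subfield hyps(3,4), of u] ideal_add[OF K_subfield hyps(3), of t "u * of_nat m"] by auto
    qed
    show ?thesis using J
    \<comment> \<open>An ideal containing \<open>m\<close> is determined by the representatives that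
      it contains, so a strictly larger ideal leaves out fewer elements of \<open>T\<close>.\<close>
    proof (induction "card (T - J)" arbitrary: J rule: less_induct)
      case less
      note J = less.prems
      show ?case
      proof (cases "J = carrier (ring_ints K)")
        case True
        have "ideal_class K J = \<one>\<^bsub>Cl K\<^esub>"
          using ideal_class_principal[OF K_subfield, of 1] totally_positive_of_nat[OF K_subfield, of 1] K_subfield
          by (simp add: True subfield_one)
        thus ?thesis using dual_one[OF Cl.monoid_axioms f] dual_one[OF Cl.monoid_axioms f'] by simp
      next
        case False
        \<comment> \<open>Among the proper ideals above \<open>J\<close>, one that contains the
          greatest number of representatives is a maximal ideal.\<close>
        define M where "M = (\<lambda>I. ideal I (ring_ints K) \<and> J \<subseteq> I \<and> I \<noteq> carrier (ring_ints K))"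
        have "M J" using J False by (simp add: M_def)
        moreover have "\<forall>I. M I \<longrightarrow> card (T \<inter> I) < Suc (card T)" using finT by (simp add: card_mono less_Suc_eq_le)
        ultimately obtain P where P: "M P" "\<forall>I. M I \<longrightarrow> card (T \<inter> I) \<le> card (T \<inter> P)"
          using ex_has_greatest_nat[of M J "\<lambda>I. card (T \<inter> I)"] by blast
        have Pi: "ideal P (ring_ints K)" and JP: "J \<subseteq> P" and PO: "P \<noteq> carrier (ring_ints K)" using P(1) by (auto simp: M_def)
        have mP: "of_nat m \<in> P" using J JP by blast
        have "maximalideal P (ring_ints K)"
        proof (rule maximalidealI[OF Pi])
          show "carrier (ring_ints K) \<noteq> P" using PO by simp
          fix I assume I: "ideal I (ring_ints K)" "P \<subseteq> I" "I \<subseteq> carrier (ring_ints K)"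
          show "I = P \<or> I = carrier (ring_ints K)"
          proof (rule disjCI)
            assume "I \<noteq> carrier (ring_ints K)"
            hence "M I" using I JP by (auto simp: M_def)
            hence "card (T \<inter> I) \<le> card (T \<inter> P)" using P(2) by blast
            hence "T \<inter> P = T \<inter> I" using I(2) finT by (intro card_seteq) blast+
            hence TI: "T \<inter> I \<subseteq> P" by blast
            have "of_nat m \<in> I" using mP I(2) by blast
            from det[OF I(1) this Pi mP TI] have "I \<subseteq> P" .
            thus "I = P" using I(2) by blast
          qed
        qed
        hence Pp: "primeideal P (ring_ints K)" by (rule OK.maximalideal_prime)
        have "P \<noteq> {0}" using mP m by auto
        hence nP: "nonzero_prime K P" using Pp by (simp add: nonzero_prime_def)
        have P1: "1 \<notin> P" using Pp by (simp add: primeideal_ring_ints_iff[OF K_subfield])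
        obtain l where l: "prime l" "of_nat l \<in> P" by (rule nonzero_prime_contains_prime[OF K_subfield nP]) blast
        have l0: "(of_nat l :: qbar) \<noteq> 0" using prime_gt_0_nat[OF l(1)] by simp
        obtain P' where P': "ideal P' (ring_ints K)"
            "ideal_prod (ring_ints K) P P' = (\<lambda>z. of_nat l * z) ` carrier (ring_ints K)"
          by (rule prime_ideal_invertible[OF nP l]) blast
        \<comment> \<open>The quotient of \<open>J\<close> by \<open>P\<close>, since
          \<open>P'\<close> divided by \<open>l\<close> is the inverse of \<open>P\<close>.\<close>
        define J' where "J' = (\<lambda>z. z / of_nat l) ` ideal_prod (ring_ints K) J P'"
        have JP'i: "ideal (ideal_prod (ring_ints K) J P') (ring_ints K)" by (rule ideal_prod_ring_ints[OF K_subfield J(1) P'(1)])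
        note JPc = ideal_closed[OF K_subfield JP'i]
        have J'O: "y / of_nat l \<in> carrier (ring_ints K)" if "y \<in> ideal_prod (ring_ints K) J P'" for y
        proof -
          have "y \<in> (\<lambda>z. of_nat l * z) ` carrier (ring_ints K)"
            using that ideal_prod_mono[OF K_subfield JP, of P' P'] P'(2) by blast
          then obtain u where "y = of_nat l * u" "u \<in> carrier (ring_ints K)" by (rule imageE)
          thus ?thesis using l0 by simp
        qed
        have J'i: "ideal J' (ring_ints K)"
          unfolding ideal_ring_ints_iff[OF K_subfield]
        proof (intro conjI ballI allI impI)
          show "0 \<in> J'" unfolding J'_def using JPc(3) by (intro image_eqI[of _ _ 0]) auto
          fix y assume "y \<in> J'"
          then obtain u where u: "y = u / of_nat l" "u \<in> ideal_prod (ring_ints K) J P'" unfolding J'_def by (rule imageE)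
          show "y \<in> K" "algebraic_int y" using J'O[OF u(2)] by (simp_all add: u(1))
          show "y + y' \<in> J'" if y': "y' \<in> J'" for y'
          proof -
            obtain u' where u': "y' = u' / of_nat l" "u' \<in> ideal_prod (ring_ints K) J P'"
              using y' unfolding J'_def by (rule imageE)
            show ?thesis unfolding J'_def
              by (rule image_eqI[of _ _ "u + u'"]) (simp_all add: u u' add_divide_distrib JPc(4))
          qed
          show "v * y \<in> J'" if "v \<in> K" "algebraic_int v" for v
            unfolding J'_def using JPc(5)[OF u(2) that] by (intro image_eqI[of _ _ "v * u"]) (simp_all add: u(1))
        qed
        have PJ': "ideal_prod (ring_ints K) P J' = J"
        proof -
          have "ideal_prod (ring_ints K) P J' = (\<lambda>z. z / of_nat l) ` ideal_prod (ring_ints K) P (ideal_prod (ring_ints K) J P')"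
            using ideal_prod_scale[OF K_subfield, of 1 P "of_nat l" "ideal_prod (ring_ints K) J P'"] by (simp add: J'_def)
          also have "ideal_prod (ring_ints K) P (ideal_prod (ring_ints K) J P') = ideal_prod (ring_ints K) J (ideal_prod (ring_ints K) P P')"
            by (metis ideal_prod_assoc_sets[OF K_subfield] ideal_prod_comm[OF K_subfield])
          also have "\<dots> = (\<lambda>z. z * of_nat l) ` ideal_prod (ring_ints K) J (carrier (ring_ints K))"
            using ideal_prod_scale[OF K_subfield, of 1 J "inverse (of_nat l)" "carrier (ring_ints K)"]
            by (simp add: P'(2) divide_inverse mult.commute)
          also have "ideal_prod (ring_ints K) J (carrier (ring_ints K)) = J" by (rule OK.ideal_prod_one[OF J(1)])
          also have "(\<lambda>z. z / of_nat l) ` (\<lambda>z. z * of_nat l) ` J = J" using l0 by (simp add: image_image)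
          finally show ?thesis .
        qed
        have JJ': "J \<subseteq> J'" using OK.ideal_prod_inter[OF Pi J'i] PJ' by blast
        \<comment> \<open>If division by \<open>P\<close> did not enlarge \<open>J\<close>, then
          \<open>J\<close> would equal its product with \<open>P\<close> and lie in every power of
          \<open>P\<close>, but some power misses \<open>m\<close>.\<close>
        have "\<not> J' \<subseteq> J"
        proof
          assume "J' \<subseteq> J"
          hence "J' = J" using JJ' by blast
          hence eq: "ideal_prod (ring_ints K) P J = J" using PJ' by simp
          have "J \<subseteq> ideal_pow K P e" for e
          proof (induction e)
            case 0
            thus ?case using ideal_closed[OF K_subfield J(1)] by auto
          next
            case (Suc e)
            have "J = ideal_prod (ring_ints K) J P" using eq ideal_prod_comm[OF K_subfield] by metis
            also have "\<dots> \<subseteq> ideal_prod (ring_ints K) (ideal_pow K P e) P" by (rule ideal_prod_mono[OF K_subfield Suc]) simp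
            finally show ?case by simp
          qed
          moreover obtain e where "of_nat m \<notin> ideal_pow K P e"
            by (rule integer_notin_ideal_pow[OF K_subfield Pi T m P1]) blast
          ultimately show False using J(2) by blast
        qed
        have mJ': "of_nat m \<in> J'" using J(2) JJ' by blast
        have "\<not> T \<inter> J' \<subseteq> J" using det[OF J'i mJ' J] \<open>\<not> J' \<subseteq> J\<close> by blast
        hence "T - J' \<subset> T - J" using JJ' by blast
        hence "card (T - J') < card (T - J)" using finT by (intro psubset_card_mono) auto
        from less.hyps[OF this J'i mJ'] have IH: "f (ideal_class K J') = f' (ideal_class K J')" .
        have "J' \<noteq> {0}" using mJ' m by auto
        note fr = frac[OF Pi \<open>P \<noteq> {0}\<close>] frac[OF J'i \<open>J' \<noteq> {0}\<close>]
        have "ideal_class K J = ideal_class K P \<otimes>\<^bsub>Cl K\<^esub> ideal_class K J'" using pm[OF fr] PJ' by simp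
        thus ?thesis
          using dual_mult[OF f cls[OF fr(1)] cls[OF fr(2)]] dual_mult[OF f' cls[OF fr(1)] cls[OF fr(2)]] IH primes[OF nP] by simp
      qed
    qed
  qed
  have ideals': "f (ideal_class K J) = f' (ideal_class K J)" if "ideal J (ring_ints K)" "J \<noteq> {0}" for J
    using nonzero_ideal_contains_nat[OF K_subfield that] ideals[OF that(1)] by blast
  have "f c = f' c" if "c \<in> carrier (Cl K)" for c
  proof -
    have "c \<in> ideal_class K ` carrier (frac_ideals K)" using that unfolding carrier_Cl[OF K_subfield] .
    then obtain I where I: "I \<in> carrier (frac_ideals K)" "c = ideal_class K I" by fast
    obtain J d where J: "ideal J (ring_ints K)" "J \<noteq> {0}" "d \<in> carrier (ring_ints K)" "d \<noteq> 0" "I = (\<lambda>z. z / d) ` J"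
      using frac_idealE[OF K_subfield I(1)] by blast
    \<comment> \<open>The fractional ideal \<open>J / d\<close> times the principal ideal of
      \<open>d\<close> is \<open>J\<close>. The case of integral ideals covers both, whether or not
      \<open>d\<close> is totally positive.\<close>
    define D where "D = (\<lambda>z. d * z) ` carrier (ring_ints K)"
    have Di: "ideal D (ring_ints K)" unfolding D_def by (rule principal_ideal[OF K_subfield J(3)])
    have "d * 1 \<in> D" unfolding D_def using OK.one_closed by (intro imageI) simp
    hence D0: "D \<noteq> {0}" using J(4) by auto
    have "ideal_prod (ring_ints K) I D = J"
      using ideal_prod_scale[OF K_subfield, of d J "inverse d" "carrier (ring_ints K)"] OK.ideal_prod_one[OF J(1)] J(4)
      by (simp add: J(5) D_def divide_inverse mult.commute)
    hence "ideal_class K I \<otimes>\<^bsub>Cl K\<^esub> ideal_class K D = ideal_class K J" using pm[OF I(1) frac[OF Di D0]] by simp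
    hence "f (ideal_class K I) + f (ideal_class K D) = f (ideal_class K J)"
      "f' (ideal_class K I) + f' (ideal_class K D) = f' (ideal_class K J)"
      using dual_mult[OF f cls[OF I(1)] cls[OF frac[OF Di D0]]] dual_mult[OF f' cls[OF I(1)] cls[OF frac[OF Di D0]]] by simp_all
    thus ?thesis using ideals'[OF Di D0] ideals'[OF J(1,2)] by (metis I(2) add_right_cancel)
  qed
  thus ?thesis using f f' by (intro extensionalityI[of _ "carrier (Cl K)"]) (auto simp: dual_def)
qed

text \<open>Every prime of \<open>K\<close> has a Frobenius element above it, so the map prescribes
  the values at all prime classes. This makes the \<open>THE\<close> in \<open>as_Cl_char\<close>
  well defined.\<close>

lemma corresponds_Cl_unique:
  assumes "corresponds_Cl K f \<phi>" "corresponds_Cl K f' \<phi>"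
  shows "f = f'"
proof (rule dual_Cl_eqI)
  fix P assume "nonzero_prime K P"
  then obtain R \<sigma> where "nonzero_prime UNIV R" "R \<inter> K = P" "\<sigma> \<in> frob_elts K UNIV R"
    by (rule nonzero_prime_frobenius)
  thus "f (ideal_class K P) = f' (ideal_class K P)" using assms unfolding corresponds_Cl_def by metis
qed (use assms in \<open>simp_all add: corresponds_Cl_def\<close>)

lemma as_Cl_char_eq: "corresponds_Cl K f \<phi> \<Longrightarrow> as_Cl_char K \<phi> = f"
  unfolding as_Cl_char_def using corresponds_Cl_unique by (intro the_equality) auto

lemma ram_in_frac_ideals: "b dvd x \<Longrightarrow> ram b \<in> carrier (frac_ideals K)"
proof (rule ideal_in_frac_ideals[OF K_subfield ram_ideal])
  assume "b dvd x"
  hence "b > 0" by (rule b_pos)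
  thus "ram b \<noteq> {0}" using of_nat_in_ram[of b] by auto
qed

text \<open>The square of \<open>ram b\<close> is generated by the positive integer
  \<open>b\<close>, which is totally positive; hence the relation holds even in the narrow
  sense.\<close>

lemma ideal_class_ram_square:
  assumes b: "b dvd x"
  shows "ideal_class K (ram b) \<otimes>\<^bsub>Cl K\<^esub> ideal_class K (ram b) = \<one>\<^bsub>Cl K\<^esub>"
  unfolding ideal_class_mult[OF K_subfield ram_in_frac_ideals[OF b] ram_in_frac_ideals[OF b]] ram_square[OF b]
  using b_pos[OF b] K_subfield
  by (intro ideal_class_principal[OF K_subfield] totally_positive_of_nat[OF K_subfield]) (auto simp: subfield_of_nat)

end

section \<open>Frobenius elements over two quadratic fields\<close>

lemma frob_elts_GQ: "subfield K ring_of_type_algebra \<Longrightarrow> \<tau> \<in> frob_elts K UNIV R \<Longrightarrow> \<tau> \<in> GQ"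
  using gal_UNIV_subset_GQ unfolding frob_elts_def by blast

lemma of_F2_eq_zero_iff [simp]: "of_F2 e = 0 \<longleftrightarrow> e = 0"
proof -
  have "half \<noteq> 0"
  proof
    assume "half = 0"
    hence "(1 / 2 :: rat) - 0 \<in> \<int>" by transfer blast
    then obtain n :: int where "(1 / 2 :: rat) = of_int n" by (auto elim: Ints_cases)
    hence "(of_int (2 * n) :: rat) = of_int 1" by (simp add: field_simps)
    hence "2 * n = 1" by (simp only: of_int_eq_iff)
    thus False by presburger
  qed
  thus ?thesis by (simp add: of_F2_def)
qed

context real_quadratic
begin

lemma ideal_class_carrier: "I \<in> carrier (frac_ideals K) \<Longrightarrow> ideal_class K I \<in> carrier (Cl K)"
  unfolding carrier_Cl[OF K_subfield] by (rule imageI)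

lemma dual_ram_torsion:
  assumes f: "f \<in> carrier (dual (Cl K))" and b: "b dvd x"
  shows "nmult 2 (f (ideal_class K (ram b))) = 0"
proof -
  interpret Cl: comm_monoid "Cl K" by (rule Cl_comm_monoid[OF K_subfield])
  have c: "ideal_class K (ram b) \<in> carrier (Cl K)" by (rule ideal_class_carrier[OF ram_in_frac_ideals[OF b]])
  have "f (ideal_class K (ram b)) + f (ideal_class K (ram b)) = 0"
    using dual_mult[OF f c c] ideal_class_ram_square[OF b] dual_one[OF Cl.monoid_axioms f] by simp
  thus ?thesis by (simp add: numeral_2_eq_2)
qed

lemma frob_ramified_iff:
  assumes R: "primeideal R (ring_ints UNIV)" and l: "prime l" "of_nat l \<in> R" "l dvd x"
  shows "\<sigma> \<in> frob_elts K UNIV R \<longleftrightarrow> \<sigma> \<in> gal UNIV K \<and> (\<forall>z. algebraic_int z \<longrightarrow> \<sigma> z - z ^ l \<in> R)"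
  by (auto simp add: frob_elts_def restrict_ramified_prime(1)[OF R l] abs_norm_ram[OF l(3)])

text \<open>Modulo the ramified prime every integer of \<open>K\<close> is a rational integer, so
  Fermat's little theorem makes the \<open>l\<close>-th power map trivial there.\<close>

lemma frob_ramified_exists:
  assumes R: "primeideal R (ring_ints UNIV)" and l: "prime l" "of_nat l \<in> R" "l dvd x"
  obtains \<sigma> where "\<sigma> \<in> frob_elts K UNIV R"
proof -
  have "\<exists>\<sigma>. \<sigma> \<in> frob_elts K UNIV R"
  proof (rule frob_elts_exists[OF K_subfield R l(1,2), of 1])
    show "abs_norm K (R \<inter> K) = l ^ 1" using restrict_ramified_prime(1)[OF R l] abs_norm_ram[OF l(3)] by simp
    fix z assume z: "z \<in> carrier (ring_ints K)"
    then obtain n where "z - of_int n \<in> ram l" using ram_residue[OF l(3)] by blast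
    hence n: "z - of_int n \<in> R" using restrict_ramified_prime(1)[OF R l] by blast
    have "z ^ l - of_int n ^ l \<in> R" using power_cong[OF R_ideal[OF R] l(1,2) _ _ n] z by simp
    moreover have "of_int n ^ l - of_int n \<in> R" by (rule fermat_int[OF R_ideal[OF R] l(1,2)])
    ultimately have "(z ^ l - of_int n ^ l) + (of_int n ^ l - of_int n) \<in> R" by (rule R_closed(4)[OF R])
    hence "(z ^ l - of_int n ^ l) + (of_int n ^ l - of_int n) - (z - of_int n) \<in> R" using n by (rule R_closed(8)[OF R])
    thus "z ^ (l ^ 1) - z \<in> R" by simp
  qed
  thus ?thesis using that by blast
qed

text \<open>Every automorphism acts trivially on the integers of \<open>K\<close> modulo a prime
  above a ramified one. So the inverse \<open>F\<close> of a conjugation \<open>c\<close> is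
  congruent to some \<open>h\<close> fixing \<open>K\<close>, and \<open>h\<close> after
  \<open>c\<close> is trivial modulo \<open>R\<close> but still moves \<open>w\<close>.\<close>

lemma inertia_moves_sqrt:
  assumes R: "primeideal R (ring_ints UNIV)" and l: "prime l" "of_nat l \<in> R" "l dvd x"
  obtains \<iota> where "\<iota> \<in> GQ" "\<And>z. algebraic_int z \<Longrightarrow> \<iota> z - z \<in> R" "\<iota> w = - w"
proof -
  obtain c where c: "c \<in> GQ" "c w = - w" by (rule conjugation)
  define F where "F = inv_into UNIV c"
  have F: "F \<in> GQ" unfolding F_def by (rule gal_UNIV_inv[OF c(1)])
  have Fw: "F w = - w" using inv_gal_apply[OF c(1), of "- w"] c(2) gal_minus[OF c(1), of w] by (simp add: F_def)
  have "\<exists>h\<in>gal UNIV K. \<forall>z. algebraic_int z \<longrightarrow> F z - h z \<in> R"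
  proof (rule conjugate_modulo_prime_all[OF R K_subfield])
    fix u assume u: "algebraic_int u" "u \<in> K"
    then obtain n where n: "u - of_int n \<in> ram l" using ram_residue[OF l(3), of u] by auto
    \<comment> \<open>Up to a rational integer, \<open>u\<close> is an element \<open>v\<close> for
      which \<open>v ^ 2 / l\<close> is integral. Integrality survives \<open>F\<close>, so the
      square of \<open>F v\<close> is a multiple of \<open>l\<close> and \<open>F v\<close> lies in
      \<open>R\<close>.\<close>
    define v where "v = u - of_int n"
    have v: "v \<in> R" using n restrict_ramified_prime(1)[OF R l] by (auto simp: v_def)
    have "algebraic_int (v ^ 2 / of_nat l)" using n by (simp add: ram_def v_def)
    hence "algebraic_int (F (v ^ 2 / of_nat l))" by (rule GQ_algebraic_int[OF F])
    hence "of_nat l * F (v ^ 2 / of_nat l) \<in> R" using l(2) R_closed(6)[OF R] by simp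
    moreover have "of_nat l * F (v ^ 2 / of_nat l) = F v ^ 2"
    proof -
      have "F (of_nat l * (v ^ 2 / of_nat l)) = of_nat l * F (v ^ 2 / of_nat l)"
        by (simp only: gal_mult[OF F] gal_fixes[OF F Rats_of_nat])
      moreover have "of_nat l * (v ^ 2 / of_nat l) = v ^ 2" using prime_gt_0_nat[OF l(1)] by simp
      ultimately show ?thesis using gal_power[OF F, of v 2] by metis
    qed
    ultimately have "F v * F v \<in> R" by (simp add: power2_eq_square)
    moreover have "algebraic_int (F v)" using R_closed(2)[OF R v] by (rule GQ_algebraic_int[OF F])
    ultimately have "F v \<in> R" using R_prime[OF R] by blast
    hence "F v - v \<in> R" using v by (rule R_closed(8)[OF R])
    moreover have "F v = F u - of_int n" using gal_diff[OF F, of u "of_int n"] gal_fixes[OF F, of "of_int n"] by (simp add: v_def)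
    ultimately show "F u - u \<in> R" by (simp add: v_def)
  next
    show "F (u + v) - (F u + F v) \<in> R" for u v using R_closed(3)[OF R] gal_add[OF F, of u v] by simp
    show "F (u * v) - F u * F v \<in> R" for u v using R_closed(3)[OF R] gal_mult[OF F, of u v] by simp
  qed (rule GQ_algebraic_int[OF F])
  then obtain h where h: "h \<in> gal UNIV K" "\<And>z. algebraic_int z \<Longrightarrow> F z - h z \<in> R" by blast
  have hQ: "h \<in> GQ" using h(1) gal_UNIV_subset_GQ[OF K_subfield] by blast
  show thesis
  proof (rule that[of "\<lambda>z. h (c z)"])
    show "(\<lambda>z. h (c z)) \<in> GQ" by (rule gal_UNIV_comp[OF hQ c(1)])
    show "h (c w) = - w" using c(2) gal_minus[OF hQ, of w] h(1) gal_K_iff by simp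
    fix z :: qbar assume "algebraic_int z"
    hence "F (c z) - h (c z) \<in> R" by (intro h(2) GQ_algebraic_int[OF c(1)])
    hence "- (F (c z) - h (c z)) \<in> R" by (rule R_closed(7)[OF R])
    thus "h (c z) - z \<in> R" using inv_gal_apply[OF c(1), of z] by (simp add: F_def)
  qed
qed

end

lemma frobenius_transfer:
  assumes A: "real_quadratic a u" and dvd: "a dvd x" and X: "real_quadratic x w"
    and R: "primeideal R (ring_ints UNIV)" and l: "prime l" "of_nat l \<in> R" "l dvd a"
    and f: "corresponds_Cl (quad_field (int x)) f \<phi>"
    and \<phi>: "\<And>\<sigma>. \<sigma> \<in> GQ \<Longrightarrow> nmult (2 ^ s) (\<phi> \<sigma>) = of_F2 (quad_char (int a) \<sigma>)" and s: "s \<ge> 1"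
    and \<tau>: "\<tau> \<in> frob_elts (quad_field (int a)) UNIV R"
  shows "\<tau> \<in> frob_elts (quad_field (int x)) UNIV R"
    "\<phi> \<tau> = f (ideal_class (quad_field (int x)) (Up (quad_field (int x)) l))"
    "nmult 2 (\<phi> \<tau>) = 0"
proof -
  interpret A: real_quadratic a u by (rule A)
  interpret X: real_quadratic x w by (rule X)
  have lx: "l dvd x" using l(3) dvd by (rule dvd_trans)
  note lX = l(1,2) lx
  define c where "c = ideal_class X.K (X.ram l)"
  have f': "f \<in> carrier (dual (Cl X.K))" using f by (simp add: corresponds_Cl_def X.K_def)
  have two: "nmult 2 (f c) = 0" unfolding c_def by (rule X.dual_ram_torsion[OF f' lx])
  have \<phi>_frob: "\<phi> \<rho> = f c" if "\<rho> \<in> frob_elts X.K UNIV R" for \<rho>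
  proof -
    have "R \<noteq> {0}" using l(2) prime_gt_0_nat[OF l(1)] by auto
    hence "nonzero_prime UNIV R" using R by (simp add: nonzero_prime_def)
    thus ?thesis using f that by (simp add: corresponds_Cl_def X.K_def[symmetric] c_def X.restrict_ramified_prime(1)[OF R lX])
  qed
  \<comment> \<open>The value of \<open>\<phi>\<close> at such an element is two-torsion, and
    \<open>2 ^ s\<close> is even because \<open>s \<ge> 1\<close>.\<close>
  have fixes_u: "quad_char (int a) \<rho> = 0" if \<rho>: "\<rho> \<in> frob_elts X.K UNIV R" for \<rho>
  proof -
    have "\<rho> \<in> GQ" by (rule frob_elts_GQ[OF X.K_subfield \<rho>])
    moreover have "(2::nat) ^ s = 2 ^ (s - 1) * 2" using s by (simp add: power_eq_if)
    ultimately have "of_F2 (quad_char (int a) \<rho>) = nmult (2 ^ (s - 1) * 2) (\<phi> \<rho>)" using \<phi>[of \<rho>] by simp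
    also have "\<dots> = 0" using two \<phi>_frob[OF \<rho>] by (simp add: nmult_mult)
    finally show ?thesis by simp
  qed
  obtain \<sigma> where \<sigma>: "\<sigma> \<in> frob_elts X.K UNIV R" by (rule X.frob_ramified_exists[OF R lX])
  note \<sigma>' = \<sigma>[unfolded X.frob_ramified_iff[OF R lX]]
  have \<sigma>Q: "\<sigma> \<in> GQ" by (rule frob_elts_GQ[OF X.K_subfield \<sigma>])
  note \<tau>' = \<tau>[folded A.K_def, unfolded A.frob_ramified_iff[OF R l]]
  have \<tau>Q: "\<tau> \<in> GQ" by (rule frob_elts_GQ[OF A.K_subfield \<tau>[folded A.K_def]])
  \<comment> \<open>Together with \<open>\<sigma>\<close>, also \<open>\<iota>\<close> after
    \<open>\<sigma>\<close> is a Frobenius element over \<open>X.K\<close>. The character of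
    \<open>a\<close> vanishes on both, hence on \<open>\<iota>\<close>.\<close>
  have inertia: "quad_char (int a) \<iota> = 0"
    if \<iota>: "\<iota> \<in> GQ" "\<And>z. algebraic_int z \<Longrightarrow> \<iota> z - z \<in> R" "quad_char (int x) \<iota> = 0" for \<iota>
  proof -
    have "\<iota> \<in> gal UNIV X.K" using \<iota> X.quad_char_iff by blast
    hence "(\<lambda>z. \<iota> (\<sigma> z)) \<in> gal UNIV X.K" using \<sigma>' gal_UNIV_comp by blast
    moreover have "\<iota> (\<sigma> z) - z ^ l \<in> R" if "algebraic_int z" for z
      using R_closed(4)[OF R \<iota>(2)[OF GQ_algebraic_int[OF \<sigma>Q that]] \<sigma>'[THEN conjunct2, rule_format, OF that]] by simp
    ultimately have "(\<lambda>z. \<iota> (\<sigma> z)) \<in> frob_elts X.K UNIV R" using X.frob_ramified_iff[OF R lX] by blast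
    hence "quad_char (int a) \<iota> + quad_char (int a) \<sigma> = 0" using fixes_u quad_char_mult[OF \<iota>(1) \<sigma>Q] by metis
    thus ?thesis using fixes_u[OF \<sigma>] by simp
  qed
  obtain \<iota>0 where \<iota>0: "\<iota>0 \<in> GQ" "\<And>z. algebraic_int z \<Longrightarrow> \<iota>0 z - z \<in> R" "\<iota>0 u = - u"
    by (rule A.inertia_moves_sqrt[OF R l]) blast
  have "u \<noteq> 0" using A.w_irrational by auto
  hence a\<iota>0: "quad_char (int a) \<iota>0 = 1"
    using A.quad_char_iff[OF \<iota>0(1)] A.gal_K_iff[of \<iota>0] \<iota>0(3) by (cases "quad_char (int a) \<iota>0") auto
  hence x\<iota>0: "quad_char (int x) \<iota>0 = 1"
    using inertia[OF \<iota>0(1,2)] by (cases "quad_char (int x) \<iota>0") auto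
  define \<sigma>i where "\<sigma>i = inv_into UNIV \<sigma>"
  \<comment> \<open>Both \<open>\<tau>\<close> and \<open>\<sigma>\<close> act as the
    \<open>l\<close>-th power modulo \<open>R\<close>, so they differ by an element acting trivially
    modulo \<open>R\<close>.\<close>
  define \<iota> where "\<iota> = (\<lambda>z. \<tau> (\<sigma>i z))"
  have \<sigma>iQ: "\<sigma>i \<in> GQ" unfolding \<sigma>i_def by (rule gal_UNIV_inv[OF \<sigma>Q])
  have \<iota>Q: "\<iota> \<in> GQ" unfolding \<iota>_def by (rule gal_UNIV_comp[OF \<tau>Q \<sigma>iQ])
  have \<iota>R: "\<iota> z - z \<in> R" if "algebraic_int z" for z
  proof -
    have y: "algebraic_int (\<sigma>i z)" by (rule GQ_algebraic_int[OF \<sigma>iQ that])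
    have "(\<tau> (\<sigma>i z) - \<sigma>i z ^ l) - (\<sigma> (\<sigma>i z) - \<sigma>i z ^ l) \<in> R"
      using \<tau>'[THEN conjunct2, rule_format, OF y] \<sigma>'[THEN conjunct2, rule_format, OF y] by (rule R_closed(8)[OF R])
    thus ?thesis using apply_inv_gal[OF \<sigma>Q, of z] by (simp add: \<iota>_def \<sigma>i_def)
  qed
  have \<tau>_eq: "(\<lambda>z. \<iota> (\<sigma> z)) = \<tau>" using inv_gal_apply[OF \<sigma>Q] by (simp add: \<iota>_def \<sigma>i_def)
  have a\<tau>: "quad_char (int a) \<tau> = 0" using A.quad_char_iff[OF \<tau>Q] \<tau>' by blast
  have a\<iota>: "quad_char (int a) \<iota> = 0"
    using quad_char_mult[OF \<iota>Q \<sigma>Q, of "int a"] a\<tau> fixes_u[OF \<sigma>] \<tau>_eq by simp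
  \<comment> \<open>If \<open>\<iota>\<close> moved \<open>w\<close>, then \<open>\<iota>0\<close>
    after \<open>\<iota>\<close> would act trivially modulo \<open>R\<close>, fix \<open>w\<close>
    and move \<open>u\<close>.\<close>
  have x\<iota>: "quad_char (int x) \<iota> = 0"
  proof (rule ccontr)
    assume "quad_char (int x) \<iota> \<noteq> 0"
    hence "quad_char (int x) (\<lambda>z. \<iota>0 (\<iota> z)) = 0" using quad_char_mult[OF \<iota>0(1) \<iota>Q, of "int x"] x\<iota>0 by simp
    moreover have "\<iota>0 (\<iota> z) - z \<in> R" if "algebraic_int z" for z
      using R_closed(4)[OF R \<iota>0(2)[OF GQ_algebraic_int[OF \<iota>Q that]] \<iota>R[OF that]] by simp
    ultimately have "quad_char (int a) (\<lambda>z. \<iota>0 (\<iota> z)) = 0" by (intro inertia gal_UNIV_comp[OF \<iota>0(1) \<iota>Q])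
    thus False using quad_char_mult[OF \<iota>0(1) \<iota>Q, of "int a"] a\<iota>0 a\<iota> by simp
  qed
  have "\<iota> \<in> gal UNIV X.K" using X.quad_char_iff[OF \<iota>Q] x\<iota> by blast
  hence "\<tau> \<in> gal UNIV X.K" using \<sigma>' gal_UNIV_comp[of \<iota> X.K \<sigma>] unfolding \<tau>_eq by blast
  hence \<tau>X: "\<tau> \<in> frob_elts X.K UNIV R" using \<tau>' X.frob_ramified_iff[OF R lX] by blast
  thus "\<tau> \<in> frob_elts (quad_field (int x)) UNIV R" by (simp add: X.K_def)
  show "\<phi> \<tau> = f (ideal_class (quad_field (int x)) (Up (quad_field (int x)) l))"
    using \<phi>_frob[OF \<tau>X] X.Up_eq_ram[OF lx] by (simp add: c_def X.K_def)
  show "nmult 2 (\<phi> \<tau>) = 0" using \<phi>_frob[OF \<tau>X] two by simp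
qed

section \<open>The Artin pairing\<close>

lemma half_add_half: "half + half = 0"
  by transfer (auto simp: dyadic_def intro: exI[of _ 1])

lemma of_F2_add: "of_F2 (e + e') = of_F2 e + of_F2 e'"
  by (cases e; cases e') (auto simp: of_F2_def half_add_half)

lemma inj_of_F2: "inj of_F2"
  by (rule injI) (metis of_F2_add of_F2_eq_zero_iff bit_eq_iff add.right_neutral bit.exhaust of_F2_def)

lemma to_F2_of_F2 [simp]: "to_F2 (of_F2 e) = e"
  by (simp add: to_F2_def inj_of_F2)

lemma to_F2_zero [simp]: "to_F2 0 = 0"
  using to_F2_of_F2[of 0] by (simp del: to_F2_of_F2 add: of_F2_def)

lemma of_F2_to_F2: "y \<in> range of_F2 \<Longrightarrow> of_F2 (to_F2 y) = y"
  by auto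

lemma two_torsion_range: "nmult 2 y = 0 \<Longrightarrow> y \<in> range of_F2"
proof -
  have "y + y = 0 \<Longrightarrow> y = 0 \<or> y = half"
  proof transfer
    fix r :: rat assume "dyadic r \<and> dyadic r \<and> r - r \<in> \<int>" "dyadic (r + r) \<and> dyadic 0 \<and> r + r - 0 \<in> \<int>"
    then obtain n where n: "dyadic r" "r + r = of_int n" by (auto elim: Ints_cases)
    have "r - 0 \<in> \<int> \<or> r - 1 / 2 \<in> \<int>"
    proof (cases "even n")
      case True
      then obtain m where "n = 2 * m" ..
      hence "r = of_int m" using n(2) by simp
      thus ?thesis by simp
    next
      case False
      then obtain m where "n = 2 * m + 1" ..
      hence "r - 1 / 2 = of_int m" using n(2) by simp
      thus ?thesis by (metis Ints_of_int)
    qed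
    thus "(dyadic r \<and> dyadic 0 \<and> r - 0 \<in> \<int>) \<or> (dyadic r \<and> dyadic (1 / 2) \<and> r - 1 / 2 \<in> \<int>)"
      using n(1) by (auto simp: dyadic_def intro: exI[of _ 1])
  qed
  moreover assume "nmult 2 y = 0"
  ultimately have "y = of_F2 0 \<or> y = of_F2 1" by (simp add: numeral_2_eq_2 of_F2_def)
  thus ?thesis by auto
qed

text \<open>Outside the two-torsion the value of \<open>to_F2\<close> is arbitrary, so additivity
  holds only for summands known to be two-torsion.\<close>

lemma to_F2_sum:
  assumes "\<And>i. i \<in> I \<Longrightarrow> f i \<in> range of_F2"
  shows "to_F2 (\<Sum>i\<in>I. f i) = (\<Sum>i\<in>I. to_F2 (f i))"
proof -
  have sum: "of_F2 (\<Sum>i\<in>I. g i) = (\<Sum>i\<in>I. of_F2 (g i))" for g :: "'a \<Rightarrow> bit"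
    by (induction I rule: infinite_finite_induct) (simp_all only: sum.infinite sum.empty sum.insert of_F2_add of_F2_eq_zero_iff not_False_eq_True)
  have "(\<Sum>i\<in>I. f i) = (\<Sum>i\<in>I. of_F2 (to_F2 (f i)))"
    by (rule sum.cong) (simp_all add: of_F2_to_F2 assms)
  thus ?thesis using sum[of "\<lambda>i. to_F2 (f i)"] by (metis to_F2_of_F2)
qed

text \<open>The pairing uses an unspecified \<open>g\<close> on the two-part whose multiple by
  \<open>2 ^ s\<close> is the character. At \<open>c\<close> raised to \<open>2 ^ s\<close> the
  value of \<open>g\<close> depends on that multiple only, and the restriction of \<open>f\<close>
  shows that such a \<open>g\<close> exists.\<close>

lemma artin_pairing_eq:
  assumes K: "subfield K ring_of_type_algebra" and f: "f \<in> carrier (dual (Cl K))"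
    and c: "c \<in> carrier (Cl K)" "c [^]\<^bsub>Cl K\<^esub> ((2::nat) ^ (s + 1)) = \<one>\<^bsub>Cl K\<^esub>"
  shows "artin_pairing K (s + 1) (c [^]\<^bsub>Cl K\<^esub> ((2::nat) ^ s)) (\<lambda>c\<in>carrier (Cl K). nmult (2 ^ s) (f c)) =
    to_F2 (f (c [^]\<^bsub>Cl K\<^esub> ((2::nat) ^ s)))"
proof -
  interpret comm_monoid "Cl K" by (rule Cl_comm_monoid[OF K])
  define A where "A = two_part (Cl K)"
  define H where "H = {c \<in> carrier (Cl K). \<exists>n. c [^]\<^bsub>Cl K\<^esub> ((2::nat) ^ n) = \<one>\<^bsub>Cl K\<^esub>}"
  have A: "A = (Cl K) \<lparr>carrier := H\<rparr>" by (simp add: A_def two_part_def H_def)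
  have HA: "carrier A = H" "\<one>\<^bsub>A\<^esub> = \<one>\<^bsub>Cl K\<^esub>" "\<And>x y. x \<otimes>\<^bsub>A\<^esub> y = x \<otimes>\<^bsub>Cl K\<^esub> y" by (simp_all add: A)
  have HC: "H \<subseteq> carrier (Cl K)" by (auto simp: H_def)
  have closed: "x \<otimes>\<^bsub>Cl K\<^esub> y \<in> H" if xyH: "x \<in> H" "y \<in> H" for x y
  proof -
    obtain m n where mn: "x [^]\<^bsub>Cl K\<^esub> ((2::nat) ^ m) = \<one>\<^bsub>Cl K\<^esub>" "y [^]\<^bsub>Cl K\<^esub> ((2::nat) ^ n) = \<one>\<^bsub>Cl K\<^esub>"
      and xy: "x \<in> carrier (Cl K)" "y \<in> carrier (Cl K)" using xyH by (auto simp: H_def)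
    have "x [^]\<^bsub>Cl K\<^esub> ((2::nat) ^ m * 2 ^ n) = \<one>\<^bsub>Cl K\<^esub>" "y [^]\<^bsub>Cl K\<^esub> ((2::nat) ^ n * 2 ^ m) = \<one>\<^bsub>Cl K\<^esub>"
      using mn xy by (simp_all flip: nat_pow_pow)
    hence "(x \<otimes>\<^bsub>Cl K\<^esub> y) [^]\<^bsub>Cl K\<^esub> ((2::nat) ^ (m + n)) = \<one>\<^bsub>Cl K\<^esub>"
      using xy by (simp add: nat_pow_distrib power_add mult.commute)
    thus ?thesis using xy by (auto simp: H_def)
  qed
  have one: "\<one>\<^bsub>Cl K\<^esub> \<in> H" by (simp add: H_def)
  have monA: "Group.monoid A"
    by (rule monoidI) (use closed one HC in \<open>simp_all add: HA m_assoc subset_iff\<close>)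
  have powA: "x [^]\<^bsub>A\<^esub> (n::nat) = x [^]\<^bsub>Cl K\<^esub> n" for x n unfolding A by (rule nat_pow_consistent[symmetric])
  have cH: "c \<in> H" using c unfolding H_def by blast
  have "restrict f H \<in> carrier (dual A)"
    using f closed by (auto simp: dual_def hom_def HA dest!: subsetD[OF HC])
  moreover from this have "restrict f H [^]\<^bsub>dual A\<^esub> ((2::nat) ^ s) = restrict (\<lambda>c\<in>carrier (Cl K). nmult (2 ^ s) (f c)) H"
    using HC by (subst pow_dual) (auto simp: HA fun_eq_iff restrict_def)
  moreover define g where "g = (SOME g. g \<in> carrier (dual A) \<and>
      g [^]\<^bsub>dual A\<^esub> ((2::nat) ^ s) = restrict (\<lambda>c\<in>carrier (Cl K). nmult (2 ^ s) (f c)) (carrier A))"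
  ultimately have g: "g \<in> carrier (dual A)"
      "g [^]\<^bsub>dual A\<^esub> ((2::nat) ^ s) = restrict (\<lambda>c\<in>carrier (Cl K). nmult (2 ^ s) (f c)) H"
    using someI[of "\<lambda>g. g \<in> carrier (dual A) \<and>
      g [^]\<^bsub>dual A\<^esub> ((2::nat) ^ s) = restrict (\<lambda>c\<in>carrier (Cl K). nmult (2 ^ s) (f c)) (carrier A)" "restrict f H"]
    by (simp_all add: HA)
  have "g (c [^]\<^bsub>Cl K\<^esub> ((2::nat) ^ s)) = nmult (2 ^ s) (g c)"
    using dual_pow[OF monA g(1), of c "2 ^ s"] cH by (simp add: HA powA)
  also have "\<dots> = (g [^]\<^bsub>dual A\<^esub> ((2::nat) ^ s)) c" using cH by (simp add: pow_dual[OF g(1)] HA)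
  also have "\<dots> = nmult (2 ^ s) (f c)" using cH HC by (auto simp: g(2))
  also have "\<dots> = f (c [^]\<^bsub>Cl K\<^esub> ((2::nat) ^ s))" by (rule dual_pow[OF monoid_axioms f c(1), symmetric])
  finally show ?thesis by (simp add: artin_pairing_def Let_def g_def A_def)
qed

context real_quadratic
begin

lemma corresponds_Cl_nmult:
  assumes f: "corresponds_Cl K f \<phi>" and \<phi>: "\<And>\<sigma>. \<sigma> \<in> GQ \<Longrightarrow> nmult n (\<phi> \<sigma>) = \<phi>' \<sigma>"
  shows "corresponds_Cl K (\<lambda>c\<in>carrier (Cl K). nmult n (f c)) \<phi>'"
  unfolding corresponds_Cl_def
proof (intro conjI allI impI ballI)
  interpret Cl: comm_monoid "Cl K" by (rule Cl_comm_monoid[OF K_subfield])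
  show "(\<lambda>c\<in>carrier (Cl K). nmult n (f c)) \<in> carrier (dual (Cl K))"
    using f by (intro pow_dual_carrier Cl.monoid_axioms) (simp add: corresponds_Cl_def)
  fix R \<sigma> assume R: "nonzero_prime UNIV R" and \<sigma>: "\<sigma> \<in> frob_elts K UNIV R"
  \<comment> \<open>The character is zero-extended nowhere, being restricted to the carrier; so the
    class of \<open>R \<inter> K\<close> must be shown to belong to it, for which this ideal has to
    be nonzero.\<close>
  obtain l :: nat where l: "prime l" "of_nat l \<in> R"
    by (rule nonzero_prime_contains_prime[OF subfield_UNIV R]) blast
  have "primeideal (R \<inter> K) (ring_ints K)"
    using R by (intro primeideal_restrict[OF K_subfield]) (simp add: nonzero_prime_def)
  moreover have "of_nat l \<in> R \<inter> K" using l K_subfield by (simp add: subfield_of_nat)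
  hence "R \<inter> K \<noteq> {0}" using prime_gt_0_nat[OF l(1)] by (metis of_nat_eq_0_iff order_less_irrefl singletonD)
  ultimately have "R \<inter> K \<in> carrier (frac_ideals K)"
    by (intro ideal_in_frac_ideals[OF K_subfield]) (auto simp: primeideal_def)
  thus "\<phi>' \<sigma> = (\<lambda>c\<in>carrier (Cl K). nmult n (f c)) (ideal_class K (R \<inter> K))"
    using f R \<sigma> \<phi>[OF frob_elts_GQ[OF K_subfield \<sigma>]] ideal_class_carrier by (simp add: corresponds_Cl_def)
qed

text \<open>The multiples of \<open>f\<close> by \<open>n\<close> and by zero both correspond to the
  zero map, and the corresponding character is unique.\<close>

lemma dual_torsion:
  assumes f: "corresponds_Cl K f \<phi>" and \<phi>: "\<And>\<sigma>. \<sigma> \<in> GQ \<Longrightarrow> nmult n (\<phi> \<sigma>) = 0"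
  shows "f [^]\<^bsub>dual (Cl K)\<^esub> n = \<one>\<^bsub>dual (Cl K)\<^esub>"
proof -
  have f': "f \<in> carrier (dual (Cl K))" using f by (simp add: corresponds_Cl_def)
  have "(\<lambda>c\<in>carrier (Cl K). nmult n (f c)) = (\<lambda>c\<in>carrier (Cl K). nmult 0 (f c))"
    by (rule corresponds_Cl_unique[of _ "\<lambda>_. 0"]) (rule corresponds_Cl_nmult[OF f]; simp add: \<phi>)+
  hence "f [^]\<^bsub>dual (Cl K)\<^esub> n = f [^]\<^bsub>dual (Cl K)\<^esub> (0::nat)" by (simp only: pow_dual[OF f'])
  thus ?thesis by simp
qed

lemma dual_ram_prod:
  assumes f: "f \<in> carrier (dual (Cl K))" and S: "finite S" "\<And>l. l \<in> S \<Longrightarrow> prime l" and dvd: "\<Prod>S dvd x"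
  shows "f (ideal_class K (ram (\<Prod>S))) = (\<Sum>l\<in>S. f (ideal_class K (ram l)))"
  using S dvd
proof (induction S rule: finite_induct)
  interpret Cl: comm_monoid "Cl K" by (rule Cl_comm_monoid[OF K_subfield])
  case empty
  have "ram 1 = carrier (ring_ints K)" by (auto simp: ram_def algebraic_int_power)
  also have "\<dots> = (\<lambda>z. 1 * z) ` carrier (ring_ints K)" by simp
  finally have "ideal_class K (ram 1) = \<one>\<^bsub>Cl K\<^esub>"
    using ideal_class_principal[OF K_subfield, of 1] totally_positive_of_nat[OF K_subfield, of 1] subfield_one[OF K_subfield]
    by simp
  thus ?case using dual_one[OF Cl.monoid_axioms f] by simp
next
  case (insert l S)
  have lS: "l * \<Prod>S dvd x" using insert by simp
  hence dvds: "l dvd x" "\<Prod>S dvd x" by (auto intro: dvd_mult_left dvd_mult_right)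
  have cop: "coprime l (\<Prod>S)" using squarefree_mono[OF lS squarefree] by (rule squarefree_mult_imp_coprime)
  note fr = ram_in_frac_ideals[OF dvds(1)] ram_in_frac_ideals[OF dvds(2)]
  have "ideal_class K (ram (\<Prod>(insert l S))) = ideal_class K (ram l) \<otimes>\<^bsub>Cl K\<^esub> ideal_class K (ram (\<Prod>S))"
    using insert(1,2) ideal_class_mult[OF K_subfield fr] ram_mult[OF lS cop] by simp
  thus ?case using dual_mult[OF f ideal_class_carrier[OF fr(1)] ideal_class_carrier[OF fr(2)]] insert dvds(2) by simp
qed

lemma dual_ram_prime_factors:
  assumes f: "f \<in> carrier (dual (Cl K))" and a: "a dvd x"
  shows "f (ideal_class K (ram a)) = (\<Sum>l\<in>prime_factors a. f (ideal_class K (ram l)))"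
proof -
  have "a > 0" "squarefree a" using b_pos[OF a] b_squarefree[OF a] by auto
  hence "\<Prod>(prime_factors a) = a"
    using prime_factorization_nat[of a] squarefree_factorial_semiring'[of a] by simp
  thus ?thesis using dual_ram_prod[OF f, of "prime_factors a"] a by (simp add: in_prime_factors_imp_prime)
qed

end

section \<open>Expansion maps\<close>

lemma openin_krullI:
  assumes "N \<subseteq> gal UNIV F"
    and "\<And>u. u \<in> N \<Longrightarrow> \<exists>S. finite S \<and> (\<forall>\<sigma>\<in>gal UNIV F. (\<forall>z\<in>S. \<sigma> z = u z) \<longrightarrow> \<sigma> \<in> N)"
  shows "openin (krull UNIV F) N"
proof (subst openin_subopen, rule ballI)
  fix u assume u: "u \<in> N"
  from assms(2)[OF this] obtain S where S: "finite S" "\<forall>\<sigma>\<in>gal UNIV F. (\<forall>z\<in>S. \<sigma> z = u z) \<longrightarrow> \<sigma> \<in> N" by blast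
  define B where "B = (\<Pi>\<^sub>E z\<in>UNIV. if z \<in> S then {u z} else UNIV)"
  have "openin (product_topology (\<lambda>_. discrete_topology UNIV) UNIV) B"
    unfolding B_def openin_PiE_gen by (rule disjI2) (use S(1) in \<open>auto elim: rev_finite_subset\<close>)
  hence "openin (krull UNIV F) (B \<inter> gal UNIV F)" unfolding krull_def openin_subtopology by blast
  moreover have "u \<in> B \<inter> gal UNIV F" using u assms(1) by (auto simp: B_def)
  moreover have "B \<inter> gal UNIV F \<subseteq> N"
  proof
    fix \<sigma> assume \<sigma>: "\<sigma> \<in> B \<inter> gal UNIV F"
    have "\<sigma> z = u z" if "z \<in> S" for z
      using \<sigma> PiE_mem[of \<sigma> UNIV "\<lambda>z. if z \<in> S then {u z} else UNIV" z] that by (simp add: B_def)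
    thus "\<sigma> \<in> N" using S(2) \<sigma> by blast
  qed
  ultimately show "\<exists>T. openin (krull UNIV F) T \<and> u \<in> T \<and> T \<subseteq> N" by blast
qed

lemma carrier_gal_group [simp]: "carrier (gal_group E F) = gal E F"
  by (simp add: gal_group_def)

lemma one_gal_group_UNIV [simp]: "\<one>\<^bsub>gal_group UNIV F\<^esub> = (\<lambda>x. x)"
  by (simp add: gal_group_def restrict_def)

lemma group_gal: "Group.group (gal_group UNIV F)"
proof (rule groupI)
  fix \<sigma> assume "\<sigma> \<in> carrier (gal_group UNIV F)"
  hence \<sigma>: "\<sigma> \<in> gal UNIV F" by simp
  show "\<exists>\<tau>\<in>carrier (gal_group UNIV F). \<tau> \<otimes>\<^bsub>gal_group UNIV F\<^esub> \<sigma> = \<one>\<^bsub>gal_group UNIV F\<^esub>"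
    by (rule bexI[of _ "inv_into UNIV \<sigma>"]) (simp_all add: gal_UNIV_inv[OF \<sigma>] inv_gal_apply[OF \<sigma>])
qed (simp_all add: gal_UNIV_comp gal_UNIV_id)

lemma normal_gal_iff:
  "N \<lhd> gal_group UNIV F \<longleftrightarrow> N \<subseteq> gal UNIV F \<and> (\<lambda>x. x) \<in> N \<and> (\<forall>\<sigma>\<in>N. \<forall>\<tau>\<in>N. (\<lambda>x. \<sigma> (\<tau> x)) \<in> N) \<and>
     (\<forall>\<sigma>\<in>N. inv_into UNIV \<sigma> \<in> N) \<and> (\<forall>\<sigma>\<in>gal UNIV F. \<forall>\<tau>\<in>N. (\<lambda>x. \<sigma> (\<tau> (inv_into UNIV \<sigma> x))) \<in> N)"
proof -
  interpret Group.group "gal_group UNIV F" by (rule group_gal)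
  have inv: "m_inv (gal_group UNIV F) \<sigma> = inv_into UNIV \<sigma>" if "\<sigma> \<in> gal UNIV F" for \<sigma>
    by (rule inv_equality) (simp_all add: inv_gal_apply[OF that] that gal_UNIV_inv[OF that])
  have sub: "subgroup N (gal_group UNIV F) \<longleftrightarrow> N \<subseteq> gal UNIV F \<and> (\<lambda>x. x) \<in> N \<and>
      (\<forall>\<sigma>\<in>N. \<forall>\<tau>\<in>N. (\<lambda>x. \<sigma> (\<tau> x)) \<in> N) \<and> (\<forall>\<sigma>\<in>N. m_inv (gal_group UNIV F) \<sigma> \<in> N)"
    by (auto simp: subgroup_def)
  show ?thesis unfolding normal_inv_iff sub by (auto simp: inv subset_iff)
qed

lemma normal_gal_comp: "N \<lhd> gal_group UNIV F \<Longrightarrow> \<sigma> \<in> N \<Longrightarrow> \<tau> \<in> N \<Longrightarrow> (\<lambda>x. \<sigma> (\<tau> x)) \<in> N"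
  by (simp add: normal_gal_iff)

lemma openin_krull_normal:
  assumes N: "N \<lhd> gal_group UNIV F" and S: "finite S" "{\<sigma>\<in>gal UNIV F. \<forall>z\<in>S. \<sigma> z = z} \<subseteq> N"
  shows "openin (krull UNIV F) N"
proof (rule openin_krullI)
  show NF: "N \<subseteq> gal UNIV F" using N by (simp add: normal_gal_iff)
  fix u assume u: "u \<in> N"
  hence uF: "u \<in> gal UNIV F" using NF by blast
  have "\<sigma> \<in> N" if \<sigma>: "\<sigma> \<in> gal UNIV F" "\<forall>z\<in>S. \<sigma> z = u z" for \<sigma>
  proof -
    have "(\<lambda>x. inv_into UNIV u (\<sigma> x)) \<in> {\<sigma>\<in>gal UNIV F. \<forall>z\<in>S. \<sigma> z = z}"
      using \<sigma> gal_UNIV_comp[OF gal_UNIV_inv[OF uF] \<sigma>(1)] inv_gal_apply[OF uF] by simp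
    hence "(\<lambda>x. inv_into UNIV u (\<sigma> x)) \<in> N" by (rule subsetD[OF S(2)])
    from normal_gal_comp[OF N u this] show ?thesis by (simp add: apply_inv_gal[OF uF])
  qed
  thus "\<exists>S. finite S \<and> (\<forall>\<sigma>\<in>gal UNIV F. (\<forall>z\<in>S. \<sigma> z = u z) \<longrightarrow> \<sigma> \<in> N)" using S(1) by blast
qed

text \<open>The \<open>GREATEST\<close> is taken with respect to inclusion. It exists because the
  elements that can be deleted from any place in a product without changing \<open>\<phi>\<close>
  form an open normal subgroup \<open>U\<close>, which contains every admissible one.\<close>

lemma field_of_def_subset:
  assumes N: "openin (krull UNIV \<rat>) N" "N \<lhd> gal_group UNIV \<rat>"
    and \<phi>: "\<And>\<sigma> \<tau>. \<sigma> \<in> GQ \<Longrightarrow> \<tau> \<in> N \<Longrightarrow> \<phi> (\<lambda>x. \<sigma> (\<tau> x)) = \<phi> \<sigma>"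
  shows "field_of_def \<phi> \<subseteq> fixed_field N"
proof -
  define U where "U = {\<tau>\<in>GQ. \<forall>\<sigma>\<in>GQ. \<forall>\<rho>\<in>GQ. \<phi> (\<lambda>x. \<sigma> (\<tau> (\<rho> x))) = \<phi> (\<lambda>x. \<sigma> (\<rho> x))}"
  define P where "P = (\<lambda>N. openin (krull UNIV \<rat>) N \<and> N \<lhd> gal_group UNIV \<rat> \<and>
     (\<forall>\<sigma>\<in>GQ. \<forall>\<tau>\<in>N. \<phi> (\<sigma> \<otimes>\<^bsub>gal_group UNIV \<rat>\<^esub> \<tau>) = \<phi> \<sigma>))"
  have sub: "N' \<subseteq> U" if N': "P N'" for N'
  proof
    fix \<tau> assume \<tau>: "\<tau> \<in> N'"
    note n = N'[unfolded P_def normal_gal_iff, THEN conjunct2, THEN conjunct1]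
    note inv = N'[unfolded P_def, THEN conjunct2, THEN conjunct2, rule_format, unfolded mult_gal_group_UNIV]
    have \<tau>Q: "\<tau> \<in> GQ" using n \<tau> by blast
    have "\<phi> (\<lambda>x. \<sigma> (\<tau> (\<rho> x))) = \<phi> (\<lambda>x. \<sigma> (\<rho> x))" if \<sigma>\<rho>: "\<sigma> \<in> GQ" "\<rho> \<in> GQ" for \<sigma> \<rho>
    proof -
      define \<rho>i where "\<rho>i = inv_into UNIV \<rho>"
      have \<rho>i: "\<rho>i \<in> GQ" unfolding \<rho>i_def by (rule gal_UNIV_inv[OF \<sigma>\<rho>(2)])
      have "(\<lambda>x. \<rho>i (\<tau> (inv_into UNIV \<rho>i x))) \<in> N'" using n \<tau> \<rho>i by blast
      moreover have "inv_into UNIV \<rho>i = \<rho>" unfolding \<rho>i_def using gal_bij[OF \<sigma>\<rho>(2)] by (rule inv_inv_eq)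
      ultimately have t: "(\<lambda>x. \<rho>i (\<tau> (\<rho> x))) \<in> N'" by simp
      from inv[OF gal_UNIV_comp[OF \<sigma>\<rho>] t] show ?thesis
        using apply_inv_gal[OF \<sigma>\<rho>(2)] by (simp add: \<rho>i_def)
    qed
    thus "\<tau> \<in> U" using \<tau>Q by (simp add: U_def)
  qed
  have PN: "P N" using N \<phi> by (simp add: P_def)
  have UQ: "U \<subseteq> GQ" by (auto simp: U_def)
  have normal: "U \<lhd> gal_group UNIV \<rat>"
    unfolding normal_gal_iff
  proof (intro conjI ballI UQ)
    show "(\<lambda>x. x) \<in> U" by (simp add: U_def gal_UNIV_id)
    fix \<sigma> assume \<sigma>: "\<sigma> \<in> U"
    hence \<sigma>Q: "\<sigma> \<in> GQ" using UQ by blast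
    note eq = \<sigma>[unfolded U_def mem_Collect_eq, THEN conjunct2, rule_format]
    show "(\<lambda>x. \<sigma> (\<tau> x)) \<in> U" if \<tau>: "\<tau> \<in> U" for \<tau>
    proof -
      have \<tau>Q: "\<tau> \<in> GQ" using \<tau> UQ by blast
      note eq' = \<tau>[unfolded U_def mem_Collect_eq, THEN conjunct2, rule_format]
      show ?thesis using eq[OF _ gal_UNIV_comp[OF \<tau>Q]] eq' gal_UNIV_comp[OF \<sigma>Q \<tau>Q] by (simp add: U_def)
    qed
    show "inv_into UNIV \<sigma> \<in> U"
      unfolding U_def mem_Collect_eq
    proof (intro conjI ballI gal_UNIV_inv[OF \<sigma>Q])
      fix \<alpha> \<rho> assume *: "\<alpha> \<in> GQ" "\<rho> \<in> GQ"
      show "\<phi> (\<lambda>x. \<alpha> (inv_into UNIV \<sigma> (\<rho> x))) = \<phi> (\<lambda>x. \<alpha> (\<rho> x))"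
        using eq[OF *(1) gal_UNIV_comp[OF gal_UNIV_inv[OF \<sigma>Q] *(2)]] by (simp add: apply_inv_gal[OF \<sigma>Q])
    qed
  next
    fix g \<tau> assume g: "g \<in> GQ" and \<tau>: "\<tau> \<in> U"
    note eq = \<tau>[unfolded U_def mem_Collect_eq, THEN conjunct2, rule_format]
    have \<tau>Q: "\<tau> \<in> GQ" using \<tau> UQ by blast
    have gi: "inv_into UNIV g \<in> GQ" by (rule gal_UNIV_inv[OF g])
    show "(\<lambda>x. g (\<tau> (inv_into UNIV g x))) \<in> U"
      unfolding U_def mem_Collect_eq
    proof (intro conjI ballI gal_UNIV_comp[OF g gal_UNIV_comp[OF \<tau>Q gi]])
      fix \<alpha> \<rho> assume *: "\<alpha> \<in> GQ" "\<rho> \<in> GQ"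
      show "\<phi> (\<lambda>x. \<alpha> (g (\<tau> (inv_into UNIV g (\<rho> x))))) = \<phi> (\<lambda>x. \<alpha> (\<rho> x))"
        using eq[OF gal_UNIV_comp[OF *(1) g] gal_UNIV_comp[OF gi *(2)]] by (simp add: apply_inv_gal[OF g])
    qed
  qed
  have "(\<lambda>x. x) \<in> N" using N(2) by (simp add: normal_gal_iff)
  then obtain S where "finite S" "{\<sigma>\<in>GQ. \<forall>z\<in>S. \<sigma> z = z} \<subseteq> N"
    by (rule krull_open_contains_stabiliser[OF N(1)]) blast
  hence "openin (krull UNIV \<rat>) U" using sub[OF PN] by (intro openin_krull_normal[OF normal]) auto
  moreover have "\<phi> (\<lambda>x. \<sigma> (\<tau> x)) = \<phi> \<sigma>" if "\<sigma> \<in> GQ" "\<tau> \<in> U" for \<sigma> \<tau>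
    using that(2)[unfolded U_def mem_Collect_eq, THEN conjunct2, rule_format, OF that(1) gal_UNIV_id] .
  ultimately have "P U" using normal by (simp add: P_def)
  hence "(GREATEST N. P N) = U" using sub by (intro Greatest_equality) auto
  moreover have "N \<subseteq> U" by (rule sub[OF PN])
  ultimately show ?thesis unfolding field_of_def_def P_def fixed_field_def by blast
qed

section \<open>Kernels and fields attached to an expansion map\<close>

locale expansion =
  fixes W \<chi>\<^sub>0 \<phi> assumes expansion: "expansion_map W \<chi>\<^sub>0 \<phi>"
begin

abbreviation "B \<equiv> W - {\<chi>\<^sub>0}"

text \<open>With all subsets of \<open>B\<close> this is the kernel that defines
  \<open>L_exp\<close>; with the proper subsets its fixed field contains \<open>M_exp\<close> for
  nonempty \<open>B\<close>. Families closed under subsets give open normal subgroups.\<close>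

definition "common_kernel \<Y> = {\<sigma> \<in> GQ. (\<forall>\<chi>\<in>B. \<chi> \<sigma> = 0) \<and> (\<forall>Y\<in>\<Y>. \<phi> Y \<sigma> = 0)}"

lemma finite_B: "finite B" and pointer: "\<sigma> \<in> GQ \<Longrightarrow> \<phi> {} \<sigma> = \<chi>\<^sub>0 \<sigma>"
  and continuous: "Y \<subseteq> B \<Longrightarrow> continuous_GQ (\<phi> Y)"
  using expansion unfolding expansion_map_def by blast+

lemma characters: "\<chi> \<in> W \<Longrightarrow> \<exists>a. \<chi> = quad_char a"
  using expansion unfolding expansion_map_def by blast

lemma character_mult: "\<chi> \<in> W \<Longrightarrow> \<sigma> \<in> GQ \<Longrightarrow> \<tau> \<in> GQ \<Longrightarrow> \<chi> (\<lambda>x. \<sigma> (\<tau> x)) = \<chi> \<sigma> + \<chi> \<tau>"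
  using characters quad_char_mult by blast

lemma character_id: "\<chi> \<in> W \<Longrightarrow> \<chi> (\<lambda>x. x) = 0"
  using characters[of \<chi>] by (auto simp: quad_char_def)

lemma cocycle:
  assumes "Y \<subseteq> B" "\<sigma> \<in> GQ" "\<tau> \<in> GQ"
  shows "\<phi> Y (\<lambda>x. \<sigma> (\<tau> x)) = \<phi> Y \<sigma> + \<phi> Y \<tau> + (\<Sum>S \<in> Pow Y - {{}}. (\<Prod>\<chi>\<in>S. \<chi> \<sigma>) * \<phi> (Y - S) \<tau>)"
proof -
  have "\<phi> Y (\<lambda>x. \<sigma> (\<tau> x)) + \<phi> Y \<sigma> + \<phi> Y \<tau> = (\<Sum>S \<in> Pow Y - {{}}. (\<Prod>\<chi>\<in>S. \<chi> \<sigma>) * \<phi> (Y - S) \<tau>)"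
    using expansion assms unfolding expansion_map_def mult_gal_group_UNIV by blast
  moreover have "x = y + z + w" if "x + y + z = w" for x y z w :: bit using that by (cases x; cases y; cases z) auto
  ultimately show ?thesis by blast
qed

text \<open>The cocycle relation is not symmetric: on the left, vanishing of the characters removes
  the mixed terms; on the right, this is done by vanishing of the components, as in
  \<open>cocycle_right_kernel\<close>.\<close>

lemma cocycle_left_kernel:
  assumes "Y \<subseteq> B" "\<sigma> \<in> GQ" "\<And>\<chi>. \<chi> \<in> B \<Longrightarrow> \<chi> \<sigma> = 0" "\<tau> \<in> GQ"
  shows "\<phi> Y (\<lambda>x. \<sigma> (\<tau> x)) = \<phi> Y \<sigma> + \<phi> Y \<tau>"
proof -
  have "(\<Prod>\<chi>\<in>S. \<chi> \<sigma>) = 0" if S: "S \<in> Pow Y - {{}}" for S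
  proof (rule prod_zero)
    show "finite S" using S assms(1) by (intro finite_subset[OF _ finite_B]) blast
    show "\<exists>\<chi>\<in>S. \<chi> \<sigma> = 0" using S assms(1,3) by blast
  qed
  thus ?thesis using cocycle[OF assms(1,2,4)] by simp
qed

lemma cocycle_right_kernel:
  assumes "Y \<subseteq> B" "\<sigma> \<in> GQ" "\<tau> \<in> GQ" "\<And>Z. Z \<subseteq> Y \<Longrightarrow> \<phi> Z \<tau> = 0"
  shows "\<phi> Y (\<lambda>x. \<sigma> (\<tau> x)) = \<phi> Y \<sigma>"
  using cocycle[OF assms(1-3)] assms(4) by simp

lemma at_id: "Y \<subseteq> B \<Longrightarrow> \<phi> Y (\<lambda>x. x) = 0"
proof -
  assume Y: "Y \<subseteq> B"
  have "\<chi> (\<lambda>x. x) = 0" if "\<chi> \<in> B" for \<chi> using character_id that by blast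
  thus ?thesis using cocycle_left_kernel[OF Y, of "\<lambda>x. x" "\<lambda>x. x"] by (simp add: gal_UNIV_id)
qed

context
  fixes \<Y> assumes \<Y>: "\<And>Y. Y \<in> \<Y> \<Longrightarrow> Y \<subseteq> B" "\<And>Y Z. Y \<in> \<Y> \<Longrightarrow> Z \<subseteq> Y \<Longrightarrow> Z \<in> \<Y>"
begin

lemma kernel_GQ: "common_kernel \<Y> \<subseteq> GQ" by (auto simp: common_kernel_def)

lemma kernelD: "\<sigma> \<in> common_kernel \<Y> \<Longrightarrow> \<chi> \<in> B \<Longrightarrow> \<chi> \<sigma> = 0" "\<sigma> \<in> common_kernel \<Y> \<Longrightarrow> Y \<in> \<Y> \<Longrightarrow> \<phi> Y \<sigma> = 0"
  by (auto simp: common_kernel_def)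

lemma kernel_id: "(\<lambda>x. x) \<in> common_kernel \<Y>"
  using character_id at_id \<Y>(1) by (simp add: common_kernel_def gal_UNIV_id)

lemma invariant_right: "\<sigma> \<in> GQ \<Longrightarrow> \<tau> \<in> common_kernel \<Y> \<Longrightarrow> Y \<in> \<Y> \<Longrightarrow> \<phi> Y (\<lambda>x. \<sigma> (\<tau> x)) = \<phi> Y \<sigma>"
  by (rule cocycle_right_kernel[OF \<Y>(1)]) (use kernel_GQ kernelD \<Y>(2) in blast)+

lemma invariant_left:
  "\<sigma> \<in> common_kernel \<Y> \<Longrightarrow> \<tau> \<in> GQ \<Longrightarrow> Y \<in> \<Y> \<Longrightarrow> \<phi> Y (\<lambda>x. \<sigma> (\<tau> x)) = \<phi> Y \<tau>"
  using cocycle_left_kernel[OF \<Y>(1), of Y \<sigma> \<tau>] kernel_GQ kernelD[of \<sigma>] by auto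

text \<open>A kernel element can be deleted on the right because lower components vanish on it, and
  on the left because the characters do. Comparing the two ways of writing a product gives inverses
  and conjugates.\<close>

lemma kernel_normal: "common_kernel \<Y> \<lhd> gal_group UNIV \<rat>"
  unfolding normal_gal_iff
proof (intro conjI ballI kernel_GQ kernel_id)
  fix \<sigma> assume \<sigma>: "\<sigma> \<in> common_kernel \<Y>"
  hence \<sigma>Q: "\<sigma> \<in> GQ" using kernel_GQ by blast
  show "(\<lambda>x. \<sigma> (\<tau> x)) \<in> common_kernel \<Y>" if \<tau>: "\<tau> \<in> common_kernel \<Y>" for \<tau>
  proof -
    have \<tau>Q: "\<tau> \<in> GQ" using \<tau> kernel_GQ by blast
    have "\<chi> (\<lambda>x. \<sigma> (\<tau> x)) = 0" if "\<chi> \<in> B" for \<chi>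
      using character_mult[OF _ \<sigma>Q \<tau>Q, of \<chi>] kernelD(1)[OF \<sigma> that] kernelD(1)[OF \<tau> that] that by simp
    thus ?thesis using gal_UNIV_comp[OF \<sigma>Q \<tau>Q] invariant_right[OF \<sigma>Q \<tau>] kernelD(2)[OF \<sigma>]
      by (simp add: common_kernel_def)
  qed
  define \<rho> where "\<rho> = inv_into UNIV \<sigma>"
  have \<rho>Q: "\<rho> \<in> GQ" unfolding \<rho>_def by (rule gal_UNIV_inv[OF \<sigma>Q])
  have id: "(\<lambda>x. \<sigma> (\<rho> x)) = (\<lambda>x. x)" by (simp add: \<rho>_def apply_inv_gal[OF \<sigma>Q])
  have "\<phi> Y \<rho> = 0" if "Y \<in> \<Y>" for Y
    using invariant_left[OF \<sigma> \<rho>Q that] at_id[OF \<Y>(1)[OF that]] id by simp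
  moreover have "\<chi> \<rho> = 0" if "\<chi> \<in> B" for \<chi>
    using character_mult[OF _ \<sigma>Q \<rho>Q, of \<chi>] kernelD(1)[OF kernel_id that] kernelD(1)[OF \<sigma> that] that id by simp
  ultimately show "inv_into UNIV \<sigma> \<in> common_kernel \<Y>" using \<rho>Q unfolding \<rho>_def[symmetric] common_kernel_def by blast
next
  fix g \<tau> assume g: "g \<in> GQ" and \<tau>: "\<tau> \<in> common_kernel \<Y>"
  define m where "m = (\<lambda>x. g (\<tau> (inv_into UNIV g x)))"
  have \<tau>Q: "\<tau> \<in> GQ" using \<tau> kernel_GQ by blast
  have mQ: "m \<in> GQ" unfolding m_def by (intro gal_UNIV_comp[OF g] gal_UNIV_comp[OF \<tau>Q] gal_UNIV_inv[OF g])
  have mg: "(\<lambda>x. m (g x)) = (\<lambda>x. g (\<tau> x))" by (simp add: m_def inv_gal_apply[OF g])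
  have \<chi>m: "\<chi> m = 0" if "\<chi> \<in> B" for \<chi>
    using character_mult[OF _ mQ g, of \<chi>] character_mult[OF _ g \<tau>Q, of \<chi>] kernelD(1)[OF \<tau> that] that mg
    by (cases "\<chi> m"; cases "\<chi> g") simp_all
  have "\<phi> Y m = 0" if "Y \<in> \<Y>" for Y
    using cocycle_left_kernel[OF \<Y>(1)[OF that] mQ _ g] \<chi>m invariant_right[OF g \<tau> that] mg
    by (cases "\<phi> Y m"; cases "\<phi> Y g") simp_all
  thus "m \<in> common_kernel \<Y>" using mQ \<chi>m by (simp add: common_kernel_def)
qed

lemma kernel_stabiliser: "\<exists>S. finite S \<and> {\<sigma>\<in>GQ. \<forall>z\<in>S. \<sigma> z = z} \<subseteq> common_kernel \<Y>"
proof -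
  have "\<exists>S. finite S \<and> (\<forall>\<sigma>\<in>GQ. (\<forall>z\<in>S. \<sigma> z = z) \<longrightarrow> \<chi> \<sigma> = 0)" if "\<chi> \<in> B" for \<chi>
  proof -
    obtain a where a: "\<chi> = quad_char a" using characters \<open>\<chi> \<in> B\<close> by fast
    obtain w :: qbar where "w ^ 2 = of_int a" by (rule qbar_sqrt)
    thus ?thesis by (intro exI[of _ "{w}"]) (simp add: a quad_char_zero_iff)
  qed
  then obtain S where S: "\<And>\<chi>. \<chi> \<in> B \<Longrightarrow> finite (S \<chi>)"
      "\<And>\<chi> \<sigma>. \<chi> \<in> B \<Longrightarrow> \<sigma> \<in> GQ \<Longrightarrow> \<forall>z\<in>S \<chi>. \<sigma> z = z \<Longrightarrow> \<chi> \<sigma> = 0" by metis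
  have "\<exists>S. finite S \<and> (\<forall>\<sigma>\<in>GQ. (\<forall>z\<in>S. \<sigma> z = z) \<longrightarrow> \<phi> Y \<sigma> = 0)" if Y: "Y \<in> \<Y>" for Y
  proof -
    have "openin (krull UNIV \<rat>) {\<sigma> \<in> GQ. \<phi> Y \<sigma> \<in> {0}}"
      using continuous[OF \<Y>(1)[OF Y]] openin_continuous_map_preimage[of "krull UNIV \<rat>" "discrete_topology UNIV" "\<phi> Y" "{0}"]
      by (simp add: continuous_GQ_def topspace_krull)
    then obtain S where "finite S" "{\<sigma>\<in>GQ. \<forall>z\<in>S. \<sigma> z = z} \<subseteq> {\<sigma> \<in> GQ. \<phi> Y \<sigma> \<in> {0}}"
      by (rule krull_open_contains_stabiliser) (simp add: at_id[OF \<Y>(1)[OF Y]] gal_UNIV_id)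
    thus ?thesis by (intro exI[of _ S]) auto
  qed
  then obtain T where T: "\<And>Y. Y \<in> \<Y> \<Longrightarrow> finite (T Y)"
      "\<And>Y \<sigma>. Y \<in> \<Y> \<Longrightarrow> \<sigma> \<in> GQ \<Longrightarrow> \<forall>z\<in>T Y. \<sigma> z = z \<Longrightarrow> \<phi> Y \<sigma> = 0" by metis
  have "\<Y> \<subseteq> Pow B" using \<Y>(1) by blast
  hence "finite \<Y>" using finite_B by (auto intro: finite_subset)
  hence "finite (\<Union>(S ` B) \<union> \<Union>(T ` \<Y>))" using finite_B S(1) T(1) by blast
  moreover have "{\<sigma>\<in>GQ. \<forall>z\<in>\<Union>(S ` B) \<union> \<Union>(T ` \<Y>). \<sigma> z = z} \<subseteq> common_kernel \<Y>"
  proof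
    fix \<sigma> assume \<sigma>0: "\<sigma> \<in> {\<sigma>\<in>GQ. \<forall>z\<in>\<Union>(S ` B) \<union> \<Union>(T ` \<Y>). \<sigma> z = z}"
    hence \<sigma>: "\<sigma> \<in> GQ" by simp
    have fixed: "\<sigma> z = z" if "z \<in> \<Union>(S ` B) \<union> \<Union>(T ` \<Y>)" for z using \<sigma>0 that by simp
    have "\<chi> \<sigma> = 0" if "\<chi> \<in> B" for \<chi> using fixed that by (intro S(2)[OF that \<sigma>]) blast
    moreover have "\<phi> Y \<sigma> = 0" if "Y \<in> \<Y>" for Y using fixed that by (intro T(2)[OF that \<sigma>]) blast
    ultimately show "\<sigma> \<in> common_kernel \<Y>" using \<sigma> by (simp add: common_kernel_def)
  qed
  ultimately show ?thesis by blast
qed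

lemma kernel_open: "openin (krull UNIV \<rat>) (common_kernel \<Y>)"
  using kernel_stabiliser openin_krull_normal[OF kernel_normal] by blast

text \<open>The pointer is not among the characters of \<open>B\<close>; it is the component at the
  empty set, whence the condition \<open>{} \<in> \<Y>\<close>.\<close>

lemma field_of_def_character: "\<chi> \<in> W \<Longrightarrow> {} \<in> \<Y> \<Longrightarrow> field_of_def \<chi> \<subseteq> fixed_field (common_kernel \<Y>)"
proof (rule field_of_def_subset[OF kernel_open kernel_normal])
  fix \<sigma> \<tau> assume \<chi>: "\<chi> \<in> W" "{} \<in> \<Y>" and \<sigma>: "\<sigma> \<in> GQ" and \<tau>: "\<tau> \<in> common_kernel \<Y>"
  have \<tau>Q: "\<tau> \<in> GQ" using \<tau> kernel_GQ by blast
  have "\<chi> \<tau> = 0"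
    using kernelD[OF \<tau>] pointer[OF \<tau>Q] \<chi> by (cases "\<chi> = \<chi>\<^sub>0") auto
  thus "\<chi> (\<lambda>x. \<sigma> (\<tau> x)) = \<chi> \<sigma>" using character_mult[OF \<chi>(1) \<sigma> \<tau>Q] by simp
qed

lemma field_of_def_component: "Y \<in> \<Y> \<Longrightarrow> field_of_def (\<phi> Y) \<subseteq> fixed_field (common_kernel \<Y>)"
  by (rule field_of_def_subset[OF kernel_open kernel_normal]) (rule invariant_right)

end

lemma L_exp_eq: "L_exp W \<chi>\<^sub>0 \<phi> = fixed_field (common_kernel {Y. Y \<subseteq> B})"
  by (simp add: L_exp_def common_kernel_def)

text \<open>For nonempty \<open>B\<close> the empty set is a proper subset, so the kernel takes the
  pointer into account.\<close>

lemma M_exp_subset: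
  assumes "B \<noteq> {}"
  shows "M_exp W \<chi>\<^sub>0 \<phi> \<subseteq> fixed_field (common_kernel {Y. Y \<subset> B})"
proof -
  have *: "\<And>Y. Y \<in> {Y. Y \<subset> B} \<Longrightarrow> Y \<subseteq> B" by blast
  have down: "\<And>Y Z. Y \<in> {Y. Y \<subset> B} \<Longrightarrow> Z \<subseteq> Y \<Longrightarrow> Z \<in> {Y. Y \<subset> B}" by blast
  have empty: "{} \<in> {Y. Y \<subset> B}" using assms by blast
  show ?thesis
    unfolding M_exp_def
  proof (intro gen_field_minimal subfield_fixed_field Un_least UN_least)
    show "common_kernel {Y. Y \<subset> B} \<subseteq> GQ" by (rule kernel_GQ) (use * down in blast)+
    show "field_of_def \<chi> \<subseteq> fixed_field (common_kernel {Y. Y \<subset> B})" if "\<chi> \<in> W" for \<chi>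
      by (rule field_of_def_character[where \<Y> = "{Y. Y \<subset> B}"]) (use * down empty that in blast)+
    show "field_of_def (\<phi> Y) \<subseteq> fixed_field (common_kernel {Y. Y \<subset> B})" if "Y \<in> {Y. Y \<subset> B}" for Y
      by (rule field_of_def_component[where \<Y> = "{Y. Y \<subset> B}"]) (use * down that in blast)+
  qed
qed

end

section \<open>Splitting and Frobenius elements\<close>

lemma coeff_synthetic_div_Suc: "coeff p (Suc k) = coeff (synthetic_div p c) k - c * coeff (synthetic_div p c) (Suc k)"
  for p :: "'a::comm_ring_1 poly"
proof -
  have "coeff (p + smult c (synthetic_div p c)) (Suc k) = coeff (pCons (poly p c) (synthetic_div p c)) (Suc k)"
    by (simp only: synthetic_div_correct)
  thus ?thesis by (simp add: algebra_simps)
qed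

text \<open>Division by the linear factor of one root leaves a monic polynomial, and this vanishes
  modulo \<open>R\<close> at the other roots because \<open>R\<close> is prime.\<close>

lemma monic_roots_modulo_prime:
  assumes R: "primeideal R (ring_ints (UNIV :: qbar set))"
    and g: "\<And>i. algebraic_int (coeff g i)" "lead_coeff g = 1"
    and A: "finite A" "\<And>a. a \<in> A \<Longrightarrow> algebraic_int a" "\<And>a. a \<in> A \<Longrightarrow> poly g a \<in> R"
      "\<And>a b. a \<in> A \<Longrightarrow> b \<in> A \<Longrightarrow> a - b \<in> R \<Longrightarrow> a = b"
  shows "card A \<le> degree g"
  using g A
proof (induction "degree g" arbitrary: g A)
  case 0
  then obtain b where "g = [:b:]" by (metis degree_eq_zeroE)
  hence "g = [:1:]" using 0(3) by simp
  hence "A = {}" using 0(6) R_one[OF R] by auto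
  thus ?case by simp
next
  case (Suc n)
  show ?case
  proof (cases "A = {}")
    case False
    then obtain a where a: "a \<in> A" by blast
    define q where "q = synthetic_div g a"
    have deg: "degree q = n" using Suc.hyps(2) by (simp add: q_def degree_synthetic_div)
    have int: "algebraic_int (poly p a)" "algebraic_int (coeff (synthetic_div p a) i)"
      if "\<And>i. algebraic_int (coeff p i)" for p i
    proof -
      have pa: "algebraic_int (poly p a)" if "\<And>i. algebraic_int (coeff p i)" for p
        using that Suc.prems(4)[OF a] unfolding poly_altdef
        by (intro algebraic_int_sum algebraic_int_mult algebraic_int_power)
      thus "algebraic_int (poly p a)" using that by blast
      show "algebraic_int (coeff (synthetic_div p a) i)" using that
      proof (induction p arbitrary: i)
        case (pCons c p)
        have "\<And>i. algebraic_int (coeff p i)" using pCons.prems[of "Suc _"] by simp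
        thus ?case using pCons.IH pa by (simp add: coeff_pCons split: nat.split)
      qed simp
    qed
    have "coeff g (Suc n) = coeff q n"
      using coeff_synthetic_div_Suc[of g n a] deg by (simp add: q_def coeff_eq_0)
    hence lead: "lead_coeff q = 1" using Suc.prems(2) Suc.hyps(2) deg by simp
    have "card (A - {a}) \<le> degree q"
    proof (rule Suc.hyps(1)[OF deg[symmetric] int(2)[OF Suc.prems(1), folded q_def] lead])
      fix b assume b: "b \<in> A - {a}"
      have "poly g b = (b - a) * poly q b + poly g a"
        using arg_cong[OF synthetic_div_correct'[of a g], of "\<lambda>p. poly p b"] by (simp add: q_def algebra_simps)
      hence "(b - a) * poly q b \<in> R" using R_closed(8)[OF R Suc.prems(5)[of b] Suc.prems(5)[OF a]] b by simp
      moreover have "algebraic_int (poly q b)"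
        using Suc.prems(4)[of b] b int(2)[OF Suc.prems(1), folded q_def] unfolding poly_altdef
        by (intro algebraic_int_sum algebraic_int_mult algebraic_int_power) auto
      moreover have "b - a \<notin> R" using Suc.prems(6)[of b a] a b by blast
      ultimately show "poly q b \<in> R"
        using R_prime[OF R, of "b - a" "poly q b"] algebraic_int_diff[OF Suc.prems(4)[of b] Suc.prems(4)[OF a]] b by blast
    qed (use Suc.prems in auto)
    thus ?thesis using a Suc.prems(3) Suc.hyps(2) deg by (simp add: card_Diff_singleton)
  qed simp
qed

text \<open>The integers from \<open>0\<close> to \<open>l - 1\<close> already provide
  \<open>l\<close> incongruent roots of \<open>X ^ l - X\<close> modulo \<open>R\<close>; a further
  class would be one root too many.\<close>

lemma frobenius_fixed_imp_integer:
  assumes R: "primeideal R (ring_ints UNIV)" and l: "prime l" "of_nat l \<in> R"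
    and z: "algebraic_int z" "z ^ l - z \<in> R"
  shows "\<exists>n. z - of_int n \<in> R"
proof (rule ccontr)
  assume no: "\<nexists>n. z - of_int n \<in> R"
  define g :: "qbar poly" where "g = monom 1 l - monom 1 1"
  have l1: "l > 1" by (rule prime_gt_1_nat[OF l(1)])
  have deg: "degree g = l"
    using l1 degree_add_eq_left[of "- monom 1 1" "monom 1 l :: qbar poly"] by (simp add: g_def degree_monom_eq degree_minus del: One_nat_def)
  define I :: "qbar set" where "I = (\<lambda>n. of_int n) ` {0..<int l}"
  have "card (insert z I) \<le> degree g"
  proof (rule monic_roots_modulo_prime[OF R])
    show "algebraic_int (coeff g i)" for i by (simp add: g_def algebraic_int_diff)
    show "lead_coeff g = 1" unfolding deg using l1 by (simp add: g_def)
    show "finite (insert z I)" by (simp add: I_def)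
    show "algebraic_int b" if "b \<in> insert z I" for b using that z(1) by (auto simp: I_def)
    show "poly g b \<in> R" if "b \<in> insert z I" for b
      using that z(2) fermat_int[OF R_ideal[OF R] l] by (auto simp: I_def g_def poly_monom)
    fix b c assume bc: "b \<in> insert z I" "c \<in> insert z I" "b - c \<in> R"
    have cb: "c - b \<in> R" using R_closed(7)[OF R bc(3)] by simp
    consider "b = z" "c = z" | "b = z" "c \<in> I" | "c = z" "b \<in> I" | "b \<in> I" "c \<in> I" using bc by blast
    thus "b = c"
    proof cases
      case 4
      then obtain m n where mn: "b = of_int m" "c = of_int n" "m \<in> {0..<int l}" "n \<in> {0..<int l}" by (auto simp: I_def)
      hence "of_int (m - n) \<in> R" using bc(3) by simp
      hence "int l dvd m - n" using of_int_in_prime_iff[OF subfield_UNIV R_ideal[OF R] R_one[OF R] l] by blast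
      hence "m = n" using mn(3,4) zdvd_imp_le[of "int l" "m - n"] zdvd_imp_le[of "int l" "n - m"]
        by (auto simp: dvd_diff_commute) (metis atLeastLessThan_iff mod_pos_pos_trivial mod_eq_dvd_iff mn(3,4))
      thus ?thesis using mn by simp
    qed (use no bc(3) cb in \<open>auto simp: I_def\<close>)
  qed
  moreover have "z \<notin> I"
  proof
    assume "z \<in> I"
    then obtain n where "z = of_int n" by (auto simp: I_def)
    hence "z - of_int n \<in> R" using R_closed(3)[OF R] by simp
    thus False using no by blast
  qed
  moreover have "card I = l" by (simp add: I_def card_image inj_on_def)
  ultimately show False using deg by (simp add: I_def)
qed

text \<open>The two products are taken in different rings, so that powers of primes of
  \<open>K\<close>, \<open>M\<close> and \<open>L\<close> can be compared directly as sets.\<close>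

lemma ideal_prod_mono_ring:
  assumes "I \<subseteq> I'" "J \<subseteq> J'"
  shows "ideal_prod (ring_ints K) I J \<subseteq> ideal_prod (ring_ints L) I' J'"
proof
  fix z assume "z \<in> ideal_prod (ring_ints K) I J"
  thus "z \<in> ideal_prod (ring_ints L) I' J'"
  proof induction
    case (prod i j)
    thus ?case using ideal_prod.prod[of i I' j J' "ring_ints L"] assms by auto
  next
    case (sum s t)
    thus ?case using ideal_prod.sum[of s "ring_ints L" I' J' t] by simp
  qed
qed

context real_quadratic
begin

lemma ram_prime:
  assumes l: "prime l" "l dvd x"
  shows "primeideal (ram l) (ring_ints K)"
  unfolding primeideal_ring_ints_iff[OF K_subfield]
proof (intro conjI allI impI)
  note int_iff = of_int_in_ram_iff[OF b_squarefree[OF l(2)] b_pos[OF l(2)]]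
  show "1 \<notin> ram l" using int_iff[of 1] prime_gt_1_nat[OF l(1)] by simp
  fix y z assume y: "y \<in> K" "algebraic_int y" and z: "z \<in> K" "algebraic_int z" and yz: "y * z \<in> ram l"
  obtain m where m: "y - of_int m \<in> ram l" using ram_residue[OF l(2), of y] y by auto
  obtain n where n: "z - of_int n \<in> ram l" using ram_residue[OF l(2), of z] z by auto
  have "(y - of_int m) * z + of_int m * (z - of_int n) \<in> ram l"
    using z K_subfield by (intro ram_closed(4) ram_closed(6)[OF m] ram_closed(5)[OF n]) (simp_all add: subfield_of_int)
  hence "y * z - ((y - of_int m) * z + of_int m * (z - of_int n)) \<in> ram l" by (rule ram_closed(7)[OF yz])
  hence "of_int (m * n) \<in> ram l" by (simp add: algebra_simps)
  hence "int l dvd m * n" using int_iff by blast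
  hence "int l dvd m \<or> int l dvd n" using l(1) by (simp add: prime_dvd_mult_iff)
  thus "y \<in> ram l \<or> z \<in> ram l"
    using int_iff ram_closed(4)[OF m, of "of_int m"] ram_closed(4)[OF n, of "of_int n"] by auto
qed (rule ram_ideal)

text \<open>An integer of \<open>M\<close> is fixed by a Frobenius element, hence by the
  \<open>l\<close>-th power modulo \<open>R\<close>, hence congruent to a rational integer. If
  \<open>ram l\<close> were contained in the square of \<open>Q\<close>, then \<open>l\<close>,
  which lies in the square of \<open>ram l\<close>, would lie in the fourth power of a prime of
  \<open>L\<close>.\<close>

lemma splits_completely_ramified:
  assumes l: "prime l" "l dvd x" and M: "subfield M ring_of_type_algebra"
    and L: "subfield L ring_of_type_algebra" "M \<subseteq> L" "\<And>m. m > 0 \<Longrightarrow> \<exists>T. residue_system L m T"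
    and ram_index: "\<And>Q. nonzero_prime L Q \<Longrightarrow> ram_index \<rat> L Q \<le> 2"
    and frob: "\<And>R \<tau> z. primeideal R (ring_ints UNIV) \<Longrightarrow> of_nat l \<in> R \<Longrightarrow> \<tau> \<in> frob_elts K UNIV R \<Longrightarrow> z \<in> M \<Longrightarrow> \<tau> z = z"
  shows "splits_completely K M (ram l)"
  unfolding splits_completely_def
proof (intro allI impI)
  fix Q assume Q: "nonzero_prime M Q \<and> Q \<inter> K = ram l"
  hence Qp: "primeideal Q (ring_ints M)" by (simp add: nonzero_prime_def)
  obtain R where R: "primeideal R (ring_ints (UNIV :: qbar set))" "R \<inter> M = Q" by (rule lying_over[OF M Qp]) blast
  have lram: "of_nat l \<in> ram l" using prime_gt_0_nat[OF l(1)] by (rule of_nat_in_ram)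
  have lR: "of_nat l \<in> R" using lram Q R(2) by blast
  have l0: "l > 0" by (rule prime_gt_0_nat[OF l(1)])
  have Qi: "ideal Q (ring_ints M)" and Q1: "1 \<notin> Q" using Qp primeideal_ring_ints_iff[OF M] by blast+
  have lQ: "of_nat l \<in> Q" using lram Q by blast
  obtain \<tau> where \<tau>: "\<tau> \<in> frob_elts K UNIV R" by (rule frob_ramified_exists[OF R(1) l(1) lR l(2)])
  have "abs_norm M Q = l"
  proof (rule abs_norm_integers[OF M Qi l0 of_int_in_prime_iff[OF M Qi Q1 l(1) lQ]])
    fix z assume z: "z \<in> carrier (ring_ints M)"
    hence "\<tau> z - z ^ l \<in> R" using \<tau> frob_ramified_iff[OF R(1) l(1) lR l(2)] by simp
    hence "- (\<tau> z - z ^ l) \<in> R" by (rule R_closed(7)[OF R(1)])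
    hence "z ^ l - z \<in> R" using frob[OF R(1) lR \<tau>, of z] z by simp
    then obtain n where "z - of_int n \<in> R" using frobenius_fixed_imp_integer[OF R(1) l(1) lR] z by auto
    moreover have "z - of_int n \<in> M" using z M by (simp add: subfield_diff subfield_of_int)
    ultimately show "\<exists>n. z - of_int n \<in> Q" using R(2) by blast
  qed
  moreover have "ram_index K M Q = 1"
    unfolding ram_index_def
  proof (rule Greatest_equality)
    show "Q \<inter> K \<subseteq> ideal_pow M Q 1" using ideal_pow_1[OF M Qi] by simp
    fix e assume e: "Q \<inter> K \<subseteq> ideal_pow M Q e"
    show "e \<le> 1"
    proof (rule ccontr)
      assume "\<not> e \<le> 1"
      hence "2 \<le> e" by simp
      define Q' where "Q' = R \<inter> L"
      have Q'p: "primeideal Q' (ring_ints L)" unfolding Q'_def by (rule primeideal_restrict[OF L(1) R(1)])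
      hence Q'i: "ideal Q' (ring_ints L)" and Q'1: "1 \<notin> Q'" using primeideal_ring_ints_iff[OF L(1)] by blast+
      have two: "ideal_pow F P 2 = ideal_prod (ring_ints F) P P"
        if "subfield F ring_of_type_algebra" "ideal P (ring_ints F)" for F P
        using ideal_pow_1[OF that] by (simp add: numeral_2_eq_2)
      have four: "ideal_pow L Q' 4 = ideal_prod (ring_ints L) (ideal_prod (ring_ints L) Q' Q') (ideal_prod (ring_ints L) Q' Q')"
      proof -
        have "ideal_pow L Q' (Suc (Suc 2)) = ideal_prod (ring_ints L) (ideal_prod (ring_ints L) (ideal_prod (ring_ints L) Q' Q') Q') Q'"
          unfolding ideal_pow_Suc two[OF L(1) Q'i] ..
        thus ?thesis by (simp add: ideal_prod_assoc_sets[OF L(1)])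
      qed
      have "ram l \<subseteq> ideal_pow M Q 2" using ideal_pow_antimono[OF M Qi \<open>2 \<le> e\<close>] e Q by blast
      also have "\<dots> = ideal_prod (ring_ints M) Q Q" by (rule two[OF M Qi])
      also have "\<dots> \<subseteq> ideal_prod (ring_ints L) Q' Q'"
        by (rule ideal_prod_mono_ring) (use R(2) L(2) in \<open>auto simp: Q'_def\<close>)
      finally have "ideal_prod (ring_ints K) (ram l) (ram l) \<subseteq> ideal_pow L Q' 4"
        unfolding four by (intro ideal_prod_mono_ring)
      moreover have "of_nat l * 1 \<in> (\<lambda>z. of_nat l * z) ` carrier (ring_ints K)"
        using subfield_one[OF K_subfield] by (intro imageI) simp
      ultimately have l4: "of_nat l \<in> ideal_pow L Q' 4" using ram_square[OF l(2)] by auto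
      have lQ': "of_nat l \<in> Q'" using lR subfield_of_nat[OF L(1)] by (simp add: Q'_def)
      hence "Q' \<noteq> {0}" using l0 by auto
      hence "nonzero_prime L Q'" using Q'p by (simp add: nonzero_prime_def)
      hence "ram_index \<rat> L Q' \<le> 2" by (rule ram_index)
      moreover obtain T where "residue_system L l T" using L(3)[OF l0] by blast
      hence "4 \<le> ram_index \<rat> L Q'"
      proof (rule ram_index_ge[OF L(1) Q'i _ l0 Q'1])
        show "of_nat l \<in> Q' \<inter> \<rat>" using lQ' by simp
        show "Q' \<inter> \<rat> \<subseteq> ideal_pow L Q' 4"
        proof
          fix z assume z: "z \<in> Q' \<inter> \<rat>"
          hence "algebraic_int z" using ideal_closed(2)[OF L(1) Q'i] by blast
          hence "z \<in> \<int>" using z rational_algebraic_int_is_int by blast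
          then obtain n where n: "z = of_int n" by (rule Ints_cases)
          hence "int l dvd n" using z of_int_in_prime_iff[OF L(1) Q'i Q'1 l(1) lQ'] by blast
          thus "z \<in> ideal_pow L Q' 4" unfolding n
            by (rule int_multiple_in_ideal[OF L(1) ideal_pow_ideal[OF L(1) Q'i] l4])
        qed
      qed
      ultimately show False by simp
    qed
  qed
  ultimately show "ram_index K M Q = 1 \<and> abs_norm M Q = abs_norm K (ram l)" using abs_norm_ram[OF l(2)] by simp
qed

end

section \<open>Fixed fields of normal subgroups and lifting of Frobenius elements\<close>

lemma normal_subset_gal: "N \<lhd> gal_group UNIV F \<Longrightarrow> N \<subseteq> gal UNIV F"
  by (simp add: normal_gal_iff)

context
  fixes N :: "(qbar \<Rightarrow> qbar) set" assumes N: "N \<lhd> gal_group UNIV \<rat>"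
begin

lemma fixed_field_normal:
  assumes "g \<in> GQ" "z \<in> fixed_field N"
  shows "g z \<in> fixed_field N"
  unfolding fixed_field_def mem_Collect_eq
proof
  fix \<tau> assume \<tau>: "\<tau> \<in> N"
  define h where "h = inv_into UNIV g"
  have h: "h \<in> GQ" unfolding h_def by (rule gal_UNIV_inv[OF assms(1)])
  have hi: "inv_into UNIV h = g" unfolding h_def using gal_bij[OF assms(1)] by (rule inv_inv_eq)
  have "(\<lambda>x. h (\<tau> (inv_into UNIV h x))) \<in> N" using N h \<tau> unfolding normal_gal_iff by blast
  hence "h (\<tau> (g z)) = z" using assms(2) hi by (auto simp: fixed_field_def)
  thus "\<tau> (g z) = g z" using apply_inv_gal[OF assms(1), of "\<tau> (g z)"] by (simp add: h_def)
qed

lemma restrict_gal: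
  assumes "\<sigma> \<in> gal UNIV K" "subfield K ring_of_type_algebra" "K \<subseteq> fixed_field N"
  shows "restrict \<sigma> (fixed_field N) \<in> gal (fixed_field N) K"
proof -
  let ?L = "fixed_field N"
  have \<sigma>: "\<sigma> \<in> GQ" using gal_UNIV_subset_GQ assms(1,2) by blast
  note L = subfield_fixed_field[OF normal_subset_gal[OF N]]
  have "?L \<subseteq> \<sigma> ` ?L"
  proof
    fix z assume "z \<in> ?L"
    hence "inv_into UNIV \<sigma> z \<in> ?L" by (rule fixed_field_normal[OF gal_UNIV_inv[OF \<sigma>]])
    thus "z \<in> \<sigma> ` ?L" using apply_inv_gal[OF \<sigma>, of z] by (intro image_eqI[of _ _ "inv_into UNIV \<sigma> z"]) simp_all
  qed
  hence img: "\<sigma> ` ?L = ?L" using fixed_field_normal[OF \<sigma>] by blast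
  have "bij_betw (restrict \<sigma> ?L) ?L ?L"
    unfolding bij_betw_def using img gal_eq_iff[OF \<sigma>] by (auto simp: inj_on_def)
  thus ?thesis
    unfolding gal_iff using subfield_add[OF L] subfield_mult[OF L] subfield_one[OF L] gal_add[OF \<sigma>] gal_mult[OF \<sigma>] gal_one[OF \<sigma>]
      gal_fixes[OF assms(1)] assms(3) by auto
qed

context
  fixes S assumes S: "finite S" "{\<sigma>\<in>GQ. \<forall>z\<in>S. \<sigma> z = z} \<subseteq> N"
begin

lemma gal_fixed_field_normal: "\<sigma> \<in> gal UNIV (fixed_field N) \<Longrightarrow> \<sigma> \<in> N"
  by (rule gal_fixed_field_open[OF normal_subset_gal[OF N] _ _ S]) (use N in \<open>simp_all add: normal_gal_iff\<close>)

text \<open>The lift selected by \<open>inv_into\<close> differs from \<open>\<tau>\<close> by an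
  automorphism over the fixed field, and such an automorphism lies in \<open>N\<close>.\<close>

lemma value_at_restrict:
  assumes \<tau>: "\<tau> \<in> GQ" and \<phi>: "\<And>\<kappa>. \<kappa> \<in> N \<Longrightarrow> \<phi> (\<lambda>x. \<tau> (\<kappa> x)) = \<phi> \<tau>"
  shows "value_at (fixed_field N) \<phi> (restrict \<tau> (fixed_field N)) = \<phi> \<tau>"
proof -
  let ?r = "\<lambda>\<sigma>. restrict \<sigma> (fixed_field N)"
  define g where "g = inv_into GQ ?r (?r \<tau>)"
  have g: "g \<in> GQ" "?r g = ?r \<tau>"
    unfolding g_def using \<tau> by (auto intro!: inv_into_into f_inv_into_f[of _ ?r])
  define \<kappa> where "\<kappa> = (\<lambda>x. inv_into UNIV \<tau> (g x))"
  have \<kappa>: "\<kappa> \<in> GQ" unfolding \<kappa>_def by (rule gal_UNIV_comp[OF gal_UNIV_inv[OF \<tau>] g(1)])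
  have "\<kappa> z = z" if "z \<in> fixed_field N" for z
    using fun_cong[OF g(2), of z] that inv_gal_apply[OF \<tau>] by (simp add: \<kappa>_def)
  hence "\<kappa> \<in> gal UNIV (fixed_field N)" using \<kappa> by (simp add: gal_UNIV_iff)
  hence "\<kappa> \<in> N" by (rule gal_fixed_field_normal)
  moreover have "(\<lambda>x. \<tau> (\<kappa> x)) = g" by (simp add: \<kappa>_def apply_inv_gal[OF \<tau>])
  ultimately show ?thesis using \<phi>[of \<kappa>] by (simp add: value_at_def g_def)
qed

end

end

context real_quadratic
begin

text \<open>\<open>Frob\<close> is attached to an unspecified prime \<open>Q\<close> of
  \<open>L\<close>. A prime \<open>R\<close> above \<open>Q\<close> is fixed, the chosen element is
  extended to some \<open>g\<close>, and \<open>g\<close> is corrected by an automorphism over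
  \<open>L\<close> so as to be a Frobenius element at \<open>R\<close>.\<close>

lemma Frob_lifts:
  assumes N: "N \<lhd> gal_group UNIV \<rat>" and S: "finite S" "{\<sigma>\<in>GQ. \<forall>z\<in>S. \<sigma> z = z} \<subseteq> N"
    and KL: "K \<subseteq> fixed_field N" and l: "prime l" "l dvd x"
  obtains R \<tau> where "primeideal R (ring_ints UNIV)" "of_nat l \<in> R" "\<tau> \<in> frob_elts K UNIV R"
    "restrict \<tau> (fixed_field N) = Frob K (fixed_field N) (ram l)"
proof -
  define L where "L = fixed_field N"
  have L: "subfield L ring_of_type_algebra" unfolding L_def by (rule subfield_fixed_field[OF normal_subset_gal[OF N]])
  have KL': "K \<subseteq> L" using KL by (simp add: L_def)
  have lram: "of_nat l \<in> ram l" using prime_gt_0_nat[OF l(1)] by (rule of_nat_in_ram)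
  have norm: "abs_norm K (ram l) = l" by (rule abs_norm_ram[OF l(2)])
  obtain R0 where R0: "primeideal R0 (ring_ints (UNIV :: qbar set))" "of_nat l \<in> R0"
    using lying_over[OF K_subfield ram_prime[OF l]] lram by blast
  obtain \<tau>0 where \<tau>0: "\<tau>0 \<in> frob_elts K UNIV R0" by (rule frob_ramified_exists[OF R0(1) l(1) R0(2) l(2)])
  have R0K: "R0 \<inter> K = ram l" by (rule restrict_ramified_prime(1)[OF R0(1) l(1) R0(2) l(2)])
  have "restrict \<tau>0 L \<in> gal L K"
    using restrict_gal[OF N _ K_subfield KL] \<tau>0 by (simp add: L_def frob_elts_def)
  moreover have "\<tau>0 z - z ^ l \<in> R0 \<inter> L" if z: "z \<in> carrier (ring_ints L)" for z
  proof
    show "\<tau>0 z - z ^ l \<in> R0" using z \<tau>0 frob_ramified_iff[OF R0(1) l(1) R0(2) l(2)] by simp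
    have "\<tau>0 z \<in> L" using z fixed_field_normal[OF N frob_elts_GQ[OF K_subfield \<tau>0]] by (simp add: L_def)
    thus "\<tau>0 z - z ^ l \<in> L" using z L by (simp add: subfield_diff subfield_power)
  qed
  moreover have "R0 \<inter> L \<inter> K = ram l" using R0K KL' by blast
  ultimately have "restrict \<tau>0 L \<in> frob_elts K L (R0 \<inter> L)" by (simp add: frob_elts_def norm)
  moreover have "nonzero_prime L (R0 \<inter> L)"
  proof -
    have "of_nat l \<in> R0 \<inter> L" using R0 L by (simp add: subfield_of_nat)
    hence "R0 \<inter> L \<noteq> {0}" using prime_gt_0_nat[OF l(1)] by (metis of_nat_eq_0_iff order_less_irrefl singletonD)
    thus ?thesis using primeideal_restrict[OF L R0(1)] by (simp add: nonzero_prime_def)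
  qed
  \<comment> \<open>Restricting a Frobenius element of the algebraic closure shows that the
    \<open>SOME\<close> in \<open>Frob\<close> selects among existing elements.\<close>
  ultimately have "\<exists>\<tau> Q. nonzero_prime L Q \<and> Q \<inter> K = ram l \<and> \<tau> \<in> frob_elts K L Q"
    using \<open>R0 \<inter> L \<inter> K = ram l\<close> by blast
  hence "\<exists>Q. nonzero_prime L Q \<and> Q \<inter> K = ram l \<and> Frob K L (ram l) \<in> frob_elts K L Q"
    unfolding Frob_def by (rule someI_ex)
  then obtain Q where Q: "nonzero_prime L Q" "Q \<inter> K = ram l" and FQ: "Frob K L (ram l) \<in> frob_elts K L Q" by blast
  define \<rho> where "\<rho> = Frob K L (ram l)"
  have \<rho>: "\<rho> \<in> gal L K" "\<And>z. z \<in> L \<Longrightarrow> algebraic_int z \<Longrightarrow> \<rho> z - z ^ l \<in> Q"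
    using FQ by (simp_all add: frob_elts_def \<rho>_def[symmetric] Q(2) norm)
  note \<rho>' = \<rho>(1)[unfolded gal_iff]
  have img: "\<rho> ` L = L" using \<rho>' by (simp add: bij_betw_def)
  obtain R where R: "primeideal R (ring_ints (UNIV :: qbar set))" "R \<inter> L = Q"
    using lying_over[OF L] Q(1) unfolding nonzero_prime_def by blast
  have lR: "of_nat l \<in> R" using lram Q(2) R(2) by blast
  obtain g where g: "g \<in> GQ" "\<And>z. z \<in> L \<Longrightarrow> g z = \<rho> z"
    by (rule subfield_hom_extends[OF L, of \<rho>]) (use \<rho>' in blast)+
  \<comment> \<open>\<open>F\<close> is the identity modulo \<open>R\<close> on the integers of
    \<open>L\<close>, so it is congruent to some \<open>h\<close> over \<open>L\<close>. Evaluated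
    at \<open>g z\<close>, the congruence says that \<open>h\<close> after \<open>g\<close> is the
    \<open>l\<close>-th power modulo \<open>R\<close>.\<close>
  define F where "F = (\<lambda>z. inv_into UNIV g z ^ l)"
  have gi: "inv_into UNIV g \<in> GQ" by (rule gal_UNIV_inv[OF g(1)])
  note gi_int = GQ_algebraic_int[OF gi]
  have "\<exists>h\<in>gal UNIV L. \<forall>z. algebraic_int z \<longrightarrow> F z - h z \<in> R"
  proof (rule conjugate_modulo_prime_all[OF R(1) L])
    show "algebraic_int (F z)" if "algebraic_int z" for z
      unfolding F_def by (intro algebraic_int_power gi_int that)
    show "F (y + z) - (F y + F z) \<in> R" if "algebraic_int y" "algebraic_int z" for y z
      using frobenius_add[OF R_ideal[OF R(1)] l(1) lR gi_int[OF that(1)] gi_int[OF that(2)]] by (simp add: F_def gal_add[OF gi])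
    show "F (y * z) - F y * F z \<in> R" for y z
      using R_closed(3)[OF R(1)] by (simp add: F_def gal_mult[OF gi] power_mult_distrib)
    fix z assume z: "algebraic_int z" "z \<in> L"
    then obtain v where v: "v \<in> L" "\<rho> v = z" using img by (metis imageE)
    have "inv_into UNIV g z = v" using inv_gal_apply[OF g(1), of v] g(2)[OF v(1)] v(2) by simp
    moreover from this have "algebraic_int v" using gi_int[OF z(1)] by simp
    hence "- (\<rho> v - v ^ l) \<in> R" using \<rho>(2)[OF v(1)] R(2) by (intro R_closed(7)[OF R(1)]) blast
    ultimately show "F z - z \<in> R" using v(2) by (simp add: F_def)
  qed
  then obtain h where h: "h \<in> gal UNIV L" "\<And>z. algebraic_int z \<Longrightarrow> F z - h z \<in> R" by blast
  have hQ: "h \<in> GQ" using h(1) gal_UNIV_subset_GQ[OF L] by blast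
  define \<tau> where "\<tau> = (\<lambda>z. h (g z))"
  have \<tau>Q: "\<tau> \<in> GQ" unfolding \<tau>_def by (rule gal_UNIV_comp[OF hQ g(1)])
  have \<tau>L: "\<tau> z = \<rho> z" if "z \<in> L" for z
  proof -
    have "\<rho> z \<in> L" using that img by blast
    thus ?thesis using gal_fixes[OF h(1)] g(2)[OF that] by (simp add: \<tau>_def)
  qed
  have "\<forall>z\<in>K. \<rho> z = z" using \<rho>' by blast
  hence "\<tau> z = z" if "z \<in> K" for z using \<tau>L[of z] subsetD[OF KL' that] that by simp
  hence "\<tau> \<in> gal UNIV K" using \<tau>Q by (simp add: gal_UNIV_iff)
  moreover have "\<tau> z - z ^ l \<in> R" if "algebraic_int z" for z
    using R_closed(7)[OF R(1) h(2)[OF GQ_algebraic_int[OF g(1) that]]] inv_gal_apply[OF g(1), of z] by (simp add: F_def \<tau>_def)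
  ultimately have "\<tau> \<in> frob_elts K UNIV R" using frob_ramified_iff[OF R(1) l(1) lR l(2)] by blast
  moreover have "restrict \<tau> L = \<rho>"
  proof (rule extensionalityI[of _ L])
    show "\<rho> \<in> extensional L" using \<rho>' by blast
  qed (simp_all add: \<tau>L)
  ultimately show thesis using that[OF R(1) lR] by (simp add: L_def \<rho>_def)
qed

end

section \<open>The sum over the cube\<close>

lemma nmult_2_of_F2: "nmult 2 (of_F2 e) = 0"
  by (simp add: numeral_2_eq_2 of_F2_def half_add_half)

lemma sum_const_nmult: "finite A \<Longrightarrow> (\<Sum>x\<in>A. y) = nmult (card A) y"
  by (induction A rule: finite_induct) (simp_all add: add.commute)

context real_quadratic
begin

text \<open>Only the class of \<open>ram b\<close> itself is assumed to be a multiple by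
  \<open>2 ^ s\<close>. Its value is nevertheless the sum of the values at the primes dividing
  \<open>b\<close>, and \<open>to_F2\<close> may be taken termwise since those classes have order at
  most 2.\<close>

lemma artin_pairing_ram:
  assumes f: "corresponds_Cl K f \<phi>" and \<phi>: "\<And>\<sigma>. \<sigma> \<in> GQ \<Longrightarrow> nmult (2 ^ s) (\<phi> \<sigma>) = \<phi>' \<sigma>"
    and b: "b dvd x" "ideal_class K (ram b) \<in> pow_tors (Cl K) s (s + 1)"
  shows "artin_pairing K (s + 1) (ideal_class K (ram b)) (as_Cl_char K \<phi>') =
    (\<Sum>l\<in>prime_factors b. to_F2 (f (ideal_class K (ram l))))"
proof -
  have f': "f \<in> carrier (dual (Cl K))" using f by (simp add: corresponds_Cl_def)
  obtain c where c: "c \<in> carrier (Cl K)" "c [^]\<^bsub>Cl K\<^esub> ((2::nat) ^ (s + 1)) = \<one>\<^bsub>Cl K\<^esub>"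
      "ideal_class K (ram b) = c [^]\<^bsub>Cl K\<^esub> ((2::nat) ^ s)" using b(2) unfolding pow_tors_def by blast
  have "as_Cl_char K \<phi>' = (\<lambda>c\<in>carrier (Cl K). nmult (2 ^ s) (f c))"
    by (rule as_Cl_char_eq[OF corresponds_Cl_nmult[OF f \<phi>]])
  hence "artin_pairing K (s + 1) (ideal_class K (ram b)) (as_Cl_char K \<phi>') = to_F2 (f (ideal_class K (ram b)))"
    using artin_pairing_eq[OF K_subfield f' c(1,2)] c(3) by simp
  also have "\<dots> = to_F2 (\<Sum>l\<in>prime_factors b. f (ideal_class K (ram l)))"
    by (simp only: dual_ram_prime_factors[OF f' b(1)])
  also have "\<dots> = (\<Sum>l\<in>prime_factors b. to_F2 (f (ideal_class K (ram l))))"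
    using b(1) by (intro to_F2_sum two_torsion_range dual_ram_torsion[OF f']) (auto dest: in_prime_factors_imp_dvd dvd_trans)
  finally show ?thesis .
qed

end

section \<open>Radicands of the points of the cube\<close>

context
  fixes s p d0 assumes cube: "valid_cube s p d0"
begin

definition "radicand = (\<lambda>x::point. \<Prod>i\<in>{1..s+1}. x i)"

lemma val_eq: "val s x = int (radicand x)"
  by (simp add: val_def radicand_def)

lemma s_pos: "s \<ge> 1" and d0_pos_squarefree: "d0 > 0" "squarefree d0"
  and p_prime: "i \<in> {1..s} \<Longrightarrow> h \<in> {1,2} \<Longrightarrow> prime (p i h)"
  and p_coprime: "i \<in> {1..s} \<Longrightarrow> h \<in> {1,2} \<Longrightarrow> coprime d0 (p i h)"
  using cube unfolding valid_cube_def by blast+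

lemma p_inj:
  assumes "i \<in> {1..s}" "j \<in> {1..s}" "h \<in> {1,2}" "k \<in> {1,2}" "p i h = p j k"
  shows "i = j \<and> h = k"
proof -
  have "inj_on (\<lambda>(i, h). p i h) ({1..s} \<times> {1,2})" using cube unfolding valid_cube_def by blast
  from inj_onD[OF this, of "(i, h)" "(j, k)"] show ?thesis using assms by simp
qed

lemma cube_mem: "x \<in> cube s p d0 \<Longrightarrow> i \<in> {1..s+1} \<Longrightarrow> x i \<in> (if i = s + 1 then {d0} else {p i 1, p i 2})"
  unfolding cube_def by (rule PiE_mem)

lemma cube_coordinate:
  assumes "x \<in> cube s p d0" "i \<in> {1..s}"
  obtains h where "h \<in> {1,2}" "x i = p i h"
proof -
  have "x i \<in> {p i 1, p i 2}" using cube_mem[OF assms(1), of i] assms(2) by simp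
  thus ?thesis using that by blast
qed

lemma cube_last: "x \<in> cube s p d0 \<Longrightarrow> x (s + 1) = d0"
  using cube_mem[of x "s + 1"] by simp

lemma finite_cube: "finite (cube s p d0)"
  unfolding cube_def by (rule finite_PiE) auto

lemma card_cube: "card (cube s p d0) = 2 ^ s"
proof -
  have "card (cube s p d0) = (\<Prod>i\<in>{1..s+1}. card (if i = s + 1 then {d0} else {p i 1, p i 2}))"
    unfolding cube_def by (rule card_PiE) simp
  also have "\<dots> = (\<Prod>i\<in>{1..s}. card (if i = s + 1 then {d0} else {p i 1, p i 2}))" by simp
  also have "\<dots> = (\<Prod>i\<in>{1..s}. 2)"
    using p_inj[of _ _ 1 2] by (intro prod.cong refl) (auto simp: card_insert_if)
  finally show ?thesis by simp
qed

lemma base_point_in_cube: "base_point s p d0 \<in> cube s p d0"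
  by (auto simp: base_point_def cube_def)

lemma radicand:
  assumes x: "x \<in> cube s p d0"
  shows "squarefree (radicand x)" "radicand x > 1" "d0 dvd radicand x"
proof -
  have prime: "prime (x i)" "coprime d0 (x i)" if "i \<in> {1..s}" for i
    using cube_coordinate[OF x that] p_prime[OF that] p_coprime[OF that] by metis+
  show "squarefree (radicand x)"
    unfolding radicand_def
  proof (rule squarefree_prod_coprime)
    fix i j assume ij: "i \<in> {1..s+1}" "j \<in> {1..s+1}" "i \<noteq> j"
    consider "i \<in> {1..s}" "j \<in> {1..s}" | "i = s + 1" "j \<in> {1..s}" | "j = s + 1" "i \<in> {1..s}" using ij by force
    thus "coprime (x i) (x j)"
    proof cases
      case 1
      obtain h k where "h \<in> {1,2}" "x i = p i h" "k \<in> {1,2}" "x j = p j k"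
        using cube_coordinate[OF x 1(1)] cube_coordinate[OF x 1(2)] by metis
      hence "x i \<noteq> x j" using p_inj[OF 1, of h k] ij(3) by auto
      thus ?thesis using prime 1 by (intro primes_coprime)
    qed (use prime cube_last[OF x] in \<open>simp_all add: coprime_commute\<close>)
  next
    fix i assume "i \<in> {1..s+1}"
    hence "i = s + 1 \<or> i \<in> {1..s}" by auto
    thus "squarefree (x i)" using prime cube_last[OF x] d0_pos_squarefree squarefree_prime by auto
  qed
  have "x 1 dvd radicand x" unfolding radicand_def by (rule dvd_prodI) auto
  moreover have "radicand x > 0"
    using \<open>squarefree (radicand x)\<close> by (metis gr0I not_squarefree_0)
  ultimately show "radicand x > 1"
    using prime(1)[of 1] s_pos prime_gt_1_nat[of "x 1"] dvd_imp_le[of "x 1" "radicand x"] by fastforce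
  have "x (s + 1) dvd radicand x" unfolding radicand_def by (rule dvd_prodI) auto
  thus "d0 dvd radicand x" using cube_last[OF x] by simp
qed

text \<open>Two points that differ only in coordinate \<open>i\<close> have radicands whose product
  is \<open>pp p i\<close> up to a square, so an automorphism fixing both square roots also fixes
  that of \<open>pp p i\<close>.\<close>

lemma radicand_neighbours:
  assumes i: "i \<in> {1..s}"
  obtains x y m where "x \<in> cube s p d0" "y \<in> cube s p d0" "m > 0" "int (radicand x * radicand y) = pp p i * int m ^ 2"
proof -
  define x where "x = base_point s p d0"
  define y where "y = x(i := p i 2)"
  define m where "m = (\<Prod>j\<in>{1..s+1} - {i}. x j)"
  have x: "x \<in> cube s p d0" unfolding x_def by (rule base_point_in_cube)
  have y: "y \<in> cube s p d0" using x i by (auto simp: y_def cube_def PiE_iff extensional_def)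
  have "radicand x = x i * m" unfolding radicand_def m_def using i by (intro prod.remove) auto
  moreover have "radicand y = y i * (\<Prod>j\<in>{1..s+1} - {i}. y j)" unfolding radicand_def using i by (intro prod.remove) auto
  moreover have "(\<Prod>j\<in>{1..s+1} - {i}. y j) = m" unfolding m_def by (rule prod.cong) (auto simp: y_def)
  moreover have "x i = p i 1" using i by (simp add: x_def base_point_def)
  ultimately have "int (radicand x * radicand y) = pp p i * int m ^ 2"
    by (simp add: pp_def y_def power2_eq_square)
  moreover have "m > 0"
    using radicand(2)[OF x] \<open>radicand x = x i * m\<close> by (auto intro: Nat.gr0I)
  ultimately show ?thesis using that x y by blast
qed

text \<open>This separates the pointer from the other characters of the support, since the primes of
  the cube do not divide \<open>d0\<close>.\<close>

lemma pp_notdvd: "i \<in> {1..s} \<Longrightarrow> a dvd d0 \<Longrightarrow> pp p i \<noteq> int a"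
proof
  assume i: "i \<in> {1..s}" and a: "a dvd d0" and "pp p i = int a"
  hence "p i 1 * p i 2 = a" unfolding pp_def by (simp only: of_nat_eq_iff)
  hence "p i 1 dvd d0" using a by (metis dvd_mult_left)
  thus False using p_coprime[OF i, of 1] p_prime[OF i, of 1]
    by (metis coprime_absorb_right insertI1 not_prime_unit)
qed

end

text \<open>
  The map \<open>quad_char\<close> is compared on all maps, not only on automorphisms, so that distinct integers
  give distinct characters for a trivial reason.
\<close>
lemma quad_char_inj: "quad_char b = quad_char c \<Longrightarrow> b = c"
proof (rule ccontr)
  assume eq: "quad_char b = quad_char c" and "b \<noteq> c"
  define \<sigma> :: "qbar \<Rightarrow> qbar" where "\<sigma> = (\<lambda>z. if z\<^sup>2 = of_int b then z + 1 else z)"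
  obtain w :: qbar where "w ^ 2 = of_int b" by (rule qbar_sqrt)
  hence "quad_char b \<sigma> = 1" by (auto simp: quad_char_def \<sigma>_def)
  moreover have "quad_char c \<sigma> = 0" using \<open>b \<noteq> c\<close> by (auto simp: quad_char_def \<sigma>_def)
  ultimately show False using eq by simp
qed

lemma quad_char_1: "\<sigma> \<in> GQ \<Longrightarrow> quad_char 1 \<sigma> = 0"
  using quad_char_zero_iff[of 1 1 \<sigma>] gal_one[of \<sigma> \<rat>] by simp

theorem theorem5p3:
  fixes av :: "nat \<Rightarrow> 'l::{alg_closed_field,field_char_0} \<Rightarrow> real"
    and Qv :: "nat \<Rightarrow> 'l set"
    and emb :: "nat \<Rightarrow> qbar \<Rightarrow> 'l"
    and sg :: "nat \<Rightarrow> qbar \<Rightarrow> qbar"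
    and sg21 sg22 :: "qbar \<Rightarrow> qbar"
    and s d0 a :: nat
    and p :: "nat \<Rightarrow> nat \<Rightarrow> nat"
    and \<psi> :: "point \<Rightarrow> (qbar \<Rightarrow> qbar) \<Rightarrow> q2z2"
  assumes choices: "fixed_choices av Qv emb sg sg21 sg22"
    and profitable: "profitable sg sg21 sg22 s p d0 a \<psi>"
    and attached: "attached s p d0 a \<psi>"
    and Up_a: "\<forall>x \<in> cube s p d0.
      ideal_class (point_field s x) (Up (point_field s x) a)
        \<in> pow_tors (Cl (point_field s x)) s (s + 1)"
  shows "(\<forall>l. prime l \<and> l dvd a \<longrightarrow>
            splits_completely (quad_field (int a)) (M_psi s p d0 a \<psi>) (Up (quad_field (int a)) l)) \<and>
         factors_through_Cl (point_field s (base_point s p d0)) (of_F2 \<circ> quad_char (int a)) \<and>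
         as_Cl_char (point_field s (base_point s p d0)) (of_F2 \<circ> quad_char (int a))
           \<in> pow_tors (dual (Cl (point_field s (base_point s p d0)))) s (s + 1) \<and>
         (\<Sum>x \<in> cube s p d0. artin_pairing (point_field s x) (s + 1)
              (ideal_class (point_field s x) (Up (point_field s x) a))
              (as_Cl_char (point_field s x) (of_F2 \<circ> quad_char (int a)))) =
         (\<Sum>l \<in> prime_factors a. psi_Frob s p d0 a \<psi> (Up (quad_field (int a)) l))"
proof -
  let ?x0 = "base_point s p d0" and ?C = "cube s p d0" and ?\<chi> = "quad_char (int a)"
  have cube: "valid_cube s p d0" and a_dvd: "a dvd d0"
    and triple: "\<And>x. x \<in> ?C - {?x0} \<Longrightarrow> raw_cocycle (s + 1) (val s x) (\<psi> x)"
      "\<And>x \<sigma>. x \<in> ?C - {?x0} \<Longrightarrow> \<sigma> \<in> GQ \<Longrightarrow> nmult (2 ^ s) (\<psi> x \<sigma>) = of_F2 (?\<chi> \<sigma>)"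
    using profitable unfolding profitable_def by blast+
  note s = s_pos[OF cube] and x0 = base_point_in_cube[OF cube]
  have raw: "raw_cocycle (s + 1) (val s x) (\<psi> x)" if "x \<in> ?C" for x
    using triple(1) attached that unfolding attached_def by (cases "x = ?x0") blast+
  have cube_sum: "(\<Sum>x\<in>?C. lower (s + 1) i (\<psi> x) \<sigma>) = 0" if "i \<in> {1..s}" "\<sigma> \<in> GQ" for i \<sigma>
    using attached that unfolding attached_def by blast
  \<comment> \<open>The relation with index 1 says that the multiples of all \<open>\<psi> x\<close>
    by \<open>2 ^ s\<close> add up to zero. So do copies of the character at all points, whose
    number \<open>2 ^ s\<close> is even; comparing the two sums gives the equation at the base
    point.\<close>
  have \<psi>_\<chi>: "nmult (2 ^ s) (\<psi> x \<sigma>) = of_F2 (?\<chi> \<sigma>)" if x: "x \<in> ?C" and \<sigma>: "\<sigma> \<in> GQ" for x \<sigma>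
  proof (cases "x = ?x0")
    case True
    have rest: "(\<Sum>x\<in>?C - {?x0}. nmult (2 ^ s) (\<psi> x \<sigma>)) = (\<Sum>x\<in>?C - {?x0}. of_F2 (?\<chi> \<sigma>))"
      by (rule sum.cong) (simp_all add: triple(2) \<sigma>)
    have "(\<Sum>x\<in>?C. of_F2 (?\<chi> \<sigma>)) = nmult (2 ^ (s - 1) * 2) (of_F2 (?\<chi> \<sigma>))"
      using s card_cube[OF cube] by (simp add: sum_const_nmult finite_cube[OF cube] power_eq_if)
    also have "\<dots> = 0" by (simp only: nmult_mult nmult_2_of_F2 nmult_zero)
    finally have "of_F2 (?\<chi> \<sigma>) + (\<Sum>x\<in>?C - {?x0}. of_F2 (?\<chi> \<sigma>)) = 0"
      by (simp only: sum.remove[OF finite_cube[OF cube] x0])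
    moreover have "(\<Sum>x\<in>?C. nmult (2 ^ s) (\<psi> x \<sigma>)) = 0"
      using cube_sum[of 1 \<sigma>] s \<sigma> by (simp add: lower_def)
    hence "nmult (2 ^ s) (\<psi> ?x0 \<sigma>) + (\<Sum>x\<in>?C - {?x0}. nmult (2 ^ s) (\<psi> x \<sigma>)) = 0"
      by (simp only: sum.remove[OF finite_cube[OF cube] x0])
    ultimately show ?thesis unfolding rest True by (metis add_right_cancel)
  qed (use triple(2) that in blast)

  have expansion_map: "expansion_map (psi_support s p a) ?\<chi> (psi_exp s p d0 \<psi>)"
    using attached unfolding attached_def by blast
  interpret E: expansion "psi_support s p a" ?\<chi> "psi_exp s p d0 \<psi>" by unfold_locales (rule expansion_map)
  \<comment> \<open>The support of an expansion map is linearly independent, so the pointer is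
    nontrivial. This excludes \<open>a = 1\<close>.\<close>
  have "\<exists>\<sigma>\<in>GQ. ?\<chi> \<sigma> \<noteq> 0"
  proof -
    have "{?\<chi>} \<subseteq> psi_support s p a \<and> {?\<chi>} \<noteq> {}" by (simp add: psi_support_def)
    hence "\<exists>\<sigma>\<in>GQ. (\<Sum>\<chi>\<in>{?\<chi>}. \<chi> \<sigma>) \<noteq> 0" using expansion_map unfolding expansion_map_def by blast
    thus ?thesis by simp
  qed
  hence "a \<noteq> 1" using quad_char_1 by auto
  moreover have "a > 0" using a_dvd d0_pos_squarefree(1)[OF cube] by (metis dvd_0_left_iff gr0I less_irrefl)
  ultimately have a1: "a > 1" by simp
  obtain wa :: qbar where wa: "wa ^ 2 = of_nat a" by (rule qbar_sqrt)
  interpret A: real_quadratic a wa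
    by unfold_locales (use a1 wa squarefree_mono[OF a_dvd d0_pos_squarefree(2)[OF cube]] in auto)
  have "\<exists>u. u ^ 2 = (of_nat (radicand s x) :: qbar)" for x by (rule qbar_sqrt) (rule exI)
  hence "\<forall>x. \<exists>u. u ^ 2 = (of_nat (radicand s x) :: qbar)" by blast
  then obtain w :: "point \<Rightarrow> qbar" where w: "\<forall>x. w x ^ 2 = of_nat (radicand s x)" by (rule choice[THEN exE])
  have X: "real_quadratic (radicand s x) (w x)" if "x \<in> ?C" for x
    by unfold_locales (use radicand[OF cube that] w in auto)
  have a_dvd_x: "a dvd radicand s x" if "x \<in> ?C" for x using a_dvd radicand(3)[OF cube that] by (rule dvd_trans)
  have pf: "point_field s x = quad_field (int (radicand s x))" for x by (simp add: point_field_def val_eq[OF cube])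
  have "\<exists>f. corresponds_Cl (point_field s x) f (\<psi> x)" if "x \<in> ?C" for x
    using raw[OF that] unfolding raw_cocycle_def factors_through_Cl_def point_field_def by blast
  then obtain f where f: "\<And>x. x \<in> ?C \<Longrightarrow> corresponds_Cl (point_field s x) (f x) (\<psi> x)" by metis
  define c where "c = (\<lambda>x l. ideal_class (point_field s x) (Up (point_field s x) l))"

  let ?N = "E.common_kernel {Y. Y \<subseteq> E.B}" and ?L = "L_psi s p d0 a \<psi>" and ?M = "M_psi s p d0 a \<psi>"
  have down: "\<And>Y. Y \<in> {Y. Y \<subseteq> E.B} \<Longrightarrow> Y \<subseteq> E.B" "\<And>Y Z. Y \<in> {Y. Y \<subseteq> E.B} \<Longrightarrow> Z \<subseteq> Y \<Longrightarrow> Z \<in> {Y. Y \<subseteq> E.B}"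
    by blast+
  have L_eq: "?L = fixed_field ?N" by (simp add: L_psi_def E.L_exp_eq)
  have pp_B: "quad_char (pp p i) \<in> E.B" if "i \<in> {1..s}" for i
    using that quad_char_inj[of "pp p i" "int a"] pp_notdvd[OF cube that a_dvd] by (auto simp: psi_support_def)
  have B_pp: "\<exists>i\<in>{1..s}. \<chi> = quad_char (pp p i)" if "\<chi> \<in> E.B" for \<chi> using that by (auto simp: psi_support_def)
  have M_eq: "?M \<subseteq> fixed_field (E.common_kernel {Y. Y \<subset> E.B})"
    unfolding M_psi_def by (rule E.M_exp_subset) (use pp_B[of 1] s in auto)
  have normal: "?N \<lhd> gal_group UNIV \<rat>" by (rule E.kernel_normal[OF down])
  obtain S where S: "finite S" "{\<sigma>\<in>GQ. \<forall>z\<in>S. \<sigma> z = z} \<subseteq> ?N"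
    using E.kernel_stabiliser[OF down] by blast
  have L: "subfield ?L ring_of_type_algebra"
    unfolding L_eq by (rule subfield_fixed_field[OF normal_subset_gal[OF normal]])
  have M: "subfield ?M ring_of_type_algebra"
    unfolding M_psi_def M_exp_def by (rule subfield_gen_field)
  have "?N \<subseteq> E.common_kernel {Y. Y \<subset> E.B}" by (auto simp add: E.common_kernel_def simp del: Diff_iff)
  hence "fixed_field (E.common_kernel {Y. Y \<subset> E.B}) \<subseteq> fixed_field ?N" unfolding fixed_field_def by blast
  hence M_sub_L: "?M \<subseteq> ?L" using M_eq unfolding L_eq by (rule order_trans[rotated])
  have KL: "A.K \<subseteq> fixed_field ?N"
  proof
    fix z assume z: "z \<in> A.K"
    have "\<sigma> z = z" if \<sigma>: "\<sigma> \<in> ?N" for \<sigma>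
    proof -
      have \<sigma>Q: "\<sigma> \<in> GQ" and "psi_exp s p d0 \<psi> {} \<sigma> = 0" using \<sigma> by (auto simp: E.common_kernel_def)
      hence "?\<chi> \<sigma> = 0" using E.pointer by simp
      thus ?thesis using A.quad_char_iff[OF \<sigma>Q] gal_fixes[of \<sigma> A.K z] z by blast
    qed
    thus "z \<in> fixed_field ?N" by (simp add: fixed_field_def)
  qed

  have frobenius: "\<psi> x \<tau> = f x (c x l)" "nmult 2 (\<psi> x \<tau>) = 0" "\<tau> (w x) = w x"
    if l: "prime l" "l dvd a" and R: "primeideal R (ring_ints UNIV)" "of_nat l \<in> R"
      and \<tau>: "\<tau> \<in> frob_elts A.K UNIV R" and x: "x \<in> ?C" for l R \<tau> x
  proof -
    note transfer = frobenius_transfer[OF A.real_quadratic_axioms a_dvd_x[OF x] X[OF x] R(1) l(1) R(2) l(2)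
        f[OF x, unfolded pf] \<psi>_\<chi>[OF x] s \<tau>[unfolded A.K_def]]
    show "\<psi> x \<tau> = f x (c x l)" "nmult 2 (\<psi> x \<tau>) = 0" using transfer(2,3) by (simp_all add: c_def pf)
    interpret X: real_quadratic "radicand s x" "w x" by (rule X[OF x])
    show "\<tau> (w x) = w x" using transfer(1) X.gal_K_iff by (simp add: frob_elts_def X.K_def)
  qed
  have kernel: "\<tau> \<in> E.common_kernel {Y. Y \<subset> E.B}"
    if l: "prime l" "l dvd a" and R: "primeideal R (ring_ints UNIV)" "of_nat l \<in> R"
      and \<tau>: "\<tau> \<in> frob_elts A.K UNIV R" for l R \<tau>
  proof -
    have \<tau>Q: "\<tau> \<in> GQ" by (rule frob_elts_GQ[OF A.K_subfield \<tau>])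
    note frob = frobenius[OF l R \<tau>]
    have "quad_char (pp p i) \<tau> = 0" if i: "i \<in> {1..s}" for i
    proof -
      obtain x y m where xy: "x \<in> ?C" "y \<in> ?C" "m > 0" "int (radicand s x * radicand s y) = pp p i * int m ^ 2"
        by (rule radicand_neighbours[OF cube i]) blast
      have "(of_nat (radicand s x * radicand s y) :: qbar) = of_int (pp p i) * of_nat m ^ 2"
        using arg_cong[OF xy(4), of "of_int :: int \<Rightarrow> qbar"] by simp
      hence "(w x * w y / of_nat m) ^ 2 = of_int (pp p i)"
        using xy(3) by (simp add: power_divide power_mult_distrib w)
      moreover have "\<tau> (w x * w y / of_nat m) = w x * w y / of_nat m"
        using frob(3)[OF xy(1)] frob(3)[OF xy(2)] gal_fixes[OF \<tau>Q, of "inverse (of_nat m)"]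
        by (simp add: divide_inverse gal_mult[OF \<tau>Q])
      ultimately show ?thesis using quad_char_zero_iff[OF _ \<tau>Q] by blast
    qed
    hence "\<chi> \<tau> = 0" if "\<chi> \<in> E.B" for \<chi> using B_pp[OF that] by blast
    moreover have "psi_exp s p d0 \<psi> Y \<tau> = 0" if Y: "Y \<subset> E.B" for Y
    proof -
      define T where "T = {i \<in> {1..s}. quad_char (pp p i) \<in> Y}"
      have "T \<subset> {1..s}" using Y B_pp unfolding T_def by blast
      hence "card T < s" using psubset_card_mono[of "{1..s}" T] by simp
      \<comment> \<open>For a proper subset \<open>s - card T\<close> is positive, so
        \<open>lower\<close> multiplies a two-torsion value by an even number.\<close>
      hence "(2::nat) ^ (s + 1 - (card T + 1)) = 2 ^ (s - card T - 1) * 2" by (simp add: power_eq_if)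
      hence "lower (s + 1) (card T + 1) (\<psi> x) \<tau> = 0" if "x \<in> ?C" for x
        using frob(2)[OF that] by (simp add: lower_def nmult_mult)
      hence "psi_comp s p d0 \<psi> T \<tau> = 0" unfolding psi_comp_def subcube_def by (intro sum.neutral) auto
      thus ?thesis by (simp add: psi_exp_def T_def)
    qed
    ultimately show ?thesis using \<tau>Q by (simp add: E.common_kernel_def)
  qed

  have splits: "splits_completely (quad_field (int a)) ?M (Up (quad_field (int a)) l)" if l: "prime l" "l dvd a" for l
  proof -
    obtain V where V: "finite V" "fixed_field ?N \<subseteq> Qvs.span V"
      using finite_dimensional_fixed_field[OF normal_subset_gal[OF normal] S] by blast
    have "splits_completely A.K ?M (A.ram l)"
    proof (rule A.splits_completely_ramified[OF l M L M_sub_L])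
      show "\<exists>T. residue_system ?L m T" if "m > 0" for m
        by (rule residue_system_exists[OF L V(1) _ that]) (simp add: L_eq V(2))
      show "ram_index \<rat> ?L Q \<le> 2" if "nonzero_prime ?L Q" for Q using attached that unfolding attached_def by blast
      show "\<tau> z = z" if "primeideal R (ring_ints UNIV)" "of_nat l \<in> R" "\<tau> \<in> frob_elts A.K UNIV R" "z \<in> ?M" for R \<tau> z
        using kernel[OF l that(1-3)] M_eq that(4) by (auto simp: fixed_field_def)
    qed
    thus ?thesis by (simp add: A.Up_eq_ram[OF l(2)] A.K_def[symmetric])
  qed

  have psi_Frob: "psi_Frob s p d0 a \<psi> (Up (quad_field (int a)) l) = (\<Sum>x\<in>?C. to_F2 (f x (c x l)))"
    if l: "prime l" "l dvd a" for l
  proof -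
    obtain R \<tau> where R: "primeideal R (ring_ints UNIV)" "of_nat l \<in> R" and \<tau>: "\<tau> \<in> frob_elts A.K UNIV R"
      and Frob: "restrict \<tau> (fixed_field ?N) = Frob A.K (fixed_field ?N) (A.ram l)"
      by (rule A.Frob_lifts[OF normal S KL l])
    note frob = frobenius[OF l R \<tau>]
    have \<tau>Q: "\<tau> \<in> GQ" by (rule frob_elts_GQ[OF A.K_subfield \<tau>])
    let ?top = "psi_comp s p d0 \<psi> {1..s}"
    have top: "psi_exp s p d0 \<psi> E.B \<sigma> = to_F2 (?top \<sigma>)" for \<sigma>
    proof -
      have "{i \<in> {1..s}. quad_char (pp p i) \<in> E.B} = {1..s}" using pp_B by blast
      thus ?thesis by (simp only: psi_exp_def)
    qed
    have range: "?top \<sigma> \<in> range of_F2" if "\<sigma> \<in> GQ" for \<sigma> using attached that unfolding attached_def by blast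
    have "value_at (fixed_field ?N) ?top (restrict \<tau> (fixed_field ?N)) = ?top \<tau>"
    proof (rule value_at_restrict[OF normal S \<tau>Q])
      fix \<kappa> assume \<kappa>: "\<kappa> \<in> ?N"
      hence \<kappa>Q: "\<kappa> \<in> GQ" using normal_subset_gal[OF normal] by blast
      have "psi_exp s p d0 \<psi> E.B (\<lambda>x. \<tau> (\<kappa> x)) = psi_exp s p d0 \<psi> E.B \<tau>"
        by (rule E.invariant_right[where \<Y> = "{Y. Y \<subseteq> E.B}", OF _ _ \<tau>Q \<kappa>]) blast+
      thus "?top (\<lambda>x. \<tau> (\<kappa> x)) = ?top \<tau>"
        unfolding top using of_F2_to_F2 range[OF gal_UNIV_comp[OF \<tau>Q \<kappa>Q]] range[OF \<tau>Q] by metis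
    qed
    hence "psi_Frob s p d0 a \<psi> (Up (quad_field (int a)) l) = to_F2 (?top \<tau>)"
      by (simp add: psi_Frob_def Let_def L_eq A.Up_eq_ram[OF l(2)] A.K_def[symmetric] Frob)
    \<comment> \<open>At the top the index \<open>card {1..s} + 1\<close> is \<open>s + 1\<close>,
      so \<open>lower\<close> multiplies by 1, and the subcube with no condition is the whole
      cube.\<close>
    also have "?top \<tau> = (\<Sum>x\<in>?C. \<psi> x \<tau>)" by (simp add: psi_comp_def subcube_def lower_def)
    also have "to_F2 \<dots> = (\<Sum>x\<in>?C. to_F2 (\<psi> x \<tau>))" by (rule to_F2_sum[OF two_torsion_range[OF frob(2)]])
    also have "\<dots> = (\<Sum>x\<in>?C. to_F2 (f x (c x l)))" by (rule sum.cong) (simp_all add: frob(1))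
    finally show ?thesis .
  qed

  have artin: "artin_pairing (point_field s x) (s + 1) (ideal_class (point_field s x) (Up (point_field s x) a))
      (as_Cl_char (point_field s x) (of_F2 \<circ> ?\<chi>)) = (\<Sum>l\<in>prime_factors a. to_F2 (f x (c x l)))" if x: "x \<in> ?C" for x
  proof -
    interpret X: real_quadratic "radicand s x" "w x" by (rule X[OF x])
    have K: "point_field s x = X.K" by (simp add: pf X.K_def)
    have Up: "Up X.K b = X.ram b" if "b dvd a" for b using that a_dvd_x[OF x] by (intro X.Up_eq_ram) (rule dvd_trans)
    have "artin_pairing X.K (s + 1) (ideal_class X.K (X.ram a)) (as_Cl_char X.K (of_F2 \<circ> ?\<chi>)) =
        (\<Sum>l\<in>prime_factors a. to_F2 (f x (ideal_class X.K (X.ram l))))"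
    proof (rule X.artin_pairing_ram)
      show "corresponds_Cl X.K (f x) (\<psi> x)" using f[OF x] by (simp add: K)
      show "nmult (2 ^ s) (\<psi> x \<sigma>) = (of_F2 \<circ> ?\<chi>) \<sigma>" if "\<sigma> \<in> GQ" for \<sigma> using \<psi>_\<chi>[OF x that] by simp
      show "ideal_class X.K (X.ram a) \<in> pow_tors (Cl X.K) s (s + 1)" using bspec[OF Up_a x] by (simp add: K Up)
    qed (rule a_dvd_x[OF x])
    also have "\<dots> = (\<Sum>l\<in>prime_factors a. to_F2 (f x (c x l)))"
      by (rule sum.cong) (simp_all add: c_def K Up in_prime_factors_imp_dvd)
    finally show ?thesis by (simp add: K Up)
  qed

  have base: "factors_through_Cl (point_field s ?x0) (of_F2 \<circ> ?\<chi>)"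
    "as_Cl_char (point_field s ?x0) (of_F2 \<circ> ?\<chi>) \<in> pow_tors (dual (Cl (point_field s ?x0))) s (s + 1)"
  proof -
    interpret X: real_quadratic "radicand s ?x0" "w ?x0" by (rule X[OF x0])
    have K: "point_field s ?x0 = X.K" by (simp add: pf X.K_def)
    have f0: "corresponds_Cl X.K (f ?x0) (\<psi> ?x0)" using f[OF x0] by (simp add: K)
    hence f0': "f ?x0 \<in> carrier (dual (Cl X.K))" by (simp add: corresponds_Cl_def)
    \<comment> \<open>The character of \<open>a\<close> is \<open>2 ^ s\<close> times the class
      group character of the cocycle at the base point, and that character is the witness for
      membership in \<open>pow_tors\<close>.\<close>
    have corr: "corresponds_Cl X.K (f ?x0 [^]\<^bsub>dual (Cl X.K)\<^esub> ((2::nat) ^ s)) (of_F2 \<circ> ?\<chi>)"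
      unfolding pow_dual[OF f0'] by (rule X.corresponds_Cl_nmult[OF f0]) (simp add: \<psi>_\<chi>[OF x0])
    thus "factors_through_Cl (point_field s ?x0) (of_F2 \<circ> ?\<chi>)" unfolding factors_through_Cl_def K by blast
    have "f ?x0 [^]\<^bsub>dual (Cl X.K)\<^esub> ((2::nat) ^ (s + 1)) = \<one>\<^bsub>dual (Cl X.K)\<^esub>"
      by (rule X.dual_torsion[OF f0]) (use raw[OF x0] in \<open>simp add: raw_cocycle_def\<close>)
    thus "as_Cl_char (point_field s ?x0) (of_F2 \<circ> ?\<chi>) \<in> pow_tors (dual (Cl (point_field s ?x0))) s (s + 1)"
      unfolding K X.as_Cl_char_eq[OF corr] pow_tors_def using f0' by blast
  qed

  have "(\<Sum>x\<in>?C. artin_pairing (point_field s x) (s + 1) (ideal_class (point_field s x) (Up (point_field s x) a))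
      (as_Cl_char (point_field s x) (of_F2 \<circ> ?\<chi>))) = (\<Sum>x\<in>?C. \<Sum>l\<in>prime_factors a. to_F2 (f x (c x l)))"
    by (rule sum.cong[OF refl artin])
  also have "\<dots> = (\<Sum>l\<in>prime_factors a. \<Sum>x\<in>?C. to_F2 (f x (c x l)))" by (rule sum.swap)
  also have "\<dots> = (\<Sum>l\<in>prime_factors a. psi_Frob s p d0 a \<psi> (Up (quad_field (int a)) l))"
    by (rule sum.cong) (simp_all add: psi_Frob in_prime_factors_imp_prime in_prime_factors_imp_dvd)
  finally show ?thesis using splits base by blast
qed

end
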